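(* $\operatorname{SI}_{\beta_{3,2}}(K_{3,2}^2)$ is minimally generated, as a $k$-algebra, by the thirteen elements $$\{x_1,x_2,\dots,x_8,\ x_2^\circ,\ x_3',\ x_{31}:=C_W(\mathsf{e}_{31}),\ x_{32}:=C_W(\mathsf{e}_{32}),\ x_{312}:=C_W(\mathsf{e}_{312})\}.$$
   Context: $k$ is an algebraically closed field of characteristic zero. The quiver $K_{3,2}^2$ is $-1\to-2\to-3\rightrightarrows2\to1$, with middle arrows $a_1,a_2$, and $\beta_{3,2}(i)=|i|$. Representations assign to an arrow $u\to v$ a $|u|\times|v|$ matrix, and a path acts by the product of matrices from left to right. $\operatorname{SI}_{\beta_{3,2}}(K_{3,2}^2)=k[\operatorname{Rep}_{\beta_{3,2}}(K_{3,2}^2)]^{\operatorname{SL}}$ with $\operatorname{SL}=\prod_i\operatorname{SL}_{|i|}$ acting by base change. With $p^\epsilon_{-i,j}$ the path from $-i$ to $j$ through $a_\epsilon$, put $s_{i;j,k}(M)=\det(M(p^1_{-i,j})\,|\,M(p^2_{-i,k}))$ and $s_{j,k;i}(M)=\det\begin{pmatrix}M(p^1_{-j,i})\\ M(p^2_{-k,i})\end{pmatrix}$ ($i=j+k$; blocks with index $0$ omitted). Set $x_1=s_{1;1,0}$, $x_2=s_{1;0,1}$, $x_3=s_{2;1,1}$, $x_4=s_{1,1;2}$, $x_5=s_{2;2,0}$, $x_6=s_{2;0,2}$, $x_7=s_{3;2,1}$, $x_8=s_{3;1,2}$. $\operatorname{SI}_{\beta_{3,2}}(K_{3,2}^2)$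 is the upper cluster algebra with initial extended cluster $x_1,\dots,x_8$ and the following ice quiver $\Delta$ on vertices $1,\dots,8$ (mutable: $1,2,3$; frozen: $4,\dots,8$). Arrows: two arrows $c_+,c_-:2\to1$, and single arrows $1\to3$, $1\to4$, $3\to2$, $4\to2$, $5\to1$, $2\to6$, $6\to3$, $6\to4$, $3\to5$, $4\to5$, $7\to3$, $3\to8$, $8\to7$, $5\to7$, $8\to6$. The potential $W$ is the signed sum of 3-cycles $$W=(5\,1\,3)+(3\,2\,6)+(7\,3\,8)-(3\,2\,1)_{c_+}-(7\,3\,5)-(8\,6\,3)+(5\,1\,4)+(4\,2\,6)-(4\,2\,1)_{c_-},$$ where $(u\,v\,w)$ is the cycle $u\to v\to w\to u$ and the subscript indicates which arrow $2\to1$ is used. $J$ is the Jacobian algebra of $(\Delta,W)$ (completed path algebra, paths composed left to right, modulo the closed ideal generated by the cyclic derivatives of $W$ with respect to all arrows); modules are right modules and $P_u=e_uJ$. For $\mathsf{g}\in\mathbb{Z}^8$, $\operatorname{Coker}(\mathsf{g})$ is the cokernel of a general map $\bigoplus_u\max(\mathsf{g}(u),0)P_u\to\bigoplus_u\max(-\mathsf{g}(u),0)P_u$. If it is supported on mutable vertices, $$C_W(\mathsf{g})=\mathbf{x}^{\mathsf{g}}\sum_{\mathsf{e}}\chi(\operatorname{Gr}^{\mathsf{e}}(\operatorname{Coker}(\mathsf{g})))\,\mathbf{y}^{\mathsf{e}},\qquad y_u=\prod_{v\to u}x_v\Big/\prod_{u\to w}x_w\quad(u=1,2,3),$$ products over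 arrows with multiplicity, $\operatorname{Gr}^{\mathsf{e}}(M)$ the variety of $\mathsf{e}$-dimensional quotients of $M$, $\chi$ the Euler characteristic. Writing $\mathsf{e}_u$ for unit vectors of $\mathbb{Z}^8$: $x_2^\circ=C_W(\mathsf{e}_6+\mathsf{e}_1-\mathsf{e}_2)$; $x_3'=(x_2x_5x_8+x_1x_6x_7)/x_3$ is the cluster variable obtained by mutating the initial seed at $3$; $\mathsf{e}_{31}=\mathsf{e}_8+\mathsf{e}_4-\mathsf{e}_1$, $\mathsf{e}_{32}=\mathsf{e}_8+\mathsf{e}_5+\mathsf{e}_1-\mathsf{e}_3$, $\mathsf{e}_{312}=2\mathsf{e}_8+\mathsf{e}_5-\mathsf{e}_3$. *)

theory Defs
  imports
    "HOL-Homology.Homology"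
    "HOL-Library.Poly_Mapping"
    "HOL-Computational_Algebra.Polynomial_Factorial"
    "HOL-Algebra.QuotRing"
    "HOL-Algebra.Subrings"
    "Jordan_Normal_Form.VS_Connect"
    "Jordan_Normal_Form.Conjugate"
    "Graph_Theory.Arc_Walk"
begin

section \<open>Completed path algebras and Jacobian algebras\<close>

text \<open>A quiver is a \<^typ>\<open>('v, 'a) pre_digraph\<close>. A path is a pair of its starting vertex and its
  list of arrows; the pair \<open>(u, [])\<close> is the trivial path at \<open>u\<close>. An element of the completed path
  algebra is the family of its (arbitrarily many) coefficients.\<close>

type_synonym ('v, 'a, 'k) series = "'v \<times> 'a list \<Rightarrow> 'k"

definition qpaths :: "('v, 'a) pre_digraph \<Rightarrow> ('v \<times> 'a list) set" where
  "qpaths Q = {(u, w). \<exists>v. pre_digraph.awalk Q u w v}"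

definition pend :: "('v, 'a) pre_digraph \<Rightarrow> 'v \<Rightarrow> 'a list \<Rightarrow> 'v" where
  "pend Q u w = last (pre_digraph.awalk_verts Q u w)"

definition cpath_alg :: "('v, 'a) pre_digraph \<Rightarrow> ('v, 'a, 'k::field) series ring" where
  "cpath_alg Q =
     \<lparr>carrier = {f. \<forall>p. p \<notin> qpaths Q \<longrightarrow> f p = 0},
      mult = (\<lambda>f g (u, w). \<Sum>i\<le>length w. f (u, take i w) * g (pend Q u (take i w), drop i w)),
      one = (\<lambda>(u, w). of_bool (u \<in> verts Q \<and> w = [])),
      zero = (\<lambda>p. 0),
      add = (\<lambda>f g p. f p + g p)\<rparr>"

definition path_elt :: "'v \<times> 'a list \<Rightarrow> ('v, 'a, 'k::field) series" where
  "path_elt p = (\<lambda>q. of_bool (q = p))"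

text \<open>Closedness in the topology defined by the powers of the arrow ideal; for finite quivers the
  \<open>n\<close>-th power consists of the series without terms of length less than \<open>n\<close>.\<close>

definition adic_closed :: "('v, 'a) pre_digraph \<Rightarrow> ('v, 'a, 'k::field) series set \<Rightarrow> bool" where
  "adic_closed Q S \<longleftrightarrow>
     (\<forall>f \<in> carrier (cpath_alg Q).
        (\<forall>n. \<exists>g\<in>S. \<forall>p. length (snd p) < n \<longrightarrow> f p = g p) \<longrightarrow> f \<in> S)"

text \<open>A potential is a list of cycles with integer coefficients. A cycle \<open>a\<^sub>1 \<dots> a\<^sub>d\<close> contributes
  \<open>a\<^sub>i\<^sub>+\<^sub>1 \<dots> a\<^sub>d a\<^sub>1 \<dots> a\<^sub>i\<^sub>-\<^sub>1\<close> to the cyclic derivative with respect to \<open>a\<close> for each \<open>i\<close>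
  with \<open>a\<^sub>i = a\<close>.\<close>

definition cyclic_deriv ::
    "('v, 'a) pre_digraph \<Rightarrow> (int \<times> 'a list) list \<Rightarrow> 'a \<Rightarrow> ('v, 'a, 'k::field) series" where
  "cyclic_deriv Q W a = (\<lambda>p. \<Sum>(c, w)\<leftarrow>W. \<Sum>i | i < length w \<and> w ! i = a.
     of_int c * path_elt (head Q a, drop (Suc i) w @ take i w) p)"

definition jac_ideal ::
    "('v, 'a) pre_digraph \<Rightarrow> (int \<times> 'a list) list \<Rightarrow> ('v, 'a, 'k::field) series set" where
  "jac_ideal Q W =
     \<Inter> {I. ideal I (cpath_alg Q) \<and> adic_closed Q I \<and> cyclic_deriv Q W ` arcs Q \<subseteq> I}"

definition jac_alg ::
    "('v, 'a) pre_digraph \<Rightarrow> (int \<times> 'a list) list \<Rightarrow> ('v, 'a, 'k::field) series set ring" where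
  "jac_alg Q W = cpath_alg Q Quot jac_ideal Q W"

definition jac_class :: "('v, 'a) pre_digraph \<Rightarrow> (int \<times> 'a list) list \<Rightarrow>
    ('v, 'a, 'k::field) series \<Rightarrow> ('v, 'a, 'k) series set" where
  "jac_class Q W f = jac_ideal Q W +>\<^bsub>cpath_alg Q\<^esub> f"

definition jac_idem ::
    "('v, 'a) pre_digraph \<Rightarrow> (int \<times> 'a list) list \<Rightarrow> 'v \<Rightarrow> ('v, 'a, 'k::field) series set" where
  "jac_idem Q W u = jac_class Q W (path_elt (u, []))"

definition jac_arrow ::
    "('v, 'a) pre_digraph \<Rightarrow> (int \<times> 'a list) list \<Rightarrow> 'a \<Rightarrow> ('v, 'a, 'k::field) series set" where
  "jac_arrow Q W a = jac_class Q W (path_elt (tail Q a, [a]))"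

definition jac_scalar ::
    "('v, 'a) pre_digraph \<Rightarrow> (int \<times> 'a list) list \<Rightarrow> 'k::field \<Rightarrow> ('v, 'a, 'k) series set" where
  "jac_scalar Q W c = jac_class Q W (\<lambda>p. c * \<one>\<^bsub>cpath_alg Q\<^esub> p)"


section \<open>Projective right modules and general morphisms\<close>

text \<open>The right module \<open>\<Oplus>\<^sub>u m(u) P\<^sub>u\<close> with \<open>P\<^sub>u = e\<^sub>u J\<close>: its elements are the families indexed by
  the pairs \<open>(u, i)\<close> with \<open>i < m(u)\<close> whose \<open>(u, i)\<close>-th entry is in \<open>P\<^sub>u\<close>.\<close>

type_synonym ('v, 'a, 'k) pelem = "'v \<times> nat \<Rightarrow> ('v, 'a, 'k) series set"

definition copies :: "('v, 'a) pre_digraph \<Rightarrow> ('v \<Rightarrow> nat) \<Rightarrow> ('v \<times> nat) set" where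
  "copies Q m = {(u, i). u \<in> verts Q \<and> i < m u}"

definition pmod :: "('v, 'a) pre_digraph \<Rightarrow> (int \<times> 'a list) list \<Rightarrow> ('v \<Rightarrow> nat) \<Rightarrow>
    ('v, 'a, 'k::field) pelem set" where
  "pmod Q W m = (\<Pi>\<^sub>E s \<in> copies Q m.
     (\<lambda>x. jac_idem Q W (fst s) \<otimes>\<^bsub>jac_alg Q W\<^esub> x) ` carrier (jac_alg Q W))"

definition padd :: "('v, 'a) pre_digraph \<Rightarrow> (int \<times> 'a list) list \<Rightarrow> ('v \<Rightarrow> nat) \<Rightarrow>
    ('v, 'a, 'k::field) pelem \<Rightarrow> ('v, 'a, 'k) pelem \<Rightarrow> ('v, 'a, 'k) pelem" where
  "padd Q W m x y = (\<lambda>s \<in> copies Q m. x s \<oplus>\<^bsub>jac_alg Q W\<^esub> y s)"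

definition pact :: "('v, 'a) pre_digraph \<Rightarrow> (int \<times> 'a list) list \<Rightarrow> ('v \<Rightarrow> nat) \<Rightarrow>
    ('v, 'a, 'k::field) pelem \<Rightarrow> ('v, 'a, 'k) series set \<Rightarrow> ('v, 'a, 'k) pelem" where
  "pact Q W m x r = (\<lambda>s \<in> copies Q m. x s \<otimes>\<^bsub>jac_alg Q W\<^esub> r)"

definition phom :: "('v, 'a) pre_digraph \<Rightarrow> (int \<times> 'a list) list \<Rightarrow> ('v \<Rightarrow> nat) \<Rightarrow> ('v \<Rightarrow> nat) \<Rightarrow>
    (('v, 'a, 'k::field) pelem \<Rightarrow> ('v, 'a, 'k) pelem) set" where
  "phom Q W m n = {\<phi> \<in> pmod Q W m \<rightarrow>\<^sub>E pmod Q W n.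
     (\<forall>x \<in> pmod Q W m. \<forall>y \<in> pmod Q W m. \<phi> (padd Q W m x y) = padd Q W n (\<phi> x) (\<phi> y)) \<and>
     (\<forall>x \<in> pmod Q W m. \<forall>r \<in> carrier (jac_alg Q W). \<phi> (pact Q W m x r) = pact Q W n (\<phi> x) r)}"

definition phom_functionals :: "('v, 'a) pre_digraph \<Rightarrow> (int \<times> 'a list) list \<Rightarrow>
    ('v \<Rightarrow> nat) \<Rightarrow> ('v \<Rightarrow> nat) \<Rightarrow>
    ((('v, 'a, 'k::field) pelem \<Rightarrow> ('v, 'a, 'k) pelem) \<Rightarrow> 'k) set" where
  "phom_functionals Q W m n = {l.
     (\<forall>\<phi> \<in> phom Q W m n. \<forall>\<psi> \<in> phom Q W m n.
        l (\<lambda>x \<in> pmod Q W m. padd Q W n (\<phi> x) (\<psi> x)) = l \<phi> + l \<psi>) \<and>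
     (\<forall>\<phi> \<in> phom Q W m n. \<forall>c.
        l (\<lambda>x \<in> pmod Q W m. pact Q W n (\<phi> x) (jac_scalar Q W c)) = c * l \<phi>)}"

inductive_set poly_functions :: "('h \<Rightarrow> 'k::field) set \<Rightarrow> ('h \<Rightarrow> 'k) set"
  for L :: "('h \<Rightarrow> 'k) set"
where
  const: "(\<lambda>_. c) \<in> poly_functions L"
| linear: "l \<in> L \<Longrightarrow> l \<in> poly_functions L"
| add: "p \<in> poly_functions L \<Longrightarrow> q \<in> poly_functions L \<Longrightarrow> (\<lambda>h. p h + q h) \<in> poly_functions L"
| mult: "p \<in> poly_functions L \<Longrightarrow> q \<in> poly_functions L \<Longrightarrow> (\<lambda>h. p h * q h) \<in> poly_functions L"

text \<open>A property holds for a general homomorphism if it holds on a nonempty Zariski open subset of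
  the affine space of homomorphisms; equivalently, on a nonempty principal open subset.\<close>

definition general_hom :: "('v, 'a) pre_digraph \<Rightarrow> (int \<times> 'a list) list \<Rightarrow>
    ('v \<Rightarrow> nat) \<Rightarrow> ('v \<Rightarrow> nat) \<Rightarrow>
    ((('v, 'a, 'k::field) pelem \<Rightarrow> ('v, 'a, 'k) pelem) \<Rightarrow> bool) \<Rightarrow> bool" where
  "general_hom Q W m n P \<longleftrightarrow>
     (\<exists>p \<in> poly_functions (phom_functionals Q W m n).
        (\<exists>\<phi> \<in> phom Q W m n. p \<phi> \<noteq> 0) \<and> (\<forall>\<phi> \<in> phom Q W m n. p \<phi> \<noteq> 0 \<longrightarrow> P \<phi>))"


section \<open>Representations and Grassmannians of quotients\<close>

text \<open>A representation has a \<open>d(u) \<times> d(v)\<close> matrix for each arrow \<open>u \<rightarrow> v\<close>. A right module corresponds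
  to the representation in which the arrow acts from \<open>M e\<^sub>u\<close> to \<open>M e\<^sub>v\<close>, on row vectors, by right
  multiplication with its matrix; for a column vector this is multiplication with the transpose.\<close>

definition is_rep ::
    "('v, 'a) pre_digraph \<Rightarrow> ('v \<Rightarrow> nat) \<Rightarrow> ('a \<Rightarrow> 'r mat) \<Rightarrow> bool" where
  "is_rep Q d M \<longleftrightarrow> (\<forall>a \<in> arcs Q. M a \<in> carrier_mat (d (tail Q a)) (d (head Q a)))"

text \<open>\<open>M\<close> is isomorphic to the cokernel of \<open>\<phi>\<close>: there are surjective linear maps \<open>\<pi>\<^sub>u\<close> from \<open>Y e\<^sub>u\<close>
  to \<open>M e\<^sub>u\<close>, where \<open>Y\<close> is the codomain of \<open>\<phi>\<close>, that are compatible with the arrows and whose kernel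
  is the image of \<open>\<phi>\<close>.\<close>

definition is_coker :: "('v, 'a) pre_digraph \<Rightarrow> (int \<times> 'a list) list \<Rightarrow>
    ('v \<Rightarrow> nat) \<Rightarrow> ('v \<Rightarrow> nat) \<Rightarrow> (('v, 'a, 'k::field) pelem \<Rightarrow> ('v, 'a, 'k) pelem) \<Rightarrow>
    ('v \<Rightarrow> nat) \<Rightarrow> ('a \<Rightarrow> 'k mat) \<Rightarrow> bool" where
  "is_coker Q W m n \<phi> d M \<longleftrightarrow> is_rep Q d M \<and>
     (let Y = (\<lambda>u. (\<lambda>y. pact Q W n y (jac_idem Q W u)) ` pmod Q W n) in
      \<exists>\<pi> :: 'v \<Rightarrow> ('v, 'a, 'k) pelem \<Rightarrow> 'k vec.
        (\<forall>u \<in> verts Q.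
           \<pi> u ` Y u = carrier_vec (d u) \<and>
           (\<forall>x \<in> Y u. \<forall>y \<in> Y u. \<pi> u (padd Q W n x y) = \<pi> u x + \<pi> u y) \<and>
           (\<forall>y \<in> Y u. \<forall>c. \<pi> u (pact Q W n y (jac_scalar Q W c)) = c \<cdot>\<^sub>v \<pi> u y) \<and>
           (\<forall>y \<in> Y u. \<pi> u y = 0\<^sub>v (d u) \<longleftrightarrow> y \<in> \<phi> ` pmod Q W m)) \<and>
        (\<forall>a \<in> arcs Q. \<forall>y \<in> Y (tail Q a).
           \<pi> (head Q a) (pact Q W n y (jac_arrow Q W a)) = (M a)\<^sup>T *\<^sub>v \<pi> (tail Q a) y))"

text \<open>A quotient of \<open>M\<close> is given by its kernel, a subrepresentation \<open>N\<close>; the dimension vector of the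
  quotient is \<open>e\<close>.\<close>

definition quot_grass :: "('v, 'a) pre_digraph \<Rightarrow> ('v \<Rightarrow> nat) \<Rightarrow> ('a \<Rightarrow> 'k::field mat) \<Rightarrow>
    ('v \<Rightarrow> nat) \<Rightarrow> ('v \<Rightarrow> 'k vec set) set" where
  "quot_grass Q d M e = {N \<in> extensional (verts Q).
     (\<forall>u \<in> verts Q. VectorSpace.subspace class_ring (N u) (module_vec TYPE('k) (d u)) \<and>
        vectorspace.dim class_ring (module_vec TYPE('k) (d u) \<lparr>carrier := N u\<rparr>) + e u = d u) \<and>
     (\<forall>a \<in> arcs Q. \<forall>v \<in> N (tail Q a). (M a)\<^sup>T *\<^sub>v v \<in> N (head Q a))}"

definition orth_proj :: "nat \<Rightarrow> complex vec set \<Rightarrow> complex mat" where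
  "orth_proj n N = (THE P. P \<in> carrier_mat n n \<and>
     (\<forall>v \<in> carrier_vec n. P *\<^sub>v v \<in> N \<and> (\<forall>w \<in> N. (v - P *\<^sub>v v) \<bullet>c w = 0)))"

text \<open>The analytic topology of a complex Grassmannian is induced by the embedding that maps a
  subspace to the matrix of its orthogonal projection.\<close>

definition quot_grass_top :: "('v, 'a) pre_digraph \<Rightarrow> ('v \<Rightarrow> nat) \<Rightarrow> ('a \<Rightarrow> complex mat) \<Rightarrow>
    ('v \<Rightarrow> nat) \<Rightarrow> ('v \<Rightarrow> complex vec set) topology" where
  "quot_grass_top Q d M e = pullback_topology (quot_grass Q d M e)
     (\<lambda>N u i j. if u \<in> verts Q \<and> i < d u \<and> j < d u then orth_proj (d u) (N u) $$ (i, j) else 0)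
     (euclidean :: ('v \<Rightarrow> nat \<Rightarrow> nat \<Rightarrow> complex) topology)"

definition abelian_rank :: "('g, 'm) monoid_scheme \<Rightarrow> nat" where
  "abelian_rank G = (GREATEST n. \<exists>S. finite S \<and> S \<subseteq> carrier G \<and> card S = n \<and>
     (\<forall>c :: 'g \<Rightarrow> int. finprod G (\<lambda>x. x [^]\<^bsub>G\<^esub> c x) S = \<one>\<^bsub>G\<^esub> \<longrightarrow> (\<forall>x\<in>S. c x = 0)))"

definition euler_char :: "'p topology \<Rightarrow> int" where
  "euler_char X = (\<Sum>p | abelian_rank (homology_group (int p) X) \<noteq> 0.
     (-1) ^ p * int (abelian_rank (homology_group (int p) X)))"

text \<open>The Euler characteristic over an arbitrary algebraically closed field of characteristic zero:
  the representation is defined over a subfield \<open>K\<close> that embeds into the complex numbers, and one takes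
  the Euler characteristic of the space of complex points. The result does not depend on \<open>K\<close> and
  \<open>\<sigma>\<close>.\<close>

definition quot_grass_euler :: "('v, 'a) pre_digraph \<Rightarrow> ('v \<Rightarrow> nat) \<Rightarrow>
    ('a \<Rightarrow> 'k::field mat) \<Rightarrow> ('v \<Rightarrow> nat) \<Rightarrow> int" where
  "quot_grass_euler Q d M e = (THE n. \<exists>K \<sigma>.
     subfield K class_ring \<and> (\<forall>a \<in> arcs Q. elements_mat (M a) \<subseteq> K) \<and>
     \<sigma> \<in> Ring.ring_hom (class_ring \<lparr>carrier := K\<rparr>) (class_ring :: complex ring) \<and>
     n = euler_char (quot_grass_top Q d (\<lambda>a. map_mat \<sigma> (M a)) e))"


section \<open>Semi-invariants of the quiver \<open>K\<^sup>2\<^sub>3\<^sub>,\<^sub>2\<close>\<close>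

text \<open>\<open>-1 \<rightarrow> -2 \<rightarrow> -3\<close> by \<open>L12\<close> and \<open>L23\<close>, two arrows \<open>Mid1\<close>, \<open>Mid2\<close> from \<open>-3\<close> to \<open>2\<close>, and \<open>2 \<rightarrow> 1\<close>
  by \<open>R21\<close>.\<close>

datatype karc = L12 | L23 | Mid1 | Mid2 | R21

primrec ktail :: "karc \<Rightarrow> int" where
  "ktail L12 = -1" | "ktail L23 = -2" | "ktail Mid1 = -3" | "ktail Mid2 = -3" | "ktail R21 = 2"

primrec khead :: "karc \<Rightarrow> int" where
  "khead L12 = -2" | "khead L23 = -3" | "khead Mid1 = 2" | "khead Mid2 = 2" | "khead R21 = 1"

definition KQ :: "(int, karc) pre_digraph" where
  "KQ = \<lparr>verts = {-1, -2, -3, 2, 1}, arcs = UNIV, tail = ktail, head = khead\<rparr>"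

definition kbeta :: "int \<Rightarrow> nat" where
  "kbeta i = nat \<bar>i\<bar>"

text \<open>\<open>Coord a i j\<close> is the coordinate function of entry \<open>(i, j)\<close> of the matrix of \<open>a\<close>. The order is
  only needed because the library proves that polynomials have no zero divisors for linearly ordered
  variables.\<close>

datatype coord = Coord karc nat nat

instance karc :: countable by countable_datatype
instance coord :: countable by countable_datatype

instantiation coord :: linorder
begin
definition less_eq_coord :: "coord \<Rightarrow> coord \<Rightarrow> bool" where
  "less_eq_coord x y \<longleftrightarrow> to_nat x \<le> to_nat y"
definition less_coord :: "coord \<Rightarrow> coord \<Rightarrow> bool" where
  "less_coord x y \<longleftrightarrow> to_nat x < to_nat y"
instance
  by standard (auto simp: less_eq_coord_def less_coord_def)
end

type_synonym 'k kpoly = "(coord \<Rightarrow>\<^sub>0 nat) \<Rightarrow>\<^sub>0 'k"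

definition kcoords :: "coord set" where
  "kcoords = {Coord a i j | a i j. i < kbeta (ktail a) \<and> j < kbeta (khead a)}"

definition kpoly_ring :: "'k::field kpoly set" where
  "kpoly_ring = {f. \<forall>m \<in> Poly_Mapping.keys f. Poly_Mapping.keys m \<subseteq> kcoords}"

definition kconst :: "'k::field \<Rightarrow> 'k kpoly" where
  "kconst c = Poly_Mapping.single 0 c"

definition kvar :: "coord \<Rightarrow> 'k::field kpoly" where
  "kvar v = Poly_Mapping.single (Poly_Mapping.single v 1) 1"

definition keval :: "'k::field kpoly \<Rightarrow> (karc \<Rightarrow> 'k mat) \<Rightarrow> 'k" where
  "keval f M = (\<Sum>m \<in> Poly_Mapping.keys f. Poly_Mapping.lookup f m *
     (\<Prod>v \<in> Poly_Mapping.keys m. (case v of Coord a i j \<Rightarrow> M a $$ (i, j)) ^ Poly_Mapping.lookup m v))"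

definition SL_group :: "(int \<Rightarrow> 'k::field mat) set" where
  "SL_group = {g. \<forall>u \<in> verts KQ. g u \<in> carrier_mat (kbeta u) (kbeta u) \<and> det (g u) = 1}"

text \<open>The adjugate is the inverse, as the determinants are \<open>1\<close>.\<close>

definition base_change ::
    "(int \<Rightarrow> 'k::field mat) \<Rightarrow> (karc \<Rightarrow> 'k mat) \<Rightarrow> karc \<Rightarrow> 'k mat" where
  "base_change g M a = g (ktail a) * M a * adj_mat (g (khead a))"

definition SI :: "'k::field kpoly set" where
  "SI = {f \<in> kpoly_ring. \<forall>g \<in> SL_group. \<forall>M. is_rep KQ kbeta M \<longrightarrow>
     keval f (base_change g M) = keval f M}"

definition path_mat :: "(karc \<Rightarrow> 'r::semiring_1 mat) \<Rightarrow> int \<Rightarrow> karc list \<Rightarrow> 'r mat" where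
  "path_mat M u w = foldl (\<lambda>A a. A * M a) (1\<^sub>m (kbeta u)) w"

text \<open>The path from \<open>-i\<close> to \<open>j\<close> through the middle arrow \<open>a\<close>.\<close>

definition kpath :: "karc \<Rightarrow> nat \<Rightarrow> nat \<Rightarrow> karc list" where
  "kpath a i j = drop (i - 1) [L12, L23] @ [a] @ take (2 - j) [R21]"

lemma awalk_kpath:
  assumes "a \<in> {Mid1, Mid2}" "i \<in> {1, 2, 3}" "j \<in> {1, 2}"
  shows "pre_digraph.awalk KQ (- int i) (kpath a i j) (int j)"
  using assms by (auto simp: pre_digraph.awalk_def kpath_def KQ_def pre_digraph.cas.simps)

definition kblock :: "(karc \<Rightarrow> 'r::semiring_1 mat) \<Rightarrow> karc \<Rightarrow> nat \<Rightarrow> nat \<Rightarrow> 'r mat" where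
  "kblock M a i j = (if i = 0 \<or> j = 0 then 0\<^sub>m i j else path_mat M (- int i) (kpath a i j))"

text \<open>\<open>s_row M i j k\<close> is \<open>s\<^sub>i\<^sub>;\<^sub>j\<^sub>,\<^sub>k(M)\<close> and \<open>s_col M j k i\<close> is \<open>s\<^sub>j\<^sub>,\<^sub>k\<^sub>;\<^sub>i(M)\<close>.\<close>

definition s_row :: "(karc \<Rightarrow> 'r::comm_ring_1 mat) \<Rightarrow> nat \<Rightarrow> nat \<Rightarrow> nat \<Rightarrow> 'r" where
  "s_row M i j k =
     det (four_block_mat (kblock M Mid1 i j) (kblock M Mid2 i k) (0\<^sub>m 0 j) (0\<^sub>m 0 k))"

definition s_col :: "(karc \<Rightarrow> 'r::comm_ring_1 mat) \<Rightarrow> nat \<Rightarrow> nat \<Rightarrow> nat \<Rightarrow> 'r" where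
  "s_col M j k i = det (kblock M Mid1 j i @\<^sub>r kblock M Mid2 k i)"

definition generic_rep :: "karc \<Rightarrow> 'k::field kpoly mat" where
  "generic_rep a = mat (kbeta (ktail a)) (kbeta (khead a)) (\<lambda>(i, j). kvar (Coord a i j))"

text \<open>The initial extended cluster, as elements of the function field.\<close>

definition xv :: "nat \<Rightarrow> 'k::field kpoly fract" where
  "xv i = to_fract
    ([s_row generic_rep 1 1 0, s_row generic_rep 1 0 1, s_row generic_rep 2 1 1,
      s_col generic_rep 1 1 2, s_row generic_rep 2 2 0, s_row generic_rep 2 0 2,
      s_row generic_rep 3 2 1, s_row generic_rep 3 1 2] ! (i - 1))"


section \<open>The ice quiver with potential and the cluster character\<close>

text \<open>\<open>Arr u v\<close> is the single arrow from \<open>u\<close> to \<open>v\<close>.\<close>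

datatype darc = Cplus | Cminus | Arr nat nat

primrec dtail :: "darc \<Rightarrow> nat" where
  "dtail Cplus = 2" | "dtail Cminus = 2" | "dtail (Arr u v) = u"

primrec dhead :: "darc \<Rightarrow> nat" where
  "dhead Cplus = 1" | "dhead Cminus = 1" | "dhead (Arr u v) = v"

definition Delta :: "(nat, darc) pre_digraph" where
  "Delta = \<lparr>verts = {1..8},
     arcs = {Cplus, Cminus, Arr 1 3, Arr 1 4, Arr 3 2, Arr 4 2, Arr 5 1, Arr 2 6, Arr 6 3, Arr 6 4,
       Arr 3 5, Arr 4 5, Arr 7 3, Arr 3 8, Arr 8 7, Arr 5 7, Arr 8 6},
     tail = dtail, head = dhead\<rparr>"

definition mutables :: "nat set" where
  "mutables = {1, 2, 3}"

definition potW :: "(int \<times> darc list) list" where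
  "potW =
    [( 1, [Arr 5 1, Arr 1 3, Arr 3 5]),
     ( 1, [Arr 3 2, Arr 2 6, Arr 6 3]),
     ( 1, [Arr 7 3, Arr 3 8, Arr 8 7]),
     (-1, [Arr 3 2, Cplus, Arr 1 3]),
     (-1, [Arr 7 3, Arr 3 5, Arr 5 7]),
     (-1, [Arr 8 6, Arr 6 3, Arr 3 8]),
     ( 1, [Arr 5 1, Arr 1 4, Arr 4 5]),
     ( 1, [Arr 4 2, Arr 2 6, Arr 6 4]),
     (-1, [Arr 4 2, Cminus, Arr 1 4])]"

definition yv :: "nat \<Rightarrow> 'k::field kpoly fract" where
  "yv u = (\<Prod>a | a \<in> arcs Delta \<and> head Delta a = u. xv (tail Delta a)) /
          (\<Prod>a | a \<in> arcs Delta \<and> tail Delta a = u. xv (head Delta a))"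

definition cluster_char_rep ::
    "(nat \<Rightarrow> int) \<Rightarrow> (nat \<Rightarrow> nat) \<Rightarrow> (darc \<Rightarrow> 'k::field mat) \<Rightarrow> 'k kpoly fract" where
  "cluster_char_rep g d M = (\<Prod>u \<in> verts Delta. xv u powi g u) *
     (\<Sum>e | \<forall>u. e u \<le> (if u \<in> mutables then d u else 0).
        of_int (quot_grass_euler Delta d M e) * (\<Prod>u \<in> mutables. yv u ^ e u))"

text \<open>The value of \<open>cluster_char_rep\<close> at the cokernel of a general map with weight vector \<open>g\<close>, for
  \<open>g\<close> whose general cokernel is supported on the mutable vertices.\<close>

definition CW :: "(nat \<Rightarrow> int) \<Rightarrow> 'k::field kpoly fract" where
  "CW g = (THE c.
     general_hom Delta potW (\<lambda>u. nat (max (g u) 0)) (\<lambda>u. nat (max (- g u) 0))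
       (\<lambda>\<phi> :: (nat, darc, 'k) pelem \<Rightarrow> (nat, darc, 'k) pelem. \<exists>d M.
          is_coker Delta potW (\<lambda>u. nat (max (g u) 0)) (\<lambda>u. nat (max (- g u) 0)) \<phi> d M \<and>
          (\<forall>u \<in> verts Delta - mutables. d u = 0) \<and>
          c = cluster_char_rep g d M))"

definition ev :: "nat \<Rightarrow> nat \<Rightarrow> int" where
  "ev u = (\<lambda>v. of_bool (v = u))"

definition x2circ :: "'k::field kpoly fract" where
  "x2circ = CW (\<lambda>v. ev 6 v + ev 1 v - ev 2 v)"

definition x3prime :: "'k::field kpoly fract" where
  "x3prime = (xv 2 * xv 5 * xv 8 + xv 1 * xv 6 * xv 7) / xv 3"

definition x31 :: "'k::field kpoly fract" where
  "x31 = CW (\<lambda>v. ev 8 v + ev 4 v - ev 1 v)"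

definition x32 :: "'k::field kpoly fract" where
  "x32 = CW (\<lambda>v. ev 8 v + ev 5 v + ev 1 v - ev 3 v)"

definition x312 :: "'k::field kpoly fract" where
  "x312 = CW (\<lambda>v. 2 * ev 8 v + ev 5 v - ev 3 v)"


section \<open>Generation of subalgebras\<close>

text \<open>The \<open>k\<close>-subalgebra of the function field generated by \<open>S\<close>.\<close>

inductive_set k_subalgebra :: "'k::field kpoly fract set \<Rightarrow> 'k kpoly fract set"
  for S :: "'k kpoly fract set"
where
  const: "to_fract (kconst c) \<in> k_subalgebra S"
| gen: "x \<in> S \<Longrightarrow> x \<in> k_subalgebra S"
| add: "x \<in> k_subalgebra S \<Longrightarrow> y \<in> k_subalgebra S \<Longrightarrow> x + y \<in> k_subalgebra S"
| mult: "x \<in> k_subalgebra S \<Longrightarrow> y \<in> k_subalgebra S \<Longrightarrow> x * y \<in> k_subalgebra S"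

definition minimally_generates :: "'k::field kpoly fract set \<Rightarrow> 'k kpoly fract set \<Rightarrow> bool" where
  "minimally_generates S A \<longleftrightarrow>
     k_subalgebra S = A \<and> (\<forall>T. T \<subset> S \<longrightarrow> k_subalgebra T \<noteq> A)"

end

theory Submission
  imports Defs "HOL-Computational_Algebra.Fundamental_Theorem_Algebra"
begin

text \<open>All thirteen elements are polynomials in the entries of the representation. For the cluster characters,
  the corner spaces of the Jacobian algebra at the vertices \<open>1\<close>, \<open>2\<close>, \<open>3\<close> are finite dimensional and spanned by
  explicit paths, so that a general map has an explicit uniserial cokernel; its Grassmannians of quotients are empty
  or single points, and the resulting Laurent polynomials simplify by the relations among the generators.

  Every invariant of \<open>SL\<close> is determined by its restriction to a slice that general representations can be
  moved to. There the invariants become polynomials in the restricted generators after multiplication with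
  a power of one of them. This denominator is removed by a saturation argument: monomials in the generators that
  are in normal form for a rewriting system remain linearly independent where the denominator vanishes.

  Minimality holds because for each of the thirteen elements there are two representations that are separated by
  this element but not by the other twelve.\<close>

section \<open>Polynomial functions\<close>

text \<open>Two denominators arise, hence two runs of the saturation argument. On the slice a
  one-parameter shear still acts; normalising it divides by \<open>v 3\<close>, the restriction of
  \<open>gen 4\<close>. Rewriting slice coordinates as invariants then divides by
  \<open>gen 12\<close>, that is by x_4. In both runs termination of the rewriting gives spanning,
  and leading terms on an explicit family of zeros give independence, so neither confluence nor a
  presentation of the ring has to be established. For the cluster characters the obstacle is that
  the Jacobian ideal is only given as an intersection of closed ideals. No basis of the algebra is
  computed: paths killed by relations bound the corner spaces from above, and coefficients at words
  that no relation contains bound them from below. Since \<open>CW\<close> and the Euler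
  characteristic are definite descriptions, each value is shown for every admissible choice: every
  map in an open set, every matrix presentation of its cokernel, every embedding of a field of
  definition into the complex numbers.\<close>

lemma poly_functions_uminus: "p \<in> poly_functions L \<Longrightarrow> (\<lambda>h. - p h) \<in> poly_functions L"
  using poly_functions.mult[OF poly_functions.const[of "-1"], of p L] by simp

lemma poly_functions_diff:
  "p \<in> poly_functions L \<Longrightarrow> q \<in> poly_functions L \<Longrightarrow> (\<lambda>h. p h - q h) \<in> poly_functions L"
  using poly_functions.add[OF _ poly_functions_uminus, of p L q] by simp

lemma poly_functions_sum:
  "(\<And>i. i \<in> I \<Longrightarrow> p i \<in> poly_functions L) \<Longrightarrow> (\<lambda>h. \<Sum>i\<in>I. p i h) \<in> poly_functions L"
  by (induction I rule: infinite_finite_induct)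
    (auto intro: poly_functions.add poly_functions.const[of 0])

lemma poly_functions_prod:
  "(\<And>i. i \<in> I \<Longrightarrow> p i \<in> poly_functions L) \<Longrightarrow> (\<lambda>h. \<Prod>i\<in>I. p i h) \<in> poly_functions L"
  by (induction I rule: infinite_finite_induct)
    (auto intro: poly_functions.mult poly_functions.const[of 1])

lemma poly_functions_power:
  "p \<in> poly_functions L \<Longrightarrow> (\<lambda>h. p h ^ n) \<in> poly_functions L"
  by (induction n) (auto intro: poly_functions.mult poly_functions.const[of 1])

lemmas poly_functions_intros =
  poly_functions.const poly_functions.add poly_functions.mult
  poly_functions_uminus poly_functions_diff poly_functions_sum poly_functions_prod
  poly_functions_power

lemma poly_functions_subst:
  assumes "p \<in> poly_functions L" "\<And>l. l \<in> L \<Longrightarrow> (\<lambda>x. l (s x)) \<in> poly_functions L'"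
  shows "(\<lambda>x. p (s x)) \<in> poly_functions L'"
  using assms by induction (auto intro: poly_functions.intros)

lemma poly_functions_mono: "p \<in> poly_functions L \<Longrightarrow> L \<subseteq> L' \<Longrightarrow> p \<in> poly_functions L'"
  using poly_functions_subst[of p L "\<lambda>x. x" L'] by (auto intro: poly_functions.linear)

text \<open>Restriction to a parametrised curve reduces questions about open sets to polynomials in
  one variable. Only the functions in \<open>L\<close> have to be polynomial along the curve, so its
  points may be homomorphisms as well as coordinate vectors.\<close>

lemma poly_functions_along:
  assumes "p \<in> poly_functions L" "\<And>l. l \<in> L \<Longrightarrow> \<exists>P. \<forall>t. l (\<gamma> t) = poly P t"
  shows "\<exists>P. \<forall>t. p (\<gamma> t) = poly P t"
  using assms(1)
proof induction
  case (const c)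
  show ?case by (intro exI[of _ "[:c:]"]) simp
next
  case (linear l)
  then show ?case using assms(2) by blast
next
  case (add p q)
  then show ?case by (metis poly_add)
next
  case (mult p q)
  then show ?case by (metis poly_mult)
qed

text \<open>Two nonempty principal open subsets of a parametrised line meet, because a product of
  nonzero polynomials is nonzero and the field is infinite. Irreducibility of affine spaces enters
  in this form.\<close>

lemma poly_functions_common_nonzero:
  fixes \<gamma> :: "'k::field_char_0 \<Rightarrow> 'h"
  assumes "p \<in> poly_functions L" "q \<in> poly_functions L"
    and "\<And>l. l \<in> L \<Longrightarrow> \<exists>P. \<forall>t. l (\<gamma> t) = poly P t"
    and "p (\<gamma> a) \<noteq> 0" "q (\<gamma> b) \<noteq> 0"
  shows "\<exists>t. p (\<gamma> t) \<noteq> 0 \<and> q (\<gamma> t) \<noteq> 0"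
proof -
  obtain P where P: "\<And>t. p (\<gamma> t) = poly P t" using poly_functions_along[OF assms(1), of \<gamma>] assms(3) by blast
  obtain Q where Q: "\<And>t. q (\<gamma> t) = poly Q t" using poly_functions_along[OF assms(2), of \<gamma>] assms(3) by blast
  have "P \<noteq> 0" "Q \<noteq> 0" using assms(4,5) P Q by auto
  then have "P * Q \<noteq> 0" by simp
  then obtain t where "poly (P * Q) t \<noteq> 0" using poly_all_0_iff_0 by blast
  then show ?thesis using P Q by auto
qed

section \<open>Independence of monomials and formal leading coefficients\<close>

lemma poly_eq_0_of_nonzero_args:
  fixes P :: "'k::field_char_0 poly"
  assumes "\<And>t. t \<noteq> 0 \<Longrightarrow> poly P t = 0"
  shows "P = 0"
proof -
  have "poly ([:0, 1:] * P) t = 0" for t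
    using assms[of t] by (cases "t = 0") auto
  then have "[:0, 1:] * P = 0" using poly_all_0_iff_0 by blast
  then show ?thesis by simp
qed

text \<open>Variables are split off one at a time: as a polynomial in the value at \<open>v\<close>,
  the relation separates into one relation for each exponent of \<open>v\<close>. Only nowhere
  vanishing assignments are tested, since the parameters of the families used later also occur in
  denominators.\<close>

lemma monomials_independent:
  fixes c :: "'i \<Rightarrow> 'k::field_char_0"
  assumes "finite V" "finite I"
    and "\<And>i j. i \<in> I \<Longrightarrow> j \<in> I \<Longrightarrow> (\<forall>v\<in>V. a i v = a j v) \<Longrightarrow> i = j"
    and "\<And>e. (\<forall>v. e v \<noteq> 0) \<Longrightarrow> (\<Sum>i\<in>I. c i * (\<Prod>v\<in>V. e v ^ a i v)) = 0"
  shows "\<forall>i\<in>I. c i = 0"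
  using assms
proof (induction V arbitrary: I rule: finite_induct)
  case empty
  show ?case
  proof
    fix i assume i: "i \<in> I"
    then have "I = {i}" using empty(2) by auto
    then show "c i = 0" using empty(3)[of "\<lambda>_. 1"] by simp
  qed
next
  case (insert v V)
  show ?case
  proof
    fix i assume i: "i \<in> I"
    define J where "J = {j\<in>I. a j v = a i v}"
    have "\<forall>j\<in>J. c j = 0"
    proof (rule insert.IH)
      show "finite J" using insert.prems(1) by (simp add: J_def)
    next
      fix j j' assume "j \<in> J" "j' \<in> J" "\<forall>v\<in>V. a j v = a j' v"
      then show "j = j'" using insert.prems(2)[of j j'] by (auto simp: J_def)
    next
      fix e :: "'a \<Rightarrow> 'k" assume e: "\<forall>v. e v \<noteq> 0"
      define P where "P = (\<Sum>j\<in>I. monom (c j * (\<Prod>v\<in>V. e v ^ a j v)) (a j v))"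
      have "poly P t = 0" if "t \<noteq> 0" for t
      proof -
        have "(\<Sum>j\<in>I. c j * (\<Prod>u\<in>insert v V. (e(v := t)) u ^ a j u)) = 0"
          by (rule insert.prems(3)) (use e that in auto)
        also have "(\<Sum>j\<in>I. c j * (\<Prod>u\<in>insert v V. (e(v := t)) u ^ a j u)) = poly P t"
          unfolding P_def poly_sum poly_monom using insert.hyps
          by (auto intro!: sum.cong prod.cong arg_cong2[of _ _ _ _ "(*)"] simp: mult_ac)
        finally show ?thesis .
      qed
      then have "coeff P (a i v) = 0" using poly_eq_0_of_nonzero_args[of P] by simp
      then show "(\<Sum>j\<in>J. c j * (\<Prod>v\<in>V. e v ^ a j v)) = 0"
        unfolding P_def coeff_sum coeff_monom J_def using insert.prems(1)
        by (simp add: sum.inter_filter)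
    qed
    then show "c i = 0" using i by (simp add: J_def)
  qed
qed

text \<open>The coefficient at a degree bound behaves like a leading coefficient even if the bound
  is not attained; in that case both sides vanish.\<close>

lemma coeff_mult_degree_le:
  assumes "degree p \<le> m" "degree q \<le> n"
  shows "coeff (p * q) (m + n) = coeff p m * coeff q n"
proof (cases "degree p = m \<and> degree q = n")
  case True
  then show ?thesis using coeff_mult_degree_sum[of p q] by auto
next
  case False
  then have "degree p + degree q < m + n" using assms by auto
  then have "coeff (p * q) (m + n) = 0"
    using degree_mult_le[of p q] by (intro coeff_eq_0) linarith
  moreover have "coeff p m * coeff q n = 0"
    using False assms by (metis coeff_eq_0 le_neq_implies_less mult_eq_0_iff mult_zero_left mult_zero_right)
  ultimately show ?thesis by simp
qed

lemma coeff_power_degree_le: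
  assumes "degree p \<le> m"
  shows "degree (p ^ n) \<le> m * n \<and> coeff (p ^ n) (m * n) = coeff p m ^ n"
proof (induction n)
  case 0
  then show ?case by simp
next
  case (Suc n)
  then show ?case using assms coeff_mult_degree_le[of p m "p ^ n" "m * n"]
      order_trans[OF degree_mult_le[of p "p ^ n"]] by (simp add: algebra_simps)
qed

lemma coeff_prod_degree_le:
  fixes p :: "'i \<Rightarrow> 'k::comm_ring_1 poly"
  assumes "finite I" "\<And>i. i \<in> I \<Longrightarrow> degree (p i) \<le> m i"
  shows "degree (\<Prod>i\<in>I. p i) \<le> (\<Sum>i\<in>I. m i) \<and>
    coeff (\<Prod>i\<in>I. p i) (\<Sum>i\<in>I. m i) = (\<Prod>i\<in>I. coeff (p i) (m i))"
  using assms
proof (induction I rule: finite_induct)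
  case empty
  then show ?case by simp
next
  case (insert i I)
  then have IH: "degree (\<Prod>i\<in>I. p i) \<le> (\<Sum>i\<in>I. m i)"
    "coeff (\<Prod>i\<in>I. p i) (\<Sum>i\<in>I. m i) = (\<Prod>i\<in>I. coeff (p i) (m i))" "degree (p i) \<le> m i"
    by auto
  have "degree (p i * (\<Prod>i\<in>I. p i)) \<le> m i + (\<Sum>i\<in>I. m i)"
    using order_trans[OF degree_mult_le[of "p i" "\<Prod>i\<in>I. p i"]] IH by simp
  then show ?case using insert.hyps IH coeff_mult_degree_le[OF IH(3,1)] by simp
qed


section \<open>Saturation of a subalgebra at one of its elements\<close>

definition mon :: "'i set \<Rightarrow> ('i \<Rightarrow> 'h \<Rightarrow> 'k::field) \<Rightarrow> ('i \<Rightarrow> nat) \<Rightarrow> 'h \<Rightarrow> 'k" where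
  "mon I g \<alpha> h = (\<Prod>i\<in>I. g i h ^ \<alpha> i)"

lemma mon_add: "mon I g (\<lambda>i. \<alpha> i + \<beta> i) h = mon I g \<alpha> h * mon I g \<beta> h"
  by (simp add: mon_def power_add prod.distrib)

lemma mon_in_poly_functions:
  "g ` I \<subseteq> L \<Longrightarrow> mon I g \<alpha> \<in> poly_functions L"
  unfolding mon_def[abs_def] by (auto intro!: poly_functions_intros intro: poly_functions.linear)

text \<open>A rewriting system for monomials in the generators modulo \<open>\<delta>\<close> whose normal forms have
  distinct leading terms on a family of zeros of \<open>\<delta>\<close>: leading terms are taken first with respect to
  the parameter \<open>x\<close>, and are then monomials in the parameters \<open>s\<close>.\<close>

locale saturation =
  fixes I :: "'i set" and g :: "'i \<Rightarrow> 'h \<Rightarrow> 'k::field_char_0" and \<delta> :: "'h \<Rightarrow> 'k"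
    and B :: "('i \<Rightarrow> nat) set" and wt :: "'i \<Rightarrow> nat"
    and n :: nat and \<tau> :: "(nat \<Rightarrow> 'k) \<Rightarrow> 'k \<Rightarrow> 'h"
    and W :: "'i \<Rightarrow> nat" and E :: "'i \<Rightarrow> nat \<Rightarrow> nat" and \<epsilon> :: "'i \<Rightarrow> 'k"
    and P :: "(nat \<Rightarrow> 'k) \<Rightarrow> 'i \<Rightarrow> 'k poly"
  assumes fin: "finite I"
    and out: "\<And>\<alpha> i. \<alpha> \<in> B \<Longrightarrow> i \<notin> I \<Longrightarrow> \<alpha> i = 0"
    and red: "\<And>\<alpha>. \<alpha> \<notin> B \<Longrightarrow> \<forall>i. i \<notin> I \<longrightarrow> \<alpha> i = 0 \<Longrightarrow>
      \<exists>\<kappa> rs q. (\<forall>i. \<kappa> i \<le> \<alpha> i) \<and> q \<in> poly_functions (insert \<delta> (g ` I)) \<and>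
        (\<forall>(c, \<mu>) \<in> set rs. (\<forall>i. i \<notin> I \<longrightarrow> \<mu> i = 0) \<and>
            (\<Sum>i\<in>I. wt i * \<mu> i) < (\<Sum>i\<in>I. wt i * \<kappa> i)) \<and>
        (\<forall>h. mon I g \<kappa> h = (\<Sum>(c, \<mu>)\<leftarrow>rs. c * mon I g \<mu> h) + \<delta> h * q h)"
    and zero: "\<And>s x. (\<forall>j. s j \<noteq> 0) \<Longrightarrow> \<delta> (\<tau> s x) = 0"
    and par: "\<And>s x i. (\<forall>j. s j \<noteq> 0) \<Longrightarrow> i \<in> I \<Longrightarrow> g i (\<tau> s x) = poly (P s i) x"
    and deg: "\<And>s i. (\<forall>j. s j \<noteq> 0) \<Longrightarrow> i \<in> I \<Longrightarrow> degree (P s i) \<le> W i"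
    and lead: "\<And>s i. (\<forall>j. s j \<noteq> 0) \<Longrightarrow> i \<in> I \<Longrightarrow>
      coeff (P s i) (W i) = \<epsilon> i * (\<Prod>j<n. s j ^ E i j)"
    and eps: "\<And>i. i \<in> I \<Longrightarrow> \<epsilon> i \<noteq> 0"
    and inj: "\<And>\<alpha> \<beta>. \<alpha> \<in> B \<Longrightarrow> \<beta> \<in> B \<Longrightarrow> (\<Sum>i\<in>I. W i * \<alpha> i) = (\<Sum>i\<in>I. W i * \<beta> i) \<Longrightarrow>
      (\<And>j. j < n \<Longrightarrow> (\<Sum>i\<in>I. E i j * \<alpha> i) = (\<Sum>i\<in>I. E i j * \<beta> i)) \<Longrightarrow> \<alpha> = \<beta>"
begin

text \<open>The cofactor \<open>q\<close> has to lie in the algebra generated by the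
  \<open>g\<close> and \<open>\<delta>\<close> and not merely be a function: it becomes the quotient
  returned by \<open>divides\<close>. The coefficients \<open>c\<close> are not claimed to be
  unique.\<close>

definition nf :: "('h \<Rightarrow> 'k) \<Rightarrow> bool" where
  "nf F \<longleftrightarrow> (\<exists>S c. finite S \<and> S \<subseteq> B \<and> (\<exists>q\<in>poly_functions (insert \<delta> (g ` I)).
     \<forall>h. F h = (\<Sum>\<alpha>\<in>S. c \<alpha> * mon I g \<alpha> h) + \<delta> h * q h))"

lemma nf_mult_delta: "q \<in> poly_functions (insert \<delta> (g ` I)) \<Longrightarrow> nf (\<lambda>h. \<delta> h * q h)"
  unfolding nf_def by (intro exI[of _ "{}"]) auto

lemma nf_add:
  assumes "nf F" "nf G"
  shows "nf (\<lambda>h. F h + G h)"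
proof -
  obtain S c q where F: "finite S" "S \<subseteq> B" "q \<in> poly_functions (insert \<delta> (g ` I))"
    "\<And>h. F h = (\<Sum>\<alpha>\<in>S. c \<alpha> * mon I g \<alpha> h) + \<delta> h * q h" using assms(1) unfolding nf_def by blast
  obtain T d r where G: "finite T" "T \<subseteq> B" "r \<in> poly_functions (insert \<delta> (g ` I))"
    "\<And>h. G h = (\<Sum>\<alpha>\<in>T. d \<alpha> * mon I g \<alpha> h) + \<delta> h * r h" using assms(2) unfolding nf_def by blast
  have *: "(\<Sum>\<alpha>\<in>S. c \<alpha> * mon I g \<alpha> h) =
      (\<Sum>\<alpha>\<in>S\<union>T. (if \<alpha> \<in> S then c \<alpha> else 0) * mon I g \<alpha> h)"
    "(\<Sum>\<alpha>\<in>T. d \<alpha> * mon I g \<alpha> h) =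
      (\<Sum>\<alpha>\<in>S\<union>T. (if \<alpha> \<in> T then d \<alpha> else 0) * mon I g \<alpha> h)" for h
    using F(1) G(1) by (auto intro!: sum.mono_neutral_cong_left)
  show ?thesis unfolding nf_def
    using F G(1,2) poly_functions.add[OF F(3) G(3)]
    by (intro exI[of _ "S \<union> T"]
        exI[of _ "\<lambda>\<alpha>. (if \<alpha> \<in> S then c \<alpha> else 0) + (if \<alpha> \<in> T then d \<alpha> else 0)"] conjI
        bexI[of _ "\<lambda>h. q h + r h"])
      (auto simp: F(4) G(4) * algebra_simps sum.distrib)
qed

lemma nf_scale: 
  assumes "nf F" shows "nf (\<lambda>h. a * F h)"
proof -
  obtain S c q where F: "finite S" "S \<subseteq> B" "q \<in> poly_functions (insert \<delta> (g ` I))"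
    "\<And>h. F h = (\<Sum>\<alpha>\<in>S. c \<alpha> * mon I g \<alpha> h) + \<delta> h * q h" using assms(1) unfolding nf_def by blast
  show ?thesis unfolding nf_def
    using F poly_functions.mult[OF poly_functions.const[of a] F(3)]
    by (intro exI[of _ S] exI[of _ "\<lambda>\<alpha>. a * c \<alpha>"] conjI bexI[of _ "\<lambda>h. a * q h"])
      (auto simp: algebra_simps sum_distrib_left)
qed

lemma nf_sum_list:
  "(\<And>r. r \<in> set rs \<Longrightarrow> nf (F r)) \<Longrightarrow> nf (\<lambda>h. \<Sum>r\<leftarrow>rs. F r h)"
proof (induction rs)
  case Nil
  then show ?case using nf_mult_delta[OF poly_functions.const[of 0]] by simp
next
  case (Cons r rs)
  then show ?case using nf_add[of "F r" "\<lambda>h. \<Sum>r\<leftarrow>rs. F r h"] by simp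
qed

lemma nf_sum:
  "(\<And>r. r \<in> S \<Longrightarrow> nf (F r)) \<Longrightarrow> nf (\<lambda>h. \<Sum>r\<in>S. F r h)"
proof (induction S rule: infinite_finite_induct)
  case (insert r S)
  then show ?case using nf_add[of "F r" "\<lambda>h. \<Sum>r\<in>S. F r h"] by simp
qed (use nf_mult_delta[OF poly_functions.const[of 0]] in simp_all)

text \<open>Induction on the weight. Writing \<alpha> as \<beta> + \<kappa>, a rule replaces
  \<kappa> by lighter monomials; adding \<beta> on both sides keeps the inequality strict because
  weights are additive.\<close>

lemma nf_mon:
  assumes "\<And>i. i \<notin> I \<Longrightarrow> \<alpha> i = 0"
  shows "nf (mon I g \<alpha>)"
  using assms
proof (induction "\<Sum>i\<in>I. wt i * \<alpha> i" arbitrary: \<alpha> rule: less_induct)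
  case less
  show ?case
  proof (cases "\<alpha> \<in> B")
    case True
    then show ?thesis unfolding nf_def
      by (intro exI[of _ "{\<alpha>}"] exI[of _ "\<lambda>_. 1"] conjI bexI[OF _ poly_functions.const[of 0]]) auto
  next
    case False
    have "\<forall>i. i \<notin> I \<longrightarrow> \<alpha> i = 0" using less.prems by simp
    from red[OF False this] obtain \<kappa> rs q where R: "(\<forall>i. \<kappa> i \<le> \<alpha> i) \<and> q \<in> poly_functions (insert \<delta> (g ` I)) \<and>
        (\<forall>(c, \<mu>) \<in> set rs. (\<forall>i. i \<notin> I \<longrightarrow> \<mu> i = 0) \<and>
            (\<Sum>i\<in>I. wt i * \<mu> i) < (\<Sum>i\<in>I. wt i * \<kappa> i)) \<and>
        (\<forall>h. mon I g \<kappa> h = (\<Sum>(c, \<mu>)\<leftarrow>rs. c * mon I g \<mu> h) + \<delta> h * q h)" by iprover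
    have r: "\<And>i. \<kappa> i \<le> \<alpha> i" "q \<in> poly_functions (insert \<delta> (g ` I))"
      "\<And>c \<mu> i. (c, \<mu>) \<in> set rs \<Longrightarrow> i \<notin> I \<Longrightarrow> \<mu> i = 0"
      "\<And>c \<mu>. (c, \<mu>) \<in> set rs \<Longrightarrow> (\<Sum>i\<in>I. wt i * \<mu> i) < (\<Sum>i\<in>I. wt i * \<kappa> i)"
      "\<And>h. mon I g \<kappa> h = (\<Sum>(c, \<mu>)\<leftarrow>rs. c * mon I g \<mu> h) + \<delta> h * q h"
      using R by fastforce+
    define \<beta> where "\<beta> = (\<lambda>i. \<alpha> i - \<kappa> i)"
    have \<alpha>: "\<alpha> = (\<lambda>i. \<beta> i + \<kappa> i)" using r(1) by (auto simp: \<beta>_def)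
    have "nf (\<lambda>h. \<Sum>(c, \<mu>)\<leftarrow>rs. c * mon I g (\<lambda>i. \<beta> i + \<mu> i) h)"
    proof (rule nf_sum_list)
      fix r assume "r \<in> set rs"
      then obtain c \<mu> where rr: "r = (c, \<mu>)" "(c, \<mu>) \<in> set rs" by (metis surj_pair)
      have "nf (mon I g (\<lambda>i. \<beta> i + \<mu> i))"
        using r(3,4)[OF rr(2)] less.prems
        by (intro less.hyps) (auto simp: \<alpha> sum.distrib algebra_simps)
      then show "nf (\<lambda>h. case r of (c, \<mu>) \<Rightarrow> c * mon I g (\<lambda>i. \<beta> i + \<mu> i) h)"
        using nf_scale by (simp add: rr)
    qed
    moreover have "nf (\<lambda>h. \<delta> h * (mon I g \<beta> h * q h))"
      by (intro nf_mult_delta poly_functions.mult mon_in_poly_functions r) auto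
    ultimately have "nf (\<lambda>h. (\<Sum>(c, \<mu>)\<leftarrow>rs. c * mon I g (\<lambda>i. \<beta> i + \<mu> i) h) + \<delta> h * (mon I g \<beta> h * q h))"
      by (rule nf_add)
    also have "(\<lambda>h. (\<Sum>(c, \<mu>)\<leftarrow>rs. c * mon I g (\<lambda>i. \<beta> i + \<mu> i) h) + \<delta> h * (mon I g \<beta> h * q h)) = mon I g \<alpha>"
      by (subst \<alpha>) (auto simp: fun_eq_iff mon_add r(5) algebra_simps sum_list_const_mult[symmetric]
          case_prod_unfold)
    finally show ?thesis .
  qed
qed

text \<open>Formulated for multiplication by \<open>G\<close> with \<open>F\<close> arbitrary, so
  that a product acts as a composition and two normal forms never have to be multiplied out.\<close>

lemma nf_poly_functions_mult:
  assumes "G \<in> poly_functions (insert \<delta> (g ` I))" "nf F"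
  shows "nf (\<lambda>h. G h * F h)"
  using assms
proof (induction arbitrary: F)
  case (const c)
  then show ?case using nf_scale by blast
next
  case (linear l F)
  obtain S c q where F: "finite S" "S \<subseteq> B" "q \<in> poly_functions (insert \<delta> (g ` I))"
    "\<And>h. F h = (\<Sum>\<alpha>\<in>S. c \<alpha> * mon I g \<alpha> h) + \<delta> h * q h" using linear(2) unfolding nf_def by blast
  \<comment> \<open>A normal form is itself an element of the algebra; this makes it an admissible
    cofactor in the case \<open>l = \<delta>\<close>.\<close>
  have "(\<lambda>h. (\<Sum>\<alpha>\<in>S. c \<alpha> * mon I g \<alpha> h) + \<delta> h * q h) \<in> poly_functions (insert \<delta> (g ` I))"
    by (intro poly_functions_intros mon_in_poly_functions F) (auto intro: poly_functions.linear)
  then have FA: "F \<in> poly_functions (insert \<delta> (g ` I))" unfolding F(4)[symmetric] .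
  show ?case
  proof (cases "l = \<delta>")
    case True
    then show ?thesis using nf_mult_delta[OF FA] by simp
  next
    case False
    then obtain i where i: "i \<in> I" "l = g i" using linear by auto
    have e: "mon I g (\<lambda>j. \<alpha> j + of_bool (j = i)) h = g i h * mon I g \<alpha> h" for \<alpha> h
    proof -
      have "(\<Prod>j\<in>I. g j h ^ (of_bool (j = i) :: nat)) = (\<Prod>j\<in>I. if j = i then g j h else 1)"
        by (intro prod.cong) auto
      also have "\<dots> = g i h" using i fin by simp
      finally show ?thesis by (simp add: mon_add) (simp add: mon_def)
    qed
    have "nf (\<lambda>h. (\<Sum>\<alpha>\<in>S. c \<alpha> * mon I g (\<lambda>j. \<alpha> j + of_bool (j = i)) h) + \<delta> h * (g i h * q h))"
    proof (intro nf_add nf_sum nf_scale nf_mon nf_mult_delta)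
      show "(\<lambda>h. g i h * q h) \<in> poly_functions (insert \<delta> (g ` I))"
        by (rule poly_functions.mult[OF poly_functions.linear F(3)]) (use i in auto)
    qed (use F i out in auto)
    then show ?thesis by (simp add: e i F(4) algebra_simps sum_distrib_left)
  qed
next
  case (add p q)
  then show ?case using nf_add by (simp add: distrib_right)
next
  case (mult p q)
  then show ?case by (simp add: mult.assoc)
qed

text \<open>On the family both \<open>\<delta>\<close> and \<open>G\<close> vanish, hence so does
  the normal part of \<open>G\<close>. Its terms of highest degree in \<open>x\<close> would give a
  relation between distinct monomials in \<open>s\<close>, so the normal part is zero and
  \<open>G\<close> is \<open>\<delta>\<close> times its cofactor.\<close>

theorem divides:
  assumes G: "G \<in> poly_functions (insert \<delta> (g ` I))"
    and vanish: "\<And>s x. (\<forall>j. s j \<noteq> 0) \<Longrightarrow> G (\<tau> s x) = 0"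
  shows "\<exists>q\<in>poly_functions (insert \<delta> (g ` I)). \<forall>h. G h = \<delta> h * q h"
proof -
  \<comment> \<open>The empty monomial is the constant 1, which turns the statement about
    multiplication by \<open>G\<close> into one about \<open>G\<close>.\<close>
  have "nf (\<lambda>h. G h * mon I g (\<lambda>_. 0) h)"
    using G by (intro nf_poly_functions_mult nf_mon) auto
  then obtain S c q where F: "finite S" "S \<subseteq> B" "q \<in> poly_functions (insert \<delta> (g ` I))"
    "\<And>h. G h = (\<Sum>\<alpha>\<in>S. c \<alpha> * mon I g \<alpha> h) + \<delta> h * q h" unfolding nf_def by (auto simp: mon_def)
  have "c \<alpha> = 0" if "\<alpha> \<in> S" for \<alpha>
  proof (rule ccontr)
    assume "c \<alpha> \<noteq> 0"
    define S' where "S' = {\<alpha>\<in>S. c \<alpha> \<noteq> 0}"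
    define w where "w \<alpha> = (\<Sum>i\<in>I. W i * \<alpha> i)" for \<alpha>
    have S': "finite S'" "S' \<noteq> {}" "S' \<subseteq> B" using F(1,2) that \<open>c \<alpha> \<noteq> 0\<close> by (auto simp: S'_def)
    define m where "m = Max (w ` S')"
    \<comment> \<open>Only monomials of maximal degree \<open>m\<close> in \<open>x\<close> matter:
      by \<open>inj\<close>, distinct normal monomials of equal degree have distinct exponents in
      \<open>s\<close>.\<close>
    define T where "T = {\<alpha>\<in>S'. w \<alpha> = m}"
    have "m \<in> w ` S'" unfolding m_def using S' by (intro Max_in) auto
    then have T: "finite T" "T \<subseteq> S'" "T \<noteq> {}" using S' by (auto simp: T_def)
    have "\<forall>\<alpha>\<in>T. c \<alpha> * (\<Prod>i\<in>I. \<epsilon> i ^ \<alpha> i) = 0"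
    proof (rule monomials_independent[where V = "{..<n}" and a = "\<lambda>\<alpha> j. \<Sum>i\<in>I. E i j * \<alpha> i"])
      fix \<alpha> \<beta> assume "\<alpha> \<in> T" "\<beta> \<in> T" "\<forall>v\<in>{..<n}. (\<Sum>i\<in>I. E i v * \<alpha> i) = (\<Sum>i\<in>I. E i v * \<beta> i)"
      then show "\<alpha> = \<beta>" using S' by (intro inj) (auto simp: T_def w_def)
    next
      fix s :: "nat \<Rightarrow> 'k" assume s: "\<forall>v. s v \<noteq> 0"
      \<comment> \<open>The normal part along the family for fixed \<open>s\<close>, as a polynomial
        in \<open>x\<close>. It vanishes at every \<open>x\<close>, so its coefficient at
        \<open>m\<close> is zero.\<close>
      define R where "R = (\<Sum>\<alpha>\<in>S'. Polynomial.smult (c \<alpha>) (\<Prod>i\<in>I. P s i ^ \<alpha> i))"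
      have "poly R x = 0" for x
      proof -
        have "poly R x = (\<Sum>\<alpha>\<in>S'. c \<alpha> * mon I g \<alpha> (\<tau> s x))"
          using par[OF s] by (simp add: R_def poly_sum poly_prod mon_def)
        also have "\<dots> = (\<Sum>\<alpha>\<in>S. c \<alpha> * mon I g \<alpha> (\<tau> s x))"
          using F(1) by (intro sum.mono_neutral_left) (auto simp: S'_def)
        also have "\<dots> = 0" using vanish[OF s, of x] F(4)[of "\<tau> s x"] zero[OF s] by simp
        finally show ?thesis .
      qed
      then have "coeff R m = 0" by (metis poly_all_0_iff_0 coeff_0)
      moreover have "coeff (\<Prod>i\<in>I. P s i ^ \<alpha> i) m =
          (if w \<alpha> = m then (\<Prod>i\<in>I. \<epsilon> i ^ \<alpha> i) * (\<Prod>v<n. s v ^ (\<Sum>i\<in>I. E i v * \<alpha> i)) else 0)"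
        if "\<alpha> \<in> S'" for \<alpha>
      proof -
        have c: "degree (\<Prod>i\<in>I. P s i ^ \<alpha> i) \<le> w \<alpha> \<and>
          coeff (\<Prod>i\<in>I. P s i ^ \<alpha> i) (w \<alpha>) = (\<Prod>i\<in>I. coeff (P s i ^ \<alpha> i) (W i * \<alpha> i))"
          unfolding w_def using coeff_power_degree_le deg[OF s]
          by (intro coeff_prod_degree_le fin) blast
        have "(\<Prod>i\<in>I. coeff (P s i ^ \<alpha> i) (W i * \<alpha> i)) = (\<Prod>i\<in>I. (\<epsilon> i * (\<Prod>j<n. s j ^ E i j)) ^ \<alpha> i)"
          using coeff_power_degree_le[OF deg[OF s]] lead[OF s] by (intro prod.cong) auto
        also have "\<dots> = (\<Prod>i\<in>I. \<epsilon> i ^ \<alpha> i) * (\<Prod>i\<in>I. \<Prod>j<n. s j ^ (E i j * \<alpha> i))"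
          by (simp add: power_mult_distrib prod.distrib prod_power_distrib power_mult)
        also have "(\<Prod>i\<in>I. \<Prod>j<n. s j ^ (E i j * \<alpha> i)) = (\<Prod>v<n. s v ^ (\<Sum>i\<in>I. E i v * \<alpha> i))"
          by (subst prod.swap) (simp add: power_sum)
        moreover have "coeff (\<Prod>i\<in>I. P s i ^ \<alpha> i) m = 0" if "w \<alpha> \<noteq> m"
        proof -
          have "w \<alpha> \<le> m" unfolding m_def using S' \<open>\<alpha> \<in> S'\<close> by auto
          then show ?thesis using c that by (intro coeff_eq_0) linarith
        qed
        ultimately show ?thesis using c by auto
      qed
      ultimately have "(\<Sum>\<alpha>\<in>S'. c \<alpha> * (if w \<alpha> = m then (\<Prod>i\<in>I. \<epsilon> i ^ \<alpha> i) *
          (\<Prod>v<n. s v ^ (\<Sum>i\<in>I. E i v * \<alpha> i)) else 0)) = 0"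
        by (simp add: R_def coeff_sum)
      also have "(\<Sum>\<alpha>\<in>S'. c \<alpha> * (if w \<alpha> = m then (\<Prod>i\<in>I. \<epsilon> i ^ \<alpha> i) *
          (\<Prod>v<n. s v ^ (\<Sum>i\<in>I. E i v * \<alpha> i)) else 0)) =
        (\<Sum>\<alpha>\<in>T. c \<alpha> * (\<Prod>i\<in>I. \<epsilon> i ^ \<alpha> i) * (\<Prod>v<n. s v ^ (\<Sum>i\<in>I. E i v * \<alpha> i)))"
        unfolding T_def using S'(1) by (intro sum.mono_neutral_cong_right) (auto simp: mult.assoc)
      finally show "(\<Sum>\<alpha>\<in>T. c \<alpha> * (\<Prod>i\<in>I. \<epsilon> i ^ \<alpha> i) * (\<Prod>v<n. s v ^ (\<Sum>i\<in>I. E i v * \<alpha> i))) = 0" .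
    qed (use T in auto)
    moreover have "(\<Prod>i\<in>I. \<epsilon> i ^ \<alpha> i) \<noteq> 0" for \<alpha> :: "'i \<Rightarrow> nat" using eps fin by auto
    ultimately have "\<forall>\<alpha>\<in>T. c \<alpha> = 0" by auto
    then show False using T by (auto simp: S'_def)
  qed
  then have "G h = \<delta> h * q h" for h using F(4) by simp
  then show ?thesis using F(3) by blast
qed

end


section \<open>Evaluation of polynomials\<close>

definition mpe :: "(coord \<Rightarrow> 'k::comm_ring_1) \<Rightarrow> (coord \<Rightarrow>\<^sub>0 nat) \<Rightarrow> 'k" where
  "mpe e m = (\<Prod>v\<in>Poly_Mapping.keys m. e v ^ Poly_Mapping.lookup m v)"

text \<open>\<open>keval\<close> with a free assignment of values to the variables, so that matrix
  shapes and out-of-range entries play no part in the algebra.\<close>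

definition pev :: "'k::comm_ring_1 kpoly \<Rightarrow> (coord \<Rightarrow> 'k) \<Rightarrow> 'k" where
  "pev f e = (\<Sum>m\<in>Poly_Mapping.keys f. Poly_Mapping.lookup f m * mpe e m)"

lemma mpe_superset:
  "finite V \<Longrightarrow> Poly_Mapping.keys m \<subseteq> V \<Longrightarrow> mpe e m = (\<Prod>v\<in>V. e v ^ Poly_Mapping.lookup m v)"
  unfolding mpe_def by (rule prod.mono_neutral_left) (auto simp: in_keys_iff)

lemma mpe_0 [simp]: "mpe e 0 = 1"
  by (simp add: mpe_def)

lemma mpe_single [simp]: "mpe e (Poly_Mapping.single v n) = e v ^ n"
  by (simp add: mpe_def)

lemma mpe_add: "mpe e (m + n) = mpe e m * mpe e n"
proof -
  let ?V = "Poly_Mapping.keys m \<union> Poly_Mapping.keys n"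
  have "Poly_Mapping.keys (m + n) \<subseteq> ?V" by (rule keys_add)
  then have "mpe e (m + n) = (\<Prod>v\<in>?V. e v ^ Poly_Mapping.lookup (m + n) v)"
    by (intro mpe_superset) auto
  also have "\<dots> = (\<Prod>v\<in>?V. e v ^ Poly_Mapping.lookup m v) * (\<Prod>v\<in>?V. e v ^ Poly_Mapping.lookup n v)"
    by (simp add: lookup_add power_add prod.distrib)
  also have "\<dots> = mpe e m * mpe e n" by (simp add: mpe_superset[of ?V])
  finally show ?thesis .
qed

lemma pev_superset:
  "finite S \<Longrightarrow> Poly_Mapping.keys f \<subseteq> S \<Longrightarrow> pev f e = (\<Sum>m\<in>S. Poly_Mapping.lookup f m * mpe e m)"
  unfolding pev_def by (rule sum.mono_neutral_left) (auto simp: in_keys_iff)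

lemma pev_add [simp]: "pev (f + g) e = pev f e + pev g e"
proof -
  let ?V = "Poly_Mapping.keys f \<union> Poly_Mapping.keys g"
  have "Poly_Mapping.keys (f + g) \<subseteq> ?V" by (rule keys_add)
  then have "pev (f + g) e = (\<Sum>m\<in>?V. Poly_Mapping.lookup (f + g) m * mpe e m)"
    by (intro pev_superset) auto
  then show ?thesis by (simp add: lookup_add distrib_right sum.distrib pev_superset[of ?V])
qed

lemma pev_single [simp]: "pev (Poly_Mapping.single m c) e = c * mpe e m"
  by (simp add: pev_def)

lemma pev_0 [simp]: "pev 0 e = 0"
  by (simp add: pev_def)

lemma pev_sum [simp]: "pev (\<Sum>i\<in>I. f i) e = (\<Sum>i\<in>I. pev (f i) e)"
  by (induction I rule: infinite_finite_induct) auto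

lemma kpoly_expand: "f = (\<Sum>m\<in>Poly_Mapping.keys f. Poly_Mapping.single m (Poly_Mapping.lookup f m))"
  by (rule poly_mapping_eqI) (auto simp: lookup_sum lookup_single when_def in_keys_iff)

lemma pev_mult [simp]: "pev (f * g) e = pev f e * pev g e"
proof -
  have "pev (f * g) e = pev ((\<Sum>m\<in>Poly_Mapping.keys f. Poly_Mapping.single m (Poly_Mapping.lookup f m)) *
      (\<Sum>n\<in>Poly_Mapping.keys g. Poly_Mapping.single n (Poly_Mapping.lookup g n))) e"
    by (metis kpoly_expand)
  also have "\<dots> = (\<Sum>m\<in>Poly_Mapping.keys f. \<Sum>n\<in>Poly_Mapping.keys g.
      Poly_Mapping.lookup f m * Poly_Mapping.lookup g n * (mpe e m * mpe e n))"
    by (simp add: sum_product mult_single mpe_add)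
  also have "\<dots> = pev f e * pev g e"
    by (simp add: pev_def sum_product mult_ac)
  finally show ?thesis .
qed

lemma pev_1 [simp]: "pev 1 e = 1"
  by (simp flip: single_one)

lemma pev_uminus [simp]: "pev (- f) e = - pev f e"
  using pev_add[of f "- f" e] by (simp add: add_eq_0_iff)

lemma pev_diff [simp]: "pev (f - g) e = pev f e - pev g e"
  using pev_add[of f "- g" e] by simp

lemma pev_kvar [simp]: "pev (kvar v) e = e v"
  by (simp add: kvar_def)

lemma pev_kconst [simp]: "pev (kconst c) e = c"
  by (simp add: kconst_def)

text \<open>Distinct monomials differ in their exponents on the finite set of variables that occur,
  so \<open>monomials_independent\<close> applies to the coefficients.\<close>

lemma pev_eq_0_imp:
  fixes f :: "'k::field_char_0 kpoly"
  assumes "\<And>e. (\<forall>v. e v \<noteq> 0) \<Longrightarrow> pev f e = 0"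
  shows "f = 0"
proof -
  let ?V = "\<Union>(Poly_Mapping.keys ` Poly_Mapping.keys f)"
  have "\<forall>m\<in>Poly_Mapping.keys f. Poly_Mapping.lookup f m = 0"
  proof (rule monomials_independent[where V = ?V and a = Poly_Mapping.lookup])
    fix m n assume "m \<in> Poly_Mapping.keys f" "n \<in> Poly_Mapping.keys f"
      "\<forall>v\<in>?V. Poly_Mapping.lookup m v = Poly_Mapping.lookup n v"
    then show "m = n" by (intro poly_mapping_eqI) (metis UnionI image_eqI in_keys_iff)
  next
    fix e :: "coord \<Rightarrow> 'k" assume "\<forall>v. e v \<noteq> 0"
    then have "pev f e = 0" by (rule assms)
    also have "pev f e = (\<Sum>m\<in>Poly_Mapping.keys f. Poly_Mapping.lookup f m *
        (\<Prod>v\<in>?V. e v ^ Poly_Mapping.lookup m v))"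
      unfolding pev_def by (intro sum.cong refl) (subst mpe_superset[of ?V], auto)
    finally show "(\<Sum>m\<in>Poly_Mapping.keys f. Poly_Mapping.lookup f m *
        (\<Prod>v\<in>?V. e v ^ Poly_Mapping.lookup m v)) = 0" .
  qed auto
  then show ?thesis using in_keys_iff by (metis keys_eq_empty equals0I)
qed

lemma pev_inject:
  fixes f g :: "'k::field_char_0 kpoly"
  assumes "\<And>e. pev f e = pev g e"
  shows "f = g"
  using pev_eq_0_imp[of "f - g"] assms by simp

lemma pev_in_poly_functions: "pev f \<in> poly_functions (range (\<lambda>v e. e v))"
  unfolding pev_def[abs_def] mpe_def[abs_def] by (auto intro!: poly_functions_intros intro: poly_functions.linear)

lemma keval_eq_pev: "keval f M = pev f (\<lambda>v. case v of Coord a i j \<Rightarrow> M a $$ (i, j))"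
  by (simp add: keval_def pev_def mpe_def)

lemma pev_cong_kcoords:
  assumes "f \<in> kpoly_ring" "\<And>v. v \<in> kcoords \<Longrightarrow> e v = e' v"
  shows "pev f e = pev f e'"
  unfolding pev_def mpe_def using assms
  by (intro sum.cong prod.cong refl arg_cong2[of _ _ _ _ "(*)"] arg_cong2[of _ _ _ _ power])
    (auto simp: kpoly_ring_def subset_iff)

lemma kpoly_ring_add: "f \<in> kpoly_ring \<Longrightarrow> g \<in> kpoly_ring \<Longrightarrow> f + g \<in> kpoly_ring"
  unfolding kpoly_ring_def using keys_add[of f g] by blast

lemma kpoly_ring_mult: "f \<in> kpoly_ring \<Longrightarrow> g \<in> kpoly_ring \<Longrightarrow> f * g \<in> kpoly_ring"
  unfolding kpoly_ring_def
proof (clarify, goal_cases)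
  case (1 m v)
  then obtain a b where "m = a + b" "a \<in> Poly_Mapping.keys f" "b \<in> Poly_Mapping.keys g"
    using keys_mult[of f g] by blast
  then show ?case using 1 keys_add[of a b] by blast
qed

lemma kpoly_ring_uminus: "f \<in> kpoly_ring \<Longrightarrow> - f \<in> kpoly_ring"
  unfolding kpoly_ring_def by (simp add: in_keys_iff)

lemma kpoly_ring_diff: "f \<in> kpoly_ring \<Longrightarrow> g \<in> kpoly_ring \<Longrightarrow> f - g \<in> kpoly_ring"
  using kpoly_ring_add[OF _ kpoly_ring_uminus, of f g] by simp

lemma kpoly_ring_0: "0 \<in> kpoly_ring"
  by (simp add: kpoly_ring_def)

lemma kpoly_ring_kconst: "kconst c \<in> kpoly_ring"
  by (simp add: kpoly_ring_def kconst_def)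

lemma kpoly_ring_kvar: "v \<in> kcoords \<Longrightarrow> kvar v \<in> kpoly_ring"
  by (simp add: kpoly_ring_def kvar_def)

text \<open>With the converse below, this translates membership in a subalgebra of the function
  field into a statement about functions on the representation space, where identities can be
  checked pointwise.\<close>

lemma k_subalgebra_of_poly_functions:
  fixes Y :: "'k::field kpoly set"
  assumes "F \<in> poly_functions (pev ` Y)"
  shows "\<exists>y. to_fract y \<in> k_subalgebra (to_fract ` Y) \<and> pev y = F"
  using assms
proof induction
  case (const c)
  show ?case by (intro exI[of _ "kconst c"]) (auto intro: k_subalgebra.const)
next
  case (linear l)
  then show ?case by (auto intro: k_subalgebra.gen)
next
  case (add p q)
  then obtain y z where "to_fract y \<in> k_subalgebra (to_fract ` Y)" "pev y = p"
    "to_fract z \<in> k_subalgebra (to_fract ` Y)" "pev z = q" by blast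
  then show ?case using k_subalgebra.add[of "to_fract y" _ "to_fract z"]
    by (intro exI[of _ "y + z"]) auto
next
  case (mult p q)
  then obtain y z where "to_fract y \<in> k_subalgebra (to_fract ` Y)" "pev y = p"
    "to_fract z \<in> k_subalgebra (to_fract ` Y)" "pev z = q" by blast
  then show ?case using k_subalgebra.mult[of "to_fract y" _ "to_fract z"]
    by (intro exI[of _ "y * z"]) auto
qed

lemma poly_functions_of_k_subalgebra:
  fixes Y :: "'k::field kpoly set"
  assumes "x \<in> k_subalgebra (to_fract ` Y)"
  shows "\<exists>y. x = to_fract y \<and> pev y \<in> poly_functions (pev ` Y)"
  using assms
proof induction
  case (const c)
  show ?case by (intro exI[of _ "kconst c"]) (auto simp: fun_eq_iff intro: poly_functions.const)
next
  case (gen x)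
  then show ?case by (auto intro: poly_functions.linear)
next
  case (add x y)
  then obtain a b where "x = to_fract a" "pev a \<in> poly_functions (pev ` Y)"
    "y = to_fract b" "pev b \<in> poly_functions (pev ` Y)" by blast
  then show ?case using poly_functions.add[of "pev a" _ "pev b"]
    by (intro exI[of _ "a + b"]) (auto simp: pev_add[abs_def] cong: if_cong)
next
  case (mult x y)
  then obtain a b where "x = to_fract a" "pev a \<in> poly_functions (pev ` Y)"
    "y = to_fract b" "pev b \<in> poly_functions (pev ` Y)" by blast
  then show ?case using poly_functions.mult[of "pev a" _ "pev b"]
    by (intro exI[of _ "a * b"]) (auto simp: pev_mult[abs_def])
qed

text \<open>Points that the generators do not separate are not separated by the algebra. This serves
  to compare a representation with its image in the slice and, for two fixed representations, to
  prove that a generator is indispensable.\<close>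

lemma poly_functions_eq:
  assumes "F \<in> poly_functions L" "\<And>l. l \<in> L \<Longrightarrow> l a = l b"
  shows "F a = F b"
  using assms by induction auto


section \<open>The generators\<close>

lemma det_2x2:
  assumes A: "A \<in> carrier_mat 2 2"
  shows "det A = A $$ (0, 0) * A $$ (1, 1) - A $$ (0, 1) * A $$ (1, 0)"
proof -
  have "det A = (\<Sum>j<2. A $$ (0, j) * cofactor A 0 j)"
    by (rule laplace_expansion_row[OF A]) simp
  also have "\<dots> = A $$ (0, 0) * A $$ (1, 1) - A $$ (0, 1) * A $$ (1, 0)"
    using A by (simp add: numeral_2_eq_2 cofactor_def det_single mat_delete_carrier)
      (simp add: mat_delete_def det_single)
  finally show ?thesis .
qed

text \<open>The arguments are the three columns, each listed from top to bottom.\<close>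

definition det3 :: "('r::comm_ring_1) \<Rightarrow> 'r \<Rightarrow> 'r \<Rightarrow> 'r \<Rightarrow> 'r \<Rightarrow> 'r \<Rightarrow> 'r \<Rightarrow> 'r \<Rightarrow> 'r \<Rightarrow> 'r" where
  "det3 x0 x1 x2 y0 y1 y2 z0 z1 z2 =
     x0 * (y1 * z2 - y2 * z1) - y0 * (x1 * z2 - x2 * z1) + z0 * (x1 * y2 - x2 * y1)"

lemma det_3x3:
  assumes A: "A \<in> carrier_mat 3 3"
  shows "det A = det3 (A $$ (0, 0)) (A $$ (1, 0)) (A $$ (2, 0)) (A $$ (0, 1)) (A $$ (1, 1))
    (A $$ (2, 1)) (A $$ (0, 2)) (A $$ (1, 2)) (A $$ (2, 2))"
proof -
  have d: "det (mat_delete A 0 j) = mat_delete A 0 j $$ (0, 0) * mat_delete A 0 j $$ (1, 1) -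
      mat_delete A 0 j $$ (0, 1) * mat_delete A 0 j $$ (1, 0)" if "j < 3" for j
    using A that by (intro det_2x2) (simp add: mat_delete_def)
  have "det A = (\<Sum>j<3. A $$ (0, j) * cofactor A 0 j)"
    by (rule laplace_expansion_row[OF A]) simp
  also have "\<dots> = A $$ (0, 0) * cofactor A 0 0 + A $$ (0, 1) * cofactor A 0 1 + A $$ (0, 2) * cofactor A 0 2"
    by (simp add: numeral_3_eq_3 numeral_2_eq_2)
  also have "\<dots> = det3 (A $$ (0, 0)) (A $$ (1, 0)) (A $$ (2, 0)) (A $$ (0, 1)) (A $$ (1, 1))
    (A $$ (2, 1)) (A $$ (0, 2)) (A $$ (1, 2)) (A $$ (2, 2))"
    using A unfolding cofactor_def
    by (simp add: d) (simp add: det3_def mat_delete_def algebra_simps numeral_2_eq_2)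
  finally show ?thesis .
qed

text \<open>Writing \<open>A\<close>, \<open>B\<close>, \<open>C\<^sub>m\<close>, \<open>D\<close> for the matrices of a representation, \<open>gP e m\<close> is the row \<open>A B C\<^sub>m\<close>, \<open>gE e m\<close> is
  \<open>B C\<^sub>m\<close>, and \<open>gR1 e\<close>, \<open>gR2 e\<close> are the rows of the linear forms \<open>det (C\<^sub>1 | C\<^sub>2 v)\<close> and
  \<open>det (C\<^sub>1 v | C\<^sub>2)\<close>.\<close>

definition gP :: "(coord \<Rightarrow> 'r::comm_ring_1) \<Rightarrow> karc \<Rightarrow> nat \<Rightarrow> 'r" where
  "gP e m s =
     (e (Coord L12 0 0) * e (Coord L23 0 0) + e (Coord L12 0 1) * e (Coord L23 1 0)) * e (Coord m 0 s) +
     (e (Coord L12 0 0) * e (Coord L23 0 1) + e (Coord L12 0 1) * e (Coord L23 1 1)) * e (Coord m 1 s) +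
     (e (Coord L12 0 0) * e (Coord L23 0 2) + e (Coord L12 0 1) * e (Coord L23 1 2)) * e (Coord m 2 s)"

definition gE :: "(coord \<Rightarrow> 'r::comm_ring_1) \<Rightarrow> karc \<Rightarrow> nat \<Rightarrow> nat \<Rightarrow> 'r" where
  "gE e m r s = e (Coord L23 r 0) * e (Coord m 0 s) + e (Coord L23 r 1) * e (Coord m 1 s) +
     e (Coord L23 r 2) * e (Coord m 2 s)"

definition gv :: "(coord \<Rightarrow> 'r::comm_ring_1) \<Rightarrow> karc \<Rightarrow> nat \<Rightarrow> 'r" where
  "gv e m r = gE e m r 0 * e (Coord R21 0 0) + gE e m r 1 * e (Coord R21 1 0)"

definition gR1 :: "(coord \<Rightarrow> 'r::comm_ring_1) \<Rightarrow> nat \<Rightarrow> 'r" where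
  "gR1 e s = det3 (e (Coord Mid1 0 0)) (e (Coord Mid1 1 0)) (e (Coord Mid1 2 0))
     (e (Coord Mid1 0 1)) (e (Coord Mid1 1 1)) (e (Coord Mid1 2 1))
     (e (Coord Mid2 0 s)) (e (Coord Mid2 1 s)) (e (Coord Mid2 2 s))"

definition gR2 :: "(coord \<Rightarrow> 'r::comm_ring_1) \<Rightarrow> nat \<Rightarrow> 'r" where
  "gR2 e s = det3 (e (Coord Mid1 0 s)) (e (Coord Mid1 1 s)) (e (Coord Mid1 2 s))
     (e (Coord Mid2 0 0)) (e (Coord Mid2 1 0)) (e (Coord Mid2 2 0))
     (e (Coord Mid2 0 1)) (e (Coord Mid2 1 1)) (e (Coord Mid2 2 1))"

definition dotD :: "(coord \<Rightarrow> 'r::comm_ring_1) \<Rightarrow> (nat \<Rightarrow> 'r) \<Rightarrow> 'r" where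
  "dotD e w = w 0 * e (Coord R21 0 0) + w 1 * e (Coord R21 1 0)"

definition br :: "(nat \<Rightarrow> 'r::comm_ring_1) \<Rightarrow> (nat \<Rightarrow> 'r) \<Rightarrow> 'r" where
  "br v w = v 0 * w 1 - v 1 * w 0"

text \<open>The polarised 2x2 determinant: the coefficient of t in det(x + t y).\<close>

definition mixed_det :: "(nat \<Rightarrow> nat \<Rightarrow> 'r::comm_ring_1) \<Rightarrow> (nat \<Rightarrow> nat \<Rightarrow> 'r) \<Rightarrow> 'r" where
  "mixed_det x y = x 0 0 * y 1 1 - x 1 0 * y 0 1 + y 0 0 * x 1 1 - y 1 0 * x 0 1"

text \<open>Indices 0, 1, 11, 12, 4, 6, 2, 3 are x_1, ..., x_8 in this order; indices 5, 8, 9, 7, 10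
  turn out to be \<open>x2circ\<close>, \<open>x3prime\<close>, \<open>x31\<close>,
  \<open>x32\<close>, \<open>x312\<close>. Entries 0 to 3 pair the four covariant rows
  \<open>gP e Mid1\<close>, \<open>gP e Mid2\<close>, \<open>gR1 e\<close>, \<open>gR2 e\<close>
  with the column D; entries 7 to 10 and 12 are their brackets. The sixth bracket, of
  \<open>gP e Mid1\<close> with \<open>gR2 e\<close>, is minus that of \<open>gP e Mid2\<close> with
  \<open>gR1 e\<close>. Entries 4 to 6 are the coefficients of det(B C_1 + t B C_2). The signs of
  entries 9 and 10 are those of the cluster characters.\<close>

definition gens :: "(coord \<Rightarrow> 'r::comm_ring_1) \<Rightarrow> 'r list" where
  "gens e = [dotD e (gP e Mid1), dotD e (gP e Mid2), dotD e (gR1 e), dotD e (gR2 e),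
     gE e Mid1 0 0 * gE e Mid1 1 1 - gE e Mid1 1 0 * gE e Mid1 0 1,
     mixed_det (gE e Mid1) (gE e Mid2),
     gE e Mid2 0 0 * gE e Mid2 1 1 - gE e Mid2 1 0 * gE e Mid2 0 1,
     br (gP e Mid1) (gR1 e), br (gP e Mid2) (gR1 e), - br (gP e Mid2) (gR2 e), - br (gR1 e) (gR2 e),
     br (gv e Mid1) (gv e Mid2), br (gP e Mid1) (gP e Mid2)]"

definition gen :: "nat \<Rightarrow> (coord \<Rightarrow> 'r::comm_ring_1) \<Rightarrow> 'r" where
  "gen i e = gens e ! i"

lemma length_gens [simp]: "length (gens e) = 13"
  by (simp add: gens_def)

lemma gen_simps:
  "gen 0 e = dotD e (gP e Mid1)" "gen 1 e = dotD e (gP e Mid2)" "gen (Suc 0) e = dotD e (gP e Mid2)"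
  "gen 2 e = dotD e (gR1 e)" "gen 3 e = dotD e (gR2 e)"
  "gen 4 e = gE e Mid1 0 0 * gE e Mid1 1 1 - gE e Mid1 1 0 * gE e Mid1 0 1"
  "gen 5 e = mixed_det (gE e Mid1) (gE e Mid2)"
  "gen 6 e = gE e Mid2 0 0 * gE e Mid2 1 1 - gE e Mid2 1 0 * gE e Mid2 0 1"
  "gen 7 e = br (gP e Mid1) (gR1 e)" "gen 8 e = br (gP e Mid2) (gR1 e)"
  "gen 9 e = - br (gP e Mid2) (gR2 e)" "gen 10 e = - br (gR1 e) (gR2 e)"
  "gen 11 e = br (gv e Mid1) (gv e Mid2)" "gen 12 e = br (gP e Mid1) (gP e Mid2)"
  by (simp_all add: gen_def gens_def)

lemma less_13_iff: "i < (13::nat) \<longleftrightarrow> i \<in> {0,1,2,3,4,5,6,7,8,9,10,11,12}"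
  by (auto simp: numeral_eq_Suc less_Suc_eq)

lemma less_13E:
  assumes "i < (13::nat)"
  obtains "i = 0" | "i = 1" | "i = 2" | "i = 3" | "i = 4" | "i = 5" | "i = 6" | "i = 7" | "i = 8"
    | "i = 9" | "i = 10" | "i = 11" | "i = 12"
  using assms unfolding less_13_iff by blast

lemmas gen_defs = gP_def gE_def gv_def gR1_def gR2_def dotD_def br_def mixed_det_def det3_def

text \<open>The same formula read at \<open>kvar\<close> is the polynomial and read at field
  elements its value; this is why \<open>gen\<close> is polymorphic in the ring.\<close>

lemma pev_gen:
  fixes e :: "coord \<Rightarrow> 'k::field"
  assumes "i < 13" shows "pev (gen i kvar) e = gen i e"
  using assms by (elim less_13E; hypsubst) (simp_all only: gen_simps gen_defs pev_add pev_mult pev_diff pev_uminus pev_kvar)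

lemma kpoly_ring_gen:
  assumes "i < 13" shows "gen i (kvar :: coord \<Rightarrow> 'k::field kpoly) \<in> kpoly_ring"
proof -
  have k: "kvar (Coord a i j) \<in> (kpoly_ring :: 'k kpoly set)"
    if "i < kbeta (ktail a)" "j < kbeta (khead a)" for a i j
    by (rule kpoly_ring_kvar) (use that in \<open>auto simp: kcoords_def\<close>)
  show ?thesis
    using assms by (elim less_13E; hypsubst)
      (simp_all only: gen_simps gen_defs, (intro kpoly_ring_add kpoly_ring_mult kpoly_ring_diff kpoly_ring_uminus k; simp add: kbeta_def)+)
qed

definition mrep :: "(coord \<Rightarrow> 'r) \<Rightarrow> karc \<Rightarrow> 'r mat" where
  "mrep e a = mat (kbeta (ktail a)) (kbeta (khead a)) (\<lambda>(i, j). e (Coord a i j))"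

lemma generic_rep_eq: "generic_rep = mrep kvar"
  by (simp add: fun_eq_iff generic_rep_def mrep_def)

lemma kbeta_simps [simp]:
  "kbeta 1 = 1" "kbeta 2 = 2" "kbeta (-1) = 1" "kbeta (-2) = 2" "kbeta (-3) = 3"
  by (simp_all add: kbeta_def)

lemma mrep_carrier [simp]:
  "mrep e L12 \<in> carrier_mat 1 2" "mrep e L23 \<in> carrier_mat 2 3" "mrep e Mid1 \<in> carrier_mat 3 2"
  "mrep e Mid2 \<in> carrier_mat 3 2" "mrep e R21 \<in> carrier_mat 2 1"
  by (simp_all add: mrep_def)

lemma mrep_dim [simp]: "dim_row (mrep e a) = kbeta (ktail a)" "dim_col (mrep e a) = kbeta (khead a)"
  by (simp_all add: mrep_def)

lemma mrep_index [simp]: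
  "i < kbeta (ktail a) \<Longrightarrow> j < kbeta (khead a) \<Longrightarrow> mrep e a $$ (i, j) = e (Coord a i j)"
  by (simp add: mrep_def)

lemma sum_upt_2: "(\<Sum>i = 0..<2. f i) = f 0 + f (1::nat)"
  by (simp add: numeral_2_eq_2)

lemma sum_upt_3: "(\<Sum>i = 0..<3. f i) = f 0 + f 1 + f (2::nat)"
  by (simp add: numeral_3_eq_3 numeral_2_eq_2)

lemma less_2_iff: "i < (2::nat) \<longleftrightarrow> i = 0 \<or> i = 1" and less_3_iff: "i < (3::nat) \<longleftrightarrow> i = 0 \<or> i = 1 \<or> i = 2"
  by auto

lemma mid_arrows:
  assumes "m \<in> {Mid1, Mid2}" shows "ktail m = -3" "khead m = 2"
  using assms by auto

lemma mult_mrep_index: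
  fixes e :: "coord \<Rightarrow> 'r::comm_ring_1"
  assumes m: "m \<in> {Mid1, Mid2}"
  shows "s < 2 \<Longrightarrow> (mrep e L12 * mrep e L23 * mrep e m) $$ (0, s) = gP e m s"
    and "r < 2 \<Longrightarrow> s < 2 \<Longrightarrow> (mrep e L23 * mrep e m) $$ (r, s) = gE e m r s"
    and "(mrep e L12 * mrep e L23 * mrep e m * mrep e R21) $$ (0, 0) = dotD e (gP e m)"
    and "r < 2 \<Longrightarrow> (mrep e L23 * mrep e m * mrep e R21) $$ (r, 0) = gv e m r"
    and "r < 3 \<Longrightarrow> (mrep e m * mrep e R21) $$ (r, 0) =
      e (Coord m r 0) * e (Coord R21 0 0) + e (Coord m r 1) * e (Coord R21 1 0)"
  using mid_arrows[OF m]
  by (simp_all add: scalar_prod_def sum_upt_2 sum_upt_3 gP_def gE_def gv_def dotD_def)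

lemma kpath_simps:
  "kpath a 1 1 = [L12, L23, a, R21]" "kpath a 1 2 = [L12, L23, a]"
  "kpath a (Suc 0) (Suc 0) = [L12, L23, a, R21]" "kpath a (Suc 0) 2 = [L12, L23, a]"
  "kpath a 2 1 = [L23, a, R21]" "kpath a 2 2 = [L23, a]" "kpath a 2 (Suc 0) = [L23, a, R21]"
  "kpath a 3 1 = [a, R21]" "kpath a 3 2 = [a]" "kpath a 3 (Suc 0) = [a, R21]"
  by (simp_all add: kpath_def)

lemma kblock_mrep:
  fixes e :: "coord \<Rightarrow> 'r::comm_ring_1"
  assumes m: "m \<in> {Mid1, Mid2}"
  shows "kblock (mrep e) m 1 1 = mrep e L12 * mrep e L23 * mrep e m * mrep e R21"
    "kblock (mrep e) m 1 2 = mrep e L12 * mrep e L23 * mrep e m"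
    "kblock (mrep e) m 2 1 = mrep e L23 * mrep e m * mrep e R21"
    "kblock (mrep e) m 2 2 = mrep e L23 * mrep e m"
    "kblock (mrep e) m 3 1 = mrep e m * mrep e R21"
    "kblock (mrep e) m 3 2 = mrep e m"
    "kblock (mrep e) m i 0 = 0\<^sub>m i 0"
  using m by (auto simp: kblock_def path_mat_def kpath_simps)

text \<open>Blocks with index 0 contribute no rows or columns, so each case is a determinant of size
  1, 2 or 3. The ring is arbitrary in order to include the polynomials in which \<open>xv\<close> is
  defined.\<close>

lemma s_row_mrep:
  fixes e :: "coord \<Rightarrow> 'r::comm_ring_1"
  shows "s_row (mrep e) 1 1 0 = gen 0 e" "s_row (mrep e) 1 0 1 = gen 1 e"
    "s_row (mrep e) 2 1 1 = gen 11 e" "s_row (mrep e) 2 2 0 = gen 4 e" "s_row (mrep e) 2 0 2 = gen 6 e"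
    "s_row (mrep e) 3 2 1 = gen 2 e" "s_row (mrep e) 3 1 2 = gen 3 e"
    "s_col (mrep e) 1 1 2 = gen 12 e"
proof -
  have M: "Mid1 \<in> {Mid1, Mid2}" "Mid2 \<in> {Mid1, Mid2}" by auto
  note k = kblock_mrep[OF M(1)] kblock_mrep[OF M(2)]
  note i = mult_mrep_index[OF M(1)] mult_mrep_index[OF M(2)]
  show "s_row (mrep e) 1 1 0 = gen 0 e" "s_row (mrep e) 1 0 1 = gen 1 e"
    unfolding s_row_def k gen_simps by (subst det_single, rule carrier_matI, simp, simp, simp add: i del: index_mult_mat(1))+
  show "s_row (mrep e) 2 1 1 = gen 11 e" "s_row (mrep e) 2 2 0 = gen 4 e" "s_row (mrep e) 2 0 2 = gen 6 e"
    unfolding s_row_def k gen_simps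
    by (subst det_2x2, rule carrier_matI, simp, simp, simp add: i br_def mult_ac del: index_mult_mat(1))+
  show "s_row (mrep e) 3 2 1 = gen 2 e" "s_row (mrep e) 3 1 2 = gen 3 e"
    unfolding s_row_def k gen_simps
    by (subst det_3x3, rule carrier_matI, simp, simp, simp add: i dotD_def gR1_def gR2_def det3_def algebra_simps del: index_mult_mat(1))+
  show "s_col (mrep e) 1 1 2 = gen 12 e"
    unfolding s_col_def k gen_simps append_rows_def
    by (subst det_2x2, rule carrier_matI, simp, simp, simp add: i br_def mult_ac del: index_mult_mat(1))+
qed

lemma xv_eq:
  "xv 1 = to_fract (gen 0 kvar)" "xv 2 = to_fract (gen 1 kvar)" "xv 3 = to_fract (gen 11 kvar)"
  "xv 4 = to_fract (gen 12 kvar)" "xv 5 = to_fract (gen 4 kvar)" "xv 6 = to_fract (gen 6 kvar)"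
  "xv 7 = to_fract (gen 2 kvar)" "xv 8 = to_fract (gen 3 kvar)"
  unfolding xv_def generic_rep_eq s_row_mrep by simp_all


section \<open>Invariance of the generators\<close>

text \<open>Base change written as an intertwining relation, so that no inverse matrix occurs in
  entrywise computations.\<close>

definition moved :: "(int \<Rightarrow> 'k::field mat) \<Rightarrow> (coord \<Rightarrow> 'k) \<Rightarrow> (coord \<Rightarrow> 'k) \<Rightarrow> bool" where
  "moved g e e' \<longleftrightarrow> g \<in> SL_group \<and> (\<forall>a. mrep e' a * g (khead a) = g (ktail a) * mrep e a)"

lemma SL_groupD:
  assumes "g \<in> SL_group"
  shows "g (ktail a) \<in> carrier_mat (kbeta (ktail a)) (kbeta (ktail a))"
    "g (khead a) \<in> carrier_mat (kbeta (khead a)) (kbeta (khead a))"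
    "det (g (ktail a)) = 1" "det (g (khead a)) = 1"
  using assms by (cases a; simp add: SL_group_def KQ_def)+

lemma mrep_carrier_mat [simp]: "mrep e a \<in> carrier_mat (kbeta (ktail a)) (kbeta (khead a))"
  by (simp add: mrep_def)

lemma is_rep_mrep: "is_rep KQ kbeta (mrep e)"
  by (simp add: is_rep_def KQ_def)

lemma mrep_of_rep:
  assumes "is_rep KQ kbeta M"
  shows "mrep (\<lambda>v. case v of Coord a i j \<Rightarrow> M a $$ (i, j)) a = M a"
proof -
  have "M a \<in> carrier_mat (kbeta (ktail a)) (kbeta (khead a))"
    using assms by (simp add: is_rep_def KQ_def)
  then show ?thesis by (intro eq_matI) (simp_all add: carrier_matD mrep_def)
qed

lemma smult_one_mat: "(1 :: 'r::comm_ring_1) \<cdot>\<^sub>m A = A"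
  by (intro eq_matI) auto

lemma keval_mrep: "f \<in> kpoly_ring \<Longrightarrow> keval f (mrep e) = pev f e"
  unfolding keval_eq_pev by (rule pev_cong_kcoords) (auto simp: kcoords_def)

lemma base_change_moved:
  assumes "moved g e e'"
  shows "base_change g (mrep e) a = mrep e' a"
proof -
  have g: "g \<in> SL_group" and m: "mrep e' a * g (khead a) = g (ktail a) * mrep e a"
    using assms by (auto simp: moved_def)
  note c = SL_groupD[OF g, of a]
  have "base_change g (mrep e) a = mrep e' a * g (khead a) * adj_mat (g (khead a))"
    by (simp add: base_change_def m)
  also have "\<dots> = mrep e' a * (g (khead a) * adj_mat (g (khead a)))"
    by (rule assoc_mult_mat[OF mrep_carrier_mat c(2) adj_mat(1)[OF c(2)]])
  also have "\<dots> = mrep e' a"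
    using adj_mat(2)[OF c(2)] c(4) right_mult_one_mat[OF mrep_carrier_mat, of e' a]
    by (simp add: smult_one_mat)
  finally show ?thesis .
qed

lemma SI_moved:
  assumes f: "f \<in> SI" and m: "moved g e e'"
  shows "pev f e' = pev f e"
proof -
  have "keval f (base_change g (mrep e)) = keval f (mrep e)"
    using f m is_rep_mrep unfolding SI_def moved_def by blast
  moreover have "base_change g (mrep e) = mrep e'" using base_change_moved[OF m] by blast
  moreover have "f \<in> kpoly_ring" using f by (simp add: SI_def)
  ultimately show ?thesis using keval_mrep by metis
qed

text \<open>Every representation is the matrix form of its own coordinate vector, and the adjugate
  cancels because the determinants are 1; so intertwined pairs account for the whole group
  action.\<close>

lemma SI_I:
  assumes f: "f \<in> kpoly_ring" and inv: "\<And>g e e'. moved g e e' \<Longrightarrow> pev f e' = pev f e"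
  shows "f \<in> SI"
  unfolding SI_def
proof (clarsimp simp: f)
  fix g :: "int \<Rightarrow> 'a mat" and M :: "karc \<Rightarrow> 'a mat" assume g: "g \<in> SL_group" and M: "is_rep KQ kbeta M"
  have c: "M a \<in> carrier_mat (kbeta (ktail a)) (kbeta (khead a))" for a
    using M by (simp add: is_rep_def KQ_def)
  have "is_rep KQ kbeta (base_change g M)"
    using c SL_groupD[OF g] adj_mat(1)[OF SL_groupD(2)[OF g]]
    by (auto simp: is_rep_def KQ_def base_change_def intro!: mult_carrier_mat)
  then have r: "mrep (\<lambda>v. case v of Coord a i j \<Rightarrow> base_change g M a $$ (i, j)) a = base_change g M a" for a
    by (rule mrep_of_rep)
  have "moved g (\<lambda>v. case v of Coord a i j \<Rightarrow> M a $$ (i, j))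
      (\<lambda>v. case v of Coord a i j \<Rightarrow> base_change g M a $$ (i, j))"
    unfolding moved_def r mrep_of_rep[OF M]
  proof (intro conjI allI g)
    fix a
    note s = SL_groupD[OF g, of a]
    have "base_change g M a * g (khead a) = g (ktail a) * M a * (adj_mat (g (khead a)) * g (khead a))"
      unfolding base_change_def
      by (rule assoc_mult_mat[OF mult_carrier_mat[OF s(1) c] adj_mat(1)[OF s(2)] s(2)])
    also have "\<dots> = g (ktail a) * M a"
      using adj_mat(3)[OF s(2)] s(1,4) c[of a]
        right_mult_one_mat[of "g (ktail a) * M a" "kbeta (ktail a)" "kbeta (khead a)"]
      by (simp add: smult_one_mat)
    finally show "base_change g M a * g (khead a) = g (ktail a) * M a" .
  qed
  from inv[OF this] show "keval f (base_change g M) = keval f M" by (simp add: keval_eq_pev)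
qed

lemma mult_mat_index_2:
  "X \<in> carrier_mat n 2 \<Longrightarrow> H \<in> carrier_mat 2 m \<Longrightarrow> i < n \<Longrightarrow> j < m \<Longrightarrow>
    (X * H) $$ (i, j) = X $$ (i, 0) * H $$ (0, j) + X $$ (i, 1) * H $$ (1, j)"
  by (auto simp: scalar_prod_def sum_upt_2)

lemma mult_mat_index_3:
  "X \<in> carrier_mat n 3 \<Longrightarrow> H \<in> carrier_mat 3 m \<Longrightarrow> i < n \<Longrightarrow> j < m \<Longrightarrow>
    (X * H) $$ (i, j) = X $$ (i, 0) * H $$ (0, j) + X $$ (i, 1) * H $$ (1, j) + X $$ (i, 2) * H $$ (2, j)"
  by (auto simp: scalar_prod_def sum_upt_3)

lemma det3_mult:
  fixes g00 :: "'k::field"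
  shows "det3 (g00 * x0 + g01 * x1 + g02 * x2) (g10 * x0 + g11 * x1 + g12 * x2) (g20 * x0 + g21 * x1 + g22 * x2)
     (g00 * y0 + g01 * y1 + g02 * y2) (g10 * y0 + g11 * y1 + g12 * y2) (g20 * y0 + g21 * y1 + g22 * y2)
     (g00 * z0 + g01 * z1 + g02 * z2) (g10 * z0 + g11 * z1 + g12 * z2) (g20 * z0 + g21 * z1 + g22 * z2) =
    det3 g00 g10 g20 g01 g11 g21 g02 g12 g22 * det3 x0 x1 x2 y0 y1 y2 z0 z1 z2"
  by (simp add: det3_def algebra_simps)

text \<open>The four rows are multiplied on the right by the inverse of \<open>g 2\<close> and D on
  the left by \<open>g 2\<close>, so pairings are fixed and brackets change by a determinant, which
  is 1. The matrices B C_m change by \<open>g (-2)\<close> on the left and the inverse of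
  \<open>g 2\<close> on the right, which fixes their determinants and the polarised
  determinant.\<close>

lemma gen_moved:
  assumes m: "moved g e e'" and i: "i < 13"
  shows "gen i e' = gen i e"
proof -
  have g: "g \<in> SL_group" and eq: "\<And>a. mrep e' a * g (khead a) = g (ktail a) * mrep e a"
    using m by (auto simp: moved_def)
  have c: "g (-1) \<in> carrier_mat 1 1" "g 1 \<in> carrier_mat 1 1" "g (-2) \<in> carrier_mat 2 2"
    "g 2 \<in> carrier_mat 2 2" "g (-3) \<in> carrier_mat 3 3" "det (g (-1)) = 1" "det (g 1) = 1" "det (g (-2)) = 1"
    "det (g 2) = 1" "det (g (-3)) = 1"
    using g by (simp_all add: SL_group_def KQ_def)
  \<comment> \<open>A 1x1 matrix of determinant 1 is the identity, so the two end vertices do not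
    act.\<close>
  have one: "g (-1) = 1\<^sub>m 1" "g 1 = 1\<^sub>m 1"
    using c(1,2,6,7) by (intro eq_matI; simp add: det_single)+
  define h00 h01 h10 h11 where h: "h00 = g 2 $$ (0, 0)" "h01 = g 2 $$ (0, 1)" "h10 = g 2 $$ (1, 0)" "h11 = g 2 $$ (1, 1)"
  have dh: "h00 * h11 - h01 * h10 = 1" using det_2x2[OF c(4)] c(9) by (simp add: h)
  define a00 a01 a10 a11 where a: "a00 = g (-2) $$ (0, 0)" "a01 = g (-2) $$ (0, 1)" "a10 = g (-2) $$ (1, 0)" "a11 = g (-2) $$ (1, 1)"
  have da: "a00 * a11 - a01 * a10 = 1" using det_2x2[OF c(3)] c(8) by (simp add: a)
  have D: "e' (Coord R21 s 0) = g 2 $$ (s, 0) * e (Coord R21 0 0) + g 2 $$ (s, 1) * e (Coord R21 1 0)" if "s < 2" for s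
  proof -
    have "mrep e' R21 = g 2 * mrep e R21" using eq[of R21] one right_mult_one_mat[of "mrep e' R21" 2 1] by simp
    from arg_cong[OF this, of "\<lambda>M. M $$ (s, 0)"] show ?thesis
      using that mult_mat_index_2[OF c(4) mrep_carrier(5), of s 0 e] by simp
  qed
  have BC: "mrep e' L23 * mrep e' m * g 2 = g (-2) * (mrep e L23 * mrep e m)" if "m \<in> {Mid1, Mid2}" for m
  proof -
    have mc: "mrep e m \<in> carrier_mat 3 2" "mrep e' m \<in> carrier_mat 3 2" using that by auto
    have "mrep e' L23 * mrep e' m * g 2 = mrep e' L23 * (mrep e' m * g 2)"
      using mc c by (intro assoc_mult_mat) auto
    also have "\<dots> = mrep e' L23 * (g (-3) * mrep e m)" using eq[of m] that by auto
    also have "\<dots> = mrep e' L23 * g (-3) * mrep e m"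
      using mc c by (intro assoc_mult_mat[symmetric]) auto
    also have "\<dots> = g (-2) * mrep e L23 * mrep e m" using eq[of L23] by simp
    also have "\<dots> = g (-2) * (mrep e L23 * mrep e m)" using mc c by (intro assoc_mult_mat) auto
    finally show ?thesis .
  qed
  have Pm: "mrep e' L12 * mrep e' L23 * mrep e' m * g 2 = mrep e L12 * mrep e L23 * mrep e m" if "m \<in> {Mid1, Mid2}" for m
  proof -
    have mc: "mrep e m \<in> carrier_mat 3 2" "mrep e' m \<in> carrier_mat 3 2" using that by auto
    have "mrep e' L12 * mrep e' L23 * mrep e' m * g 2 = mrep e' L12 * (mrep e' L23 * mrep e' m * g 2)"
      using assoc_mult_mat[OF mrep_carrier(1,2) mc(2), of e' e'] mc
        assoc_mult_mat[OF mrep_carrier(1) mult_carrier_mat[OF mrep_carrier(2) mc(2)] c(4), of e' e'] by simp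
    also have "\<dots> = mrep e' L12 * (g (-2) * (mrep e L23 * mrep e m))" by (simp only: BC[OF that])
    also have "\<dots> = mrep e' L12 * g (-2) * (mrep e L23 * mrep e m)"
      using mc c by (intro assoc_mult_mat[symmetric]) auto
    also have "mrep e' L12 * g (-2) = mrep e L12" using eq[of L12] one left_mult_one_mat[of "mrep e L12" 1 2] by simp
    also have "mrep e L12 * (mrep e L23 * mrep e m) = mrep e L12 * mrep e L23 * mrep e m"
      using mc by (intro assoc_mult_mat[symmetric]) auto
    finally show ?thesis .
  qed
  have P: "gP e m s = gP e' m 0 * g 2 $$ (0, s) + gP e' m 1 * g 2 $$ (1, s)" if "m \<in> {Mid1, Mid2}" "s < 2" for m s
  proof -
    have mc: "mrep e' L12 * mrep e' L23 * mrep e' m \<in> carrier_mat 1 2" using that by (auto intro!: mult_carrier_mat)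
    show ?thesis using arg_cong[OF Pm[OF that(1)], of "\<lambda>M. M $$ (0, s)"] that
      by (simp only: mult_mat_index_2[OF mc c(4)] mult_mrep_index[OF that(1)] zero_less_one pos2 one_less_numeral_iff semiring_norm)
  qed
  have E: "gE e' m r 0 * g 2 $$ (0, s) + gE e' m r 1 * g 2 $$ (1, s) = g (-2) $$ (r, 0) * gE e m 0 s + g (-2) $$ (r, 1) * gE e m 1 s"
    if "m \<in> {Mid1, Mid2}" "r < 2" "s < 2" for m r s
  proof -
    have mc: "mrep e' L23 * mrep e' m \<in> carrier_mat 2 2" "mrep e L23 * mrep e m \<in> carrier_mat 2 2"
      using that by (auto intro!: mult_carrier_mat)
    show ?thesis using arg_cong[OF BC[OF that(1)], of "\<lambda>M. M $$ (r, s)"] that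
      by (simp only: mult_mat_index_2[OF mc(1) c(4)] mult_mat_index_2[OF c(3) mc(2)] mult_mrep_index[OF that(1)] zero_less_one pos2 one_less_numeral_iff semiring_norm)
  qed
  have C: "e' (Coord m r 0) * g 2 $$ (0, s) + e' (Coord m r 1) * g 2 $$ (1, s) =
      g (-3) $$ (r, 0) * e (Coord m 0 s) + g (-3) $$ (r, 1) * e (Coord m 1 s) + g (-3) $$ (r, 2) * e (Coord m 2 s)"
    if "m \<in> {Mid1, Mid2}" "r < 3" "s < 2" for m r s
  proof -
    have mc: "mrep e' m \<in> carrier_mat 3 2" "mrep e m \<in> carrier_mat 3 2" using that by auto
    have "mrep e' m * g 2 = g (-3) * mrep e m" using eq[of m] that by auto
    from arg_cong[OF this, of "\<lambda>M. M $$ (r, s)"] show ?thesis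
      using that mid_arrows[OF that(1)]
      by (simp add: mult_mat_index_2[OF mc(1) c(4)] mult_mat_index_3[OF c(5) mc(2)] del: index_mult_mat(1))
  qed
  have M: "Mid1 \<in> {Mid1, Mid2}" "Mid2 \<in> {Mid1, Mid2}" by auto
  have d3: "det3 (g (-3) $$ (0, 0)) (g (-3) $$ (1, 0)) (g (-3) $$ (2, 0)) (g (-3) $$ (0, 1)) (g (-3) $$ (1, 1))
    (g (-3) $$ (2, 1)) (g (-3) $$ (0, 2)) (g (-3) $$ (1, 2)) (g (-3) $$ (2, 2)) = 1"
    using det_3x3[OF c(5)] c(10) by simp
  have DD: "e' (Coord R21 0 0) = h00 * e (Coord R21 0 0) + h01 * e (Coord R21 1 0)"
    "e' (Coord R21 1 0) = h10 * e (Coord R21 0 0) + h11 * e (Coord R21 1 0)"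
    using D[of 0] D[of 1] by (simp_all add: h)
  have rows_dot: "dotD e' w' = dotD e w"
    and rows_br: "\<And>v v' :: nat \<Rightarrow> 'a. v 0 = v' 0 * h00 + v' 1 * h10 \<Longrightarrow> v 1 = v' 0 * h01 + v' 1 * h11 \<Longrightarrow> br v w = br v' w'"
    if w: "w 0 = w' 0 * h00 + w' 1 * h10" "w 1 = w' 0 * h01 + w' 1 * h11" for w w' :: "nat \<Rightarrow> 'a"
  proof -
    show "dotD e' w' = dotD e w" unfolding dotD_def DD w by (simp add: algebra_simps)
  next
    fix v v' :: "nat \<Rightarrow> 'a" assume v: "v 0 = v' 0 * h00 + v' 1 * h10" "v 1 = v' 0 * h01 + v' 1 * h11"
    have "br v w = br v' w' * (h00 * h11 - h01 * h10)" unfolding br_def w v by (simp add: algebra_simps)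
    then show "br v w = br v' w'" using dh by simp
  qed
  have P': "gP e m 0 = gP e' m 0 * h00 + gP e' m 1 * h10" "gP e m 1 = gP e' m 0 * h01 + gP e' m 1 * h11"
    if "m \<in> {Mid1, Mid2}" for m
    using P[OF that, of 0] P[OF that, of 1] by (simp_all add: h)
  have CC: "e' (Coord m r 0) * h00 + e' (Coord m r 1) * h10 =
      g (-3) $$ (r, 0) * e (Coord m 0 0) + g (-3) $$ (r, 1) * e (Coord m 1 0) + g (-3) $$ (r, 2) * e (Coord m 2 0)"
    "e' (Coord m r 0) * h01 + e' (Coord m r 1) * h11 =
      g (-3) $$ (r, 0) * e (Coord m 0 1) + g (-3) $$ (r, 1) * e (Coord m 1 1) + g (-3) $$ (r, 2) * e (Coord m 2 1)"
    if "m \<in> {Mid1, Mid2}" "r < 3" for m r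
    using C[OF that, of 0] C[OF that, of 1] by (simp_all add: h)
  \<comment> \<open>The forms \<open>gR1\<close> and \<open>gR2\<close> are alternating in the two
    columns of one middle matrix and linear in a column of the other: the alternating pair
    contributes det(\<open>g 2\<close>), the remaining column the action on rows.\<close>
  have det3_lin: "det3 (x0 * s + y0 * t) (x1 * s + y1 * t) (x2 * s + y2 * t) (x0 * u + y0 * v) (x1 * u + y1 * v) (x2 * u + y2 * v)
      (z0 * p + w0 * q) (z1 * p + w1 * q) (z2 * p + w2 * q) =
      (s * v - u * t) * (det3 x0 x1 x2 y0 y1 y2 z0 z1 z2 * p + det3 x0 x1 x2 y0 y1 y2 w0 w1 w2 * q)"
    "det3 (z0 * p + w0 * q) (z1 * p + w1 * q) (z2 * p + w2 * q) (x0 * s + y0 * t) (x1 * s + y1 * t) (x2 * s + y2 * t) (x0 * u + y0 * v) (x1 * u + y1 * v) (x2 * u + y2 * v) =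
      (s * v - u * t) * (det3 z0 z1 z2 x0 x1 x2 y0 y1 y2 * p + det3 w0 w1 w2 x0 x1 x2 y0 y1 y2 * q)"
    for s t u v p q x0 x1 x2 y0 y1 y2 z0 z1 z2 w0 w1 w2 :: 'a
    by (simp_all add: det3_def algebra_simps)
  have dh': "h00 * h11 - h01 * h10 = 1" by (rule dh)
  have R1: "gR1 e 0 = gR1 e' 0 * h00 + gR1 e' 1 * h10" "gR1 e 1 = gR1 e' 0 * h01 + gR1 e' 1 * h11"
    and R2: "gR2 e 0 = gR2 e' 0 * h00 + gR2 e' 1 * h10" "gR2 e 1 = gR2 e' 0 * h01 + gR2 e' 1 * h11"
  proof -
    \<comment> \<open>The factor det(\<open>g (-3)\<close>) = 1 is inserted so that
      \<open>det3_mult\<close> can move all three columns at once.\<close>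
    have "gR1 e 0 = det3 (g (-3) $$ (0, 0)) (g (-3) $$ (1, 0)) (g (-3) $$ (2, 0)) (g (-3) $$ (0, 1)) (g (-3) $$ (1, 1))
       (g (-3) $$ (2, 1)) (g (-3) $$ (0, 2)) (g (-3) $$ (1, 2)) (g (-3) $$ (2, 2)) * gR1 e 0" by (simp only: d3 mult_1_left)
    also have "\<dots> = (h00 * h11 - h01 * h10) * (gR1 e' 0 * h00 + gR1 e' 1 * h10)"
      unfolding gR1_def det3_mult[symmetric] det3_lin(1)[symmetric] using CC[OF M(1)] CC[OF M(2)] by simp
    finally show "gR1 e 0 = gR1 e' 0 * h00 + gR1 e' 1 * h10" by (simp add: dh)
    have "gR1 e 1 = det3 (g (-3) $$ (0, 0)) (g (-3) $$ (1, 0)) (g (-3) $$ (2, 0)) (g (-3) $$ (0, 1)) (g (-3) $$ (1, 1))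
       (g (-3) $$ (2, 1)) (g (-3) $$ (0, 2)) (g (-3) $$ (1, 2)) (g (-3) $$ (2, 2)) * gR1 e 1" by (simp only: d3 mult_1_left)
    also have "\<dots> = (h00 * h11 - h01 * h10) * (gR1 e' 0 * h01 + gR1 e' 1 * h11)"
      unfolding gR1_def det3_mult[symmetric] det3_lin(1)[symmetric] using CC[OF M(1)] CC[OF M(2)] by simp
    finally show "gR1 e 1 = gR1 e' 0 * h01 + gR1 e' 1 * h11" by (simp add: dh)
    have "gR2 e 0 = det3 (g (-3) $$ (0, 0)) (g (-3) $$ (1, 0)) (g (-3) $$ (2, 0)) (g (-3) $$ (0, 1)) (g (-3) $$ (1, 1))
       (g (-3) $$ (2, 1)) (g (-3) $$ (0, 2)) (g (-3) $$ (1, 2)) (g (-3) $$ (2, 2)) * gR2 e 0" by (simp only: d3 mult_1_left)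
    also have "\<dots> = (h00 * h11 - h01 * h10) * (gR2 e' 0 * h00 + gR2 e' 1 * h10)"
      unfolding gR2_def det3_mult[symmetric] det3_lin(2)[symmetric] using CC[OF M(1)] CC[OF M(2)] by simp
    finally show "gR2 e 0 = gR2 e' 0 * h00 + gR2 e' 1 * h10" by (simp add: dh)
    have "gR2 e 1 = det3 (g (-3) $$ (0, 0)) (g (-3) $$ (1, 0)) (g (-3) $$ (2, 0)) (g (-3) $$ (0, 1)) (g (-3) $$ (1, 1))
       (g (-3) $$ (2, 1)) (g (-3) $$ (0, 2)) (g (-3) $$ (1, 2)) (g (-3) $$ (2, 2)) * gR2 e 1" by (simp only: d3 mult_1_left)
    also have "\<dots> = (h00 * h11 - h01 * h10) * (gR2 e' 0 * h01 + gR2 e' 1 * h11)"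
      unfolding gR2_def det3_mult[symmetric] det3_lin(2)[symmetric] using CC[OF M(1)] CC[OF M(2)] by simp
    finally show "gR2 e 1 = gR2 e' 0 * h01 + gR2 e' 1 * h11" by (simp add: dh)
  qed
  have EE: "gE e' m 0 0 * h00 + gE e' m 0 1 * h10 = a00 * gE e m 0 0 + a01 * gE e m 1 0"
    "gE e' m 0 0 * h01 + gE e' m 0 1 * h11 = a00 * gE e m 0 1 + a01 * gE e m 1 1"
    "gE e' m 1 0 * h00 + gE e' m 1 1 * h10 = a10 * gE e m 0 0 + a11 * gE e m 1 0"
    "gE e' m 1 0 * h01 + gE e' m 1 1 * h11 = a10 * gE e m 0 1 + a11 * gE e m 1 1"
    if "m \<in> {Mid1, Mid2}" for m
    using E[OF that, of 0 0] E[OF that, of 0 1] E[OF that, of 1 0] E[OF that, of 1 1] by (simp_all add: h a)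
  \<comment> \<open>The polarised determinant scales by the determinants of both acting matrices;
    they are inserted here and are 1.\<close>
  have mx: "x00 * y11 - x10 * y01 + y00 * x11 - y10 * x01 = z00 * w11 - z10 * w01 + w00 * z11 - w10 * z01"
    if "z00 * h00 + z01 * h10 = a00 * x00 + a01 * x10" "z00 * h01 + z01 * h11 = a00 * x01 + a01 * x11"
      "z10 * h00 + z11 * h10 = a10 * x00 + a11 * x10" "z10 * h01 + z11 * h11 = a10 * x01 + a11 * x11"
      "w00 * h00 + w01 * h10 = a00 * y00 + a01 * y10" "w00 * h01 + w01 * h11 = a00 * y01 + a01 * y11"
      "w10 * h00 + w11 * h10 = a10 * y00 + a11 * y10" "w10 * h01 + w11 * h11 = a10 * y01 + a11 * y11"
    for x00 x01 x10 x11 y00 y01 y10 y11 z00 z01 z10 z11 w00 w01 w10 w11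
  proof -
    have "(a00 * a11 - a01 * a10) * (x00 * y11 - x10 * y01 + y00 * x11 - y10 * x01) =
      (a00 * x00 + a01 * x10) * (a10 * y01 + a11 * y11) - (a10 * x00 + a11 * x10) * (a00 * y01 + a01 * y11) +
      (a00 * y00 + a01 * y10) * (a10 * x01 + a11 * x11) - (a10 * y00 + a11 * y10) * (a00 * x01 + a01 * x11)"
      by (simp add: algebra_simps)
    also have "\<dots> = (h00 * h11 - h01 * h10) * (z00 * w11 - z10 * w01 + w00 * z11 - w10 * z01)"
      unfolding that[symmetric] by (simp add: algebra_simps)
    finally show ?thesis by (simp add: dh da)
  qed
  have sq: "x00 * x11 - x10 * x01 = z00 * z11 - z10 * z01"
    if "z00 * h00 + z01 * h10 = a00 * x00 + a01 * x10" "z00 * h01 + z01 * h11 = a00 * x01 + a01 * x11"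
      "z10 * h00 + z11 * h10 = a10 * x00 + a11 * x10" "z10 * h01 + z11 * h11 = a10 * x01 + a11 * x11"
    for x00 x01 x10 x11 z00 z01 z10 z11
  proof -
    have "(a00 * a11 - a01 * a10) * (x00 * x11 - x10 * x01) =
      (a00 * x00 + a01 * x10) * (a10 * x01 + a11 * x11) - (a10 * x00 + a11 * x10) * (a00 * x01 + a01 * x11)"
      by (simp add: algebra_simps)
    also have "\<dots> = (h00 * h11 - h01 * h10) * (z00 * z11 - z10 * z01)"
      unfolding that[symmetric] by (simp add: algebra_simps)
    finally show ?thesis by (simp add: dh da)
  qed
  have v: "gv e' m 0 = a00 * gv e m 0 + a01 * gv e m 1" "gv e' m 1 = a10 * gv e m 0 + a11 * gv e m 1"
    if "m \<in> {Mid1, Mid2}" for m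
  proof -
    have "gv e' m 0 = (gE e' m 0 0 * h00 + gE e' m 0 1 * h10) * e (Coord R21 0 0) + (gE e' m 0 0 * h01 + gE e' m 0 1 * h11) * e (Coord R21 1 0)"
      unfolding gv_def DD by (simp add: algebra_simps)
    then show "gv e' m 0 = a00 * gv e m 0 + a01 * gv e m 1" unfolding EE[OF that] gv_def by (simp add: algebra_simps)
    have "gv e' m 1 = (gE e' m 1 0 * h00 + gE e' m 1 1 * h10) * e (Coord R21 0 0) + (gE e' m 1 0 * h01 + gE e' m 1 1 * h11) * e (Coord R21 1 0)"
      unfolding gv_def DD by (simp add: algebra_simps)
    then show "gv e' m 1 = a10 * gv e m 0 + a11 * gv e m 1" unfolding EE[OF that] gv_def by (simp add: algebra_simps)
  qed
  have Q: "br (gv e' Mid1) (gv e' Mid2) = br (gv e Mid1) (gv e Mid2)"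
  proof -
    have "br (gv e' Mid1) (gv e' Mid2) = (a00 * a11 - a01 * a10) * br (gv e Mid1) (gv e Mid2)"
      unfolding br_def v[OF M(1)] v[OF M(2)] by (simp add: algebra_simps)
    then show ?thesis using da by simp
  qed
  show ?thesis using i
    apply (elim less_13E; hypsubst; unfold gen_simps)
    subgoal by (rule rows_dot[OF P'[OF M(1)]])
    subgoal by (rule rows_dot[OF P'[OF M(2)]])
    subgoal by (rule rows_dot[OF R1])
    subgoal by (rule rows_dot[OF R2])
    subgoal by (rule sq[OF EE[OF M(1)], symmetric])
    subgoal unfolding mixed_det_def by (rule mx[OF EE[OF M(1)] EE[OF M(2)], symmetric])
    subgoal by (rule sq[OF EE[OF M(2)], symmetric])
    subgoal by (rule rows_br[OF R1 P'[OF M(1)], symmetric])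
    subgoal by (rule rows_br[OF R1 P'[OF M(2)], symmetric])
    subgoal by (subst rows_br[OF R2 P'[OF M(2)]]) simp
    subgoal by (subst rows_br[OF R2 R1]) simp
    subgoal by (rule Q)
    subgoal by (rule rows_br[OF P'[OF M(2)] P'[OF M(1)], symmetric])
    done
qed

lemma gen_in_SI: "i < 13 \<Longrightarrow> gen i (kvar :: coord \<Rightarrow> 'k::field kpoly) \<in> SI"
  by (rule SI_I[OF kpoly_ring_gen]) (simp_all add: pev_gen gen_moved)


section \<open>Reduction to a slice\<close>

abbreviation coord_funs :: "(('v \<Rightarrow> 'k) \<Rightarrow> 'k) set" where
  "coord_funs \<equiv> range (\<lambda>v e. e v)"

lemma coord_in_poly_functions: "(\<lambda>e. e v) \<in> poly_functions coord_funs"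
  by (rule poly_functions.linear) auto

text \<open>If \<open>g e\<close> were nonzero, the line through \<open>e\<close> and
  \<open>e0\<close> would contain a point at which \<open>p\<close> and \<open>g\<close> are both
  nonzero.\<close>

lemma zero_of_dense:
  fixes p g :: "('v \<Rightarrow> 'k::field_char_0) \<Rightarrow> 'k"
  assumes "p \<in> poly_functions coord_funs" "g \<in> poly_functions coord_funs" "p e0 \<noteq> 0"
    and "\<And>e. p e \<noteq> 0 \<Longrightarrow> g e = 0"
  shows "g e = 0"
proof (rule ccontr)
  assume ne: "g e \<noteq> 0"
  have "\<exists>t. p ((\<lambda>t v. e v + t * (e0 v - e v)) t) \<noteq> 0 \<and> g ((\<lambda>t v. e v + t * (e0 v - e v)) t) \<noteq> 0"
  proof (rule poly_functions_common_nonzero[OF assms(1,2), where a = 1 and b = 0])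
    fix l :: "('v \<Rightarrow> 'k) \<Rightarrow> 'k" assume "l \<in> coord_funs"
    then obtain v where "l = (\<lambda>e. e v)" by auto
    then show "\<exists>P. \<forall>t. l (\<lambda>v. e v + t * (e0 v - e v)) = poly P t"
      by (intro exI[of _ "[:e v, e0 v - e v:]"]) (simp add: algebra_simps)
  qed (use assms(3) ne in auto)
  then show False using assms(4) by auto
qed

text \<open>\<open>\<sigma>\<close> plays the role of a rational map, meaningful where
  \<open>ok\<close> holds, whose coordinates become polynomial after multiplication by powers of
  \<open>\<delta>\<close>; the exponents add up under sums and products.\<close>

lemma clear_denominators:
  assumes "p \<in> poly_functions L" "\<delta> \<in> poly_functions L'"
    and "\<And>l. l \<in> L \<Longrightarrow> \<exists>n. \<exists>q\<in>poly_functions L'. \<forall>x. ok x \<longrightarrow> \<delta> x ^ n * l (\<sigma> x) = q x"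
  shows "\<exists>n. \<exists>q\<in>poly_functions L'. \<forall>x. ok x \<longrightarrow> \<delta> x ^ n * p (\<sigma> x) = q x"
  using assms(1)
proof induction
  case (const c)
  show ?case by (intro exI[of _ 0] bexI[OF _ poly_functions.const[of c]]) simp
next
  case (linear l)
  then show ?case by (rule assms(3))
next
  case (add p q)
  then obtain m n p' q' where *: "p' \<in> poly_functions L'" "q' \<in> poly_functions L'"
    "\<And>x. ok x \<Longrightarrow> \<delta> x ^ m * p (\<sigma> x) = p' x" "\<And>x. ok x \<Longrightarrow> \<delta> x ^ n * q (\<sigma> x) = q' x" by blast
  show ?case
  proof (intro exI[of _ "m + n"] bexI allI impI)
    show "(\<lambda>x. \<delta> x ^ n * p' x + \<delta> x ^ m * q' x) \<in> poly_functions L'"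
      by (intro poly_functions_intros * assms(2))
    fix x assume "ok x"
    then show "\<delta> x ^ (m + n) * (p (\<sigma> x) + q (\<sigma> x)) = \<delta> x ^ n * p' x + \<delta> x ^ m * q' x"
      by (simp add: *(3,4)[symmetric] power_add algebra_simps)
  qed
next
  case (mult p q)
  then obtain m n p' q' where *: "p' \<in> poly_functions L'" "q' \<in> poly_functions L'"
    "\<And>x. ok x \<Longrightarrow> \<delta> x ^ m * p (\<sigma> x) = p' x" "\<And>x. ok x \<Longrightarrow> \<delta> x ^ n * q (\<sigma> x) = q' x" by blast
  show ?case
  proof (intro exI[of _ "m + n"] bexI allI impI)
    show "(\<lambda>x. p' x * q' x) \<in> poly_functions L'"
      by (intro poly_functions_intros *)
    fix x assume "ok x"
    then show "\<delta> x ^ (m + n) * (p (\<sigma> x) * q (\<sigma> x)) = p' x * q' x"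
      by (simp add: *(3,4)[symmetric] power_add algebra_simps)
  qed
qed

text \<open>The slice consists of the representations with \<open>A = (1, 0)\<close>, \<open>B = (I | 0)\<close>,
  \<open>C\<^sub>1 = (1, 0; 0, v\<^sub>3; 0, v\<^sub>6)\<close>, \<open>C\<^sub>2 = (0, v\<^sub>0; v\<^sub>4, v\<^sub>5; v\<^sub>7, v\<^sub>8)\<close>, \<open>D = (v\<^sub>1; v\<^sub>2)\<close>.\<close>

definition slice :: "(nat \<Rightarrow> 'k::comm_ring_1) \<Rightarrow> coord \<Rightarrow> 'k" where
  "slice v c = (case c of Coord a i j \<Rightarrow> (case a of
      L12 \<Rightarrow> of_bool (j = 0)
    | L23 \<Rightarrow> of_bool (i = j)
    | Mid1 \<Rightarrow> if j = 0 then of_bool (i = 0) else if i = 0 then 0 else if i = 1 then v 3 else v 6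
    | Mid2 \<Rightarrow> if j = 0 then (if i = 0 then 0 else if i = 1 then v 4 else v 7)
        else if i = 0 then v 0 else if i = 1 then v 5 else v 8
    | R21 \<Rightarrow> if i = 0 then v 1 else v 2))"

lemma slice_simps [simp]:
  "slice v (Coord L12 i j) = of_bool (j = 0)" "slice v (Coord L23 i j) = of_bool (i = j)"
  "slice v (Coord Mid1 i j) = (if j = 0 then of_bool (i = 0) else if i = 0 then 0 else if i = 1 then v 3 else v 6)"
  "slice v (Coord Mid2 i j) = (if j = 0 then (if i = 0 then 0 else if i = 1 then v 4 else v 7)
        else if i = 0 then v 0 else if i = 1 then v 5 else v 8)"
  "slice v (Coord R21 i j) = (if i = 0 then v 1 else v 2)"
  by (simp_all add: slice_def)

lemma gen_slice:
  "gen 0 (slice v) = v 1" "gen 1 (slice v) = v 0 * v 2" "gen (Suc 0) (slice v) = v 0 * v 2" "gen 4 (slice v) = v 3" "gen 5 (slice v) = v 5"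
  "gen 6 (slice v) = - (v 0 * v 4)" "gen 7 (slice v) = v 3 * v 8 - v 5 * v 6"
  "gen 8 (slice v) = - v 0 * (v 3 * v 7 - v 4 * v 6)" "gen 9 (slice v) = v 0 * (v 4 * v 8 - v 5 * v 7)"
  "gen 12 (slice v) = v 0"
  by (simp_all add: gen_simps gen_defs algebra_simps)

definition mat2 :: "'a \<Rightarrow> 'a \<Rightarrow> 'a \<Rightarrow> 'a \<Rightarrow> 'a mat" where
  "mat2 a b c d = mat 2 2 (\<lambda>(i, j). if i = 0 then if j = 0 then a else b else if j = 0 then c else d)"

definition mat3 :: "(nat \<Rightarrow> 'a) \<Rightarrow> (nat \<Rightarrow> 'a) \<Rightarrow> (nat \<Rightarrow> 'a) \<Rightarrow> 'a mat" where
  "mat3 r0 r1 r2 = mat 3 3 (\<lambda>(i, j). if i = 0 then r0 j else if i = 1 then r1 j else r2 j)"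

lemma mat2_simps [simp]:
  "mat2 a b c d \<in> carrier_mat 2 2" "mat2 a b c d $$ (0, 0) = a" "mat2 a b c d $$ (0, Suc 0) = b"
  "mat2 a b c d $$ (Suc 0, 0) = c" "mat2 a b c d $$ (Suc 0, Suc 0) = d"
  "dim_row (mat2 a b c d) = 2" "dim_col (mat2 a b c d) = 2"
  by (simp_all add: mat2_def)

lemma mat3_simps [simp]:
  "mat3 x y z \<in> carrier_mat 3 3" "j < 3 \<Longrightarrow> mat3 x y z $$ (0, j) = x j"
  "j < 3 \<Longrightarrow> mat3 x y z $$ (Suc 0, j) = y j" "j < 3 \<Longrightarrow> mat3 x y z $$ (2, j) = z j"
  "dim_row (mat3 x y z) = 3" "dim_col (mat3 x y z) = 3"
  by (simp_all add: mat3_def)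

definition SL_elem :: "'k mat \<Rightarrow> 'k mat \<Rightarrow> 'k mat \<Rightarrow> int \<Rightarrow> 'k::field mat" where
  "SL_elem g2 g3 h u = (if u = -2 then g2 else if u = -3 then g3 else if u = 2 then h else 1\<^sub>m 1)"

lemma SL_elem_simps [simp]:
  "SL_elem g2 g3 h (-2) = g2" "SL_elem g2 g3 h (-3) = g3" "SL_elem g2 g3 h 2 = h"
  "SL_elem g2 g3 h 1 = 1\<^sub>m 1" "SL_elem g2 g3 h (-1) = 1\<^sub>m 1"
  by (simp_all add: SL_elem_def)

lemma moved_SL_elem:
  fixes e e' :: "coord \<Rightarrow> 'k::field"
  assumes c: "g2 \<in> carrier_mat 2 2" "g3 \<in> carrier_mat 3 3" "h \<in> carrier_mat 2 2" "det g2 = 1" "det g3 = 1" "det h = 1"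
    and A: "\<And>j. j < 2 \<Longrightarrow> e' (Coord L12 0 0) * g2 $$ (0, j) + e' (Coord L12 0 1) * g2 $$ (1, j) = e (Coord L12 0 j)"
    and B: "\<And>i j. i < 2 \<Longrightarrow> j < 3 \<Longrightarrow>
      e' (Coord L23 i 0) * g3 $$ (0, j) + e' (Coord L23 i 1) * g3 $$ (1, j) + e' (Coord L23 i 2) * g3 $$ (2, j) =
      g2 $$ (i, 0) * e (Coord L23 0 j) + g2 $$ (i, 1) * e (Coord L23 1 j)"
    and C: "\<And>m i j. m \<in> {Mid1, Mid2} \<Longrightarrow> i < 3 \<Longrightarrow> j < 2 \<Longrightarrow>
      e' (Coord m i 0) * h $$ (0, j) + e' (Coord m i 1) * h $$ (1, j) =
      g3 $$ (i, 0) * e (Coord m 0 j) + g3 $$ (i, 1) * e (Coord m 1 j) + g3 $$ (i, 2) * e (Coord m 2 j)"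
    and D: "\<And>i. i < 2 \<Longrightarrow> e' (Coord R21 i 0) = h $$ (i, 0) * e (Coord R21 0 0) + h $$ (i, 1) * e (Coord R21 1 0)"
  shows "moved (SL_elem g2 g3 h) e e'"
  unfolding moved_def
proof (intro conjI allI)
  show "SL_elem g2 g3 h \<in> SL_group"
    using c by (auto simp: SL_group_def KQ_def)
  fix a show "mrep e' a * SL_elem g2 g3 h (khead a) = SL_elem g2 g3 h (ktail a) * mrep e a"
  proof (rule eq_matI)
    fix i j assume "i < dim_row (SL_elem g2 g3 h (ktail a) * mrep e a)" "j < dim_col (SL_elem g2 g3 h (ktail a) * mrep e a)"
    then have ij: "i < kbeta (ktail a)" "j < kbeta (khead a)" using c by (cases a; simp)+
    show "(mrep e' a * SL_elem g2 g3 h (khead a)) $$ (i, j) = (SL_elem g2 g3 h (ktail a) * mrep e a) $$ (i, j)"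
    proof (cases a)
      case L12
      then show ?thesis using ij A[of j] mult_mat_index_2[OF mrep_carrier(1) c(1), of i j e']
          left_mult_one_mat[OF mrep_carrier(1), of e] by simp
    next
      case L23
      then show ?thesis using ij B[of i j] mult_mat_index_3[OF mrep_carrier(2) c(2), of i j e']
          mult_mat_index_2[OF c(1) mrep_carrier(2), of i j e] by simp
    next
      case Mid1
      then show ?thesis using ij C[of Mid1 i j] mult_mat_index_2[OF mrep_carrier(3) c(3), of i j e']
          mult_mat_index_3[OF c(2) mrep_carrier(3), of i j e] by simp
    next
      case Mid2
      then show ?thesis using ij C[of Mid2 i j] mult_mat_index_2[OF mrep_carrier(4) c(3), of i j e']
          mult_mat_index_3[OF c(2) mrep_carrier(4), of i j e] by simp
    next
      case R21
      then show ?thesis using ij D[of i] mult_mat_index_2[OF c(3) mrep_carrier(5), of i j e]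
          right_mult_one_mat[OF mrep_carrier(5), of e'] by simp
    qed
  qed (use c in \<open>cases a; simp\<close>)+
qed

text \<open>A one-parameter group that still acts on the slice: it adds \<open>t\<close> times the
  second row of C_1 and C_2 to the third. The matrix B = (I | 0) does not see this.\<close>

lemma slice_shear:
  "moved (SL_elem (1\<^sub>m 2) (mat3 (\<lambda>j. of_bool (j = 0)) (\<lambda>j. of_bool (j = 1)) (\<lambda>j. if j = 0 then 0 else if j = 1 then t else 1)) (1\<^sub>m 2))
     (slice v) (slice (v(6 := v 6 + t * v 3, 7 := v 7 + t * v 4, 8 := v 8 + t * v 5)))"
  by (rule moved_SL_elem) (auto simp: less_2_iff less_3_iff det_3x3 det3_def)

text \<open>\<open>gen 12\<close> is the intrinsic condition. The other two factors allow the group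
  element to be written down explicitly; they are harmless because the condition enters through
  density.\<close>

definition slice_cond :: "(coord \<Rightarrow> 'k::comm_ring_1) \<Rightarrow> 'k" where
  "slice_cond e = gen 12 e * e (Coord L12 0 0) *
     (e (Coord L23 0 0) * e (Coord L23 1 1) - e (Coord L23 0 1) * e (Coord L23 1 0))"

text \<open>The first row of each group element is forced: A at -2, AB at -3, A B C_1 at 2. The
  second row at 2 is A B C_2 divided by N = \<open>gen 12\<close>, for determinant 1. The other rows
  at -2 and -3 are corrected by multiples of the first ones so that C_1 acquires the first column
  (1, 0, 0).\<close>

lemma moved_to_slice:
  fixes e :: "coord \<Rightarrow> 'k::field"
  assumes "slice_cond e \<noteq> 0"
  shows "\<exists>g v. moved g e (slice v)"
proof -
  define a0 a1 where a: "a0 = e (Coord L12 0 0)" "a1 = e (Coord L12 0 1)"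
  define b0 b1 where b: "b0 j = e (Coord L23 0 j)" "b1 j = e (Coord L23 1 j)" for j
  define p10 p11 p20 p21 where p: "p10 = gP e Mid1 0" "p11 = gP e Mid1 1" "p20 = gP e Mid2 0" "p21 = gP e Mid2 1"
  define N where "N = p10 * p21 - p11 * p20"
  define d where "d = b0 0 * b1 1 - b0 1 * b1 0"
  have ne: "N \<noteq> 0" "a0 \<noteq> 0" "d \<noteq> 0"
    using assms by (auto simp: slice_cond_def gen_simps br_def N_def p a b d_def)
  define U where "U j = a0 * b0 j + a1 * b1 j" for j
  have U: "gP e m s = U 0 * e (Coord m 0 s) + U 1 * e (Coord m 1 s) + U 2 * e (Coord m 2 s)" for m s
    by (simp add: gP_def U_def a b)
  \<comment> \<open>\<open>cc\<close> is the first column of C_1 times the inverse of the matrix at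
    2; the slice demands that the rows \<open>U\<close>, \<open>V\<close>, \<open>Z\<close> send it
    to 1, 0, 0.\<close>
  define cc where "cc j = (e (Coord Mid1 j 0) * p21 - e (Coord Mid1 j 1) * p20) / N" for j
  have uc: "U 0 * cc 0 + U 1 * cc 1 + U 2 * cc 2 = 1"
  proof -
    have "U 0 * cc 0 + U 1 * cc 1 + U 2 * cc 2 = (p10 * p21 - p11 * p20) / N"
      unfolding cc_def p(1,2) U by (simp add: algebra_simps add_divide_distrib diff_divide_distrib)
    then show ?thesis using ne by (simp add: N_def)
  qed
  \<comment> \<open>\<open>\<kappa>\<close> and the coefficient of \<open>U\<close> in
    \<open>Z\<close> are found from orthogonality to \<open>cc\<close>; the factors
    \<open>1 / a0\<close> and \<open>1 / d\<close> normalise the determinants.\<close>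
  define \<kappa> where "\<kappa> = (b1 0 * cc 0 + b1 1 * cc 1 + b1 2 * cc 2) / a0"
  define V where "V j = b1 j / a0 - \<kappa> * U j" for j
  define Z where "Z j = (if j = 2 then 1 / d else 0) - cc 2 / d * U j" for j :: nat
  have vc: "V 0 * cc 0 + V 1 * cc 1 + V 2 * cc 2 = 0"
  proof -
    have "V 0 * cc 0 + V 1 * cc 1 + V 2 * cc 2 = \<kappa> - \<kappa> * (U 0 * cc 0 + U 1 * cc 1 + U 2 * cc 2)"
      by (simp add: V_def \<kappa>_def algebra_simps add_divide_distrib)
    then show ?thesis by (simp only: uc) simp
  qed
  have zc: "Z 0 * cc 0 + Z 1 * cc 1 + Z 2 * cc 2 = 0"
  proof -
    have "Z 0 * cc 0 + Z 1 * cc 1 + Z 2 * cc 2 = cc 2 / d - cc 2 / d * (U 0 * cc 0 + U 1 * cc 1 + U 2 * cc 2)"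
      by (simp add: Z_def algebra_simps)
    then show ?thesis by (simp only: uc) simp
  qed
  define al where "al X m s = X 0 * e (Coord m 0 s) + X 1 * e (Coord m 1 s) + X 2 * e (Coord m 2 s)" for X :: "nat \<Rightarrow> 'k" and m s
  \<comment> \<open>A row orthogonal to \<open>cc\<close> multiplied by C_1 is proportional to
    \<open>(p20, p21)\<close>; this is the vanishing of the first column of the slice form of C_1
    below its top entry.\<close>
  have perp: "al X Mid1 0 * p21 = al X Mid1 1 * p20" if "X 0 * cc 0 + X 1 * cc 1 + X 2 * cc 2 = 0" for X :: "nat \<Rightarrow> 'k"
  proof -
    have "(al X Mid1 0 * p21 - al X Mid1 1 * p20) / N = X 0 * cc 0 + X 1 * cc 1 + X 2 * cc 2"
      by (simp add: al_def cc_def algebra_simps add_divide_distrib diff_divide_distrib)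
    then show ?thesis using that ne by simp
  qed
  have m1: "(al X Mid1 1 * p10 - al X Mid1 0 * p11) * (p20 / N) = al X Mid1 0"
      "(al X Mid1 1 * p10 - al X Mid1 0 * p11) * (p21 / N) = al X Mid1 1"
    if "X 0 * cc 0 + X 1 * cc 1 + X 2 * cc 2 = 0" for X :: "nat \<Rightarrow> 'k"
  proof -
    have "(al X Mid1 1 * p10 - al X Mid1 0 * p11) * p20 = al X Mid1 0 * N"
      using perp[OF that] unfolding N_def by (simp add: algebra_simps)
    then show "(al X Mid1 1 * p10 - al X Mid1 0 * p11) * (p20 / N) = al X Mid1 0" using ne by (simp add: field_simps)
    have "(al X Mid1 1 * p10 - al X Mid1 0 * p11) * p21 = al X Mid1 1 * N"
      using perp[OF that] unfolding N_def by (simp add: algebra_simps)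
    then show "(al X Mid1 1 * p10 - al X Mid1 0 * p11) * (p21 / N) = al X Mid1 1" using ne by (simp add: field_simps)
  qed
  \<comment> \<open>Cramer's rule for the coordinates of a row in the basis formed by the rows of
    the matrix at 2.\<close>
  have m2: "(x * p21 - y * p20) / N * p10 + (y * p10 - x * p11) * (p20 / N) = x"
    "(x * p21 - y * p20) / N * p11 + (y * p10 - x * p11) * (p21 / N) = y" for x y
  proof -
    have "(x * p21 - y * p20) * p10 + (y * p10 - x * p11) * p20 = x * N"
      "(x * p21 - y * p20) * p11 + (y * p10 - x * p11) * p21 = y * N" by (simp_all add: N_def algebra_simps)
    then show "(x * p21 - y * p20) / N * p10 + (y * p10 - x * p11) * (p20 / N) = x"
      "(x * p21 - y * p20) / N * p11 + (y * p10 - x * p11) * (p21 / N) = y"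
      using ne by (simp_all add: nonzero_eq_divide_eq flip: add_divide_distrib)
  qed
  define v where "v = (\<lambda>i :: nat. [N, p10 * e (Coord R21 0 0) + p11 * e (Coord R21 1 0),
    p20 / N * e (Coord R21 0 0) + p21 / N * e (Coord R21 1 0),
    al V Mid1 1 * p10 - al V Mid1 0 * p11, (al V Mid2 0 * p21 - al V Mid2 1 * p20) / N, al V Mid2 1 * p10 - al V Mid2 0 * p11,
    al Z Mid1 1 * p10 - al Z Mid1 0 * p11, (al Z Mid2 0 * p21 - al Z Mid2 1 * p20) / N, al Z Mid2 1 * p10 - al Z Mid2 0 * p11] ! i)"
  have v: "v 0 = N" "v 1 = p10 * e (Coord R21 0 0) + p11 * e (Coord R21 1 0)"
    "v 2 = p20 / N * e (Coord R21 0 0) + p21 / N * e (Coord R21 1 0)"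
    "v 3 = al V Mid1 1 * p10 - al V Mid1 0 * p11" "v 4 = (al V Mid2 0 * p21 - al V Mid2 1 * p20) / N"
    "v 5 = al V Mid2 1 * p10 - al V Mid2 0 * p11"
    "v 6 = al Z Mid1 1 * p10 - al Z Mid1 0 * p11" "v 7 = (al Z Mid2 0 * p21 - al Z Mid2 1 * p20) / N"
    "v 8 = al Z Mid2 1 * p10 - al Z Mid2 0 * p11" by (simp_all add: v_def)
  have "moved (SL_elem (mat2 a0 a1 (- \<kappa> * a0) (1 / a0 - \<kappa> * a1)) (mat3 U V Z) (mat2 p10 p11 (p20 / N) (p21 / N)))
    e (slice v)"
  proof (rule moved_SL_elem)
    show "det (mat2 a0 a1 (- \<kappa> * a0) (1 / a0 - \<kappa> * a1)) = 1"
      using ne by (subst det_2x2) (auto simp: algebra_simps)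
    show "det (mat2 p10 p11 (p20 / N) (p21 / N)) = 1"
    proof -
      have "det (mat2 p10 p11 (p20 / N) (p21 / N)) = (p10 * p21 - p11 * p20) / N"
        by (subst det_2x2) (auto simp: diff_divide_distrib)
      then show ?thesis using ne by (simp add: N_def)
    qed
    show "det (mat3 U V Z) = 1"
    proof -
      have "det (mat3 U V Z) = (U 0 * V 1 - U 1 * V 0) / d"
        by (subst det_3x3) (auto simp: det3_def Z_def algebra_simps add_divide_distrib diff_divide_distrib)
      also have "U 0 * V 1 - U 1 * V 0 = d"
        using ne by (simp add: U_def V_def d_def algebra_simps)
      finally show ?thesis using ne by simp
    qed
  next
    fix j :: nat assume "j < 2"
    then show "slice v (Coord L12 0 0) * mat2 a0 a1 (- \<kappa> * a0) (1 / a0 - \<kappa> * a1) $$ (0, j) +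
         slice v (Coord L12 0 1) * mat2 a0 a1 (- \<kappa> * a0) (1 / a0 - \<kappa> * a1) $$ (1, j) = e (Coord L12 0 j)"
      by (auto simp: less_2_iff a)
  next
    fix i j :: nat assume "i < 2" "j < 3"
    then show "slice v (Coord L23 i 0) * mat3 U V Z $$ (0, j) + slice v (Coord L23 i 1) * mat3 U V Z $$ (1, j) +
        slice v (Coord L23 i 2) * mat3 U V Z $$ (2, j) =
        mat2 a0 a1 (- \<kappa> * a0) (1 / a0 - \<kappa> * a1) $$ (i, 0) * e (Coord L23 0 j) +
        mat2 a0 a1 (- \<kappa> * a0) (1 / a0 - \<kappa> * a1) $$ (i, 1) * e (Coord L23 1 j)"
      by (auto simp: less_2_iff U_def V_def b algebra_simps)
  next
    fix i :: nat assume "i < 2"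
    then show "slice v (Coord R21 i 0) = mat2 p10 p11 (p20 / N) (p21 / N) $$ (i, 0) * e (Coord R21 0 0) +
        mat2 p10 p11 (p20 / N) (p21 / N) $$ (i, 1) * e (Coord R21 1 0)"
      by (auto simp: less_2_iff v v[unfolded One_nat_def])
  next
    fix m i j assume m: "m \<in> {Mid1, Mid2}" and "i < (3::nat)" "j < (2::nat)"
    have al: "mat3 U V Z $$ (i, 0) * e (Coord m 0 j) + mat3 U V Z $$ (i, 1) * e (Coord m 1 j) + mat3 U V Z $$ (i, 2) * e (Coord m 2 j) =
      al (\<lambda>k. mat3 U V Z $$ (i, k)) m j" by (simp add: al_def)
    have alr: "al (\<lambda>k. mat3 U V Z $$ (0, k)) = al U" "al (\<lambda>k. mat3 U V Z $$ (Suc 0, k)) = al V" "al (\<lambda>k. mat3 U V Z $$ (2, k)) = al Z"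
      by (auto simp: al_def fun_eq_iff)
    have alU: "al U m s = gP e m s" for m s by (simp add: al_def U)
    note pp = p[unfolded One_nat_def] m1[OF vc, simplified] m1[OF zc, simplified]
          m2[of "al V Mid2 0" "al V Mid2 1", simplified] m2[of "al Z Mid2 0" "al Z Mid2 1", simplified]
    show "slice v (Coord m i 0) * mat2 p10 p11 (p20 / N) (p21 / N) $$ (0, j) +
        slice v (Coord m i 1) * mat2 p10 p11 (p20 / N) (p21 / N) $$ (1, j) =
        mat3 U V Z $$ (i, 0) * e (Coord m 0 j) + mat3 U V Z $$ (i, 1) * e (Coord m 1 j) + mat3 U V Z $$ (i, 2) * e (Coord m 2 j)"
      unfolding al using m \<open>i < 3\<close> \<open>j < 2\<close> ne
      by (auto simp: less_2_iff less_3_iff alr alU v pp(1-4)[symmetric] pp(5-))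
  qed auto
  then show ?thesis by blast
qed

lemma slice_cond_poly: "slice_cond \<in> poly_functions (coord_funs :: ((coord \<Rightarrow> 'k::field) \<Rightarrow> 'k) set)"
proof -
  have "gen 12 = pev (gen 12 kvar :: 'k kpoly)" by (auto simp: pev_gen)
  then have "gen 12 \<in> poly_functions (coord_funs :: ((coord \<Rightarrow> 'k) \<Rightarrow> 'k) set)" using pev_in_poly_functions by metis
  then show ?thesis unfolding slice_cond_def[abs_def]
    by (intro poly_functions_intros coord_in_poly_functions)
qed

lemma gen_poly: "i < 13 \<Longrightarrow> gen i \<in> poly_functions (coord_funs :: ((coord \<Rightarrow> 'k::field) \<Rightarrow> 'k) set)"
proof -
  assume "i < 13"
  then have "gen i = pev (gen i kvar :: 'k kpoly)" by (auto simp: pev_gen)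
  then show ?thesis using pev_in_poly_functions by metis
qed

lemma zero_of_slice_cond:
  fixes g :: "(coord \<Rightarrow> 'k::field_char_0) \<Rightarrow> 'k"
  assumes "g \<in> poly_functions coord_funs" "\<And>e. slice_cond e \<noteq> 0 \<Longrightarrow> g e = 0"
  shows "g e = 0"
proof (rule zero_of_dense[OF slice_cond_poly assms(1) _ assms(2)])
  show "slice_cond (slice (\<lambda>_. 1)) \<noteq> (0 :: 'k)" by (simp add: slice_cond_def gen_slice)
qed

section \<open>Relations between the generators\<close>

lemma poly_functions_gens:
  assumes "p \<in> poly_functions (gen ` {..<13})"
  shows "p \<in> poly_functions (coord_funs :: ((coord \<Rightarrow> 'k::field) \<Rightarrow> 'k) set)"
  using poly_functions_subst[OF assms, of "\<lambda>x. x"] gen_poly by auto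

text \<open>Both sides of a relation between generators are invariant, so it suffices to check it on
  the slice, where only nine variables remain.\<close>

lemma invariant_identity:
  fixes p :: "(coord \<Rightarrow> 'k::field_char_0) \<Rightarrow> 'k"
  assumes p: "p \<in> poly_functions (gen ` {..<13})" and z: "\<And>v. p (slice v) = 0"
  shows "p e = 0"
proof (rule zero_of_slice_cond[OF poly_functions_gens[OF p]])
  fix e :: "coord \<Rightarrow> 'k" assume "slice_cond e \<noteq> 0"
  then obtain g v where m: "moved g e (slice v)" using moved_to_slice by blast
  have "p (slice v) = p e" by (rule poly_functions_eq[OF p]) (auto simp: gen_moved[OF m])
  then show "p e = 0" using z by simp
qed

lemma gen_in_gens: "i < 13 \<Longrightarrow> gen i \<in> poly_functions (gen ` {..<13})"
  by (rule poly_functions.linear) auto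

lemma gen_slice':
  "gen 2 (slice v) = dotD (slice v) (gR1 (slice v))" "gen 3 (slice v) = dotD (slice v) (gR2 (slice v))"
  "gen 10 (slice v) = - br (gR1 (slice v)) (gR2 (slice v))"
  "gen 11 (slice v) = br (gv (slice v) Mid1) (gv (slice v) Mid2)"
  by (simp_all add: gen_simps)

text \<open>The first relation is the Pluecker relation of the four covariant rows, two of whose
  brackets agree up to sign. The next four are three-term relations between three of these rows and
  the column D. The other six involve the coefficients of det(B C_1 + t B C_2). All eleven are
  oriented as rewriting rules modulo \<open>gen 12\<close>.\<close>

lemma gen_relations:
  fixes e :: "coord \<Rightarrow> 'k::field_char_0"
  shows "gen 8 e * gen 8 e = gen 7 e * gen 9 e - gen 12 e * gen 10 e"
    "gen 1 e * gen 7 e = gen 0 e * gen 8 e + gen 12 e * gen 2 e"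
    "gen 1 e * gen 8 e = gen 0 e * gen 9 e - gen 12 e * gen 3 e"
    "gen 10 e * gen 1 e = gen 9 e * gen 2 e + gen 8 e * gen 3 e"
    "gen 10 e * gen 0 e = gen 8 e * gen 2 e + gen 7 e * gen 3 e"
    "gen 4 e * gen 9 e = gen 5 e * gen 8 e - gen 6 e * gen 7 e"
    "gen 4 e * gen 1 e * gen 1 e = gen 0 e * gen 1 e * gen 5 e - gen 0 e * gen 0 e * gen 6 e - gen 11 e * gen 12 e"
    "gen 11 e * gen 9 e = gen 1 e * gen 5 e * gen 3 e + gen 1 e * gen 6 e * gen 2 e - gen 0 e * gen 6 e * gen 3 e"
    "gen 11 e * gen 8 e = gen 1 e * gen 4 e * gen 3 e + gen 0 e * gen 6 e * gen 2 e"
    "gen 11 e * gen 7 e = gen 0 e * gen 4 e * gen 3 e + gen 0 e * gen 5 e * gen 2 e - gen 1 e * gen 4 e * gen 2 e"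
    "gen 11 e * gen 10 e = gen 6 e * gen 2 e * gen 2 e + gen 5 e * gen 2 e * gen 3 e + gen 4 e * gen 3 e * gen 3 e"
proof -
  have *: "x e = (y e :: 'k)" if "\<And>v. x (slice v) - y (slice v) = 0" "x \<in> poly_functions (gen ` {..<13})" "y \<in> poly_functions (gen ` {..<13})" for x y
    using invariant_identity[OF poly_functions_diff[OF that(2,3)] that(1), of e] by simp
  show "gen 8 e * gen 8 e = gen 7 e * gen 9 e - gen 12 e * gen 10 e"
    by (rule *[where x = "\<lambda>e. gen 8 e * gen 8 e" and y = "\<lambda>e. gen 7 e * gen 9 e - gen 12 e * gen 10 e"], simp add: gen_slice gen_slice' gen_defs algebra_simps)
      (intro poly_functions_intros gen_in_gens; simp)+
  show "gen 1 e * gen 7 e = gen 0 e * gen 8 e + gen 12 e * gen 2 e"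
    by (rule *[where x = "\<lambda>e. gen 1 e * gen 7 e" and y = "\<lambda>e. gen 0 e * gen 8 e + gen 12 e * gen 2 e"], simp add: gen_slice gen_slice' gen_defs algebra_simps)
      (intro poly_functions_intros gen_in_gens; simp)+
  show "gen 1 e * gen 8 e = gen 0 e * gen 9 e - gen 12 e * gen 3 e"
    by (rule *[where x = "\<lambda>e. gen 1 e * gen 8 e" and y = "\<lambda>e. gen 0 e * gen 9 e - gen 12 e * gen 3 e"], simp add: gen_slice gen_slice' gen_defs algebra_simps)
      (intro poly_functions_intros gen_in_gens; simp)+
  show "gen 10 e * gen 1 e = gen 9 e * gen 2 e + gen 8 e * gen 3 e"
    by (rule *[where x = "\<lambda>e. gen 10 e * gen 1 e" and y = "\<lambda>e. gen 9 e * gen 2 e + gen 8 e * gen 3 e"], simp add: gen_slice gen_slice' gen_defs algebra_simps)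
      (intro poly_functions_intros gen_in_gens; simp)+
  show "gen 10 e * gen 0 e = gen 8 e * gen 2 e + gen 7 e * gen 3 e"
    by (rule *[where x = "\<lambda>e. gen 10 e * gen 0 e" and y = "\<lambda>e. gen 8 e * gen 2 e + gen 7 e * gen 3 e"], simp add: gen_slice gen_slice' gen_defs algebra_simps)
      (intro poly_functions_intros gen_in_gens; simp)+
  show "gen 4 e * gen 9 e = gen 5 e * gen 8 e - gen 6 e * gen 7 e"
    by (rule *[where x = "\<lambda>e. gen 4 e * gen 9 e" and y = "\<lambda>e. gen 5 e * gen 8 e - gen 6 e * gen 7 e"], simp add: gen_slice gen_slice' gen_defs algebra_simps)
      (intro poly_functions_intros gen_in_gens; simp)+
  show "gen 4 e * gen 1 e * gen 1 e = gen 0 e * gen 1 e * gen 5 e - gen 0 e * gen 0 e * gen 6 e - gen 11 e * gen 12 e"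
    by (rule *[where x = "\<lambda>e. gen 4 e * gen 1 e * gen 1 e" and y = "\<lambda>e. gen 0 e * gen 1 e * gen 5 e - gen 0 e * gen 0 e * gen 6 e - gen 11 e * gen 12 e"], simp add: gen_slice gen_slice' gen_defs algebra_simps)
      (intro poly_functions_intros gen_in_gens; simp)+
  show "gen 11 e * gen 9 e = gen 1 e * gen 5 e * gen 3 e + gen 1 e * gen 6 e * gen 2 e - gen 0 e * gen 6 e * gen 3 e"
    by (rule *[where x = "\<lambda>e. gen 11 e * gen 9 e" and y = "\<lambda>e. gen 1 e * gen 5 e * gen 3 e + gen 1 e * gen 6 e * gen 2 e - gen 0 e * gen 6 e * gen 3 e"], simp add: gen_slice gen_slice' gen_defs algebra_simps)
      (intro poly_functions_intros gen_in_gens; simp)+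
  show "gen 11 e * gen 8 e = gen 1 e * gen 4 e * gen 3 e + gen 0 e * gen 6 e * gen 2 e"
    by (rule *[where x = "\<lambda>e. gen 11 e * gen 8 e" and y = "\<lambda>e. gen 1 e * gen 4 e * gen 3 e + gen 0 e * gen 6 e * gen 2 e"], simp add: gen_slice gen_slice' gen_defs algebra_simps)
      (intro poly_functions_intros gen_in_gens; simp)+
  show "gen 11 e * gen 7 e = gen 0 e * gen 4 e * gen 3 e + gen 0 e * gen 5 e * gen 2 e - gen 1 e * gen 4 e * gen 2 e"
    by (rule *[where x = "\<lambda>e. gen 11 e * gen 7 e" and y = "\<lambda>e. gen 0 e * gen 4 e * gen 3 e + gen 0 e * gen 5 e * gen 2 e - gen 1 e * gen 4 e * gen 2 e"], simp add: gen_slice gen_slice' gen_defs algebra_simps)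
      (intro poly_functions_intros gen_in_gens; simp)+
  show "gen 11 e * gen 10 e = gen 6 e * gen 2 e * gen 2 e + gen 5 e * gen 2 e * gen 3 e + gen 4 e * gen 3 e * gen 3 e"
    by (rule *[where x = "\<lambda>e. gen 11 e * gen 10 e" and y = "\<lambda>e. gen 6 e * gen 2 e * gen 2 e + gen 5 e * gen 2 e * gen 3 e + gen 4 e * gen 3 e * gen 3 e"], simp add: gen_slice gen_slice' gen_defs algebra_simps)
      (intro poly_functions_intros gen_in_gens; simp)+
qed


section \<open>The invariants are generated by the generators\<close>

lemma mon_count_list:
  assumes "finite I" "set xs \<subseteq> I"
  shows "mon I g (count_list xs) h = (\<Prod>x\<leftarrow>xs. g x h)"
  using assms(2)
proof (induction xs)
  case Nil
  then show ?case by (simp add: mon_def)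
next
  case (Cons x xs)
  have "mon I g (count_list (x # xs)) h = mon I g (\<lambda>i. of_bool (i = x) + count_list xs i) h"
    by (simp add: mon_def) (intro prod.cong, auto)
  also have "\<dots> = (\<Prod>i\<in>I. g i h ^ of_bool (i = x)) * mon I g (count_list xs) h"
    unfolding mon_add by (simp add: mon_def)
  also have "(\<Prod>i\<in>I. g i h ^ of_bool (i = x)) = (\<Prod>i\<in>I. if i = x then g i h else 1)"
    by (intro prod.cong) auto
  also have "(\<Prod>i\<in>I. if i = x then g i h else 1) * mon I g (count_list xs) h = g x h * (\<Prod>x\<leftarrow>xs. g x h)"
    using Cons assms(1) by simp
  finally show ?case by simp
qed

lemma sum_count_list:
  fixes w :: "'i \<Rightarrow> nat"
  assumes "finite I" "set xs \<subseteq> I"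
  shows "(\<Sum>i\<in>I. w i * count_list xs i) = (\<Sum>x\<leftarrow>xs. w x)"
  using assms(2)
proof (induction xs)
  case (Cons x xs)
  have "(\<Sum>i\<in>I. w i * count_list (x # xs) i) = (\<Sum>i\<in>I. (if i = x then w i else 0) + w i * count_list xs i)"
    by (intro sum.cong) auto
  then show ?case using Cons assms(1) by (simp add: sum.distrib)
qed simp

text \<open>Monomials are given as words of indices, so that a concrete rule is checked by computing
  with short lists.\<close>

lemma rewrite_rule:
  fixes g :: "'i \<Rightarrow> 'h \<Rightarrow> 'k::field" and wt :: "'i \<Rightarrow> nat"
  assumes "finite I" "set xs \<subseteq> I" "\<And>i. count_list xs i \<le> \<alpha> i"
    and "\<forall>(c, ys) \<in> set rs. set ys \<subseteq> I \<and> (\<Sum>y\<leftarrow>ys. wt y) < (\<Sum>x\<leftarrow>xs. wt x)"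
    and "q \<in> poly_functions (insert \<delta> (g ` I))"
    and "\<And>h. (\<Prod>x\<leftarrow>xs. g x h) = (\<Sum>(c, ys)\<leftarrow>rs. c * (\<Prod>y\<leftarrow>ys. g y h)) + \<delta> h * q h"
  shows "\<exists>\<kappa> rs q. (\<forall>i. \<kappa> i \<le> \<alpha> i) \<and> q \<in> poly_functions (insert \<delta> (g ` I)) \<and>
        (\<forall>(c, \<mu>) \<in> set rs. (\<forall>i. i \<notin> I \<longrightarrow> \<mu> i = 0) \<and>
            (\<Sum>i\<in>I. wt i * \<mu> i) < (\<Sum>i\<in>I. wt i * \<kappa> i)) \<and>
        (\<forall>h. mon I g \<kappa> h = (\<Sum>(c, \<mu>)\<leftarrow>rs. c * mon I g \<mu> h) + \<delta> h * q h)"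
proof (intro exI conjI)
  show "\<forall>i. count_list xs i \<le> \<alpha> i" using assms(3) by blast
  show "q \<in> poly_functions (insert \<delta> (g ` I))" by fact
  show "\<forall>(c, \<mu>) \<in> set (map (\<lambda>(c, ys). (c, count_list ys)) rs). (\<forall>i. i \<notin> I \<longrightarrow> \<mu> i = 0) \<and>
            (\<Sum>i\<in>I. wt i * \<mu> i) < (\<Sum>i\<in>I. wt i * count_list xs i)"
    using assms(4) sum_count_list[OF assms(1), of _ wt] assms(2)
    by (fastforce simp: count_list_0_iff)
  have *: "(\<Sum>(c, \<mu>)\<leftarrow>map (\<lambda>(c, ys). (c, count_list ys)) rs. c * mon I g \<mu> h) =
      (\<Sum>(c, ys)\<leftarrow>rs. c * (\<Prod>y\<leftarrow>ys. g y h))" for h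
    using assms(4) mon_count_list[OF assms(1)]
    by (simp add: o_def case_prod_unfold) (intro arg_cong[where f = sum_list] map_cong; fastforce)
  show "\<forall>h. mon I g (count_list xs) h =
      (\<Sum>(c, \<mu>)\<leftarrow>map (\<lambda>(c, ys). (c, count_list ys)) rs. c * mon I g \<mu> h) + \<delta> h * q h"
    unfolding * mon_count_list[OF assms(1,2)] using assms(6) by blast
qed

section \<open>Invariants of the shear\<close>

definition shear_gen :: "nat \<Rightarrow> (nat \<Rightarrow> 'k::comm_ring_1) \<Rightarrow> 'k" where
  "shear_gen i v = [v 0, v 1, v 2, v 4, v 5, v 3 * v 7 - v 4 * v 6, v 3 * v 8 - v 5 * v 6, v 4 * v 8 - v 5 * v 7] ! i"

lemma less_8E:
  assumes "i < (8::nat)"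
  obtains "i = 0" | "i = 1" | "i = 2" | "i = 3" | "i = 4" | "i = 5" | "i = 6" | "i = 7"
proof -
  have "i \<in> {0,1,2,3,4,5,6,7}" using assms by (auto simp: numeral_eq_Suc less_Suc_eq)
  then show thesis using that by blast
qed

lemma less_12E:
  assumes "i < (12::nat)"
  obtains "i = 0" | "i = 1" | "i = 2" | "i = 3" | "i = 4" | "i = 5" | "i = 6" | "i = 7" | "i = 8"
    | "i = 9" | "i = 10" | "i = 11"
proof -
  have "i \<in> {0,1,2,3,4,5,6,7,8,9,10,11}" using assms by (auto simp: numeral_eq_Suc less_Suc_eq)
  then show thesis using that by blast
qed

lemma shear_gen_simps:
  "shear_gen 0 v = v 0" "shear_gen 1 v = v 1" "shear_gen (Suc 0) v = v 1" "shear_gen 2 v = v 2" "shear_gen 3 v = v 4" "shear_gen 4 v = v 5"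
  "shear_gen 5 v = v 3 * v 7 - v 4 * v 6" "shear_gen 6 v = v 3 * v 8 - v 5 * v 6"
  "shear_gen 7 v = v 4 * v 8 - v 5 * v 7"
  by (simp_all add: shear_gen_def)

lemmas nat_set_simps = lessThan_nat_numeral lessThan_Suc

lemma fun_eq_upto:
  assumes "\<And>i. i \<notin> {..<n} \<Longrightarrow> \<alpha> i = (0::nat)" "\<And>i. i \<notin> {..<n} \<Longrightarrow> \<beta> i = 0" "\<And>i. i < n \<Longrightarrow> \<alpha> i = \<beta> i"
  shows "\<alpha> = \<beta>"
  using assms by (metis lessThan_iff ext)

text \<open>Points with \<open>v 3 = 0\<close> at which every \<open>shear_gen\<close> is a monomial
  in \<open>s\<close> up to sign; the entry \<open>s 6 / s 3\<close> makes the minor with index 7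
  equal to \<open>s 6\<close>.\<close>

definition shear_family :: "(nat \<Rightarrow> 'k::field) \<Rightarrow> 'k \<Rightarrow> nat \<Rightarrow> 'k" where
  "shear_family s x i = [s 0, s 1, s 2, 0, s 3, s 4, s 5, 0, s 6 / s 3] ! i"

text \<open>The invariants are the fixed coordinates and the three minors of the matrix with rows (v
  3, v 4, v 5) and (v 6, v 7, v 8); \<open>v 3\<close> is set apart as the denominator. Expanding
  the 3x3 determinant with repeated row (v 3, v 4, v 5) rewrites generator 3 times generator 6
  modulo \<open>v 3\<close>, and this rule suffices. The table lists the exponents of
  \<open>s\<close> in the leading terms, one row per generator.\<close>

lemma shear_saturation:
  "saturation {..<8} (shear_gen :: nat \<Rightarrow> (nat \<Rightarrow> 'k::field_char_0) \<Rightarrow> 'k) (\<lambda>v. v 3)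
     {\<alpha>. (\<forall>i. i \<notin> {..<8} \<longrightarrow> \<alpha> i = 0) \<and> (\<alpha> 3 = 0 \<or> \<alpha> 6 = 0)} (\<lambda>i. of_bool (i = 3)) 7
     shear_family (\<lambda>_. 0)
     (\<lambda>i j. [[1,0,0,0,0,0,0],[0,1,0,0,0,0,0],[0,0,1,0,0,0,0],[0,0,0,1,0,0,0],[0,0,0,0,1,0,0],[0,0,0,1,0,1,0],
        [0,0,0,0,1,1,0],[0,0,0,0,0,0,1]] ! i ! j)
     (\<lambda>i. if i = 5 \<or> i = 6 then -1 else 1)
     (\<lambda>s i. [:[s 0, s 1, s 2, s 3, s 4, - s 3 * s 5, - s 4 * s 5, s 6] ! i:])"
proof (unfold_locales, goal_cases)
  case (3 \<alpha>)
  then have "\<alpha> 3 \<noteq> 0" "\<alpha> 6 \<noteq> 0" by auto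
  then show ?case
    by (intro rewrite_rule[where xs = "[3, 6]" and rs = "[(1, [4, 5])]" and q = "shear_gen 7"])
      (auto intro!: poly_functions.linear simp: shear_gen_simps algebra_simps)
next
  case (5 s x i)
  then have "i < 8" by simp
  then show ?case using 5 by (elim less_8E) (simp_all add: shear_gen_simps shear_family_def)
next
  case (7 s i)
  then have "i < 8" by simp
  then show ?case by (elim less_8E) (simp_all add: nat_set_simps)
next
  case (9 \<alpha> \<beta>)
  have e: "j < 7 \<Longrightarrow> (\<Sum>i\<in>{..<8}. [[1,0,0,0,0,0,0],[0,1,0,0,0,0,0],[0,0,1,0,0,0,0],[0,0,0,1,0,0,0],[0,0,0,0,1,0,0],[0,0,0,1,0,1,0],
        [0,0,0,0,1,1,0],[0,0,0,0,0,0,1]] ! i ! j * \<alpha> i) = (\<Sum>i\<in>{..<8}. [[1,0,0,0,0,0,0],[0,1,0,0,0,0,0],[0,0,1,0,0,0,0],[0,0,0,1,0,0,0],[0,0,0,0,1,0,0],[0,0,0,1,0,1,0],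
        [0,0,0,0,1,1,0],[0,0,0,0,0,0,1]] ! i ! j * \<beta> i)" for j using 9(4) .
  have "\<alpha> 0 = \<beta> 0" "\<alpha> 1 = \<beta> 1" "\<alpha> 2 = \<beta> 2" "\<alpha> 3 + \<alpha> 5 = \<beta> 3 + \<beta> 5" "\<alpha> 4 + \<alpha> 6 = \<beta> 4 + \<beta> 6"
    "\<alpha> 5 + \<alpha> 6 = \<beta> 5 + \<beta> 6" "\<alpha> 7 = \<beta> 7"
    using e[of 0] e[of 1] e[of 2] e[of 3] e[of 4] e[of 5] e[of 6] by (simp_all add: nat_set_simps)
  moreover have "\<alpha> 3 = 0 \<or> \<alpha> 6 = 0" "\<beta> 3 = 0 \<or> \<beta> 6 = 0" using 9 by auto
  ultimately have *: "\<alpha> 0 = \<beta> 0" "\<alpha> 1 = \<beta> 1" "\<alpha> 2 = \<beta> 2" "\<alpha> 3 = \<beta> 3" "\<alpha> 4 = \<beta> 4" "\<alpha> 5 = \<beta> 5" "\<alpha> 6 = \<beta> 6" "\<alpha> 7 = \<beta> 7"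
    by auto
  show ?case
  proof (rule fun_eq_upto[of 8])
    show "\<alpha> i = \<beta> i" if "i < 8" for i using that * by (elim less_8E) simp_all
  qed (use 9 in auto)
qed (auto simp: shear_family_def)

section \<open>The rewriting system modulo \<open>gen 12\<close>\<close>

definition null_family :: "(nat \<Rightarrow> 'k::field) \<Rightarrow> 'k \<Rightarrow> coord \<Rightarrow> 'k" where
  "null_family s x c = (case c of Coord a i j \<Rightarrow> (case a of
      L12 \<Rightarrow> of_bool (j = 0)
    | L23 \<Rightarrow> of_bool (i = j)
    | Mid1 \<Rightarrow> if j = 0 then (if i = 0 then x * s 0 else
          if i = 1 then - (s 3 * s 5 + s 2 * s 4 - x * s 2 * s 5) / s 0 else s 5 / (s 0 * s 1 * s 2))
        else if i = 0 then 0 else if i = 1 then s 1 * (s 3 - x * s 2) else - 1 / s 2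
    | Mid2 \<Rightarrow> if j = 0 then (if i = 0 then s 0 else 0) else if i = 1 then s 1 * s 2 else 0
    | R21 \<Rightarrow> of_bool (i = 0)))"

text \<open>Where \<open>gen 12\<close> vanishes, the rows A B C_1 and A B C_2 are linearly
  dependent; here \<open>x\<close> is their ratio, and D = (1, 0) turns pairings into first
  coordinates. The remaining entries are arranged so that each generator is a polynomial in
  \<open>x\<close> whose leading coefficient is a monomial in \<open>s\<close> up to sign.\<close>

lemma gen_null_family:
  assumes "\<forall>j. s j \<noteq> 0"
  shows "gen 0 (null_family s x) = x * s 0" "gen 1 (null_family s x) = s 0" "gen 2 (null_family s x) = s 4"
    "gen 3 (null_family s x) = s 5" "gen 4 (null_family s x) = s 1 * s 0 * (s 3 * x - s 2 * x ^ 2)"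
    "gen 5 (null_family s x) = s 1 * s 0 * s 3" "gen 6 (null_family s x) = s 1 * s 0 * s 2"
    "gen 7 (null_family s x) = s 1 * x ^ 2 * s 0 ^ 2" "gen 8 (null_family s x) = s 1 * x * s 0 ^ 2"
    "gen 9 (null_family s x) = s 1 * s 0 ^ 2" "gen 10 (null_family s x) = s 1 * s 0 * (s 4 + x * s 5)"
    "gen 11 (null_family s x) = s 3 * s 5 + s 2 * s 4 - x * s 2 * s 5" "gen 12 (null_family s x) = 0"
  using assms[rule_format, of 0] assms[rule_format, of 1] assms[rule_format, of 2]
  by (simp_all add: gen_simps gen_defs null_family_def field_simps power2_eq_square)

text \<open>The equations compare degrees in \<open>x\<close> and exponents of \<open>s\<close>. If
  at most one of two quantities is nonzero, their difference determines both: this applies to a11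
  against a7 + a8 + a9 + a10 and to a10 against a0 + a1. What remains open between a1, a4 and a8 is
  settled by the parity of the degree in \<open>x\<close>.\<close>

lemma normal_forms_inj:
  fixes a0 :: nat
  assumes a: "a8 \<le> 1" "a1 = 0 \<or> a7 = 0" "a1 = 0 \<or> a8 = 0" "a10 = 0 \<or> a1 = 0" "a10 = 0 \<or> a0 = 0"
      "a4 = 0 \<or> a9 = 0" "a4 = 0 \<or> a1 \<le> 1" "a11 = 0 \<or> a7 = 0 \<and> a8 = 0 \<and> a9 = 0 \<and> a10 = 0"
    and b: "b8 \<le> 1" "b1 = 0 \<or> b7 = 0" "b1 = 0 \<or> b8 = 0" "b10 = 0 \<or> b1 = 0" "b10 = 0 \<or> b0 = 0"
      "b4 = 0 \<or> b9 = 0" "b4 = 0 \<or> b1 \<le> 1" "b11 = 0 \<or> b7 = 0 \<and> b8 = 0 \<and> b9 = 0 \<and> b10 = 0"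
    and e: "a0 + 2 * a4 + 2 * a7 + a8 + a10 + a11 = b0 + 2 * b4 + 2 * b7 + b8 + b10 + b11"
      "a0 + a1 + a4 + a5 + a6 + 2 * a7 + 2 * a8 + 2 * a9 + a10 = b0 + b1 + b4 + b5 + b6 + 2 * b7 + 2 * b8 + 2 * b9 + b10"
      "a4 + a5 + a6 + a7 + a8 + a9 + a10 = b4 + b5 + b6 + b7 + b8 + b9 + b10"
      "a4 + a6 + a11 = b4 + b6 + b11" "a5 = b5" "a2 = b2" "a3 + a10 + a11 = b3 + b10 + b11"
  shows "a0 = b0 \<and> a1 = b1 \<and> a2 = b2 \<and> a3 = b3 \<and> a4 = b4 \<and> a5 = b5 \<and> a6 = b6 \<and> a7 = b7 \<and>
     a8 = b8 \<and> a9 = b9 \<and> a10 = b10 \<and> a11 = b11"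
proof -
  have "a7 + a8 + a9 + a10 + b11 = b7 + b8 + b9 + b10 + a11" using e(3-5) by linarith
  then have q: "a11 = b11" and K: "a7 + a8 + a9 + a10 = b7 + b8 + b9 + b10" using a(8) b(8) by auto
  have "a0 + a1 + a7 + a8 + a9 = b0 + b1 + b7 + b8 + b9" using e(2,3) by linarith
  then have A0: "a0 + a1 + b10 = b0 + b1 + a10" using K by linarith
  then have l: "a10 = b10" using a(4,5) b(4,5) by auto
  have A: "a0 + a1 = b0 + b1" using A0 l by simp
  have M: "a7 + a8 + a9 = b7 + b8 + b9" using K l by simp
  have W: "a0 + 2 * (a4 + a7) + a8 = b0 + 2 * (b4 + b7) + b8" using e(1) q l by simp
  have p: "a1 = b1 \<and> a4 = b4 \<and> a8 = b8"
  proof (cases "a1 = 0")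
    case a1: True
    show ?thesis
    proof (cases "b1 = 0")
      case True
      then have "2 * (a4 + a7) + a8 = 2 * (b4 + b7) + b8" using A W a1 by arith
      then have "a8 = b8" using a(1) b(1) by presburger
      moreover have "a4 = b4" using \<open>a8 = b8\<close> a1 True A W M a(6) b(6) by arith
      ultimately show ?thesis using a1 True by simp
    next
      case False
      then have b7: "b7 = 0" "b8 = 0" using b(2,3) by auto
      have "b4 > 0" using W A a1 False b7 by arith
      then have "b1 = 1" "b9 = 0" using b(6,7) False by auto
      \<comment> \<open>With a8 = 0 the equation equates an odd and an even number, which excludes
        the mixed case a1 = 0, b1 = 1.\<close>
      then have "2 * (a4 + a7) + a8 + 1 = 2 * b4" "a8 = 0" using W A M b7 a1 by arith+
      then show ?thesis by presburger
    qed
  next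
    case a1: False
    then have a7: "a7 = 0" "a8 = 0" using a(2,3) by auto
    show ?thesis
    proof (cases "b1 = 0")
      case True
      have "a4 > 0" using W A a1 True a7 by arith
      then have "a1 = 1" "a9 = 0" using a(6,7) a1 by auto
      then have "2 * (b4 + b7) + b8 + 1 = 2 * a4" "b8 = 0" using W A M a7 True by arith+
      then show ?thesis by presburger
    next
      case False
      then have b7: "b7 = 0" "b8 = 0" using b(2,3) by auto
      have "a0 + 2 * a4 = b0 + 2 * b4" using W a7 b7 by simp
      then have "b1 + 2 * a4 = a1 + 2 * b4" using A by linarith
      then have "a1 = b1 \<and> a4 = b4" using a(7) b(7) a1 False by (cases "a4 = 0"; cases "b4 = 0") auto
      then show ?thesis using a7 b7 by simp
    qed
  qed
  have "a0 = b0" using A p by simp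
  moreover have "a7 = b7" using W p calculation by simp
  moreover have "a9 = b9" using M p calculation by simp
  ultimately show ?thesis using e(4-7) q l p by simp
qed

text \<open>The monomials divisible by none of the left-hand sides in \<open>gen_relations\<close>;
  \<open>gen 12\<close> itself is the element \<open>\<delta>\<close>.\<close>

definition normal_exps :: "(nat \<Rightarrow> nat) set" where
  "normal_exps = {\<alpha>. (\<forall>i. i \<notin> {..<12} \<longrightarrow> \<alpha> i = 0) \<and> \<alpha> 8 \<le> 1 \<and> (\<alpha> 1 = 0 \<or> \<alpha> 7 = 0) \<and> (\<alpha> 1 = 0 \<or> \<alpha> 8 = 0) \<and>
     (\<alpha> 10 = 0 \<or> \<alpha> 1 = 0) \<and> (\<alpha> 10 = 0 \<or> \<alpha> 0 = 0) \<and> (\<alpha> 4 = 0 \<or> \<alpha> 9 = 0) \<and> (\<alpha> 4 = 0 \<or> \<alpha> 1 \<le> 1) \<and>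
     (\<alpha> 11 = 0 \<or> \<alpha> 7 = 0 \<and> \<alpha> 8 = 0 \<and> \<alpha> 9 = 0 \<and> \<alpha> 10 = 0)}"

text \<open>The weights 1, 3, 0, 0, 1, 0, 0, 1, 2, 2, 2, 4 are a solution of the inequalities which
  say that each of the eleven rules is decreasing. Only termination is at stake; independence of
  normal monomials comes from the leading terms.\<close>

lemma gen_rewrite:
  assumes "\<alpha> \<notin> normal_exps" "\<forall>i. i \<notin> {..<12} \<longrightarrow> \<alpha> i = 0"
  shows "\<exists>\<kappa> rs q. (\<forall>i. \<kappa> i \<le> \<alpha> i) \<and> q \<in> poly_functions (insert (gen 12) (gen ` {..<12})) \<and>
        (\<forall>(c, \<mu>) \<in> set rs. (\<forall>i. i \<notin> {..<12} \<longrightarrow> \<mu> i = 0) \<and>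
            (\<Sum>i<12. [1,3,0,0,1,0,0,1,2,2,2,4] ! i * \<mu> i) < (\<Sum>i<12. [1,3,0,0,1,0,0,1,2,2,2,4] ! i * \<kappa> i)) \<and>
        (\<forall>h :: coord \<Rightarrow> 'k::field_char_0. mon {..<12} gen \<kappa> h = (\<Sum>(c, \<mu>)\<leftarrow>rs. c * mon {..<12} gen \<mu> h) + gen 12 h * q h)"
proof -
  let ?P = "poly_functions (insert (gen 12) (gen ` {..<12})) :: ((coord \<Rightarrow> 'k) \<Rightarrow> 'k) set"
  have q: "gen i \<in> ?P" "(\<lambda>e. - gen i e) \<in> ?P" if "i < 12" for i
    using that by (auto intro: poly_functions.linear poly_functions_uminus)
  have z: "(\<lambda>_. 0) \<in> ?P" by (rule poly_functions.const)
  note rule = rewrite_rule[where g = gen and I = "{..<12}" and \<delta> = "gen 12" and wt = "\<lambda>i. [1,3,0,0,1,0,0,1,2,2,2,4] ! i"]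
  note R = gen_relations
  have "2 \<le> \<alpha> 8 \<or> (1 \<le> \<alpha> 1 \<and> 1 \<le> \<alpha> 7) \<or> (1 \<le> \<alpha> 1 \<and> 1 \<le> \<alpha> 8) \<or> (1 \<le> \<alpha> 10 \<and> 1 \<le> \<alpha> 1)
    \<or> (1 \<le> \<alpha> 10 \<and> 1 \<le> \<alpha> 0) \<or> (1 \<le> \<alpha> 4 \<and> 1 \<le> \<alpha> 9) \<or> (1 \<le> \<alpha> 4 \<and> 2 \<le> \<alpha> 1)
    \<or> (1 \<le> \<alpha> 11 \<and> 1 \<le> \<alpha> 9) \<or> (1 \<le> \<alpha> 11 \<and> 1 \<le> \<alpha> 8) \<or> (1 \<le> \<alpha> 11 \<and> 1 \<le> \<alpha> 7) \<or> (1 \<le> \<alpha> 11 \<and> 1 \<le> \<alpha> 10)"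
  proof (rule ccontr)
    assume *: "\<not> ?thesis"
    have n: "\<not> 1 \<le> (x::nat) \<longleftrightarrow> x = 0" "\<not> 2 \<le> x \<longleftrightarrow> x \<le> 1" for x by auto
    have "\<alpha> \<in> normal_exps" unfolding normal_exps_def mem_Collect_eq
      using * assms(2) unfolding de_Morgan_disj de_Morgan_conj n
      by (elim conjE, intro conjI; (assumption | (cases "\<alpha> 11 = 0"; simp)))
    then show False using assms(1) by blast
  qed
  then show ?thesis
  proof (elim disjE, goal_cases)
    case 1
    note c = 1
    show ?case
    proof (rule rule[where xs = "[8, 8]" and rs = "[(1, [7, 9])]" and q = "\<lambda>e. - gen 10 e"], goal_cases)
      case 3
      show ?case using c by auto
    next
      case 5
      show ?case by (rule q(2), simp)
    next
      case (6 h)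
      show ?case using R(1)[of h] by (simp add: algebra_simps)
    qed auto
  next
    case 2
    note c = 2
    show ?case
    proof (rule rule[where xs = "[1, 7]" and rs = "[(1, [0, 8])]" and q = "gen 2"], goal_cases)
      case 3
      show ?case using c by auto
    next
      case 5
      show ?case by (rule q(1), simp)
    next
      case (6 h)
      show ?case using R(2)[of h] by (simp add: algebra_simps)
    qed auto
  next
    case 3
    note c = 3
    show ?case
    proof (rule rule[where xs = "[1, 8]" and rs = "[(1, [0, 9])]" and q = "\<lambda>e. - gen 3 e"], goal_cases)
      case 3
      show ?case using c by auto
    next
      case 5
      show ?case by (rule q(2), simp)
    next
      case (6 h)
      show ?case using R(3)[of h] by (simp add: algebra_simps)
    qed auto
  next
    case 4
    note c = 4
    show ?case
    proof (rule rule[where xs = "[10, 1]" and rs = "[(1, [9, 2]), (1, [8, 3])]" and q = "\<lambda>_. 0"], goal_cases)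
      case 3
      show ?case using c by auto
    next
      case 5
      show ?case by (rule z)
    next
      case (6 h)
      show ?case using R(4)[of h] by (simp add: algebra_simps)
    qed auto
  next
    case 5
    note c = 5
    show ?case
    proof (rule rule[where xs = "[10, 0]" and rs = "[(1, [8, 2]), (1, [7, 3])]" and q = "\<lambda>_. 0"], goal_cases)
      case 3
      show ?case using c by auto
    next
      case 5
      show ?case by (rule z)
    next
      case (6 h)
      show ?case using R(5)[of h] by (simp add: algebra_simps)
    qed auto
  next
    case 6
    note c = 6
    show ?case
    proof (rule rule[where xs = "[4, 9]" and rs = "[(1, [5, 8]), (-1, [6, 7])]" and q = "\<lambda>_. 0"], goal_cases)
      case 3
      show ?case using c by auto
    next
      case 5
      show ?case by (rule z)
    next
      case (6 h)
      show ?case using R(6)[of h] by (simp add: algebra_simps)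
    qed auto
  next
    case 7
    note c = 7
    show ?case
    proof (rule rule[where xs = "[4, 1, 1]" and rs = "[(1, [0, 1, 5]), (-1, [0, 0, 6])]" and q = "\<lambda>e. - gen 11 e"], goal_cases)
      case 3
      show ?case using c by auto
    next
      case 5
      show ?case by (rule q(2), simp)
    next
      case (6 h)
      show ?case using R(7)[of h] by (simp add: algebra_simps)
    qed auto
  next
    case 8
    note c = 8
    show ?case
    proof (rule rule[where xs = "[11, 9]" and rs = "[(1, [1, 5, 3]), (1, [1, 6, 2]), (-1, [0, 6, 3])]" and q = "\<lambda>_. 0"], goal_cases)
      case 3
      show ?case using c by auto
    next
      case 5
      show ?case by (rule z)
    next
      case (6 h)
      show ?case using R(8)[of h] by (simp add: algebra_simps)
    qed auto
  next
    case 9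
    note c = 9
    show ?case
    proof (rule rule[where xs = "[11, 8]" and rs = "[(1, [1, 4, 3]), (1, [0, 6, 2])]" and q = "\<lambda>_. 0"], goal_cases)
      case 3
      show ?case using c by auto
    next
      case 5
      show ?case by (rule z)
    next
      case (6 h)
      show ?case using R(9)[of h] by (simp add: algebra_simps)
    qed auto
  next
    case 10
    note c = 10
    show ?case
    proof (rule rule[where xs = "[11, 7]" and rs = "[(1, [0, 4, 3]), (1, [0, 5, 2]), (-1, [1, 4, 2])]" and q = "\<lambda>_. 0"], goal_cases)
      case 3
      show ?case using c by auto
    next
      case 5
      show ?case by (rule z)
    next
      case (6 h)
      show ?case using R(10)[of h] by (simp add: algebra_simps)
    qed auto
  next
    case 11
    note c = 11
    show ?case
    proof (rule rule[where xs = "[11, 10]" and rs = "[(1, [6, 2, 2]), (1, [5, 2, 3]), (1, [4, 3, 3])]" and q = "\<lambda>_. 0"], goal_cases)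
      case 3
      show ?case using c by auto
    next
      case 5
      show ?case by (rule z)
    next
      case (6 h)
      show ?case using R(11)[of h] by (simp add: algebra_simps)
    qed auto
  qed
qed

text \<open>The table gives the exponents of \<open>s\<close> in the leading coefficients, the last
  list of numbers before it the degrees in \<open>x\<close>. Generators 0 and 1, 4 and 6, as well as
  7, 8 and 9 share their monomial in \<open>s\<close> and are told apart by the degree in
  \<open>x\<close>.\<close>

lemma gen_saturation:
  "saturation {..<12} (gen :: nat \<Rightarrow> (coord \<Rightarrow> 'k::field_char_0) \<Rightarrow> 'k) (gen 12) normal_exps
     (\<lambda>i. [1,3,0,0,1,0,0,1,2,2,2,4] ! i) 6 null_family (\<lambda>i. [1,0,0,0,2,0,0,2,1,0,1,1] ! i)
     (\<lambda>i j. [[1,0,0,0,0,0],[1,0,0,0,0,0],[0,0,0,0,1,0],[0,0,0,0,0,1],[1,1,1,0,0,0],[1,1,0,1,0,0],[1,1,1,0,0,0],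
        [2,1,0,0,0,0],[2,1,0,0,0,0],[2,1,0,0,0,0],[1,1,0,0,0,1],[0,0,1,0,0,1]] ! i ! j)
     (\<lambda>i. if i = 4 \<or> i = 11 then -1 else 1)
     (\<lambda>s i. [[:0, s 0:], [:s 0:], [:s 4:], [:s 5:], [:0, s 1 * s 0 * s 3, - s 1 * s 0 * s 2:], [:s 1 * s 0 * s 3:],
        [:s 1 * s 0 * s 2:], [:0, 0, s 1 * s 0 ^ 2:], [:0, s 1 * s 0 ^ 2:], [:s 1 * s 0 ^ 2:],
        [:s 1 * s 0 * s 4, s 1 * s 0 * s 5:], [:s 3 * s 5 + s 2 * s 4, - s 2 * s 5:]] ! i)"
proof (unfold_locales, goal_cases)
  case 1
  then show ?case by simp
next
  case (2 \<alpha> i)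
  then show ?case by (simp add: normal_exps_def)
next
  case (3 \<alpha>)
  then show ?case by (rule gen_rewrite)
next
  case (4 s x)
  then show ?case by (rule gen_null_family)
next
  case (5 s x i)
  then have "i < 12" by simp
  then show ?case using gen_null_family[OF 5(1), of x]
    by (elim less_12E) (simp_all add: algebra_simps power2_eq_square)
next
  case (6 s i)
  then have "i < 12" by simp
  then show ?case by (elim less_12E) simp_all
next
  case (7 s i)
  then have "i < 12" by simp
  then show ?case by (elim less_12E) (simp_all add: nat_set_simps numeral_2_eq_2 coeff_pCons)
next
  case (8 i)
  then show ?case by simp
next
  case (9 \<alpha> \<beta>)
  have n: "(\<forall>i. i \<notin> {..<12} \<longrightarrow> \<gamma> i = 0)" "\<gamma> 8 \<le> 1" "\<gamma> 1 = 0 \<or> \<gamma> 7 = 0" "\<gamma> 1 = 0 \<or> \<gamma> 8 = 0"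
     "\<gamma> 10 = 0 \<or> \<gamma> 1 = 0" "\<gamma> 10 = 0 \<or> \<gamma> 0 = 0" "\<gamma> 4 = 0 \<or> \<gamma> 9 = 0" "\<gamma> 4 = 0 \<or> \<gamma> 1 \<le> 1"
     "\<gamma> 11 = 0 \<or> \<gamma> 7 = 0 \<and> \<gamma> 8 = 0 \<and> \<gamma> 9 = 0 \<and> \<gamma> 10 = 0" if "\<gamma> \<in> normal_exps" for \<gamma>
    using that unfolding normal_exps_def mem_Collect_eq apply -
    apply (elim conjE, assumption)+
    done
  have e: "j < 6 \<Longrightarrow> (\<Sum>i\<in>{..<12}. [[1,0,0,0,0,0],[1,0,0,0,0,0],[0,0,0,0,1,0],[0,0,0,0,0,1],[1,1,1,0,0,0],[1,1,0,1,0,0],[1,1,1,0,0,0],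
        [2,1,0,0,0,0],[2,1,0,0,0,0],[2,1,0,0,0,0],[1,1,0,0,0,1],[0,0,1,0,0,1]] ! i ! j * \<alpha> i) =
     (\<Sum>i\<in>{..<12}. [[1,0,0,0,0,0],[1,0,0,0,0,0],[0,0,0,0,1,0],[0,0,0,0,0,1],[1,1,1,0,0,0],[1,1,0,1,0,0],[1,1,1,0,0,0],
        [2,1,0,0,0,0],[2,1,0,0,0,0],[2,1,0,0,0,0],[1,1,0,0,0,1],[0,0,1,0,0,1]] ! i ! j * \<beta> i)" for j using 9(4) .
  have *: "\<alpha> 0 = \<beta> 0 \<and> \<alpha> 1 = \<beta> 1 \<and> \<alpha> 2 = \<beta> 2 \<and> \<alpha> 3 = \<beta> 3 \<and> \<alpha> 4 = \<beta> 4 \<and> \<alpha> 5 = \<beta> 5 \<and> \<alpha> 6 = \<beta> 6 \<and> \<alpha> 7 = \<beta> 7 \<and>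
     \<alpha> 8 = \<beta> 8 \<and> \<alpha> 9 = \<beta> 9 \<and> \<alpha> 10 = \<beta> 10 \<and> \<alpha> 11 = \<beta> 11"
    by (rule normal_forms_inj[OF n(2-9)[OF 9(1)] n(2-9)[OF 9(2)]])
      (use 9(3) e[of 0] e[of 1] e[of 2] e[of 3] e[of 4] e[of 5] in \<open>simp_all add: nat_set_simps\<close>)
  show ?case
  proof (rule fun_eq_upto[of 12])
    show "\<alpha> i = \<beta> i" if "i < 12" for i using that * by (elim less_12E) simp_all
  qed (use n(1) 9(1,2) in auto)
qed

text \<open>Where \<open>v 3 \<noteq> 0\<close>, the shear with t = - v 6 / v 3 makes coordinate 6
  zero and turns coordinates 7 and 8 into minors divided by \<open>v 3\<close>. So a power of
  \<open>v 3\<close> times \<open>F\<close> is a polynomial in the invariants, and saturation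
  removes this power one factor at a time.\<close>

lemma shear_invariant_poly:
  fixes F :: "(nat \<Rightarrow> 'k::field_char_0) \<Rightarrow> 'k"
  assumes F: "F \<in> poly_functions ((\<lambda>i v. v i) ` {..<9})"
    and inv: "\<And>v t. F (v(6 := v 6 + t * v 3, 7 := v 7 + t * v 4, 8 := v 8 + t * v 5)) = F v"
  shows "F \<in> poly_functions (insert (\<lambda>v. v 3) (shear_gen ` {..<8}))"
proof -
  let ?L = "insert (\<lambda>v. v 3) (shear_gen ` {..<8}) :: ((nat \<Rightarrow> 'k) \<Rightarrow> 'k) set"
  let ?\<sigma> = "\<lambda>v :: nat \<Rightarrow> 'k. v(6 := 0, 7 := (v 3 * v 7 - v 4 * v 6) / v 3, 8 := (v 3 * v 8 - v 5 * v 6) / v 3)"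
  have L_coord: "l \<in> poly_functions coord_funs" if "l \<in> ?L" for l
  proof (cases "l = (\<lambda>v. v 3)")
    case True
    then show ?thesis using coord_in_poly_functions by simp
  next
    case False
    with that have "l \<in> shear_gen ` {..<8}" by blast
    then obtain i where "i < 8" "l = shear_gen i" by blast
    then show ?thesis
      by (elim less_8E) (auto simp: shear_gen_simps[abs_def] intro!: poly_functions_intros coord_in_poly_functions)
  qed
  have PL: "p \<in> poly_functions coord_funs" if "p \<in> poly_functions ?L" for p
    using poly_functions_subst[OF that, of "\<lambda>x. x"] L_coord by auto
  have FC: "F \<in> poly_functions coord_funs" by (rule poly_functions_mono[OF F]) auto
  have \<delta>: "(\<lambda>v. v 3) \<in> poly_functions ?L" by (rule poly_functions.linear) simp
  have sg: "shear_gen i \<in> poly_functions ?L" if "i < 8" for i by (rule poly_functions.linear) (use that in simp)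
  have "\<exists>n. \<exists>q\<in>poly_functions ?L. \<forall>v. v 3 \<noteq> 0 \<longrightarrow> v 3 ^ n * F (?\<sigma> v) = q v"
  proof (rule clear_denominators[OF F \<delta>])
    fix l :: "(nat \<Rightarrow> 'k) \<Rightarrow> 'k" assume "l \<in> (\<lambda>i v. v i) ` {..<9}"
    then obtain i where i: "i < 9" "l = (\<lambda>v. v i)" by auto
    have "i \<in> {0,1,2,3,4,5,6,7,8}" using i(1) by (auto simp: numeral_eq_Suc less_Suc_eq)
    then consider "i = 0" | "i = 1" | "i = 2" | "i = 3" | "i = 4" | "i = 5" | "i = 6" | "i = 7" | "i = 8" by blast
    then show "\<exists>n. \<exists>q\<in>poly_functions ?L. \<forall>v. v 3 \<noteq> 0 \<longrightarrow> v 3 ^ n * l (?\<sigma> v) = q v"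
    proof cases
      case 1 then show ?thesis using i by (intro exI[of _ 0] bexI[OF _ sg[of 0]]) (auto simp: shear_gen_simps)
    next
      case 2 then show ?thesis using i by (intro exI[of _ 0] bexI[OF _ sg[of 1]]) (auto simp: shear_gen_simps)
    next
      case 3 then show ?thesis using i by (intro exI[of _ 0] bexI[OF _ sg[of 2]]) (auto simp: shear_gen_simps)
    next
      case 4 then show ?thesis using i by (intro exI[of _ 0] bexI[OF _ \<delta>]) auto
    next
      case 5 then show ?thesis using i by (intro exI[of _ 0] bexI[OF _ sg[of 3]]) (auto simp: shear_gen_simps)
    next
      case 6 then show ?thesis using i by (intro exI[of _ 0] bexI[OF _ sg[of 4]]) (auto simp: shear_gen_simps)
    next
      case 7 then show ?thesis using i by (intro exI[of _ 0] bexI[OF _ poly_functions.const[of 0]]) auto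
    next
      case 8 then show ?thesis using i by (intro exI[of _ 1] bexI[OF _ sg[of 5]]) (auto simp: shear_gen_simps)
    next
      case 9 then show ?thesis using i by (intro exI[of _ 1] bexI[OF _ sg[of 6]]) (auto simp: shear_gen_simps)
    qed
  qed
  then obtain n q where q: "q \<in> poly_functions ?L" "\<And>v. v 3 \<noteq> 0 \<Longrightarrow> v 3 ^ n * F (?\<sigma> v) = q v" by blast
  have "F (?\<sigma> v) = F v" if "v 3 \<noteq> 0" for v
  proof -
    have e: "?\<sigma> v = v(6 := v 6 + (- v 6 / v 3) * v 3, 7 := v 7 + (- v 6 / v 3) * v 4, 8 := v 8 + (- v 6 / v 3) * v 5)"
      using that by (auto simp: fun_eq_iff field_simps)
    show ?thesis unfolding e by (rule inv)
  qed
  then have 1: "v 3 ^ n * F v = q v" if "v 3 \<noteq> 0" for v using q(2)[of v] that by simp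
  \<comment> \<open>An identity on the dense set \<open>v 3 \<noteq> 0\<close> holds everywhere,
    which justifies dividing by \<open>v 3\<close>.\<close>
  have cancel: "G v = q v" if "G \<in> poly_functions coord_funs" "q \<in> poly_functions ?L" "\<And>v. v 3 \<noteq> 0 \<Longrightarrow> G v = q v" for G q v
    using zero_of_dense[OF coord_in_poly_functions[of 3] poly_functions_diff[OF that(1) PL[OF that(2)]], of "\<lambda>_. 1" v] that(3)
    by auto
  have VF: "(\<lambda>v. v 3 ^ n * F v) \<in> poly_functions coord_funs" for n
    by (intro poly_functions_intros coord_in_poly_functions FC)
  have "q \<in> poly_functions ?L \<Longrightarrow> (\<And>v. v 3 ^ n * F v = q v) \<Longrightarrow> F \<in> poly_functions ?L" for n q
  proof (induction n arbitrary: q)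
    case 0
    then show ?case by (metis ext mult_1 power_0)
  next
    case (Suc n)
    \<comment> \<open>As long as the exponent is positive, \<open>q\<close> vanishes on the family
      because \<open>v 3\<close> does.\<close>
    have "\<exists>q'\<in>poly_functions ?L. \<forall>v. q v = v 3 * q' v"
    proof (rule saturation.divides[OF shear_saturation Suc.prems(1)])
      fix s :: "nat \<Rightarrow> 'k" and x
      show "q (shear_family s x) = 0"
        unfolding Suc.prems(2)[symmetric] by (simp add: shear_family_def)
    qed
    then obtain q' where q': "q' \<in> poly_functions ?L" "\<And>v. q v = v 3 * q' v" by blast
    have "v 3 ^ n * F v = q' v" for v
    proof (rule cancel[OF VF q'(1)])
      fix v :: "nat \<Rightarrow> 'k" assume "v 3 \<noteq> 0"
      then show "v 3 ^ n * F v = q' v" using Suc.prems(2)[of v] q'(2)[of v] by simp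
    qed
    then show ?case by (rule Suc.IH[OF q'(1)])
  qed
  then show ?thesis using q(1) cancel[OF VF q(1) 1] by blast
qed

text \<open>The restriction of \<open>f\<close> to the slice is a polynomial in \<open>v 3\<close>
  and the \<open>shear_gen\<close>. At the slice point of a representation each of these is, up to
  sign, a generator divided by at most the first power of \<open>gen 12\<close>. Hence a power of
  \<open>gen 12\<close> times \<open>f\<close> is a polynomial in the generators, and
  \<open>gen_saturation\<close> allows the power to be cancelled.\<close>

theorem SI_poly:
  fixes f :: "'k::field_char_0 kpoly"
  assumes f: "f \<in> SI"
  shows "pev f \<in> poly_functions (gen ` {..<13})"
proof -
  let ?G = "gen ` {..<13} :: ((coord \<Rightarrow> 'k) \<Rightarrow> 'k) set"
  have G: "insert (gen 12) (gen ` {..<12}) = ?G"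
    by (simp add: nat_set_simps insert_commute)
  let ?S = "insert (\<lambda>v. v 3) (shear_gen ` {..<8}) :: ((nat \<Rightarrow> 'k) \<Rightarrow> 'k) set"
  define F where "F v = pev f (slice v)" for v
  have "F \<in> poly_functions ((\<lambda>i v. v i) ` {..<9})"
    unfolding F_def[abs_def]
  proof (rule poly_functions_subst[OF pev_in_poly_functions])
    fix l :: "(coord \<Rightarrow> 'k) \<Rightarrow> 'k" assume "l \<in> coord_funs"
    then obtain a i j where l: "l = (\<lambda>e. e (Coord a i j))" by (metis coord.exhaust imageE)
    have c: "(\<lambda>v. v i) \<in> poly_functions ((\<lambda>i v. v i) ` {..<9})" if "i < 9" for i :: nat
      by (rule poly_functions.linear) (use that in auto)
    show "(\<lambda>x. l (slice x)) \<in> poly_functions ((\<lambda>i v. v i) ` {..<9})"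
      by (cases a; cases "j = 0"; cases "i = 0"; cases "i = 1") (auto simp: l intro!: c poly_functions.const)
  qed
  moreover have "F (v(6 := v 6 + t * v 3, 7 := v 7 + t * v 4, 8 := v 8 + t * v 5)) = F v" for v t
    unfolding F_def by (rule SI_moved[OF f slice_shear])
  ultimately have FS: "F \<in> poly_functions ?S" by (rule shear_invariant_poly)
  \<comment> \<open>An arbitrary choice of slice point; only shear-invariant functions are evaluated
    there, and these do not depend on it.\<close>
  define \<sigma> where "\<sigma> e = (SOME v. \<exists>g. moved g e (slice v))" for e :: "coord \<Rightarrow> 'k"
  have \<sigma>: "\<exists>g. moved g e (slice (\<sigma> e))" if "slice_cond e \<noteq> 0" for e
    unfolding \<sigma>_def by (rule someI_ex[where P = "\<lambda>v. \<exists>g. moved g e (slice v)"]) (use moved_to_slice[OF that] in blast)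
  have g: "gen i (slice (\<sigma> e)) = gen i e" if "slice_cond e \<noteq> 0" "i < 13" for i e
    using \<sigma>[OF that(1)] gen_moved that(2) by blast
  \<comment> \<open>The slice values of the generators, to be solved for the slice coordinates;
    coordinates 6, 7 and 8 occur only in minors.\<close>
  have s: "\<sigma> e 0 = gen 12 e" "\<sigma> e 1 = gen 0 e" "gen 12 e * \<sigma> e 2 = gen 1 e" "\<sigma> e 3 = gen 4 e" "\<sigma> e 5 = gen 5 e"
    "- (gen 12 e * \<sigma> e 4) = gen 6 e" "\<sigma> e 3 * \<sigma> e 8 - \<sigma> e 5 * \<sigma> e 6 = gen 7 e"
    "- (gen 12 e * (\<sigma> e 3 * \<sigma> e 7 - \<sigma> e 4 * \<sigma> e 6)) = gen 8 e"
    "gen 12 e * (\<sigma> e 4 * \<sigma> e 8 - \<sigma> e 5 * \<sigma> e 7) = gen 9 e" if "slice_cond e \<noteq> 0" for e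
    using g[OF that, of 0] g[OF that, of 1] g[OF that, of 4] g[OF that, of 5] g[OF that, of 6] g[OF that, of 7]
      g[OF that, of 8] g[OF that, of 9] g[OF that, of 12] by (simp_all add: gen_slice del: One_nat_def)
  have "\<exists>n. \<exists>q\<in>poly_functions ?G. \<forall>e. slice_cond e \<noteq> 0 \<longrightarrow> gen 12 e ^ n * F (\<sigma> e) = q e"
  proof (rule clear_denominators[OF FS gen_in_gens])
    fix l :: "(nat \<Rightarrow> 'k) \<Rightarrow> 'k" assume "l \<in> ?S"
    then consider "l = (\<lambda>v. v 3)" | i where "i < 8" "l = shear_gen i" by auto
    then show "\<exists>n. \<exists>q\<in>poly_functions ?G. \<forall>e. slice_cond e \<noteq> 0 \<longrightarrow> gen 12 e ^ n * l (\<sigma> e) = q e"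
    proof cases
      case 1
      then show ?thesis by (intro exI[of _ 0] bexI[OF _ gen_in_gens[of 4]]) (auto simp: s)
    next
      case (2 i)
      note u = poly_functions_uminus[OF gen_in_gens]
      note l = 2(2)
      from 2(1) show ?thesis
      proof (cases rule: less_8E)
        case 1 show ?thesis unfolding l 1 by (intro exI[of _ 0] bexI[OF _ gen_in_gens[of 12]]) (auto simp: s shear_gen_simps)
      next
        case 2 show ?thesis unfolding l 2 by (intro exI[of _ 0] bexI[OF _ gen_in_gens[of 0]]) (auto simp: s shear_gen_simps simp del: One_nat_def)
      next
        case 3 show ?thesis unfolding l 3 by (intro exI[of _ 1] bexI[OF _ gen_in_gens[of 1]]) (auto simp: s shear_gen_simps simp del: One_nat_def)
      next
        case 4 show ?thesis unfolding l 4 by (intro exI[of _ 1] bexI[OF _ u[of 6]]) (auto simp: s(6)[symmetric] shear_gen_simps)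
      next
        case 5 show ?thesis unfolding l 5 by (intro exI[of _ 0] bexI[OF _ gen_in_gens[of 5]]) (auto simp: s shear_gen_simps)
      next
        case 6
        have "gen 12 e ^ 1 * shear_gen i (\<sigma> e) = - gen 8 e" if "slice_cond e \<noteq> 0" for e
          unfolding 6 shear_gen_simps power_one_right using s(8)[OF that] by (simp only: minus_equation_iff)
        then show ?thesis unfolding l by (intro exI[of _ 1] bexI[OF _ u[of 8]]) auto
      next
        case 7
        have "gen 12 e ^ 0 * shear_gen i (\<sigma> e) = gen 7 e" if "slice_cond e \<noteq> 0" for e
          unfolding 7 shear_gen_simps power_one_right power_0 mult_1 using s(7)[OF that] .
        then show ?thesis unfolding l by (intro exI[of _ 0] bexI[OF _ gen_in_gens[of 7]]) auto
      next
        case 8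
        have "gen 12 e ^ 1 * shear_gen i (\<sigma> e) = gen 9 e" if "slice_cond e \<noteq> 0" for e
          unfolding 8 shear_gen_simps power_one_right power_0 mult_1 using s(9)[OF that] .
        then show ?thesis unfolding l by (intro exI[of _ 1] bexI[OF _ gen_in_gens[of 9]]) auto
      qed
    qed
  qed simp
  then obtain n q where q: "q \<in> poly_functions ?G" "\<And>e. slice_cond e \<noteq> 0 \<Longrightarrow> gen 12 e ^ n * F (\<sigma> e) = q e" by blast
  have 1: "gen 12 e ^ n * pev f e = q e" if e: "slice_cond e \<noteq> 0" for e
  proof -
    have "F (\<sigma> e) = pev f e" unfolding F_def using \<sigma>[OF e] SI_moved[OF f] by blast
    then show ?thesis using q(2)[OF e] by simp
  qed
  have cancel: "H e = q e" if "H \<in> poly_functions coord_funs" "q \<in> poly_functions ?G" "\<And>e. slice_cond e \<noteq> 0 \<Longrightarrow> H e = q e" for H q e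
    using zero_of_slice_cond[of "\<lambda>v. H v - q v" e] that poly_functions_diff[OF that(1) poly_functions_gens[OF that(2)]] by auto
  have VF: "(\<lambda>e. gen 12 e ^ n * pev f e) \<in> poly_functions coord_funs" for n
    by (intro poly_functions_intros gen_poly pev_in_poly_functions) simp
  have "q \<in> poly_functions ?G \<Longrightarrow> (\<And>e. gen 12 e ^ n * pev f e = q e) \<Longrightarrow> pev f \<in> poly_functions ?G" for n q
  proof (induction n arbitrary: q)
    case 0
    then show ?case by (metis ext mult_1 power_0)
  next
    case (Suc n)
    have "\<exists>q'\<in>poly_functions ?G. \<forall>e. q e = gen 12 e * q' e"
      using Suc.prems(1) unfolding G[symmetric]
    proof (rule saturation.divides[OF gen_saturation])
      fix s :: "nat \<Rightarrow> 'k" and x assume "\<forall>j. s j \<noteq> 0"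
      then show "q (null_family s x) = 0"
        unfolding Suc.prems(2)[symmetric] by (simp add: gen_null_family)
    qed
    then obtain q' where q': "q' \<in> poly_functions ?G" "\<And>e. q e = gen 12 e * q' e" by blast
    have "gen 12 e ^ n * pev f e = q' e" for e
    proof (rule cancel[OF VF q'(1)])
      fix e :: "coord \<Rightarrow> 'k" assume "slice_cond e \<noteq> 0"
      then have "gen 12 e \<noteq> 0" by (auto simp: slice_cond_def)
      then show "gen 12 e ^ n * pev f e = q' e" using Suc.prems(2)[of e] q'(2)[of e] by simp
    qed
    then show ?case by (rule Suc.IH[OF q'(1)])
  qed
  then show ?thesis using q(1) cancel[OF VF q(1) 1] by blast
qed

section \<open>The ring of invariants as a subalgebra of the function field\<close>

definition gen_polys :: "'k::field kpoly set" where
  "gen_polys = (\<lambda>i. gen i kvar) ` {..<13}"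

lemma pev_gen_polys: "pev ` (gen_polys :: 'k::field kpoly set) = gen ` {..<13}"
  unfolding gen_polys_def image_image by (intro image_cong) (auto simp: pev_gen)

lemma SI_const: "kconst c \<in> SI"
  by (rule SI_I[OF kpoly_ring_kconst]) simp

lemma SI_closed:
  assumes "f \<in> SI" "g \<in> SI" shows "f + g \<in> SI" "f * g \<in> SI"
  using assms by (auto intro!: SI_I kpoly_ring_add kpoly_ring_mult simp: SI_moved) (auto simp: SI_def)

theorem SI_eq_subalgebra:
  "to_fract ` SI = k_subalgebra (to_fract ` (gen_polys :: 'k::field_char_0 kpoly set))"
proof (intro equalityI subsetI)
  fix x :: "'k kpoly fract" assume "x \<in> to_fract ` SI"
  then obtain f where f: "x = to_fract f" "f \<in> SI" by blast
  then obtain y where y: "to_fract y \<in> k_subalgebra (to_fract ` (gen_polys :: 'k kpoly set))" "pev y = pev f"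
    using k_subalgebra_of_poly_functions[of "pev f" gen_polys] SI_poly[OF f(2)] by (auto simp: pev_gen_polys)
  have "y = f" by (rule pev_inject) (simp add: y(2))
  then show "x \<in> k_subalgebra (to_fract ` gen_polys)" using y(1) f(1) by simp
next
  fix x :: "'k kpoly fract" assume "x \<in> k_subalgebra (to_fract ` gen_polys)"
  then show "x \<in> to_fract ` SI"
  proof induction
    case (const c)
    show ?case using SI_const by blast
  next
    case (gen x)
    then show ?case using gen_in_SI by (auto simp: gen_polys_def)
  next
    case (add x y)
    then obtain a b where "x = to_fract a" "y = to_fract b" "a \<in> SI" "b \<in> SI" by blast
    then show ?case using SI_closed(1)[of a b] by (intro image_eqI[of _ _ "a + b"]) simp_all
  next
    case (mult x y)
    then obtain a b where "x = to_fract a" "y = to_fract b" "a \<in> SI" "b \<in> SI" by blast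
    then show ?case using SI_closed(2)[of a b] by (intro image_eqI[of _ _ "a * b"]) simp_all
  qed
qed


section \<open>Minimality\<close>

text \<open>For each index there is a pair of representations, given by \<open>t = 1\<close> and \<open>t = -1\<close>, at which
  exactly the generator with this index takes different values.\<close>

definition point :: "'k list \<Rightarrow> coord \<Rightarrow> 'k" where
  "point xs c = (case c of Coord a i j \<Rightarrow> xs ! (case a of
     L12 \<Rightarrow> j | L23 \<Rightarrow> 2 + 3 * i + j | Mid1 \<Rightarrow> 8 + 2 * i + j | Mid2 \<Rightarrow> 14 + 2 * i + j | R21 \<Rightarrow> 20 + i))"

lemma point_simps:
  "point [x0, x1, x2, x3, x4, x5, x6, x7, x8, x9, x10, x11, x12, x13, x14, x15, x16, x17, x18, x19, x20, x21] (Coord L12 0 0) = x0"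
  "point [x0, x1, x2, x3, x4, x5, x6, x7, x8, x9, x10, x11, x12, x13, x14, x15, x16, x17, x18, x19, x20, x21] (Coord L12 0 (Suc 0)) = x1"
  "point [x0, x1, x2, x3, x4, x5, x6, x7, x8, x9, x10, x11, x12, x13, x14, x15, x16, x17, x18, x19, x20, x21] (Coord L23 0 0) = x2"
  "point [x0, x1, x2, x3, x4, x5, x6, x7, x8, x9, x10, x11, x12, x13, x14, x15, x16, x17, x18, x19, x20, x21] (Coord L23 0 (Suc 0)) = x3"
  "point [x0, x1, x2, x3, x4, x5, x6, x7, x8, x9, x10, x11, x12, x13, x14, x15, x16, x17, x18, x19, x20, x21] (Coord L23 0 2) = x4"
  "point [x0, x1, x2, x3, x4, x5, x6, x7, x8, x9, x10, x11, x12, x13, x14, x15, x16, x17, x18, x19, x20, x21] (Coord L23 (Suc 0) 0) = x5"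
  "point [x0, x1, x2, x3, x4, x5, x6, x7, x8, x9, x10, x11, x12, x13, x14, x15, x16, x17, x18, x19, x20, x21] (Coord L23 (Suc 0) (Suc 0)) = x6"
  "point [x0, x1, x2, x3, x4, x5, x6, x7, x8, x9, x10, x11, x12, x13, x14, x15, x16, x17, x18, x19, x20, x21] (Coord L23 (Suc 0) 2) = x7"
  "point [x0, x1, x2, x3, x4, x5, x6, x7, x8, x9, x10, x11, x12, x13, x14, x15, x16, x17, x18, x19, x20, x21] (Coord Mid1 0 0) = x8"
  "point [x0, x1, x2, x3, x4, x5, x6, x7, x8, x9, x10, x11, x12, x13, x14, x15, x16, x17, x18, x19, x20, x21] (Coord Mid1 0 (Suc 0)) = x9"
  "point [x0, x1, x2, x3, x4, x5, x6, x7, x8, x9, x10, x11, x12, x13, x14, x15, x16, x17, x18, x19, x20, x21] (Coord Mid1 (Suc 0) 0) = x10"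
  "point [x0, x1, x2, x3, x4, x5, x6, x7, x8, x9, x10, x11, x12, x13, x14, x15, x16, x17, x18, x19, x20, x21] (Coord Mid1 (Suc 0) (Suc 0)) = x11"
  "point [x0, x1, x2, x3, x4, x5, x6, x7, x8, x9, x10, x11, x12, x13, x14, x15, x16, x17, x18, x19, x20, x21] (Coord Mid1 2 0) = x12"
  "point [x0, x1, x2, x3, x4, x5, x6, x7, x8, x9, x10, x11, x12, x13, x14, x15, x16, x17, x18, x19, x20, x21] (Coord Mid1 2 (Suc 0)) = x13"
  "point [x0, x1, x2, x3, x4, x5, x6, x7, x8, x9, x10, x11, x12, x13, x14, x15, x16, x17, x18, x19, x20, x21] (Coord Mid2 0 0) = x14"
  "point [x0, x1, x2, x3, x4, x5, x6, x7, x8, x9, x10, x11, x12, x13, x14, x15, x16, x17, x18, x19, x20, x21] (Coord Mid2 0 (Suc 0)) = x15"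
  "point [x0, x1, x2, x3, x4, x5, x6, x7, x8, x9, x10, x11, x12, x13, x14, x15, x16, x17, x18, x19, x20, x21] (Coord Mid2 (Suc 0) 0) = x16"
  "point [x0, x1, x2, x3, x4, x5, x6, x7, x8, x9, x10, x11, x12, x13, x14, x15, x16, x17, x18, x19, x20, x21] (Coord Mid2 (Suc 0) (Suc 0)) = x17"
  "point [x0, x1, x2, x3, x4, x5, x6, x7, x8, x9, x10, x11, x12, x13, x14, x15, x16, x17, x18, x19, x20, x21] (Coord Mid2 2 0) = x18"
  "point [x0, x1, x2, x3, x4, x5, x6, x7, x8, x9, x10, x11, x12, x13, x14, x15, x16, x17, x18, x19, x20, x21] (Coord Mid2 2 (Suc 0)) = x19"
  "point [x0, x1, x2, x3, x4, x5, x6, x7, x8, x9, x10, x11, x12, x13, x14, x15, x16, x17, x18, x19, x20, x21] (Coord R21 0 0) = x20"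
  "point [x0, x1, x2, x3, x4, x5, x6, x7, x8, x9, x10, x11, x12, x13, x14, x15, x16, x17, x18, x19, x20, x21] (Coord R21 (Suc 0) 0) = x21"
  by (simp_all add: point_def)

definition sep_rep :: "nat \<Rightarrow> 'k::field \<Rightarrow> coord \<Rightarrow> 'k" where
  "sep_rep i t = point ([[1, 0, 1, 0, 0, 0, 0, 0, 1, 0, 0, 0, 0, 0, 0, 0, 0, 0, 0, 0, t, 0],
     [1, 0, 1, 0, 0, 0, 0, 0, 0, 0, 0, 0, 0, 0, 1, 0, 0, 0, 0, 0, t, 0],
     [0, 0, 0, 0, 0, 0, 0, 0, 1, 0, 0, 1, 0, 0, 0, 0, 0, 0, 1, 0, t, 0],
     [0, 0, 0, 0, 0, 0, 0, 0, 1, 0, 0, 0, 0, 0, 0, 0, 1, 0, 0, 1, t, 0],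
     [0, 0, 1, 0, 0, 0, 1, 0, 1, 0, 0, t, 0, 0, 0, 0, 0, 0, 0, 0, 0, 0],
     [0, 0, 1, 0, 0, 0, 1, 0, 1, 0, 0, 0, 0, 0, 0, 0, 0, t, 0, 0, 0, 0],
     [0, 0, 1, 0, 0, 0, 1, 0, 0, 0, 0, 0, 0, 0, 1, 0, 0, t, 0, 0, 0, 0],
     [1, 0, 1, 0, 0, 0, 0, 0, 1, 0, 0, 1, 0, 0, 0, 0, 0, 0, 0, t, 0, 0],
     [1, 0, 1, 0, 0, 0, 0, 0, 1, 0, 0, 1, 0, 0, 0, -1, 0, 0, t, 0, 0, 0],
     [1, 0, 1, 0, 0, 0, 0, 0, 0, 0, 0, 0, 0, t, 1, 0, 0, 1, 0, 0, 0, 0],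
     [0, 0, 0, 0, 0, 0, 0, 0, 1, 0, 0, 1, 0, 0, 0, 0, t, 0, 0, 1, 0, 0],
     [0, 0, 1, 0, 0, 0, 1, 0, 1, 0, 0, 0, 0, 0, 0, 0, t, 0, 0, 0, 1, 0],
     [1, 0, 1, 0, 0, 0, 0, 0, 1, 0, 0, 0, 0, 0, 0, t, 0, 0, 0, 0, 0, 0]] ! i)"

lemma sep_rep_simps:
  "sep_rep 0 t = point [1, 0, 1, 0, 0, 0, 0, 0, 1, 0, 0, 0, 0, 0, 0, 0, 0, 0, 0, 0, t, 0]"
  "sep_rep (Suc 0) t = point [1, 0, 1, 0, 0, 0, 0, 0, 0, 0, 0, 0, 0, 0, 1, 0, 0, 0, 0, 0, t, 0]"
  "sep_rep 2 t = point [0, 0, 0, 0, 0, 0, 0, 0, 1, 0, 0, 1, 0, 0, 0, 0, 0, 0, 1, 0, t, 0]"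
  "sep_rep 3 t = point [0, 0, 0, 0, 0, 0, 0, 0, 1, 0, 0, 0, 0, 0, 0, 0, 1, 0, 0, 1, t, 0]"
  "sep_rep 4 t = point [0, 0, 1, 0, 0, 0, 1, 0, 1, 0, 0, t, 0, 0, 0, 0, 0, 0, 0, 0, 0, 0]"
  "sep_rep 5 t = point [0, 0, 1, 0, 0, 0, 1, 0, 1, 0, 0, 0, 0, 0, 0, 0, 0, t, 0, 0, 0, 0]"
  "sep_rep 6 t = point [0, 0, 1, 0, 0, 0, 1, 0, 0, 0, 0, 0, 0, 0, 1, 0, 0, t, 0, 0, 0, 0]"
  "sep_rep 7 t = point [1, 0, 1, 0, 0, 0, 0, 0, 1, 0, 0, 1, 0, 0, 0, 0, 0, 0, 0, t, 0, 0]"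
  "sep_rep 8 t = point [1, 0, 1, 0, 0, 0, 0, 0, 1, 0, 0, 1, 0, 0, 0, -1, 0, 0, t, 0, 0, 0]"
  "sep_rep 9 t = point [1, 0, 1, 0, 0, 0, 0, 0, 0, 0, 0, 0, 0, t, 1, 0, 0, 1, 0, 0, 0, 0]"
  "sep_rep 10 t = point [0, 0, 0, 0, 0, 0, 0, 0, 1, 0, 0, 1, 0, 0, 0, 0, t, 0, 0, 1, 0, 0]"
  "sep_rep 11 t = point [0, 0, 1, 0, 0, 0, 1, 0, 1, 0, 0, 0, 0, 0, 0, 0, t, 0, 0, 0, 1, 0]"
  "sep_rep 12 t = point [1, 0, 1, 0, 0, 0, 0, 0, 1, 0, 0, 0, 0, 0, 0, t, 0, 0, 0, 0, 0, 0]"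
  by (simp_all add: sep_rep_def)

text \<open>In row 8 two further entries are nonzero, as they must be: the square of generator 8
  equals the product of 7 and 9 minus the product of 12 and 10. They are even in \<open>t\<close>,
  hence equal at 1 and -1.\<close>

definition sep_values :: "'k::field \<Rightarrow> 'k list list" where
  "sep_values t = [[t, 0, 0, 0, 0, 0, 0, 0, 0, 0, 0, 0, 0],
     [0, t, 0, 0, 0, 0, 0, 0, 0, 0, 0, 0, 0],
     [0, 0, t, 0, 0, 0, 0, 0, 0, 0, 0, 0, 0],
     [0, 0, 0, t, 0, 0, 0, 0, 0, 0, 0, 0, 0],
     [0, 0, 0, 0, t, 0, 0, 0, 0, 0, 0, 0, 0],
     [0, 0, 0, 0, 0, t, 0, 0, 0, 0, 0, 0, 0],
     [0, 0, 0, 0, 0, 0, t, 0, 0, 0, 0, 0, 0],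
     [0, 0, 0, 0, 0, 0, 0, t, 0, 0, 0, 0, 0],
     [0, 0, 0, 0, 0, 0, 0, 0, t, 0, t * t, 0, -1],
     [0, 0, 0, 0, 0, 0, 0, 0, 0, -t, 0, 0, 0],
     [0, 0, 0, 0, 0, 0, 0, 0, 0, 0, t, 0, 0],
     [0, 0, 0, 0, 0, 0, 0, 0, 0, 0, 0, t, 0],
     [0, 0, 0, 0, 0, 0, 0, 0, 0, 0, 0, 0, t]]"

lemma sep_values_simps:
  "sep_values t ! 0 = [t, 0, 0, 0, 0, 0, 0, 0, 0, 0, 0, 0, 0]"
  "sep_values t ! (Suc 0) = [0, t, 0, 0, 0, 0, 0, 0, 0, 0, 0, 0, 0]"
  "sep_values t ! 2 = [0, 0, t, 0, 0, 0, 0, 0, 0, 0, 0, 0, 0]"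
  "sep_values t ! 3 = [0, 0, 0, t, 0, 0, 0, 0, 0, 0, 0, 0, 0]"
  "sep_values t ! 4 = [0, 0, 0, 0, t, 0, 0, 0, 0, 0, 0, 0, 0]"
  "sep_values t ! 5 = [0, 0, 0, 0, 0, t, 0, 0, 0, 0, 0, 0, 0]"
  "sep_values t ! 6 = [0, 0, 0, 0, 0, 0, t, 0, 0, 0, 0, 0, 0]"
  "sep_values t ! 7 = [0, 0, 0, 0, 0, 0, 0, t, 0, 0, 0, 0, 0]"
  "sep_values t ! 8 = [0, 0, 0, 0, 0, 0, 0, 0, t, 0, t * t, 0, -1]"
  "sep_values t ! 9 = [0, 0, 0, 0, 0, 0, 0, 0, 0, -t, 0, 0, 0]"
  "sep_values t ! 10 = [0, 0, 0, 0, 0, 0, 0, 0, 0, 0, t, 0, 0]"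
  "sep_values t ! 11 = [0, 0, 0, 0, 0, 0, 0, 0, 0, 0, 0, t, 0]"
  "sep_values t ! 12 = [0, 0, 0, 0, 0, 0, 0, 0, 0, 0, 0, 0, t]"
  by (simp_all add: sep_values_def)

lemma gens_sep_rep:
  assumes "i < 13" shows "gens (sep_rep i t) = sep_values t ! i"
  using assms by (elim less_13E; hypsubst)
    (simp_all only: One_nat_def sep_rep_simps sep_values_simps,
      simp_all add: gens_def gen_defs point_simps)

lemma sep_values_nth:
  assumes "i < 13"
  shows "j \<noteq> i \<Longrightarrow> sep_values (1 :: 'k::field_char_0) ! i ! j = sep_values (-1) ! i ! j"
    "sep_values (1 :: 'k) ! i ! i \<noteq> sep_values (-1) ! i ! i"
proof -
  have one: "(1 :: 'k) \<noteq> -1" by simp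
  show "sep_values (1 :: 'k) ! i ! i \<noteq> sep_values (-1) ! i ! i"
    using assms one one[symmetric] by (elim less_13E; hypsubst) (simp_all only: One_nat_def sep_values_simps, simp_all)
  show "sep_values (1 :: 'k) ! i ! j = sep_values (-1) ! i ! j" if "j \<noteq> i"
  proof -
    have "sep_values (1 :: 'k) ! i = (sep_values (-1) ! i)[i := sep_values 1 ! i ! i]"
      using assms by (elim less_13E; hypsubst) (simp_all only: One_nat_def sep_values_simps, simp_all)
    then show ?thesis using that by (metis nth_list_update_neq)
  qed
qed

text \<open>A polynomial in the other twelve generators takes the same value at
  \<open>sep_rep i 1\<close> and \<open>sep_rep i (-1)\<close>, whereas generator \<open>i\<close>
  does not.\<close>

lemma gen_indecomposable:
  assumes i: "i < 13"
  shows "to_fract (gen i (kvar :: coord \<Rightarrow> 'k::field_char_0 kpoly)) \<notin>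
    k_subalgebra (to_fract ` (\<lambda>j. gen j kvar) ` ({..<13} - {i}))"
proof
  assume "to_fract (gen i (kvar :: coord \<Rightarrow> 'k kpoly)) \<in> k_subalgebra (to_fract ` (\<lambda>j. gen j kvar) ` ({..<13} - {i}))"
  then obtain y where y: "to_fract (gen i (kvar :: coord \<Rightarrow> 'k kpoly)) = to_fract y"
    "pev y \<in> poly_functions (pev ` (\<lambda>j. gen j kvar) ` ({..<13} - {i}))"
    using poly_functions_of_k_subalgebra by blast
  have yi: "pev y = gen i" using y(1) pev_gen[OF i] unfolding to_fract_eq_iff by blast
  have "pev y (sep_rep i 1) = pev y (sep_rep i (-1))"
  proof (rule poly_functions_eq[OF y(2)])
    fix l assume "l \<in> pev ` (\<lambda>j. gen j (kvar :: coord \<Rightarrow> 'k kpoly)) ` ({..<13} - {i})"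
    then obtain j where j: "j < 13" "j \<noteq> i" "l = pev (gen j kvar)" by blast
    show "l (sep_rep i 1) = l (sep_rep i (-1))"
      unfolding j(3) pev_gen[OF j(1)] unfolding gen_def gens_sep_rep[OF i] by (rule sep_values_nth(1)[OF i j(2)])
  qed
  then show False using sep_values_nth(2)[OF i] unfolding yi gen_def gens_sep_rep[OF i] by contradiction
qed

lemma k_subalgebra_mono: "x \<in> k_subalgebra S \<Longrightarrow> S \<subseteq> T \<Longrightarrow> x \<in> k_subalgebra T"
  by (induction rule: k_subalgebra.induct) (auto intro: k_subalgebra.intros)

text \<open>If two generators were equal, one of them would lie in the algebra of the
  others.\<close>

lemma gen_kvar_inj: "inj_on (\<lambda>i. gen i (kvar :: coord \<Rightarrow> 'k::field_char_0 kpoly)) {..<13}"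
proof (rule inj_onI, rule ccontr)
  fix i j assume ij: "i \<in> {..<13}" "j \<in> {..<13}" "gen i (kvar :: coord \<Rightarrow> 'k kpoly) = gen j kvar" "i \<noteq> (j :: nat)"
  then have "to_fract (gen i (kvar :: coord \<Rightarrow> 'k kpoly)) \<in> k_subalgebra (to_fract ` (\<lambda>j. gen j kvar) ` ({..<13} - {i}))"
    by (intro k_subalgebra.gen) auto
  then show False using gen_indecomposable[of i] ij(1) unfolding lessThan_iff by blast
qed

text \<open>A proper subset misses some generator and is contained in the set of the other twelve,
  whose algebra does not contain the missing one.\<close>

theorem gen_polys_minimal:
  "card (to_fract ` (gen_polys :: 'k::field_char_0 kpoly set)) = 13 \<and>
   minimally_generates (to_fract ` (gen_polys :: 'k kpoly set)) (to_fract ` SI)"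
proof (intro conjI)
  have "inj_on to_fract (gen_polys :: 'k kpoly set)" by (auto intro!: inj_onI)
  then show "card (to_fract ` (gen_polys :: 'k kpoly set)) = 13"
    using card_image[OF gen_kvar_inj[where 'k = 'k]] by (simp add: card_image gen_polys_def)
  show "minimally_generates (to_fract ` (gen_polys :: 'k kpoly set)) (to_fract ` SI)"
    unfolding minimally_generates_def
  proof (intro conjI allI impI notI)
    show "k_subalgebra (to_fract ` (gen_polys :: 'k kpoly set)) = to_fract ` SI"
      by (rule SI_eq_subalgebra[symmetric])
  next
    fix T assume T: "T \<subset> to_fract ` (gen_polys :: 'k kpoly set)" and eq: "k_subalgebra T = to_fract ` SI"
    obtain x where "x \<in> to_fract ` gen_polys" "x \<notin> T" using T by blast
    then obtain i where i: "i < 13" "to_fract (gen i kvar) \<notin> T" unfolding gen_polys_def by blast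
    have "T \<subseteq> to_fract ` (\<lambda>j. gen j kvar) ` ({..<13} - {i})"
    proof
      fix x assume x: "x \<in> T"
      then obtain j where j: "j < 13" "x = to_fract (gen j kvar)" using T unfolding gen_polys_def by blast
      then have "j \<in> {..<13} - {i}" using x i(2) by auto
      then show "x \<in> to_fract ` (\<lambda>j. gen j kvar) ` ({..<13} - {i})" unfolding j(2) by (intro imageI)
    qed
    moreover have "to_fract (gen i kvar) \<in> k_subalgebra T"
      unfolding eq using gen_in_SI[OF i(1)] by blast
    ultimately show False using gen_indecomposable[OF i(1)] k_subalgebra_mono by blast
  qed
qed


section \<open>Embedding finitely generated fields into the complex numbers\<close>

definition sub_field :: "'k::field set \<Rightarrow> bool" where
  "sub_field K \<longleftrightarrow> 1 \<in> K \<and> (\<forall>x\<in>K. \<forall>y\<in>K. x - y \<in> K \<and> x * y \<in> K \<and> inverse x \<in> K)"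

text \<open>\<open>\<sigma>\<close> is a total function on which no condition is imposed outside
  \<open>K\<close>; this makes stepwise extension of \<open>K\<close> convenient.\<close>

definition field_emb :: "'k::field set \<Rightarrow> ('k \<Rightarrow> 'l::field) \<Rightarrow> bool" where
  "field_emb K \<sigma> \<longleftrightarrow> sub_field K \<and> \<sigma> 1 = 1 \<and>
     (\<forall>x\<in>K. \<forall>y\<in>K. \<sigma> (x + y) = \<sigma> x + \<sigma> y \<and> \<sigma> (x * y) = \<sigma> x * \<sigma> y)"

lemma sub_fieldD:
  assumes "sub_field K"
  shows "0 \<in> K" "1 \<in> K" "x \<in> K \<Longrightarrow> y \<in> K \<Longrightarrow> x - y \<in> K" "x \<in> K \<Longrightarrow> y \<in> K \<Longrightarrow> x * y \<in> K"
    "x \<in> K \<Longrightarrow> inverse x \<in> K" "x \<in> K \<Longrightarrow> - x \<in> K" "x \<in> K \<Longrightarrow> y \<in> K \<Longrightarrow> x + y \<in> K"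
    "x \<in> K \<Longrightarrow> y \<in> K \<Longrightarrow> x / y \<in> K"
proof -
  show 1: "1 \<in> K" and d: "x \<in> K \<Longrightarrow> y \<in> K \<Longrightarrow> x - y \<in> K" and m: "x \<in> K \<Longrightarrow> y \<in> K \<Longrightarrow> x * y \<in> K"
    and i: "x \<in> K \<Longrightarrow> inverse x \<in> K" for x y using assms by (auto simp: sub_field_def)
  show z: "0 \<in> K" using d[OF 1 1] by simp
  show n: "x \<in> K \<Longrightarrow> - x \<in> K" for x using d[OF z, of x] by simp
  show "x \<in> K \<Longrightarrow> y \<in> K \<Longrightarrow> x + y \<in> K" using d[of x "- y"] n by simp
  show "x \<in> K \<Longrightarrow> y \<in> K \<Longrightarrow> x / y \<in> K" using m i by (simp add: divide_inverse)
qed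

lemma sub_field_sum: "sub_field K \<Longrightarrow> (\<And>i. i \<in> I \<Longrightarrow> f i \<in> K) \<Longrightarrow> (\<Sum>i\<in>I. f i) \<in> K"
  by (induction I rule: infinite_finite_induct) (auto intro: sub_fieldD)

lemma field_embD:
  fixes \<sigma> :: "'k::field \<Rightarrow> 'l::field"
  assumes "field_emb K \<sigma>"
  shows "sub_field K" "\<sigma> 0 = 0" "\<sigma> 1 = 1" "x \<in> K \<Longrightarrow> y \<in> K \<Longrightarrow> \<sigma> (x + y) = \<sigma> x + \<sigma> y"
    "x \<in> K \<Longrightarrow> y \<in> K \<Longrightarrow> \<sigma> (x * y) = \<sigma> x * \<sigma> y" "x \<in> K \<Longrightarrow> \<sigma> (- x) = - \<sigma> x"
    "x \<in> K \<Longrightarrow> y \<in> K \<Longrightarrow> \<sigma> (x - y) = \<sigma> x - \<sigma> y" "x \<in> K \<Longrightarrow> \<sigma> x = 0 \<longleftrightarrow> x = 0"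
proof -
  show K: "sub_field K" and 1: "\<sigma> 1 = 1" and a: "x \<in> K \<Longrightarrow> y \<in> K \<Longrightarrow> \<sigma> (x + y) = \<sigma> x + \<sigma> y"
    and m: "x \<in> K \<Longrightarrow> y \<in> K \<Longrightarrow> \<sigma> (x * y) = \<sigma> x * \<sigma> y" for x y
    using assms by (auto simp: field_emb_def)
  note k = sub_fieldD[OF K]
  show z: "\<sigma> 0 = 0" using a[OF k(1) k(1)] by (metis add_cancel_left_right)
  show n: "x \<in> K \<Longrightarrow> \<sigma> (- x) = - \<sigma> x" for x using a[of x "- x"] k(6)[of x] z by (simp add: eq_neg_iff_add_eq_0 add.commute)
  show "x \<in> K \<Longrightarrow> y \<in> K \<Longrightarrow> \<sigma> (x - y) = \<sigma> x - \<sigma> y" using a[of x "- y"] n[of y] k(6)[of y] by simp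
  show "x \<in> K \<Longrightarrow> \<sigma> x = 0 \<longleftrightarrow> x = 0"
  proof -
    assume x: "x \<in> K"
    have "\<sigma> x \<noteq> 0" if "x \<noteq> 0"
    proof
      assume "\<sigma> x = 0"
      moreover have "\<sigma> (x * inverse x) = \<sigma> x * \<sigma> (inverse x)" using x k(5) by (intro m) auto
      ultimately show False using that 1 by simp
    qed
    then show ?thesis using z by auto
  qed
qed

lemma field_emb_sum:
  assumes "field_emb K \<sigma>" "\<And>i. i \<in> I \<Longrightarrow> f i \<in> K"
  shows "\<sigma> (\<Sum>i\<in>I. f i) = (\<Sum>i\<in>I. \<sigma> (f i))"
  using assms(2)
proof (induction I rule: infinite_finite_induct)
  case (insert i I)
  then show ?case using field_embD(4)[OF assms(1), of "f i" "\<Sum>i\<in>I. f i"]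
      sub_field_sum[OF field_embD(1)[OF assms(1)], of I f] by auto
qed (auto simp: field_embD(2)[OF assms(1)])

section \<open>Polynomials with coefficients in a subfield\<close>

definition polys_over :: "'k::field set \<Rightarrow> 'k poly set" where
  "polys_over K = {p. \<forall>i. coeff p i \<in> K}"

lemma polys_over_closed:
  assumes K: "sub_field K" and pq: "p \<in> polys_over K" "q \<in> polys_over K"
  shows "p + q \<in> polys_over K" "p - q \<in> polys_over K" "p * q \<in> polys_over K"
  using pq sub_fieldD[OF K] by (auto simp: polys_over_def coeff_mult intro!: sub_field_sum[OF K])

lemma polys_over_monom: "sub_field K \<Longrightarrow> c \<in> K \<Longrightarrow> monom c n \<in> polys_over K"
  using sub_fieldD(1) by (auto simp: polys_over_def)

lemma polys_over_const: "sub_field K \<Longrightarrow> c \<in> K \<Longrightarrow> [:c:] \<in> polys_over K"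
  using polys_over_monom[of K c 0] by (simp add: monom_0)

lemma map_poly_emb:
  assumes e: "field_emb K \<sigma>" and pq: "p \<in> polys_over K" "q \<in> polys_over K"
  shows "map_poly \<sigma> (p + q) = map_poly \<sigma> p + map_poly \<sigma> q"
    "map_poly \<sigma> (p - q) = map_poly \<sigma> p - map_poly \<sigma> q"
    "map_poly \<sigma> (p * q) = map_poly \<sigma> p * map_poly \<sigma> q"
    "degree (map_poly \<sigma> p) = degree p" "map_poly \<sigma> p = 0 \<longleftrightarrow> p = 0"
proof -
  note s = field_embD[OF e]
  have c: "coeff p i \<in> K" "coeff q i \<in> K" for i using pq by (auto simp: polys_over_def)
  show "map_poly \<sigma> (p + q) = map_poly \<sigma> p + map_poly \<sigma> q"
    "map_poly \<sigma> (p - q) = map_poly \<sigma> p - map_poly \<sigma> q"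
    by (intro poly_eqI; simp add: coeff_map_poly s c)+
  show "map_poly \<sigma> (p * q) = map_poly \<sigma> p * map_poly \<sigma> q"
    using sub_fieldD(4)[OF s(1)] c
    by (intro poly_eqI) (simp add: coeff_map_poly s coeff_mult field_emb_sum[OF e])
  show "degree (map_poly \<sigma> p) = degree p"
  proof (cases "p = 0")
    case False
    then show ?thesis using s(8)[OF c(1)] by (intro map_poly_degree_eq) (simp add: leading_coeff_0_iff)
  qed (simp add: s)
  show "map_poly \<sigma> p = 0 \<longleftrightarrow> p = 0"
    using s(2) s(8)[OF c(1)] by (auto simp: poly_eq_iff coeff_map_poly)
qed

text \<open>Long division; the point is that the coefficients of quotient and remainder stay in
  \<open>K\<close>.\<close>

lemma polys_over_division:
  assumes K: "sub_field K" and g: "g \<in> polys_over K" "g \<noteq> 0" and f: "f \<in> polys_over K"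
  shows "\<exists>q\<in>polys_over K. \<exists>r\<in>polys_over K. f = q * g + r \<and> (r = 0 \<or> degree r < degree g)"
  using f
proof (induction "degree f" arbitrary: f rule: less_induct)
  case less
  have z: "0 \<in> polys_over K" using polys_over_const[OF K sub_fieldD(1)[OF K]] by simp
  show ?case
  proof (cases "f = 0 \<or> degree f < degree g")
    case True
    then show ?thesis using less.prems z by (intro bexI[of _ 0] bexI[of _ f]) auto
  next
    case False
    then have f0: "f \<noteq> 0" and dg: "degree g \<le> degree f" by auto
    define h where "h = monom (lead_coeff f / lead_coeff g) (degree f - degree g)"
    have h: "h \<in> polys_over K" unfolding h_def
      using less.prems g sub_fieldD(8)[OF K] by (intro polys_over_monom[OF K]) (auto simp: polys_over_def)
    have fh: "f - h * g \<in> polys_over K" using polys_over_closed[OF K] less.prems g h by blast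
    have hd: "degree h = degree f - degree g" "lead_coeff h = lead_coeff f / lead_coeff g" "h \<noteq> 0"
      using f0 g(2) by (auto simp: h_def degree_monom_eq)
    have "degree (h * g) = degree f" using hd g(2) dg by (simp add: degree_mult_eq)
    moreover have "lead_coeff (h * g) = lead_coeff f" unfolding lead_coeff_mult hd(2) using g(2) by simp
    ultimately have "degree (f - h * g) \<le> degree f" "coeff (f - h * g) (degree f) = 0"
      using degree_diff_le[of f "degree f" "h * g"] by auto
    then have "f - h * g = 0 \<or> degree (f - h * g) < degree f" by (rule eq_zero_or_degree_less)
    then show ?thesis
    proof
      assume "f - h * g = 0"
      then show ?thesis using h z by (intro bexI[of _ h] bexI[of _ 0]) auto
    next
      assume "degree (f - h * g) < degree f"
      from less.hyps[OF this fh] obtain q r where "q \<in> polys_over K" "r \<in> polys_over K"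
        "f - h * g = q * g + r" "r = 0 \<or> degree r < degree g" by blast
      then show ?thesis using polys_over_closed(1)[OF K _ h, of q]
        by (intro bexI[of _ "q + h"] bexI[of _ r]) (auto simp: algebra_simps)
    qed
  qed
qed

lemma countable_polys_over: "countable K \<Longrightarrow> countable (polys_over K)"
proof -
  assume "countable K"
  then have "countable (Poly ` lists K)" by (intro countable_image countable_lists)
  moreover have "polys_over K \<subseteq> Poly ` lists K"
  proof
    fix p assume p: "p \<in> polys_over K"
    have "coeffs p \<in> lists K" using p by (auto simp: polys_over_def coeffs_def)
    then show "p \<in> Poly ` lists K" by (metis Poly_coeffs image_eqI)
  qed
  ultimately show ?thesis by (rule countable_subset[rotated])
qed

text \<open>If \<open>a\<close> is algebraic over \<open>K\<close>, take a root of the image of its minimal polynomial; otherwise take a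
  number outside the countable set of roots of polynomials over the image of \<open>K\<close>.\<close>

lemma generic_point:
  fixes \<sigma> :: "'k::field \<Rightarrow> complex"
  assumes e: "field_emb K \<sigma>" and cK: "countable K"
  shows "\<exists>z. \<forall>p\<in>polys_over K. poly (map_poly \<sigma> p) z = 0 \<longleftrightarrow> poly p a = 0"
proof (cases "\<exists>p\<in>polys_over K. p \<noteq> 0 \<and> poly p a = 0")
  case False
  let ?R = "\<Union>p\<in>polys_over K - {0}. {z. poly (map_poly \<sigma> p) z = 0}"
  have "countable ?R"
  proof (rule countable_UN)
    show "countable (polys_over K - {0})" using countable_polys_over[OF cK] by simp
    show "countable {z. poly (map_poly \<sigma> p) z = 0}" if "p \<in> polys_over K - {0}" for p
      using that map_poly_emb(5)[OF e, of p p] by (intro countable_finite poly_roots_finite) auto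
  qed
  then obtain z where z: "z \<notin> ?R" using uncountable_UNIV_complex by (metis UNIV_eq_I)
  show ?thesis
  proof (intro exI[of _ z] ballI)
    fix p assume p: "p \<in> polys_over K"
    show "poly (map_poly \<sigma> p) z = 0 \<longleftrightarrow> poly p a = 0"
      using p z False by (cases "p = 0") auto
  qed
next
  case True
  note K = field_embD(1)[OF e]
  note cl = polys_over_closed[OF K]
  define S where "S = {p\<in>polys_over K. p \<noteq> 0 \<and> poly p a = 0}"
  obtain m where m: "m \<in> S" "\<And>p. p \<in> S \<Longrightarrow> degree m \<le> degree p"
    using True arg_min_nat_lemma[of "\<lambda>p. p \<in> S" _ degree] unfolding S_def by blast
  have mK: "m \<in> polys_over K" "m \<noteq> 0" "poly m a = 0" using m(1) by (auto simp: S_def)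
  have "degree m \<noteq> 0"
  proof
    assume "degree m = 0"
    then obtain c where "m = [:c:]" by (metis degree_eq_zeroE)
    then show False using mK by simp
  qed
  then have "degree (map_poly \<sigma> m) > 0" using map_poly_emb(4)[OF e mK(1) mK(1)] by simp
  then obtain z where z: "poly (map_poly \<sigma> m) z = 0"
    using fundamental_theorem_of_algebra[of "map_poly \<sigma> m"] constant_degree[of "map_poly \<sigma> m"] by auto
  have vanish: "poly (map_poly \<sigma> p) z = 0" if p: "p \<in> polys_over K" "poly p a = 0" for p
  proof -
    obtain q r where qr: "q \<in> polys_over K" "r \<in> polys_over K" "p = q * m + r" "r = 0 \<or> degree r < degree m"
      using polys_over_division[OF K mK(1,2) p(1)] by blast
    have "poly r a = 0" using qr(3) p(2) mK(3) by simp
    then have "r \<noteq> 0 \<Longrightarrow> r \<in> S" using qr(2) by (simp add: S_def)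
    then have "r = 0" using m(2)[of r] qr(4) by fastforce
    then have "map_poly \<sigma> p = map_poly \<sigma> q * map_poly \<sigma> m" using qr map_poly_emb(3)[OF e qr(1) mK(1)] by simp
    then show ?thesis using z by simp
  qed
  have "poly p a = 0" if p: "p \<in> polys_over K" "poly (map_poly \<sigma> p) z = 0" for p
  proof (rule ccontr)
    assume ne: "poly p a \<noteq> 0"
    \<comment> \<open>In place of irreducibility of \<open>m\<close>, a polynomial \<open>t\<close>
      of least degree among those violating the claim is compared with \<open>m\<close> by division,
      in both directions if necessary.\<close>
    define T where "T = {p\<in>polys_over K. poly (map_poly \<sigma> p) z = 0 \<and> poly p a \<noteq> 0}"
    have "p \<in> T" using p ne by (simp add: T_def)
    then obtain t where t: "t \<in> T" "\<And>p. p \<in> T \<Longrightarrow> degree t \<le> degree p"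
      using arg_min_nat_lemma[of "\<lambda>p. p \<in> T" _ degree] by blast
    have tK: "t \<in> polys_over K" "poly (map_poly \<sigma> t) z = 0" "poly t a \<noteq> 0" using t(1) by (auto simp: T_def)
    then have t0: "t \<noteq> 0" by auto
    obtain q r where qr: "q \<in> polys_over K" "r \<in> polys_over K" "m = q * t + r" "r = 0 \<or> degree r < degree t"
      using polys_over_division[OF K tK(1) t0 mK(1)] by blast
    have "map_poly \<sigma> m = map_poly \<sigma> q * map_poly \<sigma> t + map_poly \<sigma> r"
      using qr map_poly_emb[OF e cl(3)[OF qr(1) tK(1)] qr(2)] map_poly_emb(3)[OF e qr(1) tK(1)] by simp
    then have "poly (map_poly \<sigma> r) z = 0" using z tK(2) by simp
    show False
    proof (cases "poly r a = 0")
      case False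
      then have "r \<in> T" using qr(2) \<open>poly (map_poly \<sigma> r) z = 0\<close> by (simp add: T_def)
      then have "r \<noteq> 0" "degree t \<le> degree r" using t(2) False by auto
      then show False using qr(4) by auto
    next
      case True
      have dt: "degree t > 0"
      proof (rule ccontr)
        assume "\<not> degree t > 0"
        then obtain c where c: "t = [:c:]" by (metis degree_eq_zeroE gr0I)
        have "coeff t 0 \<in> K" using tK(1) unfolding polys_over_def by blast
        then have "c \<in> K" using c by simp
        then show False using tK(2,3) c field_embD(8)[OF e, of c] by (simp add: map_poly_pCons[of \<sigma>, OF field_embD(2)[OF e]])
      qed
      have qa: "poly q a = 0" using qr(3) mK(3) True tK(3) by simp
      have "r = 0"
      proof (rule ccontr)
        assume r: "r \<noteq> 0"
        obtain q' r' where qr': "q' \<in> polys_over K" "r' \<in> polys_over K" "t = q' * m + r'" "r' = 0 \<or> degree r' < degree m"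
          using polys_over_division[OF K mK(1,2) tK(1)] by blast
        have "map_poly \<sigma> t = map_poly \<sigma> q' * map_poly \<sigma> m + map_poly \<sigma> r'"
          using qr' map_poly_emb[OF e cl(3)[OF qr'(1) mK(1)] qr'(2)] map_poly_emb(3)[OF e qr'(1) mK(1)] by simp
        then have "poly (map_poly \<sigma> r') z = 0" using z tK(2) by simp
        moreover have "poly r' a \<noteq> 0" using qr'(3) mK(3) tK(3) by simp
        ultimately have "r' \<in> T" "r' \<noteq> 0" using qr'(2) by (auto simp: T_def)
        then have "degree t < degree m" using t(2)[of r'] qr'(4) by auto
        moreover have "r \<in> S" using r True qr(2) by (simp add: S_def)
        ultimately show False using m(2)[of r] qr(4) r by auto
      qed
      then have "m = q * t" using qr(3) by simp
      then have "q \<noteq> 0" "degree q < degree m" using mK(2) t0 dt by (auto simp: degree_mult_eq)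
      moreover have "q \<in> S" using calculation qa qr(1) by (simp add: S_def)
      ultimately show False using m(2)[of q] by simp
    qed
  qed
  then show ?thesis using vanish by blast
qed

text \<open>\<open>K'\<close> consists of the fractions p(a) / q(a), and the extension sends such a
  fraction to the fraction of the transported polynomials at \<open>z\<close>. One direction of
  \<open>generic_point\<close> gives well-definedness, the other keeps denominators nonzero.\<close>

lemma field_emb_extend:
  fixes \<sigma> :: "'k::field \<Rightarrow> complex"
  assumes e: "field_emb K \<sigma>" and cK: "countable K"
  shows "\<exists>K' \<sigma>' :: 'k \<Rightarrow> complex. field_emb K' \<sigma>' \<and> countable K' \<and> insert a K \<subseteq> K'"
proof -
  note K = field_embD(1)[OF e]
  note cl = polys_over_closed[OF K]
  obtain z where z: "\<And>p. p \<in> polys_over K \<Longrightarrow> poly (map_poly \<sigma> p) z = 0 \<longleftrightarrow> poly p a = 0"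
    using generic_point[OF e cK] by blast
  define D where "D = {(p, q). p \<in> polys_over K \<and> q \<in> polys_over K \<and> poly q a \<noteq> 0}"
  define val where "val = (\<lambda>(p, q). poly p a / poly q a)"
  define val' where "val' = (\<lambda>(p, q). poly (map_poly \<sigma> p) z / poly (map_poly \<sigma> q) z)"
  have val_eq: "val' x = val' y" if "x \<in> D" "y \<in> D" "val x = val y" for x y
  proof -
    obtain p q r s where xy: "x = (p, q)" "y = (r, s)" by (metis surj_pair)
    have D: "p \<in> polys_over K" "q \<in> polys_over K" "poly q a \<noteq> 0" "r \<in> polys_over K" "s \<in> polys_over K" "poly s a \<noteq> 0"
      using that by (auto simp: D_def xy)
    have "poly p a / poly q a = poly r a / poly s a" using that(3) by (simp add: val_def xy)
    then have "poly (p * s - r * q) a = 0" using frac_eq_eq[OF D(3,6)] by simp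
    moreover have "p * s - r * q \<in> polys_over K" by (intro cl D)
    ultimately have "poly (map_poly \<sigma> (p * s - r * q)) z = 0" using z by blast
    then have "poly (map_poly \<sigma> p) z * poly (map_poly \<sigma> s) z = poly (map_poly \<sigma> r) z * poly (map_poly \<sigma> q) z"
      using D by (simp add: map_poly_emb(2)[OF e cl(3) cl(3)] map_poly_emb(3)[OF e])
    moreover have "poly (map_poly \<sigma> q) z \<noteq> 0" "poly (map_poly \<sigma> s) z \<noteq> 0" using z D by auto
    ultimately show ?thesis by (simp add: val'_def xy frac_eq_eq)
  qed
  define \<sigma>' where "\<sigma>' w = val' (SOME x. x \<in> D \<and> val x = w)" for w
  have \<sigma>': "\<sigma>' (val x) = val' x" if "x \<in> D" for x
  proof -
    have "(SOME y. y \<in> D \<and> val y = val x) \<in> D \<and> val (SOME y. y \<in> D \<and> val y = val x) = val x"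
      by (rule someI[of _ x]) (use that in simp)
    then show ?thesis unfolding \<sigma>'_def using val_eq that by blast
  qed
  define K' where "K' = val ` D"
  have one: "[:1:] \<in> polys_over K" "[:0:] \<in> polys_over K"
    using polys_over_const[OF K] sub_fieldD[OF K] by blast+
  have m1: "map_poly \<sigma> [:1:] = [:1:]" using field_embD(2,3)[OF e] by (simp add: map_poly_pCons)
  have mm: "map_poly \<sigma> (p * q) = map_poly \<sigma> p * map_poly \<sigma> q" "map_poly \<sigma> (p + q) = map_poly \<sigma> p + map_poly \<sigma> q"
    if "p \<in> polys_over K" "q \<in> polys_over K" for p q using map_poly_emb[OF e that] by auto
  have ops: "\<exists>v\<in>D. val v = val x + val y \<and> val' v = val' x + val' y" "\<exists>v\<in>D. val v = val x * val y \<and> val' v = val' x * val' y"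
    "\<exists>v\<in>D. val v = - val x" "\<exists>v\<in>D. val v = inverse (val x)"
    if "x \<in> D" "y \<in> D" for x y
  proof -
    obtain p q r s where xy: "x = (p, q)" "y = (r, s)" by (metis surj_pair)
    have D: "p \<in> polys_over K" "q \<in> polys_over K" "poly q a \<noteq> 0" "r \<in> polys_over K" "s \<in> polys_over K" "poly s a \<noteq> 0"
      using that by (auto simp: D_def xy)
    have nz: "poly (map_poly \<sigma> q) z \<noteq> 0" "poly (map_poly \<sigma> s) z \<noteq> 0" using z D by auto
    show "\<exists>v\<in>D. val v = val x + val y \<and> val' v = val' x + val' y"
      by (rule bexI[of _ "(p * s + r * q, q * s)"])
        (use D nz cl in \<open>auto simp: D_def val_def val'_def xy mm add_frac_eq\<close>)
    show "\<exists>v\<in>D. val v = val x * val y \<and> val' v = val' x * val' y"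
      by (rule bexI[of _ "(p * r, q * s)"])
        (use D nz cl in \<open>auto simp: D_def val_def val'_def xy mm\<close>)
    have "0 - p \<in> polys_over K" using cl(2)[OF one(2) D(1)] by simp
    then show "\<exists>v\<in>D. val v = - val x"
      by (intro bexI[of _ "(- p, q)"]) (use D in \<open>auto simp: D_def val_def xy\<close>)
    \<comment> \<open>As \<open>inverse 0 = 0\<close>, a fraction with value 0 is represented by 0 /
      1 instead of being turned upside down.\<close>
    show "\<exists>v\<in>D. val v = inverse (val x)"
      by (rule bexI[of _ "if poly p a = 0 then ([:0:], [:1:]) else (q, p)"])
        (use D one in \<open>auto simp: D_def val_def xy\<close>)
  qed
  have oneD: "([:1:], [:1:]) \<in> D" using one by (auto simp: D_def)
  have one': "val ([:1:], [:1:]) = 1" "val' ([:1:], [:1:]) = 1" by (auto simp: val_def val'_def m1)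
  have "field_emb K' \<sigma>'" unfolding field_emb_def sub_field_def
  proof (intro conjI ballI)
    show "1 \<in> K'" using oneD one' by (force simp: K'_def)
    show "\<sigma>' 1 = 1" using \<sigma>'[OF oneD] one' by simp
  next
    fix u v assume "u \<in> K'" "v \<in> K'"
    then obtain x y where xy: "x \<in> D" "y \<in> D" "u = val x" "v = val y" by (auto simp: K'_def)
    obtain y' where y': "y' \<in> D" "val y' = - val y" using ops(3)[OF xy(2,2)] by blast
    show "u - v \<in> K'" using ops(1)[OF xy(1) y'(1)] y'(2) xy by (force simp: K'_def)
    show "u * v \<in> K'" using ops(2)[OF xy(1,2)] xy by (force simp: K'_def)
    show "inverse u \<in> K'" using ops(4)[OF xy(1,2)] xy by (force simp: K'_def)
    show "\<sigma>' (u + v) = \<sigma>' u + \<sigma>' v" using ops(1)[OF xy(1,2)] xy \<sigma>' by metis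
    show "\<sigma>' (u * v) = \<sigma>' u * \<sigma>' v" using ops(2)[OF xy(1,2)] xy \<sigma>' by metis
  qed
  moreover have "countable K'" unfolding K'_def
  proof (rule countable_image, rule countable_subset)
    show "D \<subseteq> polys_over K \<times> polys_over K" by (auto simp: D_def)
    show "countable (polys_over K \<times> polys_over K)" using countable_polys_over[OF cK] by auto
  qed
  moreover have "a \<in> K'"
  proof -
    have "[:0, 1:] \<in> polys_over K" using polys_over_monom[OF K sub_fieldD(2)[OF K], of 1] by (simp add: monom_altdef)
    then have "([:0, 1:], [:1:]) \<in> D" using one by (auto simp: D_def)
    then show ?thesis by (force simp: K'_def val_def)
  qed
  moreover have "K \<subseteq> K'"
  proof
    fix c assume "c \<in> K"
    then have "([:c:], [:1:]) \<in> D" using one polys_over_const[OF K] by (auto simp: D_def)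
    then show "c \<in> K'" by (force simp: K'_def val_def)
  qed
  ultimately show ?thesis by blast
qed

text \<open>Both fields have characteristic zero and contain the rationals; this countable field
  starts the adjunction of elements.\<close>

lemma field_emb_Rats:
  "field_emb (range of_rat :: 'k::field_char_0 set) (\<lambda>x. of_rat (inv_into UNIV of_rat x) :: 'l::field_char_0)"
proof -
  have i: "inv_into UNIV of_rat (of_rat q :: 'k) = q" for q by (rule inv_f_f) (auto intro: injI)
  have c: "x - y \<in> range of_rat" "x * y \<in> range of_rat" "inverse x \<in> range of_rat"
    if "x \<in> range of_rat" "y \<in> range of_rat" for x y :: 'k
    using that by (auto simp flip: of_rat_diff of_rat_mult of_rat_inverse)
  have o: "1 \<in> (range of_rat :: 'k set)" by (rule image_eqI[of _ _ 1]) auto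
  have o': "of_rat (inv_into UNIV of_rat (1 :: 'k)) = (1 :: 'l)" using i[of 1] by simp
  have h: "of_rat (inv_into UNIV of_rat (x + y)) = (of_rat (inv_into UNIV of_rat x) + of_rat (inv_into UNIV of_rat y) :: 'l)"
    "of_rat (inv_into UNIV of_rat (x * y)) = (of_rat (inv_into UNIV of_rat x) * of_rat (inv_into UNIV of_rat y) :: 'l)"
    if "x \<in> range of_rat" "y \<in> range of_rat" for x y :: 'k
  proof -
    obtain q r where qr: "x = of_rat q" "y = of_rat r" using \<open>x \<in> _\<close> \<open>y \<in> _\<close> by blast
    have "x + y = of_rat (q + r)" "x * y = of_rat (q * r)" by (simp_all only: qr of_rat_add of_rat_mult)
    then show "of_rat (inv_into UNIV of_rat (x + y)) = (of_rat (inv_into UNIV of_rat x) + of_rat (inv_into UNIV of_rat y) :: 'l)"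
      "of_rat (inv_into UNIV of_rat (x * y)) = (of_rat (inv_into UNIV of_rat x) * of_rat (inv_into UNIV of_rat y) :: 'l)"
      unfolding \<open>x + y = _\<close> \<open>x * y = _\<close> i by (simp_all only: qr i of_rat_add of_rat_mult)
  qed
  show ?thesis unfolding field_emb_def sub_field_def
    by (intro conjI ballI o o' c h; assumption)
qed

text \<open>Elements are adjoined one at a time. Countability is carried along because a
  transcendental element needs an image outside a countable set of roots.\<close>

lemma field_emb_exists:
  assumes "finite A"
  shows "\<exists>K (\<sigma> :: 'k::field_char_0 \<Rightarrow> complex). field_emb K \<sigma> \<and> countable K \<and> A \<subseteq> K"
  using assms
proof induction
  case empty
  show ?case
    by (intro exI conjI, rule field_emb_Rats) auto
next
  case (insert a A)
  then obtain K and \<sigma> :: "'k \<Rightarrow> complex" where "field_emb K \<sigma>" "countable K" "A \<subseteq> K" by blast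
  then show ?case using field_emb_extend[of K \<sigma> a] by blast
qed

section \<open>Comparison with subfields and ring homomorphisms of algebraic structures\<close>

lemma subfield_class_ring:
  assumes K: "sub_field K"
  shows "subfield K (class_ring :: 'k::field ring)"
proof -
  interpret f: field "class_ring :: 'k ring" by (rule class_field)
  have mon: "Group.monoid (class_ring :: 'k ring)" and ab: "abelian_group (class_ring :: 'k ring)"
    and rg: "ring (class_ring :: 'k ring)" by unfold_locales
  have inv: "inv\<^bsub>class_ring\<^esub> x = inverse x" if "x \<noteq> 0" for x :: 'k
    by (rule Group.monoid.inv_unique'[OF mon, symmetric]) (use that in auto)
  have am: "\<ominus>\<^bsub>class_ring\<^esub> x = - x" for x :: 'k
    by (rule abelian_group.minus_equality[OF ab]) auto
  show ?thesis
  proof (rule field.subfieldI'[OF class_field])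
    show "subring K (class_ring :: 'k ring)"
      by (rule ring.subringI[OF rg]) (use sub_fieldD[OF K] in \<open>auto simp: am\<close>)
    show "inv\<^bsub>class_ring\<^esub> k \<in> K" if "k \<in> K - {\<zero>\<^bsub>class_ring\<^esub>}" for k :: 'k
      using that sub_fieldD(5)[OF K, of k] by (auto simp: inv)
  qed
qed

lemma sub_field_of_subfield:
  assumes "subfield K (class_ring :: 'k::field ring)"
  shows "sub_field K"
proof -
  interpret f: field "class_ring :: 'k ring" by (rule class_field)
  have mon: "Group.monoid (class_ring :: 'k ring)" and ab: "abelian_group (class_ring :: 'k ring)"
    and rg: "ring (class_ring :: 'k ring)" by unfold_locales
  have inv: "inv\<^bsub>class_ring\<^esub> x = inverse x" if "x \<noteq> 0" for x :: 'k
    by (rule Group.monoid.inv_unique'[OF mon, symmetric]) (use that in auto)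
  have am: "\<ominus>\<^bsub>class_ring\<^esub> x = - x" for x :: 'k
    by (rule abelian_group.minus_equality[OF ab]) auto
  note s = subringE[OF subfieldE(1)[OF assms]]
  have z: "0 \<in> K" "1 \<in> K" using s(2,3) by auto
  have n: "- x \<in> K" if "x \<in> K" for x using s(5)[OF that] am by simp
  have "x - y \<in> K" "x * y \<in> K" if "x \<in> K" "y \<in> K" for x y
    using s(6)[OF that] s(7)[OF that(1) n[OF that(2)]] by auto
  moreover have "inverse x \<in> K" if "x \<in> K" for x
  proof (cases "x = 0")
    case True
    then show ?thesis using z by simp
  next
    case False
    then have "x \<in> K - {\<zero>\<^bsub>class_ring\<^esub>}" using that by simp
    then have "inv\<^bsub>class_ring\<^esub> x \<in> K" using ring.subfield_m_inv(1)[OF rg assms] by blast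
    then show ?thesis using inv False by simp
  qed
  ultimately show ?thesis using z by (auto simp: sub_field_def)
qed

lemma ring_hom_field_emb:
  assumes "sub_field K"
  shows "\<sigma> \<in> Ring.ring_hom (class_ring \<lparr>carrier := K\<rparr>) (class_ring :: 'l::field ring) \<longleftrightarrow> field_emb K \<sigma>"
  using assms by (auto simp: Ring.ring_hom_def field_emb_def)


section \<open>Euler characteristics of small spaces\<close>

text \<open>The identity element satisfies a relation with exponent 1, so the empty set is the only
  independent one.\<close>

lemma abelian_rank_trivial:
  assumes "trivial_group G" "comm_group G"
  shows "abelian_rank G = 0"
proof -
  interpret comm_group G by fact
  have c: "carrier G = {\<one>\<^bsub>G\<^esub>}" using assms(1) by (simp add: trivial_group_def)
  have "S = {}" if "S \<subseteq> carrier G"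
    "\<forall>c :: 'a \<Rightarrow> int. finprod G (\<lambda>x. x [^]\<^bsub>G\<^esub> c x) S = \<one>\<^bsub>G\<^esub> \<longrightarrow> (\<forall>x\<in>S. c x = 0)" for S
  proof (rule ccontr)
    assume "S \<noteq> {}"
    then have "S = {\<one>\<^bsub>G\<^esub>}" using that(1) c by auto
    then show False using that(2)[rule_format, of "\<lambda>_. 1"] by auto
  qed
  then have "(\<exists>S. finite S \<and> S \<subseteq> carrier G \<and> card S = n \<and>
     (\<forall>c :: 'a \<Rightarrow> int. finprod G (\<lambda>x. x [^]\<^bsub>G\<^esub> c x) S = \<one>\<^bsub>G\<^esub> \<longrightarrow> (\<forall>x\<in>S. c x = 0))) \<longleftrightarrow> n = 0" for n
    by (auto intro: exI[of _ "{}"])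
  then show ?thesis unfolding abelian_rank_def by (auto intro: Greatest_equality)
qed

lemma finprod_two:
  assumes "comm_group G" "x \<noteq> y" "f x \<in> carrier G" "f y \<in> carrier G"
  shows "finprod G f {x, y} = f x \<otimes>\<^bsub>G\<^esub> f y"
proof -
  interpret comm_group G by fact
  show ?thesis using assms by (subst finprod_insert) auto
qed

text \<open>A generator is independent, while any two elements \<open>x\<close>, \<open>y\<close>
  satisfy the relation with exponents \<open>h y\<close> and \<open>- h x\<close>.\<close>

lemma abelian_rank_infinite_cyclic:
  assumes G: "comm_group G" and iso: "G \<cong> integer_group"
  shows "abelian_rank G = 1"
proof -
  interpret comm_group G by fact
  obtain h where h: "h \<in> iso G integer_group" using iso by (auto simp: is_iso_def)
  have hb: "bij_betw h (carrier G) UNIV" and hm: "\<And>x y. x \<in> carrier G \<Longrightarrow> y \<in> carrier G \<Longrightarrow> h (x \<otimes>\<^bsub>G\<^esub> y) = h x + h y"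
    using h by (auto simp: iso_def hom_def integer_group_def)
  interpret gh: group_hom G integer_group h
    using h by (intro group_hom.intro group_hom_axioms.intro group_integer_group is_group) (simp add: iso_def)
  have hp: "h (x [^]\<^bsub>G\<^esub> (n :: int)) = n * h x" if "x \<in> carrier G" for x n
    using gh.hom_int_pow[OF that, of n] by simp
  have h1: "h x = 0 \<longleftrightarrow> x = \<one>\<^bsub>G\<^esub>" if "x \<in> carrier G" for x
    using gh.hom_one inj_onD[OF bij_betw_imp_inj_on[OF hb], of x "\<one>\<^bsub>G\<^esub>"] that by auto
  define P where "P n \<longleftrightarrow> (\<exists>S. finite S \<and> S \<subseteq> carrier G \<and> card S = n \<and>
     (\<forall>c :: 'a \<Rightarrow> int. finprod G (\<lambda>x. x [^]\<^bsub>G\<^esub> c x) S = \<one>\<^bsub>G\<^esub> \<longrightarrow> (\<forall>x\<in>S. c x = 0)))" for n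
  have "P 1"
  proof -
    obtain g where g: "g \<in> carrier G" "h g = 1" using hb by (metis UNIV_I bij_betw_iff_bijections)
    have "c g = 0" if c: "finprod G (\<lambda>x. x [^]\<^bsub>G\<^esub> c x) {g} = \<one>\<^bsub>G\<^esub>" for c :: "'a \<Rightarrow> int"
    proof -
      have "finprod G (\<lambda>x. x [^]\<^bsub>G\<^esub> c x) {g} = g [^]\<^bsub>G\<^esub> c g"
        using g by (subst finprod_insert) auto
      then have "h (g [^]\<^bsub>G\<^esub> c g) = 0" using c h1[OF one_closed] by simp
      then show ?thesis using hp[OF g(1)] g(2) by simp
    qed
    then show ?thesis using g unfolding P_def by (intro exI[of _ "{g}"]) auto
  qed
  moreover have "n \<le> 1" if "P n" for n
  proof (rule ccontr)
    assume "\<not> n \<le> 1"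
    from that[unfolded P_def] obtain S where S': "finite S \<and> S \<subseteq> carrier G \<and> card S = n \<and>
     (\<forall>c :: 'a \<Rightarrow> int. finprod G (\<lambda>x. x [^]\<^bsub>G\<^esub> c x) S = \<one>\<^bsub>G\<^esub> \<longrightarrow> (\<forall>x\<in>S. c x = 0))" ..
    then have S: "finite S" "S \<subseteq> carrier G" "card S = n" by auto
    have Sc: "\<forall>x\<in>S. c x = 0" if "finprod G (\<lambda>x. x [^]\<^bsub>G\<^esub> c x) S = \<one>\<^bsub>G\<^esub>" for c :: "'a \<Rightarrow> int"
      using S' that by simp
    have "\<not> card S \<le> Suc 0" using S(3) \<open>\<not> n \<le> 1\<close> by simp
    then obtain x y where x: "x \<in> S" and y: "y \<in> S" "y \<noteq> x"
      using card_le_Suc0_iff_eq[OF S(1)] by blast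
    \<comment> \<open>If \<open>h x = 0\<close>, the exponents \<open>h y\<close> and
      \<open>- h x\<close> could both vanish; then \<open>x\<close> alone with exponent 1 is a
      nontrivial relation.\<close>
    define c where "c u = (if h x = 0 then of_bool (u = x) else if u = x then h y else if u = y then - h x else 0)" for u
    have xc: "x \<in> carrier G" "y \<in> carrier G" using x y S(2) by auto
    have "finprod G (\<lambda>u. u [^]\<^bsub>G\<^esub> c u) S = finprod G (\<lambda>u. u [^]\<^bsub>G\<^esub> c u) {x, y}"
      using S(1,2) x y by (intro finprod_mono_neutral_cong_right) (auto simp: c_def)
    also have "\<dots> = x [^]\<^bsub>G\<^esub> c x \<otimes>\<^bsub>G\<^esub> y [^]\<^bsub>G\<^esub> c y"
      using xc y by (intro finprod_two[OF G]) auto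
    also have "\<dots> = \<one>\<^bsub>G\<^esub>"
    proof -
      have "h (x [^]\<^bsub>G\<^esub> c x \<otimes>\<^bsub>G\<^esub> y [^]\<^bsub>G\<^esub> c y) = 0"
        using xc y by (simp add: hm hp c_def)
      then show ?thesis using h1 xc by (metis int_pow_closed m_closed)
    qed
    finally have "\<forall>u\<in>S. c u = 0" by (rule Sc)
    then have "c x = 0" "c y = 0" using x y by blast+
    then show False using y by (auto simp: c_def split: if_splits)
  qed
  ultimately have "(GREATEST n. P n) = 1" by (intro Greatest_equality) auto
  then show ?thesis unfolding abelian_rank_def P_def .
qed

lemma euler_char_empty:
  assumes "topspace X = {}" shows "euler_char X = 0"
  unfolding euler_char_def
  using abelian_rank_trivial[OF trivial_homology_group_empty[OF assms] abelian_homology_group] by simp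

text \<open>A point has the integers as homology in degree 0 and trivial homology in all other
  degrees.\<close>

lemma euler_char_singleton:
  assumes "topspace X = {a}" shows "euler_char X = 1"
proof -
  have "abelian_rank (homology_group (int p) X) = of_bool (p = 0)" for p
    using abelian_rank_trivial[OF homology_dimension_axiom[OF assms, of "int p"] abelian_homology_group]
      abelian_rank_infinite_cyclic[OF abelian_homology_group homology_coefficients[OF assms]] by (cases "p = 0") auto
  note r = this
  have "{p. abelian_rank (homology_group (int p) X) \<noteq> 0} = {0}" by (simp add: r)
  then show ?thesis using r[of 0] by (simp add: euler_char_def)
qed

text \<open>Existence for the definite description comes from embedding a field containing the
  finitely many matrix entries; uniqueness needs the value for every embedding, hence the form of
  \<open>const\<close>.\<close>

lemma quot_grass_euler_eq:
  fixes M :: "'a \<Rightarrow> 'k::field_char_0 mat"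
  assumes arcs: "finite (arcs Q)"
    and const: "\<And>K (\<sigma> :: 'k \<Rightarrow> complex). field_emb K \<sigma> \<Longrightarrow> \<forall>a\<in>arcs Q. elements_mat (M a) \<subseteq> K \<Longrightarrow>
      euler_char (quot_grass_top Q d (\<lambda>a. map_mat \<sigma> (M a)) e) = n"
  shows "quot_grass_euler Q d M e = n"
proof -
  have fin: "finite (\<Union>a\<in>arcs Q. elements_mat (M a))"
    using arcs by (auto simp: elements_mat_def)
  obtain K and \<sigma> :: "'k \<Rightarrow> complex" where K: "field_emb K \<sigma>" "(\<Union>a\<in>arcs Q. elements_mat (M a)) \<subseteq> K"
    using field_emb_exists[OF fin] by blast
  have sK: "sub_field K" using field_embD(1)[OF K(1)] .
  show ?thesis unfolding quot_grass_euler_def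
  proof (rule the_equality)
    show "\<exists>K \<sigma>. subfield K class_ring \<and> (\<forall>a \<in> arcs Q. elements_mat (M a) \<subseteq> K) \<and>
     \<sigma> \<in> Ring.ring_hom (class_ring \<lparr>carrier := K\<rparr>) (class_ring :: complex ring) \<and>
     n = euler_char (quot_grass_top Q d (\<lambda>a. map_mat \<sigma> (M a)) e)"
      using K subfield_class_ring[OF sK] ring_hom_field_emb[OF sK, of \<sigma>] const[OF K(1)]
      by (intro exI[of _ K] exI[of _ \<sigma>]) auto
  next
    fix m assume "\<exists>K \<sigma>. subfield K class_ring \<and> (\<forall>a \<in> arcs Q. elements_mat (M a) \<subseteq> K) \<and>
     \<sigma> \<in> Ring.ring_hom (class_ring \<lparr>carrier := K\<rparr>) (class_ring :: complex ring) \<and>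
     m = euler_char (quot_grass_top Q d (\<lambda>a. map_mat \<sigma> (M a)) e)"
    then obtain L and \<tau> :: "'k \<Rightarrow> complex" where L: "subfield L class_ring" "\<forall>a \<in> arcs Q. elements_mat (M a) \<subseteq> L"
     "\<tau> \<in> Ring.ring_hom (class_ring \<lparr>carrier := L\<rparr>) (class_ring :: complex ring)"
     "m = euler_char (quot_grass_top Q d (\<lambda>a. map_mat \<tau> (M a)) e)" by blast
    have "field_emb L \<tau>" using ring_hom_field_emb[OF sub_field_of_subfield[OF L(1)]] L(3) by blast
    then show "m = n" using const L(2,4) by blast
  qed
qed

lemma topspace_quot_grass_top: "topspace (quot_grass_top Q d M e) = quot_grass Q d M e"
  by (simp add: quot_grass_top_def topspace_pullback_topology)


section \<open>The Jacobian algebra\<close>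

abbreviation CP :: "(nat, darc, 'k::field) series ring" where
  "CP \<equiv> cpath_alg Delta"

lemma Delta_simps [simp]:
  "verts Delta = {1..8}" "tail Delta = dtail" "head Delta = dhead"
  by (simp_all add: Delta_def)

lemma arcs_Delta:
  "arcs Delta = {Cplus, Cminus, Arr 1 3, Arr 1 4, Arr 3 2, Arr 4 2, Arr 5 1, Arr 2 6, Arr 6 3, Arr 6 4,
       Arr 3 5, Arr 4 5, Arr 7 3, Arr 3 8, Arr 8 7, Arr 5 7, Arr 8 6}"
  by (simp_all add: Delta_def)

lemma dhead_verts: "a \<in> arcs Delta \<Longrightarrow> dhead a \<in> {1..8}" and dtail_verts: "a \<in> arcs Delta \<Longrightarrow> dtail a \<in> {1..8}"
  by (auto simp: arcs_Delta)

section \<open>Paths and the ring structure of the completed path algebra\<close>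

lemma awalk_verts_ne: "pre_digraph.awalk_verts Q u w \<noteq> []"
  by (cases w) (simp_all add: pre_digraph.awalk_verts.simps)

lemma pend_Nil [simp]: "pend Q u [] = u"
  by (simp add: pend_def pre_digraph.awalk_verts.simps)

lemma pend_Cons [simp]: "pend Q u (a # w) = pend Q (head Q a) w"
  by (simp add: pend_def pre_digraph.awalk_verts.simps awalk_verts_ne)

lemma pend_append: "pend Q u (w @ w') = pend Q (pend Q u w) w'"
  by (induction w arbitrary: u) simp_all

lemma qpaths_Nil: "(u, []) \<in> qpaths Delta \<longleftrightarrow> u \<in> {1..8}"
  by (auto simp: qpaths_def pre_digraph.awalk_def pre_digraph.cas.simps)

lemma qpaths_Cons:
  "(u, a # w) \<in> qpaths Delta \<longleftrightarrow> a \<in> arcs Delta \<and> u = dtail a \<and> (dhead a, w) \<in> qpaths Delta"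
  using dhead_verts[of a] dtail_verts[of a]
  by (auto simp: qpaths_def pre_digraph.awalk_def pre_digraph.cas.simps)

lemma qpaths_append:
  "(u, w @ w') \<in> qpaths Delta \<longleftrightarrow> (u, w) \<in> qpaths Delta \<and> (pend Delta u w, w') \<in> qpaths Delta"
proof (induction w arbitrary: u)
  case Nil
  show ?case by (cases w') (use dtail_verts in \<open>auto simp: qpaths_Nil qpaths_Cons\<close>)
next
  case (Cons a w)
  then show ?case by (simp add: qpaths_Cons)
qed

lemma carrier_CP: "f \<in> carrier CP \<longleftrightarrow> (\<forall>p. p \<notin> qpaths Delta \<longrightarrow> f p = 0)"
  by (simp add: cpath_alg_def)

lemma mult_CP: "(f \<otimes>\<^bsub>CP\<^esub> g) (u, w) = (\<Sum>i\<le>length w. f (u, take i w) * g (pend Delta u (take i w), drop i w))"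
  by (simp add: cpath_alg_def)

lemma add_CP: "(f \<oplus>\<^bsub>CP\<^esub> g) p = f p + g p" and zero_CP: "\<zero>\<^bsub>CP\<^esub> = (\<lambda>p. 0)"
  by (simp_all add: cpath_alg_def)

lemma one_CP: "\<one>\<^bsub>CP\<^esub> (u, w) = of_bool (u \<in> {1..8} \<and> w = [])"
  by (simp add: cpath_alg_def)

lemma mult_CP_closed:
  assumes "f \<in> carrier CP" "g \<in> carrier CP"
  shows "f \<otimes>\<^bsub>CP\<^esub> g \<in> carrier CP"
  unfolding carrier_CP
proof (intro allI impI)
  fix p :: "nat \<times> darc list" assume p: "p \<notin> qpaths Delta"
  obtain u w where uw: "p = (u, w)" by (cases p)
  have "f (u, take i w) * g (pend Delta u (take i w), drop i w) = 0" for i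
    using p qpaths_append[of u "take i w" "drop i w"] assms by (auto simp: uw carrier_CP)
  then show "(f \<otimes>\<^bsub>CP\<^esub> g) p = 0" by (simp add: uw mult_CP)
qed

text \<open>Both sides sum over the ways of cutting one finite word into three pieces, so no
  question of convergence arises.\<close>

lemma mult_CP_assoc: "(f \<otimes>\<^bsub>CP\<^esub> g) \<otimes>\<^bsub>CP\<^esub> h = f \<otimes>\<^bsub>CP\<^esub> (g \<otimes>\<^bsub>CP\<^esub> h)"
proof
  fix p :: "nat \<times> darc list"
  obtain u w where uw: "p = (u, w)" by (cases p)
  let ?n = "length w"
  let ?T = "\<lambda>i j. f (u, take j w) * g (pend Delta u (take j w), drop j (take i w)) * h (pend Delta u (take i w), drop i w)"
  have "((f \<otimes>\<^bsub>CP\<^esub> g) \<otimes>\<^bsub>CP\<^esub> h) p = (\<Sum>i\<le>?n. \<Sum>j\<le>i. ?T i j)"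
    by (auto simp: uw mult_CP sum_distrib_right min_def intro!: sum.cong)
  also have "\<dots> = (\<Sum>j\<le>?n. \<Sum>i\<in>{j..?n}. ?T i j)"
    by (subst sum.Sigma, simp, simp, subst sum.Sigma, simp, simp)
      (rule sum.reindex_bij_witness[of _ "\<lambda>(j, i). (i, j)" "\<lambda>(i, j). (j, i)"], auto)
  also have "\<dots> = (\<Sum>j\<le>?n. \<Sum>i\<le>?n - j. ?T (i + j) j)"
  proof (rule sum.cong[OF refl])
    fix j assume "j \<in> {..?n}"
    then show "(\<Sum>i\<in>{j..?n}. ?T i j) = (\<Sum>i\<le>?n - j. ?T (i + j) j)"
      by (intro sum.reindex_bij_witness[of _ "\<lambda>i. i + j" "\<lambda>i. i - j"]) auto
  qed
  also have "\<dots> = (f \<otimes>\<^bsub>CP\<^esub> (g \<otimes>\<^bsub>CP\<^esub> h)) p"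
  proof -
    have "take (i + j) w = take j w @ take i (drop j w)" for i j by (metis add.commute take_add)
    then have "drop j (take (i + j) w) = take i (drop j w)" "pend Delta u (take (i + j) w) = pend Delta (pend Delta u (take j w)) (take i (drop j w))"
      "drop (i + j) w = drop i (drop j w)" if "j \<le> ?n" for i j
      using that by (auto simp: pend_append drop_take)
    then show ?thesis
      by (auto simp: uw mult_CP sum_distrib_left mult.assoc intro!: sum.cong)
  qed
  finally show "((f \<otimes>\<^bsub>CP\<^esub> g) \<otimes>\<^bsub>CP\<^esub> h) p = (f \<otimes>\<^bsub>CP\<^esub> (g \<otimes>\<^bsub>CP\<^esub> h)) p" .
qed

lemma one_CP_mult:
  assumes f: "f \<in> carrier CP"
  shows "\<one>\<^bsub>CP\<^esub> \<otimes>\<^bsub>CP\<^esub> f = f" "f \<otimes>\<^bsub>CP\<^esub> \<one>\<^bsub>CP\<^esub> = f"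
proof -
  have v: "u \<in> {1..8}" "pend Delta u w \<in> {1..8}" if "(u, w) \<in> qpaths Delta" for u w
    using that qpaths_append[of u "[]" w] qpaths_append[of u w "[]"] qpaths_Nil by auto
  have "(\<one>\<^bsub>CP\<^esub> \<otimes>\<^bsub>CP\<^esub> f) (u, w) = f (u, w)" for u w
  proof -
    have "(\<one>\<^bsub>CP\<^esub> \<otimes>\<^bsub>CP\<^esub> f) (u, w) = (\<Sum>i\<le>length w. if i = 0 then of_bool (u \<in> {1..8}) * f (u, w) else 0)"
      unfolding mult_CP by (intro sum.cong) (auto simp: one_CP)
    also have "\<dots> = f (u, w)" using v(1)[of u w] f by (cases "(u, w) \<in> qpaths Delta") (auto simp: carrier_CP)
    finally show ?thesis .
  qed
  then show "\<one>\<^bsub>CP\<^esub> \<otimes>\<^bsub>CP\<^esub> f = f" by auto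
  have "(f \<otimes>\<^bsub>CP\<^esub> \<one>\<^bsub>CP\<^esub>) (u, w) = f (u, w)" for u w
  proof -
    have "(f \<otimes>\<^bsub>CP\<^esub> \<one>\<^bsub>CP\<^esub>) (u, w) = (\<Sum>i\<le>length w. if i = length w then f (u, w) * of_bool (pend Delta u w \<in> {1..8}) else 0)"
      unfolding mult_CP by (intro sum.cong) (auto simp: one_CP)
    also have "\<dots> = f (u, w)" using v(2)[of u w] f by (cases "(u, w) \<in> qpaths Delta") (auto simp: carrier_CP)
    finally show ?thesis .
  qed
  then show "f \<otimes>\<^bsub>CP\<^esub> \<one>\<^bsub>CP\<^esub> = f" by auto
qed

lemma ring_CP: "ring (CP :: (nat, darc, 'k::field) series ring)"
proof (rule ringI)
  show "abelian_group (CP :: (nat, darc, 'k) series ring)"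
  proof (rule abelian_groupI)
    fix f :: "(nat, darc, 'k) series" assume "f \<in> carrier CP"
    then show "\<exists>g\<in>carrier CP. g \<oplus>\<^bsub>CP\<^esub> f = \<zero>\<^bsub>CP\<^esub>"
      by (intro bexI[of _ "\<lambda>p. - f p"]) (auto simp: carrier_CP fun_eq_iff add_CP zero_CP)
  qed (auto simp: carrier_CP fun_eq_iff add_CP zero_CP)
  show "Group.monoid (CP :: (nat, darc, 'k) series ring)"
  proof (rule monoidI)
    show "\<one>\<^bsub>CP\<^esub> \<in> carrier (CP :: (nat, darc, 'k) series ring)" by (auto simp: carrier_CP one_CP qpaths_Nil)
  qed (auto simp: mult_CP_closed mult_CP_assoc one_CP_mult)
qed (auto simp: fun_eq_iff mult_CP add_CP algebra_simps sum.distrib)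

interpretation CP: ring CP
  by (rule ring_CP)

lemma path_elt_CP: "p \<in> qpaths Delta \<Longrightarrow> path_elt p \<in> carrier CP"
  by (auto simp: carrier_CP path_elt_def)

lemma path_elt_arc_mult:
  "(path_elt (u, [a]) \<otimes>\<^bsub>CP\<^esub> f) (v, w) = (if v = u \<and> w \<noteq> [] \<and> hd w = a then f (dhead a, tl w) else 0)"
proof -
  have "(path_elt (u, [a]) \<otimes>\<^bsub>CP\<^esub> f) (v, w) =
      (\<Sum>i\<le>length w. if i = 1 then (if v = u \<and> w \<noteq> [] \<and> hd w = a then f (dhead a, tl w) else 0) else 0)"
    unfolding mult_CP
  proof (intro sum.cong refl)
    fix i assume "i \<in> {..length w}"
    show "path_elt (u, [a]) (v, take i w) * f (pend Delta v (take i w), drop i w) =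
        (if i = 1 then (if v = u \<and> w \<noteq> [] \<and> hd w = a then f (dhead a, tl w) else 0) else 0)"
    proof (cases i)
      case 0
      then show ?thesis by (simp add: path_elt_def)
    next
      case (Suc k)
      then show ?thesis using \<open>i \<in> {..length w}\<close> by (cases w; cases k; cases "tl w") (auto simp: path_elt_def)
    qed
  qed
  also have "\<dots> = (if 1 \<le> length w \<and> v = u \<and> w \<noteq> [] \<and> hd w = a then f (dhead a, tl w) else 0)"
    by (subst sum.delta) auto
  finally show ?thesis by (cases w) simp_all
qed

lemma path_elt_idem_mult:
  "(path_elt (u, []) \<otimes>\<^bsub>CP\<^esub> f) (v, w) = (if v = u then f (v, w) else 0)"
proof -
  have "(path_elt (u, []) \<otimes>\<^bsub>CP\<^esub> f) (v, w) = (\<Sum>i\<le>length w. if i = 0 then (if v = u then f (v, w) else 0) else 0)"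
    unfolding mult_CP by (intro sum.cong) (auto simp: path_elt_def)
  then show ?thesis by simp
qed

lemma path_elt_Cons:
  assumes "u = dtail a"
  shows "path_elt (u, a # w) = path_elt (u, [a]) \<otimes>\<^bsub>CP\<^esub> path_elt (dhead a, w)"
proof
  fix p show "path_elt (u, a # w) p = (path_elt (u, [a]) \<otimes>\<^bsub>CP\<^esub> path_elt (dhead a, w)) p"
    by (cases p; cases "snd p") (simp_all add: path_elt_arc_mult, auto simp: path_elt_def)
qed

text \<open>Only the coefficients at the following words are well defined on the Jacobian algebra, because no
  relation contains them; they suffice to separate all the cokernels.\<close>

definition good_words :: "darc list set" where
  "good_words = {w. length w \<le> 1} \<union> {[Arr 3 2, Cminus], [Cminus, Arr 1 3], [Arr 1 3, Arr 3 8],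
     [Arr 3 2, Cminus, Arr 1 3], [Cminus, Arr 1 3, Arr 3 8], [Arr 3 2, Cminus, Arr 1 3, Arr 3 8]}"

text \<open>Closure under prefixes and suffixes makes vanishing at good words an ideal condition:
  the coefficient of a product at \<open>w\<close> involves only the cuts of
  \<open>w\<close>.\<close>

lemma good_words_take: "w \<in> good_words \<Longrightarrow> take i w \<in> good_words"
  and good_words_drop: "w \<in> good_words \<Longrightarrow> drop i w \<in> good_words"
  unfolding good_words_def by (auto simp: take_Cons drop_Cons split: nat.splits)

text \<open>An explicit closed ideal containing all cyclic derivatives, hence an upper bound for the
  Jacobian ideal. Coefficients at good words therefore descend to the quotient.\<close>

definition good_ideal :: "(nat, darc, 'k::field) series set" where
  "good_ideal = {f \<in> carrier CP. \<forall>u w. w \<in> good_words \<longrightarrow> f (u, w) = 0}"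

lemma ideal_good_ideal: "ideal good_ideal (CP :: (nat, darc, 'k::field) series ring)"
proof (rule idealI[OF ring_CP])
  have neg: "\<ominus>\<^bsub>CP\<^esub> f = (\<lambda>p. - f p)" if "f \<in> carrier CP" for f :: "(nat, darc, 'k) series"
    by (rule CP.minus_equality) (use that in \<open>auto simp: carrier_CP add_CP zero_CP\<close>)
  show "subgroup good_ideal (add_monoid (CP :: (nat, darc, 'k) series ring))"
  proof (rule group.subgroupI[OF CP.a_group])
    show "good_ideal \<noteq> ({} :: (nat, darc, 'k) series set)"
      using CP.zero_closed by (auto simp: good_ideal_def zero_CP)
    fix f g :: "(nat, darc, 'k) series" assume f: "f \<in> good_ideal"
    show "inv\<^bsub>add_monoid CP\<^esub> f \<in> good_ideal"
      using f neg[of f, unfolded a_inv_def] by (simp add: good_ideal_def carrier_CP)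
    assume "g \<in> good_ideal"
    then show "f \<otimes>\<^bsub>add_monoid CP\<^esub> g \<in> good_ideal" using f by (auto simp: good_ideal_def carrier_CP add_CP)
  qed (auto simp: good_ideal_def)
next
  fix f g :: "(nat, darc, 'k) series" assume f: "f \<in> good_ideal" and g: "g \<in> carrier CP"
  then show "g \<otimes>\<^bsub>CP\<^esub> f \<in> good_ideal" "f \<otimes>\<^bsub>CP\<^esub> g \<in> good_ideal"
    using good_words_take good_words_drop mult_CP_closed[of f g] mult_CP_closed[of g f]
    by (auto simp: good_ideal_def mult_CP)
qed

lemma adic_closed_good_ideal: "adic_closed Delta good_ideal"
  unfolding adic_closed_def
proof (intro ballI impI)
  fix f :: "(nat, darc, 'a) series" assume f: "f \<in> carrier CP"
    and lim: "\<forall>n. \<exists>g\<in>good_ideal. \<forall>p. length (snd p) < n \<longrightarrow> f p = g p"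
  have "f (u, w) = 0" if "w \<in> good_words" for u w
  proof -
    obtain g where "g \<in> good_ideal" "\<And>p. length (snd p) < Suc (length w) \<Longrightarrow> f p = g p" using lim by blast
    then show ?thesis using that by (auto simp: good_ideal_def)
  qed
  then show "f \<in> good_ideal" using f by (auto simp: good_ideal_def)
qed

lemma sum_triple: "(\<Sum>i | i < length [x, y, z] \<and> [x, y, z] ! i = a. F i) =
    (if x = a then F 0 else 0) + (if y = a then F 1 else 0) + (if z = a then F (2::nat) else (0 :: 'b::comm_monoid_add))"
proof -
  have "{i. i < length [x, y, z] \<and> [x, y, z] ! i = a} = {i\<in>{0,1,2}. [x, y, z] ! i = a}"
    by (auto simp: less_Suc_eq numeral_2_eq_2)
  then have "(\<Sum>i | i < length [x, y, z] \<and> [x, y, z] ! i = a. F i) =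
      (\<Sum>i\<in>{0,1,2}. if [x, y, z] ! i = a then F i else 0)"
    by (simp only: sum.inter_filter finite.intros)
  then show ?thesis by (simp add: add.assoc)
qed

lemma cyclic_deriv_Nil: "cyclic_deriv Q [] a = (\<lambda>p. 0)"
  by (simp add: cyclic_deriv_def)

lemma cyclic_deriv_Cons: "cyclic_deriv Q ((c, [x, y, z]) # W) a = (\<lambda>p.
    of_int c * ((if x = a then path_elt (head Q a, [y, z]) p else 0) + (if y = a then path_elt (head Q a, [z, x]) p else 0)
     + (if z = a then path_elt (head Q a, [x, y]) p else 0)) + cyclic_deriv Q W a p)"
  unfolding cyclic_deriv_def list.map sum_list.Cons prod.case
  by (subst sum_triple) (simp add: fun_eq_iff numeral_2_eq_2 algebra_simps)

lemma cyclic_deriv_potW: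
  "cyclic_deriv Delta potW Cplus = (\<lambda>p. - path_elt (1, [Arr 1 3, Arr 3 2]) p)"
  "cyclic_deriv Delta potW Cminus = (\<lambda>p. - path_elt (1, [Arr 1 4, Arr 4 2]) p)"
  "cyclic_deriv Delta potW (Arr 1 3) = (\<lambda>p. path_elt (3, [Arr 3 5, Arr 5 1]) p - path_elt (3, [Arr 3 2, Cplus]) p)"
  "cyclic_deriv Delta potW (Arr 1 4) = (\<lambda>p. path_elt (4, [Arr 4 5, Arr 5 1]) p - path_elt (4, [Arr 4 2, Cminus]) p)"
  "cyclic_deriv Delta potW (Arr 3 2) = (\<lambda>p. path_elt (2, [Arr 2 6, Arr 6 3]) p - path_elt (2, [Cplus, Arr 1 3]) p)"
  "cyclic_deriv Delta potW (Arr 4 2) = (\<lambda>p. path_elt (2, [Arr 2 6, Arr 6 4]) p - path_elt (2, [Cminus, Arr 1 4]) p)"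
  "cyclic_deriv Delta potW (Arr 5 1) = (\<lambda>p. path_elt (1, [Arr 1 3, Arr 3 5]) p + path_elt (1, [Arr 1 4, Arr 4 5]) p)"
  "cyclic_deriv Delta potW (Arr 2 6) = (\<lambda>p. path_elt (6, [Arr 6 3, Arr 3 2]) p + path_elt (6, [Arr 6 4, Arr 4 2]) p)"
  "cyclic_deriv Delta potW (Arr 6 3) = (\<lambda>p. path_elt (3, [Arr 3 2, Arr 2 6]) p - path_elt (3, [Arr 3 8, Arr 8 6]) p)"
  "cyclic_deriv Delta potW (Arr 6 4) = (\<lambda>p. path_elt (4, [Arr 4 2, Arr 2 6]) p)"
  "cyclic_deriv Delta potW (Arr 3 5) = (\<lambda>p. path_elt (5, [Arr 5 1, Arr 1 3]) p - path_elt (5, [Arr 5 7, Arr 7 3]) p)"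
  "cyclic_deriv Delta potW (Arr 4 5) = (\<lambda>p. path_elt (5, [Arr 5 1, Arr 1 4]) p)"
  "cyclic_deriv Delta potW (Arr 7 3) = (\<lambda>p. path_elt (3, [Arr 3 8, Arr 8 7]) p - path_elt (3, [Arr 3 5, Arr 5 7]) p)"
  "cyclic_deriv Delta potW (Arr 3 8) = (\<lambda>p. path_elt (8, [Arr 8 7, Arr 7 3]) p - path_elt (8, [Arr 8 6, Arr 6 3]) p)"
  "cyclic_deriv Delta potW (Arr 8 7) = (\<lambda>p. path_elt (7, [Arr 7 3, Arr 3 8]) p)"
  "cyclic_deriv Delta potW (Arr 5 7) = (\<lambda>p. - path_elt (7, [Arr 7 3, Arr 3 5]) p)"
  "cyclic_deriv Delta potW (Arr 8 6) = (\<lambda>p. - path_elt (6, [Arr 6 3, Arr 3 8]) p)"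
  unfolding potW_def cyclic_deriv_Cons cyclic_deriv_Nil by (simp_all add: fun_eq_iff)

text \<open>Every term of a cyclic derivative is a path of length 2 different from
  \<open>[Arr 3 2, Cminus]\<close>, \<open>[Cminus, Arr 1 3]\<close> and
  \<open>[Arr 1 3, Arr 3 8]\<close>, which are the good words of that length.\<close>

lemma cyclic_deriv_good_ideal: "cyclic_deriv Delta potW ` arcs Delta \<subseteq> (good_ideal :: (nat, darc, 'k::field) series set)"
proof -
  have path: "path_elt (u, [a, b]) \<in> (good_ideal :: (nat, darc, 'k) series set)"
    if "a \<in> arcs Delta" "b \<in> arcs Delta" "u = dtail a" "dhead a = dtail b"
      "(a, b) \<notin> {(Arr 3 2, Cminus), (Cminus, Arr 1 3), (Arr 1 3, Arr 3 8)}" for u a b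
    using that dhead_verts[of b] by (auto simp: good_ideal_def path_elt_def carrier_CP qpaths_Cons qpaths_Nil good_words_def)
  have neg: "(\<lambda>p. - f p) \<in> good_ideal" if "f \<in> good_ideal" for f :: "(nat, darc, 'k) series"
    using that by (auto simp: good_ideal_def carrier_CP)
  have comb: "(\<lambda>p. f p + g p) \<in> good_ideal" "(\<lambda>p. f p - g p) \<in> good_ideal"
    if "f \<in> good_ideal" "g \<in> good_ideal" for f g :: "(nat, darc, 'k) series"
    using that by (auto simp: good_ideal_def carrier_CP)
  show ?thesis
  proof
    fix f :: "(nat, darc, 'k) series" assume "f \<in> cyclic_deriv Delta potW ` arcs Delta"
    then obtain a where a: "a \<in> arcs Delta" "f = cyclic_deriv Delta potW a" by blast
    show "f \<in> good_ideal" unfolding a(2)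
      using a(1)[unfolded arcs_Delta]
      by (elim insertE emptyE; hypsubst; unfold cyclic_deriv_potW; intro neg comb path; simp add: arcs_Delta)
  qed
qed

section \<open>The Jacobian ideal and the quotient ring\<close>

lemma jac_ideal_subset: "jac_ideal Delta potW \<subseteq> good_ideal"
  unfolding jac_ideal_def
  using ideal_good_ideal adic_closed_good_ideal cyclic_deriv_good_ideal by blast

lemma ideal_jac_ideal: "ideal (jac_ideal Delta potW) (CP :: (nat, darc, 'k::field) series ring)"
  unfolding jac_ideal_def
proof (rule CP.i_Intersect)
  show "{I. ideal I CP \<and> adic_closed Delta I \<and> cyclic_deriv Delta potW ` arcs Delta \<subseteq> I} \<noteq> ({} :: (nat, darc, 'k) series set set)"
    using ideal_good_ideal adic_closed_good_ideal cyclic_deriv_good_ideal by blast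
qed auto

lemma cyclic_deriv_jac_ideal: "a \<in> arcs Delta \<Longrightarrow> cyclic_deriv Delta potW a \<in> jac_ideal Delta potW"
  unfolding jac_ideal_def by auto

abbreviation J :: "(nat, darc, 'k::field) series set ring" where
  "J \<equiv> jac_alg Delta potW"

lemma ring_J: "ring J"
  unfolding jac_alg_def by (rule ideal.quotient_is_ring[OF ideal_jac_ideal])

interpretation J: ring J
  by (rule ring_J)

text \<open>The carrier of the quotient becomes a type, so that the Jacobian algebra is an instance
  of class \<open>ring\<close> and can be computed with by simplification.\<close>

typedef (overloaded) 'k jac = "carrier (J :: (nat, darc, 'k::field) series set ring)"
  using J.zero_closed by blast

setup_lifting type_definition_jac

instantiation jac :: (field) "{ring, monoid_mult}"
begin

lift_definition zero_jac :: "'a jac" is "\<zero>\<^bsub>J\<^esub>" by simp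
lift_definition one_jac :: "'a jac" is "\<one>\<^bsub>J\<^esub>" by simp
lift_definition plus_jac :: "'a jac \<Rightarrow> 'a jac \<Rightarrow> 'a jac" is "\<lambda>x y. x \<oplus>\<^bsub>J\<^esub> y" by simp
lift_definition times_jac :: "'a jac \<Rightarrow> 'a jac \<Rightarrow> 'a jac" is "\<lambda>x y. x \<otimes>\<^bsub>J\<^esub> y" by simp
lift_definition uminus_jac :: "'a jac \<Rightarrow> 'a jac" is "\<lambda>x. \<ominus>\<^bsub>J\<^esub> x" by simp
lift_definition minus_jac :: "'a jac \<Rightarrow> 'a jac \<Rightarrow> 'a jac" is "\<lambda>x y. x \<ominus>\<^bsub>J\<^esub> y" by simp

instance
proof
  fix a b c :: "'a jac"
  show "a * b * c = a * (b * c)" by transfer (rule J.m_assoc)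
  show "1 * a = a" by transfer (rule J.l_one)
  show "a * 1 = a" by transfer (rule J.r_one)
  show "a + b + c = a + (b + c)" by transfer (rule J.a_assoc)
  show "a + b = b + a" by transfer (rule J.a_comm)
  show "0 + a = a" by transfer (rule J.l_zero)
  show "- a + a = 0" by transfer (rule J.l_neg)
  show "a - b = a + - b" by transfer (simp add: a_minus_def)
  show "(a + b) * c = a * c + b * c" by transfer (rule J.l_distr)
  show "a * (b + c) = a * b + a * c" by transfer (rule J.r_distr)
qed

end

lemmas Rep_jac_simps = zero_jac.rep_eq one_jac.rep_eq plus_jac.rep_eq times_jac.rep_eq

definition toJ :: "(nat, darc, 'k::field) series \<Rightarrow> 'k jac" where
  "toJ f = Abs_jac (jac_class Delta potW f)"

lemma jac_class_carrier: "f \<in> carrier CP \<Longrightarrow> jac_class Delta potW f \<in> carrier J"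
  unfolding jac_class_def jac_alg_def by (rule ring_hom_closed[OF ideal.rcos_ring_hom[OF ideal_jac_ideal]])

lemma Rep_toJ: "f \<in> carrier CP \<Longrightarrow> Rep_jac (toJ f) = jac_class Delta potW f"
  unfolding toJ_def by (rule Abs_jac_inverse) (rule jac_class_carrier)

lemma toJ_hom:
  assumes "f \<in> carrier CP" "g \<in> carrier CP"
  shows "toJ (f \<oplus>\<^bsub>CP\<^esub> g) = toJ f + toJ g" "toJ (f \<otimes>\<^bsub>CP\<^esub> g) = toJ f * toJ g"
  using assms ring_hom_add[OF ideal.rcos_ring_hom[OF ideal_jac_ideal] assms] ring_hom_mult[OF ideal.rcos_ring_hom[OF ideal_jac_ideal] assms]
  by (simp_all add: Rep_jac_inject[symmetric] Rep_jac_simps Rep_toJ CP.a_closed CP.m_closed)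
    (simp_all add: jac_class_def jac_alg_def)

lemma toJ_one: "toJ \<one>\<^bsub>CP\<^esub> = 1"
  using ring_hom_one[OF ideal.rcos_ring_hom[OF ideal_jac_ideal]]
  by (simp add: Rep_jac_inject[symmetric] Rep_jac_simps Rep_toJ) (simp add: jac_class_def jac_alg_def)

lemma toJ_surj: "\<exists>f\<in>carrier CP. x = toJ f"
proof -
  have "Rep_jac x \<in> a_rcosets\<^bsub>CP\<^esub> (jac_ideal Delta potW)"
    using Rep_jac[of x] by (simp add: jac_alg_def FactRing_def)
  then obtain f where "f \<in> carrier CP" "Rep_jac x = jac_class Delta potW f"
    by (auto simp: A_RCOSETS_def' jac_class_def)
  then show ?thesis by (metis Rep_toJ Rep_jac_inject)
qed

lemma toJ_eq_iff:
  assumes "f \<in> carrier CP" "g \<in> carrier CP"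
  shows "toJ f = toJ g \<longleftrightarrow> (\<lambda>p. f p - g p) \<in> jac_ideal Delta potW"
proof -
  have m: "f \<ominus>\<^bsub>CP\<^esub> g = (\<lambda>p. f p - g p)"
  proof -
    have "\<ominus>\<^bsub>CP\<^esub> g = (\<lambda>p. - g p)"
      by (rule CP.minus_equality) (use assms in \<open>auto simp: carrier_CP add_CP zero_CP\<close>)
    then show ?thesis by (auto simp: a_minus_def add_CP)
  qed
  have "toJ f = toJ g \<longleftrightarrow> jac_ideal Delta potW +>\<^bsub>CP\<^esub> f = jac_ideal Delta potW +>\<^bsub>CP\<^esub> g"
    using assms by (simp add: Rep_jac_inject[symmetric] Rep_toJ) (simp add: jac_class_def)
  also have "\<dots> \<longleftrightarrow> f \<ominus>\<^bsub>CP\<^esub> g \<in> jac_ideal Delta potW"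
    using CP.quotient_eq_iff_same_a_r_cos[OF ideal_jac_ideal assms] by simp
  finally show ?thesis by (simp add: m)
qed


lemma toJ_sum:
  assumes "finite A" "\<And>a. a \<in> A \<Longrightarrow> g a \<in> carrier CP"
  shows "(\<lambda>p. \<Sum>a\<in>A. g a p) \<in> carrier CP \<and> toJ (\<lambda>p. \<Sum>a\<in>A. g a p) = (\<Sum>a\<in>A. toJ (g a))"
  using assms
proof induction
  case empty
  have "toJ \<zero>\<^bsub>CP\<^esub> + toJ \<zero>\<^bsub>CP\<^esub> = 0 + toJ (\<zero>\<^bsub>CP\<^esub> :: (nat, darc, 'b) series)"
    using toJ_hom(1)[OF CP.zero_closed CP.zero_closed] CP.l_zero[OF CP.zero_closed] by simp
  then show ?case by (auto simp: zero_CP carrier_CP)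
next
  case (insert a A)
  have "(\<lambda>p. \<Sum>b\<in>insert a A. g b p) = g a \<oplus>\<^bsub>CP\<^esub> (\<lambda>p. \<Sum>b\<in>A. g b p)"
    using insert by (simp add: fun_eq_iff add_CP)
  then show ?case using insert toJ_hom(1)[of "g a" "\<lambda>p. \<Sum>b\<in>A. g b p"] by simp
qed

text \<open>The vertex \<open>1\<close> has to keep the form in which the rules for arrows mention it.\<close>

declare One_nat_def [simp del]

section \<open>Idempotents, arrows, scalars and coefficients in the Jacobian algebra\<close>

definition idm :: "nat \<Rightarrow> 'k::field jac" where
  "idm u = toJ (path_elt (u, []))"

definition arr :: "darc \<Rightarrow> 'k::field jac" where
  "arr a = toJ (path_elt (dtail a, [a]))"

definition sc :: "'k::field \<Rightarrow> 'k jac" where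
  "sc c = toJ (\<lambda>p. c * \<one>\<^bsub>CP\<^esub> p)"

text \<open>Read off an arbitrary representative; by \<open>coefJ_toJ\<close> the choice does not
  matter at good words.\<close>

definition coefJ :: "nat \<Rightarrow> darc list \<Rightarrow> 'k::field jac \<Rightarrow> 'k" where
  "coefJ u w x = (SOME f. f \<in> carrier CP \<and> toJ f = x) (u, w)"

lemma coefJ_toJ:
  assumes f: "f \<in> carrier CP" and w: "w \<in> good_words"
  shows "coefJ u w (toJ f) = f (u, w)"
proof -
  define g where "g = (SOME g. g \<in> carrier CP \<and> toJ g = toJ f)"
  have g: "g \<in> carrier CP \<and> toJ g = toJ f"
    unfolding g_def by (rule someI[of _ f]) (use f in simp)
  then have "(\<lambda>p. g p - f p) \<in> good_ideal"
    using toJ_eq_iff[of g f] f jac_ideal_subset by blast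
  then have "g (u, w) - f (u, w) = 0" using w by (auto simp: good_ideal_def)
  then show ?thesis by (simp add: coefJ_def g_def)
qed

lemma scale_carrier: "f \<in> carrier CP \<Longrightarrow> (\<lambda>p. c * f p) \<in> carrier CP"
  by (auto simp: carrier_CP)

lemma sc_mult:
  assumes f: "f \<in> carrier CP"
  shows "sc c * toJ f = toJ (\<lambda>p. c * f p)" "toJ f * sc c = toJ (\<lambda>p. c * f p)"
proof -
  have "(\<lambda>p. c * \<one>\<^bsub>CP\<^esub> p) \<otimes>\<^bsub>CP\<^esub> f = (\<lambda>p. c * (\<one>\<^bsub>CP\<^esub> \<otimes>\<^bsub>CP\<^esub> f) p)" "f \<otimes>\<^bsub>CP\<^esub> (\<lambda>p. c * \<one>\<^bsub>CP\<^esub> p) = (\<lambda>p. c * (f \<otimes>\<^bsub>CP\<^esub> \<one>\<^bsub>CP\<^esub>) p)"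
    by (auto simp: fun_eq_iff mult_CP sum_distrib_left ac_simps)
  then show "sc c * toJ f = toJ (\<lambda>p. c * f p)" "toJ f * sc c = toJ (\<lambda>p. c * f p)"
    using toJ_hom(2)[OF scale_carrier[OF CP.one_closed] f, of c] toJ_hom(2)[OF f scale_carrier[OF CP.one_closed], of c]
      one_CP_mult[OF f] by (simp_all add: sc_def)
qed

lemma sc_commute: "x * sc c = sc c * x"
  using toJ_surj[of x] sc_mult by metis

lemma sc_left_commute: "x * (sc c * y) = sc c * (x * y)"
  by (metis mult.assoc sc_commute)

lemma sc_mult_mult: "sc c * sc d = sc (c * d)"
  unfolding sc_def[of d] sc_mult(1)[OF scale_carrier[OF CP.one_closed]] by (simp add: sc_def mult.assoc)

lemma sc_add: "sc (c + d) = sc c + sc d"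
proof -
  have "(\<lambda>p. (c + d) * \<one>\<^bsub>CP\<^esub> p) = (\<lambda>p. c * \<one>\<^bsub>CP\<^esub> p) \<oplus>\<^bsub>CP\<^esub> (\<lambda>p. d * \<one>\<^bsub>CP\<^esub> p)"
    by (simp add: fun_eq_iff add_CP algebra_simps)
  then show ?thesis unfolding sc_def
    using toJ_hom(1)[OF scale_carrier[OF CP.one_closed] scale_carrier[OF CP.one_closed]] by metis
qed

lemma sc_1 [simp]: "sc 1 = 1"
  by (simp add: sc_def toJ_one)

lemma sc_0 [simp]: "sc 0 = 0"
  using sc_add[of 0 0] by simp

lemma sc_minus: "sc (- c) = - sc c"
  using sc_add[of c "- c"] by (simp add: eq_neg_iff_add_eq_0 add.commute)

text \<open>Scalars act through central elements; this gives access to spans and subspaces.\<close>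

interpretation jvs: vector_space "\<lambda>c x. sc c * x"
  by unfold_locales (simp_all add: algebra_simps sc_add sc_mult_mult flip: mult.assoc)

lemma coefJ_add:
  assumes w: "w \<in> good_words"
  shows "coefJ u w (x + y) = coefJ u w x + coefJ u w y"
proof -
  obtain f g where fg: "f \<in> carrier CP" "x = toJ f" "g \<in> carrier CP" "y = toJ g" using toJ_surj by metis
  then show ?thesis using toJ_hom(1)[OF fg(1,3)] w
    by (simp add: coefJ_toJ CP.a_closed add_CP flip: toJ_hom(1))
qed

lemma coefJ_mult:
  assumes w: "w \<in> good_words"
  shows "coefJ u w (x * y) = (\<Sum>i\<le>length w. coefJ u (take i w) x * coefJ (pend Delta u (take i w)) (drop i w) y)"
proof -
  obtain f g where fg: "f \<in> carrier CP" "x = toJ f" "g \<in> carrier CP" "y = toJ g" using toJ_surj by metis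
  have "coefJ u w (x * y) = (f \<otimes>\<^bsub>CP\<^esub> g) (u, w)" using fg w by (simp add: coefJ_toJ CP.m_closed flip: toJ_hom(2))
  then show ?thesis using fg good_words_take[OF w] good_words_drop[OF w] by (simp add: mult_CP coefJ_toJ)
qed

lemma coefJ_sc:
  assumes w: "w \<in> good_words"
  shows "coefJ u w (sc c * x) = c * coefJ u w x"
proof -
  obtain f where f: "f \<in> carrier CP" "x = toJ f" using toJ_surj by metis
  then show ?thesis using w by (simp add: sc_mult coefJ_toJ scale_carrier)
qed

lemma coefJ_idm: "v \<in> {1..8} \<Longrightarrow> w \<in> good_words \<Longrightarrow> coefJ u w (idm v) = of_bool (u = v \<and> w = [])"
  unfolding idm_def using coefJ_toJ[OF path_elt_CP, of "(v, [])" w u] by (auto simp: qpaths_Nil path_elt_def)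

lemma coefJ_mult_idm:
  assumes w: "w \<in> good_words" and v: "v \<in> {1..8}"
  shows "coefJ u w (x * idm v) = (if pend Delta u w = v then coefJ u w x else 0)"
proof -
  have "coefJ u w (x * idm v) = (\<Sum>i\<le>length w. if i = length w then (if pend Delta u w = v then coefJ u w x else 0) else 0)"
    unfolding coefJ_mult[OF w] using good_words_drop[OF w] v by (intro sum.cong) (auto simp: coefJ_idm)
  then show ?thesis by simp
qed

lemma arc_qpath: "a \<in> arcs Delta \<Longrightarrow> (dtail a, [a]) \<in> qpaths Delta"
  using dhead_verts by (auto simp: qpaths_Cons qpaths_Nil)

lemma coefJ_arr: "a \<in> arcs Delta \<Longrightarrow> w \<in> good_words \<Longrightarrow> coefJ u w (arr a) = of_bool (u = dtail a \<and> w = [a])"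
  unfolding arr_def using coefJ_toJ[OF path_elt_CP[OF arc_qpath], of a w u] by (auto simp: path_elt_def)

lemma idm_mult_idm:
  assumes "u \<in> {1..8}" "v \<in> {1..8}"
  shows "idm u * idm v = (if u = v then idm u else 0 :: 'k::field jac)"
proof -
  have c: "(path_elt (u, []) :: (nat, darc, 'k) series) \<in> carrier CP" "(path_elt (v, []) :: (nat, darc, 'k) series) \<in> carrier CP"
    using assms by (auto intro!: path_elt_CP simp: qpaths_Nil)
  have "path_elt (u, []) \<otimes>\<^bsub>CP\<^esub> path_elt (v, []) = (if u = v then path_elt (u, []) else (\<lambda>p. 0 * \<one>\<^bsub>CP\<^esub> p) :: (nat, darc, 'k) series)"
    by (auto simp: fun_eq_iff path_elt_idem_mult) (auto simp: path_elt_def)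
  moreover have "sc 0 = (0 :: 'k jac)" by simp
  ultimately show ?thesis using toJ_hom(2)[OF c] by (auto simp: idm_def sc_def)
qed

lemma idm_arr: "a \<in> arcs Delta \<Longrightarrow> idm (dtail a) * arr a = (arr a :: 'k::field jac)"
proof -
  assume a: "a \<in> arcs Delta"
  have c: "(path_elt (dtail a, []) :: (nat, darc, 'k) series) \<in> carrier CP" "(path_elt (dtail a, [a]) :: (nat, darc, 'k) series) \<in> carrier CP"
    using a dtail_verts arc_qpath by (auto intro!: path_elt_CP simp: qpaths_Nil)
  have "path_elt (dtail a, []) \<otimes>\<^bsub>CP\<^esub> path_elt (dtail a, [a]) = (path_elt (dtail a, [a]) :: (nat, darc, 'k) series)"
    by (auto simp: fun_eq_iff path_elt_idem_mult) (auto simp: path_elt_def)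
  then show ?thesis using toJ_hom(2)[OF c] by (simp add: idm_def arr_def)
qed

lemma arr_idm: "a \<in> arcs Delta \<Longrightarrow> arr a * idm (dhead a) = (arr a :: 'k::field jac)"
proof -
  assume a: "a \<in> arcs Delta"
  have c: "(path_elt (dhead a, []) :: (nat, darc, 'k) series) \<in> carrier CP" "(path_elt (dtail a, [a]) :: (nat, darc, 'k) series) \<in> carrier CP"
    using a dhead_verts arc_qpath by (auto intro!: path_elt_CP simp: qpaths_Nil)
  show ?thesis using path_elt_Cons[of "dtail a" a "[]", where ?'a = 'k] toJ_hom(2)[OF c(2,1)] by (simp add: idm_def arr_def)
qed

text \<open>The first arrow is stripped off every term. The cofactors are again arbitrary series, so
  infinite sums of paths are decomposed in one step and without a limit.\<close>

lemma idm_decomp: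
  assumes v: "v \<in> {1..8}"
  shows "\<exists>c y. idm v * x = sc c * idm v + (\<Sum>a | a \<in> arcs Delta \<and> dtail a = v. arr a * y a)"
proof -
  obtain f where f: "f \<in> carrier CP" "x = toJ f" using toJ_surj by metis
  let ?A = "{a \<in> arcs Delta. dtail a = v}"
  define g where "g a = (\<lambda>(u, w). if u = dhead a then f (v, a # w) else 0)" for a
  have fin: "finite ?A" by (simp add: arcs_Delta)
  have g: "g a \<in> carrier CP" if "a \<in> ?A" for a
    using f(1) that unfolding carrier_CP g_def by (auto simp: qpaths_Cons)
  have pv: "path_elt (v, []) \<in> carrier CP" using v by (auto intro!: path_elt_CP simp: qpaths_Nil)
  have pa: "path_elt (v, [a]) \<in> carrier CP" if "a \<in> ?A" for a
    using that arc_qpath[of a] by (auto intro!: path_elt_CP)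
  let ?S = "\<lambda>p. \<Sum>a\<in>?A. (path_elt (v, [a]) \<otimes>\<^bsub>CP\<^esub> g a) p"
  have s: "?S \<in> carrier CP \<and> toJ ?S = (\<Sum>a\<in>?A. toJ (path_elt (v, [a]) \<otimes>\<^bsub>CP\<^esub> g a))"
    by (rule toJ_sum[OF fin]) (use g pa in \<open>auto intro: CP.m_closed\<close>)
  have "path_elt (v, []) \<otimes>\<^bsub>CP\<^esub> f = (\<lambda>p. f (v, []) * path_elt (v, []) p) \<oplus>\<^bsub>CP\<^esub> ?S"
  proof
    fix p :: "nat \<times> darc list"
    obtain u w where p: "p = (u, w)" by (cases p)
    show "(path_elt (v, []) \<otimes>\<^bsub>CP\<^esub> f) p = ((\<lambda>p. f (v, []) * path_elt (v, []) p) \<oplus>\<^bsub>CP\<^esub> ?S) p"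
    proof (cases w)
      case Nil
      then show ?thesis by (simp add: p add_CP path_elt_idem_mult path_elt_arc_mult) (simp add: path_elt_def)
    next
      case (Cons b w')
      have "?S p = (\<Sum>a\<in>?A. if a = b then (if u = v then f (v, w) else 0) else 0)"
        by (intro sum.cong) (auto simp: p Cons path_elt_arc_mult g_def)
      also have "\<dots> = (if u = v \<and> b \<in> ?A then f (v, w) else 0)" using fin by (simp add: sum.delta)
      also have "\<dots> = (if u = v then f (v, w) else 0)"
        using f(1) by (auto simp: Cons carrier_CP qpaths_Cons)
      finally show ?thesis by (simp add: p add_CP path_elt_idem_mult) (simp add: Cons path_elt_def)
    qed
  qed
  then have "toJ (path_elt (v, []) \<otimes>\<^bsub>CP\<^esub> f) = sc (f (v, [])) * toJ (path_elt (v, [])) + (\<Sum>a\<in>?A. toJ (path_elt (v, [a]) \<otimes>\<^bsub>CP\<^esub> g a))"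
    using s toJ_hom(1)[OF scale_carrier[OF pv] conjunct1[OF s]] by (simp add: sc_mult(1)[OF pv])
  also have "(\<Sum>a\<in>?A. toJ (path_elt (v, [a]) \<otimes>\<^bsub>CP\<^esub> g a)) = (\<Sum>a\<in>?A. arr a * toJ (g a))"
    by (intro sum.cong refl) (use toJ_hom(2)[OF pa g] in \<open>auto simp: arr_def\<close>)
  finally have "idm v * x = sc (f (v, [])) * idm v + (\<Sum>a\<in>?A. arr a * toJ (g a))"
    by (simp add: idm_def f(2) toJ_hom(2)[OF pv f(1)])
  then show ?thesis by (intro exI[of _ "f (v, [])"] exI[of _ "\<lambda>a. toJ (g a)"]) simp
qed

definition right_in :: "'k::field jac set \<Rightarrow> 'k jac \<Rightarrow> bool" where
  "right_in V b \<longleftrightarrow> (\<forall>x. b * x \<in> V)"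

text \<open>By \<open>idm_decomp\<close> the right ideal of \<open>b\<close> consists of multiples
  of \<open>b\<close> plus elements of the right ideals of the \<open>b * arr a\<close>. Once
  relations close the tree of paths after finitely many steps, finite spanning sets follow for the
  completed algebra without any nilpotency argument.\<close>

lemma right_in_step:
  assumes V: "jvs.subspace V" and b: "b * idm v = b" "b \<in> V" and v: "v \<in> {1..8}"
    and a: "\<And>a. a \<in> arcs Delta \<Longrightarrow> dtail a = v \<Longrightarrow> right_in V (b * arr a)"
  shows "right_in V b"
  unfolding right_in_def
proof
  fix x :: "'a jac"
  obtain c y where d: "idm v * x = sc c * idm v + (\<Sum>a | a \<in> arcs Delta \<and> dtail a = v. arr a * y a)"
    using idm_decomp[OF v] by blast
  have "b * x = b * (idm v * x)" using b(1) by (metis mult.assoc)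
  also have "\<dots> = sc c * b + (\<Sum>a | a \<in> arcs Delta \<and> dtail a = v. b * arr a * y a)"
    unfolding d by (simp add: distrib_left sc_left_commute b(1) sum_distrib_left mult.assoc)
  also have "\<dots> \<in> V"
    using a b(2) by (intro jvs.subspace_add[OF V] jvs.subspace_sum[OF V] jvs.subspace_scale[OF V]) (auto simp: right_in_def)
  finally show "b * x \<in> V" .
qed

lemma right_in_zero: "jvs.subspace V \<Longrightarrow> right_in V 0"
  by (simp add: right_in_def jvs.subspace_0)

lemma right_in_minus: "jvs.subspace V \<Longrightarrow> right_in V b \<Longrightarrow> right_in V (- b)"
  by (simp add: right_in_def jvs.subspace_neg)

section \<open>Relations and spanning paths\<close>

abbreviation A :: "nat \<Rightarrow> nat \<Rightarrow> 'k::field jac" where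
  "A u v \<equiv> arr (Arr u v)"

lemma toJ_path2:
  assumes "a \<in> arcs Delta" "b \<in> arcs Delta" "dhead a = dtail b" "u = dtail a"
  shows "(path_elt (u, [a, b]) :: (nat, darc, 'k::field) series) \<in> carrier CP" "toJ (path_elt (u, [a, b])) = (arr a * arr b :: 'k jac)"
proof -
  have c: "(path_elt (dtail a, [a]) :: (nat, darc, 'k) series) \<in> carrier CP" "(path_elt (dtail b, [b]) :: (nat, darc, 'k) series) \<in> carrier CP"
    using assms arc_qpath by (auto intro!: path_elt_CP)
  show "toJ (path_elt (u, [a, b])) = (arr a * arr b :: 'k jac)"
    using path_elt_Cons[OF assms(4), of "[b]", where ?'a = 'k] toJ_hom(2)[OF c] assms by (simp add: arr_def)
  show "(path_elt (u, [a, b]) :: (nat, darc, 'k) series) \<in> carrier CP"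
    using path_elt_Cons[OF assms(4), of "[b]", where ?'a = 'k] CP.m_closed[OF c] assms by simp
qed

lemma toJ_jac_ideal: "f \<in> jac_ideal Delta potW \<Longrightarrow> toJ f = 0"
proof -
  assume f: "f \<in> jac_ideal Delta potW"
  then have c: "f \<in> carrier CP" using ideal.Icarr[OF ideal_jac_ideal] by blast
  have "toJ (\<lambda>p. 0 * f p) = toJ f"
    using toJ_eq_iff[OF c scale_carrier[OF c, of 0]] f by simp
  then show ?thesis using sc_mult(1)[OF c, of 0] by simp
qed

lemma toJ_relation:
  assumes "cyclic_deriv Delta potW a = ((\<lambda>p. path_elt (u, [b, c]) p - path_elt (u, [b', c']) p) :: (nat, darc, 'k::field) series)" "a \<in> arcs Delta"
    "b \<in> arcs Delta" "c \<in> arcs Delta" "dhead b = dtail c" "u = dtail b"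
    "b' \<in> arcs Delta" "c' \<in> arcs Delta" "dhead b' = dtail c'" "u = dtail b'"
  shows "arr b * arr c = (arr b' * arr c' :: 'k jac)"
proof -
  note p = toJ_path2[OF assms(3-6), where ?'k = 'k] toJ_path2[OF assms(7-10), where ?'k = 'k]
  have "cyclic_deriv Delta potW a \<in> (jac_ideal Delta potW :: (nat, darc, 'k) series set)"
    by (rule cyclic_deriv_jac_ideal[OF assms(2)])
  then show ?thesis using toJ_eq_iff[OF p(1,3)] p(2,4) unfolding assms(1) by simp
qed

lemma toJ_relation_plus:
  assumes "cyclic_deriv Delta potW a = ((\<lambda>p. path_elt (u, [b, c]) p + path_elt (u, [b', c']) p) :: (nat, darc, 'k::field) series)" "a \<in> arcs Delta"
    "b \<in> arcs Delta" "c \<in> arcs Delta" "dhead b = dtail c" "u = dtail b"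
    "b' \<in> arcs Delta" "c' \<in> arcs Delta" "dhead b' = dtail c'" "u = dtail b'"
  shows "arr b' * arr c' = - (arr b * arr c :: 'k jac)"
proof -
  note p = toJ_path2[OF assms(3-6), where ?'k = 'k] toJ_path2[OF assms(7-10), where ?'k = 'k]
  have "cyclic_deriv Delta potW a = (path_elt (u, [b, c]) :: (nat, darc, 'k) series) \<oplus>\<^bsub>CP\<^esub> (path_elt (u, [b', c']) :: (nat, darc, 'k) series)"
    unfolding assms(1) by (simp add: fun_eq_iff add_CP)
  moreover have "toJ (cyclic_deriv Delta potW a) = (0 :: 'k jac)"
    by (rule toJ_jac_ideal[OF cyclic_deriv_jac_ideal[OF assms(2)]])
  ultimately have "arr b * arr c + arr b' * arr c' = (0 :: 'k jac)"
    using toJ_hom(1)[OF p(1,3)] p by simp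
  then show ?thesis by (simp add: eq_neg_iff_add_eq_0 add.commute)
qed

lemma toJ_relation_zero:
  assumes "cyclic_deriv Delta potW a = ((\<lambda>p. path_elt (u, [b, c]) p) :: (nat, darc, 'k::field) series) \<or> cyclic_deriv Delta potW a = ((\<lambda>p. - path_elt (u, [b, c]) p) :: (nat, darc, 'k) series)" "a \<in> arcs Delta"
    "b \<in> arcs Delta" "c \<in> arcs Delta" "dhead b = dtail c" "u = dtail b"
  shows "arr b * arr c = (0 :: 'k jac)"
proof -
  note p = toJ_path2[OF assms(3-6), where ?'k = 'k]
  have "toJ (cyclic_deriv Delta potW a) = (0 :: 'k jac)" by (rule toJ_jac_ideal[OF cyclic_deriv_jac_ideal[OF assms(2)]])
  moreover have "toJ (cyclic_deriv Delta potW a) \<in> {toJ (path_elt (u, [b, c])), sc (- 1) * toJ (path_elt (u, [b, c]) :: (nat, darc, 'k) series)}"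
    using assms(1) by (auto simp: sc_mult(1)[OF p(1)])
  ultimately show ?thesis using p(2) by (auto simp: sc_minus)
qed

lemma jac_relations:
  "A 1 3 * A 3 2 = (0 :: 'k::field jac)" "A 1 4 * A 4 2 = (0 :: 'k jac)"
  "A 3 5 * A 5 1 = (A 3 2 * arr Cplus :: 'k jac)" "A 4 5 * A 5 1 = (A 4 2 * arr Cminus :: 'k jac)"
  "A 2 6 * A 6 3 = (arr Cplus * A 1 3 :: 'k jac)" "A 2 6 * A 6 4 = (arr Cminus * A 1 4 :: 'k jac)"
  "A 1 4 * A 4 5 = - (A 1 3 * A 3 5 :: 'k jac)" "A 3 8 * A 8 6 = (A 3 2 * A 2 6 :: 'k jac)"
  "A 5 7 * A 7 3 = (A 5 1 * A 1 3 :: 'k jac)" "A 5 1 * A 1 4 = (0 :: 'k jac)"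
  "A 3 8 * A 8 7 = (A 3 5 * A 5 7 :: 'k jac)" "A 8 7 * A 7 3 = (A 8 6 * A 6 3 :: 'k jac)"
  "A 7 3 * A 3 8 = (0 :: 'k jac)" "A 7 3 * A 3 5 = (0 :: 'k jac)"
proof -
  note d = cyclic_deriv_potW
  show "A 1 3 * A 3 2 = (0 :: 'k jac)" by (rule toJ_relation_zero[OF disjI2[OF d(1)]]) (auto simp: arcs_Delta)
  show "A 1 4 * A 4 2 = (0 :: 'k jac)" by (rule toJ_relation_zero[OF disjI2[OF d(2)]]) (auto simp: arcs_Delta)
  show "A 3 5 * A 5 1 = (A 3 2 * arr Cplus :: 'k jac)" by (rule toJ_relation[OF d(3)]) (auto simp: arcs_Delta)
  show "A 4 5 * A 5 1 = (A 4 2 * arr Cminus :: 'k jac)" by (rule toJ_relation[OF d(4)]) (auto simp: arcs_Delta)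
  show "A 2 6 * A 6 3 = (arr Cplus * A 1 3 :: 'k jac)" by (rule toJ_relation[OF d(5)]) (auto simp: arcs_Delta)
  show "A 2 6 * A 6 4 = (arr Cminus * A 1 4 :: 'k jac)" by (rule toJ_relation[OF d(6)]) (auto simp: arcs_Delta)
  show "A 1 4 * A 4 5 = - (A 1 3 * A 3 5 :: 'k jac)" by (rule toJ_relation_plus[OF d(7)]) (auto simp: arcs_Delta)
  show "A 3 8 * A 8 6 = (A 3 2 * A 2 6 :: 'k jac)" by (rule toJ_relation[OF d(9), symmetric]) (auto simp: arcs_Delta)
  show "A 5 7 * A 7 3 = (A 5 1 * A 1 3 :: 'k jac)" by (rule toJ_relation[OF d(11), symmetric]) (auto simp: arcs_Delta)
  show "A 5 1 * A 1 4 = (0 :: 'k jac)" by (rule toJ_relation_zero[OF disjI1[OF d(12)]]) (auto simp: arcs_Delta)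
  show "A 3 8 * A 8 7 = (A 3 5 * A 5 7 :: 'k jac)" by (rule toJ_relation[OF d(13)]) (auto simp: arcs_Delta)
  show "A 8 7 * A 7 3 = (A 8 6 * A 6 3 :: 'k jac)" by (rule toJ_relation[OF d(14)]) (auto simp: arcs_Delta)
  show "A 7 3 * A 3 8 = (0 :: 'k jac)" by (rule toJ_relation_zero[OF disjI1[OF d(15)]]) (auto simp: arcs_Delta)
  show "A 7 3 * A 3 5 = (0 :: 'k jac)" by (rule toJ_relation_zero[OF disjI2[OF d(16)]]) (auto simp: arcs_Delta)
qed

text \<open>\<open>A 3 2 * arr Cplus\<close> is \<open>A 3 5 * A 5 1\<close>, and followed by
  \<open>A 1 3\<close> it becomes \<open>A 3 5 * A 5 7 * A 7 3\<close>; the products of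
  \<open>A 5 1\<close> with \<open>A 1 4\<close> and of \<open>A 7 3\<close> with
  \<open>A 3 5\<close> or \<open>A 3 8\<close> vanish. Paths starting with
  \<open>A 3 2 * arr Cplus\<close> thus end early, unlike those with
  \<open>arr Cminus\<close>.\<close>

lemma jac_relations_z:
  "A 3 2 * arr Cplus * A 1 4 = (0 :: 'k::field jac)" "A 3 2 * arr Cplus * A 1 3 * A 3 5 = (0 :: 'k jac)"
  "A 3 2 * arr Cplus * A 1 3 * A 3 8 = (0 :: 'k jac)"
proof -
  have "A 3 2 * arr Cplus * A 1 4 = (A 3 5 * (A 5 1 * A 1 4) :: 'k jac)"
    by (simp add: jac_relations(3) flip: mult.assoc)
  then show "A 3 2 * arr Cplus * A 1 4 = (0 :: 'k jac)" by (simp add: jac_relations)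
  have z: "A 3 2 * arr Cplus * A 1 3 = (A 3 5 * A 5 7 * A 7 3 :: 'k jac)"
    by (simp add: jac_relations(9) mult.assoc) (simp add: jac_relations(3) flip: mult.assoc)
  show "A 3 2 * arr Cplus * A 1 3 * A 3 5 = (0 :: 'k jac)" "A 3 2 * arr Cplus * A 1 3 * A 3 8 = (0 :: 'k jac)"
    unfolding z mult.assoc[of _ "A 7 3"] by (simp_all add: jac_relations(13,14))
qed

text \<open>The same rules behind an arbitrary prefix, because words are associated to the
  left.\<close>

lemma jac_relations_left:
  "x * A 1 3 * A 3 2 = (0 :: 'k::field jac)" "x * A 1 4 * A 4 2 = (0 :: 'k jac)"
  "x * A 3 5 * A 5 1 = (x * A 3 2 * arr Cplus :: 'k jac)" "x * A 2 6 * A 6 3 = (x * arr Cplus * A 1 3 :: 'k jac)"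
  "x * A 2 6 * A 6 4 = (x * arr Cminus * A 1 4 :: 'k jac)"
  "x * A 1 4 * A 4 5 = - (x * A 1 3 * A 3 5 :: 'k jac)" "x * A 3 8 * A 8 6 = (x * A 3 2 * A 2 6 :: 'k jac)"
  "x * A 5 7 * A 7 3 = (x * A 5 1 * A 1 3 :: 'k jac)"
  "x * A 3 8 * A 8 7 = (x * A 3 5 * A 5 7 :: 'k jac)"
  by (simp_all add: jac_relations mult.assoc)

lemmas jac_rules = jac_relations jac_relations_left jac_relations_z


lemma idm_mult_arr: "a \<in> arcs Delta \<Longrightarrow> v = dtail a \<Longrightarrow> idm v * arr a = arr a"
  by (simp add: idm_arr)

lemma arr_mult_idm:
  assumes "a \<in> arcs Delta" "v \<in> {1..8}"
  shows "arr a * idm v = (if dhead a = v then arr a else 0 :: 'k::field jac)"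
    "x * arr a * idm v = (if dhead a = v then x * arr a else 0 :: 'k jac)"
proof -
  show 1: "arr a * idm v = (if dhead a = v then arr a else 0 :: 'k jac)"
  proof (cases "dhead a = v")
    case True
    then show ?thesis using arr_idm[OF assms(1)] by simp
  next
    case False
    have "arr a * idm v = arr a * (idm (dhead a) * idm v :: 'k jac)"
      by (simp only: arr_idm[OF assms(1)] flip: mult.assoc)
    also have "idm (dhead a) * idm v = (0 :: 'k jac)"
      using idm_mult_idm[OF dhead_verts[OF assms(1)] assms(2)] False by simp
    finally show ?thesis using False by simp
  qed
  show "x * arr a * idm v = (if dhead a = v then x * arr a else 0 :: 'k jac)"
    unfolding mult.assoc 1 by simp
qed

lemma right_in_uminus: "jvs.subspace V \<Longrightarrow> right_in V (- b) = right_in V b"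
  using right_in_minus[of V b] right_in_minus[of V "- b"] by auto

definition right_ideal :: "'k::field jac set \<Rightarrow> bool" where
  "right_ideal I \<longleftrightarrow> jvs.subspace I \<and> (\<forall>b\<in>I. \<forall>x. b * x \<in> I)"

lemma right_idealD:
  assumes "right_ideal I"
  shows "jvs.subspace I" "b \<in> I \<Longrightarrow> b * x \<in> I" "b \<in> I \<Longrightarrow> - b \<in> I" "b \<in> I \<Longrightarrow> sc c * b \<in> I"
    "b \<in> I \<Longrightarrow> b' \<in> I \<Longrightarrow> b + b' \<in> I" "b \<in> I \<Longrightarrow> b' \<in> I \<Longrightarrow> b - b' \<in> I" "0 \<in> I"
    "sc c * b \<in> I \<Longrightarrow> c \<noteq> 0 \<Longrightarrow> b \<in> I"
proof -
  show s: "jvs.subspace I" and "b \<in> I \<Longrightarrow> b * x \<in> I" for b x using assms by (auto simp: right_ideal_def)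
  show "b \<in> I \<Longrightarrow> - b \<in> I" "b \<in> I \<Longrightarrow> sc c * b \<in> I" "b \<in> I \<Longrightarrow> b' \<in> I \<Longrightarrow> b + b' \<in> I" "b \<in> I \<Longrightarrow> b' \<in> I \<Longrightarrow> b - b' \<in> I" "0 \<in> I"
    using jvs.subspace_neg[OF s] jvs.subspace_scale[OF s] jvs.subspace_add[OF s] jvs.subspace_diff[OF s] jvs.subspace_0[OF s] by blast+
  assume "sc c * b \<in> I" "c \<noteq> 0"
  then have "sc (inverse c) * (sc c * b) \<in> I" using jvs.subspace_scale[OF s] by blast
  then show "b \<in> I" using \<open>c \<noteq> 0\<close> by (simp add: sc_mult_mult flip: mult.assoc)
qed

lemma right_in_steps:
  assumes V: "jvs.subspace V"
  shows "b * idm 1 = b \<Longrightarrow> b \<in> V \<Longrightarrow> right_in V (b * A 1 3) \<Longrightarrow> right_in V (b * A 1 4) \<Longrightarrow> right_in V b"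
    "b * idm 2 = b \<Longrightarrow> b \<in> V \<Longrightarrow> right_in V (b * arr Cplus) \<Longrightarrow> right_in V (b * arr Cminus) \<Longrightarrow> right_in V (b * A 2 6) \<Longrightarrow> right_in V b"
    "b * idm 3 = b \<Longrightarrow> b \<in> V \<Longrightarrow> right_in V (b * A 3 2) \<Longrightarrow> right_in V (b * A 3 5) \<Longrightarrow> right_in V (b * A 3 8) \<Longrightarrow> right_in V b"
    "b * idm 4 = b \<Longrightarrow> b \<in> V \<Longrightarrow> right_in V (b * A 4 2) \<Longrightarrow> right_in V (b * A 4 5) \<Longrightarrow> right_in V b"
    "b * idm 5 = b \<Longrightarrow> b \<in> V \<Longrightarrow> right_in V (b * A 5 1) \<Longrightarrow> right_in V (b * A 5 7) \<Longrightarrow> right_in V b"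
    "b * idm 6 = b \<Longrightarrow> b \<in> V \<Longrightarrow> right_in V (b * A 6 3) \<Longrightarrow> right_in V (b * A 6 4) \<Longrightarrow> right_in V b"
    "b * idm 7 = b \<Longrightarrow> b \<in> V \<Longrightarrow> right_in V (b * A 7 3) \<Longrightarrow> right_in V b"
    "b * idm 8 = b \<Longrightarrow> b \<in> V \<Longrightarrow> right_in V (b * A 8 7) \<Longrightarrow> right_in V (b * A 8 6) \<Longrightarrow> right_in V b"
         apply (rule right_in_step[OF V, of b 1]; auto simp: arcs_Delta)
        apply (rule right_in_step[OF V, of b 2]; auto simp: arcs_Delta)
       apply (rule right_in_step[OF V, of b 3]; auto simp: arcs_Delta)
      apply (rule right_in_step[OF V, of b 4]; auto simp: arcs_Delta)
     apply (rule right_in_step[OF V, of b 5]; auto simp: arcs_Delta)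
    apply (rule right_in_step[OF V, of b 6]; auto simp: arcs_Delta)
   apply (rule right_in_step[OF V, of b 7]; auto simp: arcs_Delta)
  apply (rule right_in_step[OF V, of b 8]; auto simp: arcs_Delta)
  done

text \<open>Stated for any \<open>b\<close> ending at 1, to cover e_1 as well as
  \<open>arr Cplus\<close>, \<open>arr Cminus\<close> and \<open>A 3 2 * arr Cminus\<close>. The
  longest chain stops at \<open>A 5 7\<close>: continued by \<open>A 7 3\<close> it contains
  \<open>A 1 3 * A 3 5 * A 5 1 = A 1 3 * A 3 2 * arr Cplus\<close>, which is zero.\<close>

lemma right_in_P1:
  assumes V: "jvs.subspace V" and b: "b * idm 1 = b"
    and mem: "b \<in> V" "b * A 1 3 \<in> V" "b * A 1 4 \<in> V" "b * A 1 3 * A 3 5 \<in> V" "b * A 1 3 * A 3 8 \<in> V" "b * A 1 3 * A 3 5 * A 5 7 \<in> V"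
  shows "right_in V b"
proof -
  note s = right_in_steps[OF V] and R = jac_rules arr_mult_idm right_in_zero[OF V] right_in_uminus[OF V] mem
  have a: "Arr 1 3 \<in> arcs Delta" "Arr 1 4 \<in> arcs Delta" "Arr 3 5 \<in> arcs Delta" "Arr 3 8 \<in> arcs Delta" "Arr 5 7 \<in> arcs Delta"
    by (simp_all add: arcs_Delta)
  have 1: "right_in V (b * A 1 3 * A 3 5 * A 5 7)" by (rule s(7)) (simp_all add: R a)
  have 2: "right_in V (b * A 1 3 * A 3 5)" by (rule s(5)) (simp_all add: R a 1)
  have 3: "right_in V (b * A 1 3 * A 3 8)" by (rule s(8)) (simp_all add: R a 1)
  have 4: "right_in V (b * A 1 3)" by (rule s(3)) (simp_all add: R a 2 3)
  have 5: "right_in V (b * A 1 4)" by (rule s(4)) (simp_all add: R a 2)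
  show ?thesis by (rule s(1)) (simp_all add: b mem 4 5)
qed

text \<open>The arrow to 6 adds a single path, since its two continuations are
  \<open>arr Cplus * A 1 3\<close> and \<open>arr Cminus * A 1 4\<close>.\<close>

lemma right_in_P2:
  fixes V :: "'k::field jac set"
  assumes V: "jvs.subspace V"
    and mem: "idm 2 \<in> V" "A 2 6 \<in> V" and cp: "right_in V (arr Cplus)" and cm: "right_in V (arr Cminus)"
  shows "right_in V (idm 2)"
proof -
  note s = right_in_steps[OF V] and R = jac_rules arr_mult_idm idm_mult_arr idm_mult_idm right_in_zero[OF V] right_in_uminus[OF V] mem
  have a: "Arr 2 6 \<in> arcs Delta" "Cplus \<in> arcs Delta" "Cminus \<in> arcs Delta" by (simp_all add: arcs_Delta)
  have m: "right_in V (b * x)" if "right_in V b" for b x using that by (simp add: right_in_def mult.assoc)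
  have 1: "right_in V (A 2 6)" by (rule s(6)) (simp_all add: R a m cp cm)
  show ?thesis by (rule s(2)) (simp_all add: R a 1 cp cm)
qed

lemma right_in_P3:
  fixes V :: "'k::field jac set"
  assumes V: "jvs.subspace V"
    and mem: "idm 3 \<in> V" "A 3 2 \<in> V" "A 3 5 \<in> V" "A 3 8 \<in> V" "A 3 2 * arr Cplus \<in> V" "A 3 2 * arr Cplus * A 1 3 \<in> V"
      "A 3 2 * A 2 6 \<in> V" "A 3 5 * A 5 7 \<in> V"
    and cm: "right_in V (A 3 2 * arr Cminus)"
  shows "right_in V (idm 3)"
proof -
  note s = right_in_steps[OF V] and R = jac_rules arr_mult_idm idm_mult_arr idm_mult_idm right_in_zero[OF V] right_in_uminus[OF V] mem
  have a: "Arr 1 3 \<in> arcs Delta" "Arr 1 4 \<in> arcs Delta" "Arr 3 5 \<in> arcs Delta" "Arr 3 8 \<in> arcs Delta" "Arr 5 7 \<in> arcs Delta"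
    "Arr 2 6 \<in> arcs Delta" "Cplus \<in> arcs Delta" "Cminus \<in> arcs Delta" "Arr 3 2 \<in> arcs Delta" by (simp_all add: arcs_Delta)
  have m: "right_in V (A 3 2 * arr Cminus * x)" for x using cm by (simp add: right_in_def mult.assoc)
  have z: "A 3 2 * arr Cplus * A 1 3 * A 3 2 = (0 :: 'k jac)" unfolding mult.assoc jac_relations by simp
  have 1: "right_in V (A 3 2 * arr Cplus * A 1 3)" by (rule s(3)) (simp_all add: R a z)
  have 2: "right_in V (A 3 2 * arr Cplus)" by (rule s(1)) (simp_all add: R a 1)
  have 3: "right_in V (A 3 2 * A 2 6)" by (rule s(6)) (simp_all add: R a 1 m)
  have 4: "right_in V (A 3 2)" by (rule s(2)) (simp_all add: R a 2 3 cm)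
  have 5: "right_in V (A 3 5 * A 5 7)" by (rule s(7)) (simp_all add: R a 1)
  have 6: "right_in V (A 3 5)" by (rule s(5)) (simp_all add: R a 2 5)
  have 7: "right_in V (A 3 8)" by (rule s(8)) (simp_all add: R a 3 5)
  show ?thesis by (rule s(3)) (simp_all add: R a 4 6 7)
qed

lemma span_mult_idm:
  assumes "x \<in> jvs.span S"
  shows "x * idm u \<in> jvs.span ((\<lambda>b. b * idm u) ` S)"
  using assms
proof (induction rule: jvs.span_induct_alt)
  case base
  show ?case by (simp add: jvs.span_zero)
next
  case (step c b y)
  have "sc c * (b * idm u) + y * idm u \<in> jvs.span ((\<lambda>b. b * idm u) ` S)"
    using step(1) by (intro jvs.span_add[OF jvs.span_scale[OF jvs.span_base] step(2)]) auto
  then show ?case by (simp add: distrib_right mult.assoc)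
qed

text \<open>Right multiplication by e_u kills each spanning path that does not end at
  \<open>u\<close>; in the corners needed below one or two paths survive.\<close>

lemma corner_spanned:
  assumes "right_in (jvs.span S) (idm v)" "idm v * x = x" "x * idm u = x"
  shows "x \<in> jvs.span ((\<lambda>b. b * idm u) ` S)"
proof -
  have "x \<in> jvs.span S" using assms(1,2) unfolding right_in_def by metis
  then show ?thesis using span_mult_idm[of x S u] assms(3) by simp
qed

lemma span_two_elts: "x \<in> jvs.span {a, b} \<longleftrightarrow> (\<exists>c d. x = sc c * a + sc d * b)"
  by (auto simp: jvs.span_insert algebra_simps)

lemma span_one_elt: "x \<in> jvs.span {a} \<longleftrightarrow> (\<exists>c. x = sc c * a)"
  by (auto simp: jvs.span_insert)

definition S1 :: "'k::field jac \<Rightarrow> 'k jac set" where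
  "S1 b = {b, b * A 1 3, b * A 1 4, b * A 1 3 * A 3 5, b * A 1 3 * A 3 8, b * A 1 3 * A 3 5 * A 5 7}"

lemma S1_in: "S1 b \<subseteq> S \<Longrightarrow> b * idm 1 = b \<Longrightarrow> right_in (jvs.span S) b"
  by (rule right_in_P1) (auto simp: S1_def intro: jvs.span_base)

text \<open>The corner e_v J e_u is the space of maps from P_u to P_v, so this and the next two
  lemmas list all candidates for the entries of a general map.\<close>

lemma corner1:
  fixes x :: "'k::field jac"
  assumes "idm 1 * x = x"
  shows "x * idm 8 = x \<Longrightarrow> \<exists>c. x = sc c * (A 1 3 * A 3 8)" "x * idm 4 = x \<Longrightarrow> \<exists>c. x = sc c * A 1 4"
proof -
  have a: "Arr 1 3 \<in> arcs Delta" "Arr 1 4 \<in> arcs Delta" "Arr 3 5 \<in> arcs Delta" "Arr 3 8 \<in> arcs Delta" "Arr 5 7 \<in> arcs Delta"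
    by (simp_all add: arcs_Delta)
  have r: "right_in (jvs.span (S1 (idm 1))) (idm 1 :: 'k jac)" by (rule S1_in) (simp_all add: idm_mult_idm)
  show "\<exists>c. x = sc c * (A 1 3 * A 3 8)" if "x * idm 8 = x"
    using corner_spanned[OF r assms that]
    by (simp add: S1_def arr_mult_idm idm_mult_arr idm_mult_idm a jvs.span_insert_0 span_one_elt insert_commute)
  show "\<exists>c. x = sc c * A 1 4" if "x * idm 4 = x"
    using corner_spanned[OF r assms that]
    by (simp add: S1_def arr_mult_idm idm_mult_arr idm_mult_idm a jvs.span_insert_0 span_one_elt insert_commute)
qed

lemma corner2:
  fixes x :: "'k::field jac"
  assumes "idm 2 * x = x"
  shows "x * idm 6 = x \<Longrightarrow> \<exists>c. x = sc c * A 2 6" "x * idm 1 = x \<Longrightarrow> \<exists>c d. x = sc c * arr Cplus + sc d * arr Cminus"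
proof -
  have a: "Arr 1 3 \<in> arcs Delta" "Arr 1 4 \<in> arcs Delta" "Arr 3 5 \<in> arcs Delta" "Arr 3 8 \<in> arcs Delta" "Arr 5 7 \<in> arcs Delta"
    "Arr 2 6 \<in> arcs Delta" "Cplus \<in> arcs Delta" "Cminus \<in> arcs Delta" by (simp_all add: arcs_Delta)
  let ?S = "{idm 2, A 2 6} \<union> S1 (arr Cplus) \<union> S1 (arr Cminus :: 'k jac)"
  have r: "right_in (jvs.span ?S) (idm 2 :: 'k jac)"
    by (rule right_in_P2) (auto intro!: S1_in jvs.span_base simp: arr_mult_idm a)
  show "\<exists>c. x = sc c * A 2 6" if "x * idm 6 = x"
    using corner_spanned[OF r assms that]
    by (simp add: S1_def arr_mult_idm idm_mult_arr idm_mult_idm a jvs.span_insert_0 span_one_elt insert_commute image_Un)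
  show "\<exists>c d. x = sc c * arr Cplus + sc d * arr Cminus" if "x * idm 1 = x"
    using corner_spanned[OF r assms that]
    by (simp add: S1_def arr_mult_idm idm_mult_arr idm_mult_idm a jvs.span_insert_0 span_two_elts insert_commute image_Un) (metis add.commute)
qed

lemma corner3:
  fixes x :: "'k::field jac"
  assumes "idm 3 * x = x"
  shows "x * idm 8 = x \<Longrightarrow> \<exists>c d. x = sc c * A 3 8 + sc d * (A 3 2 * arr Cminus * A 1 3 * A 3 8)"
    "x * idm 5 = x \<Longrightarrow> \<exists>c d. x = sc c * A 3 5 + sc d * (A 3 2 * arr Cminus * A 1 3 * A 3 5)"
    "x * idm 1 = x \<Longrightarrow> \<exists>c d. x = sc c * (A 3 2 * arr Cplus) + sc d * (A 3 2 * arr Cminus)"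
proof -
  have a: "Arr 1 3 \<in> arcs Delta" "Arr 1 4 \<in> arcs Delta" "Arr 3 5 \<in> arcs Delta" "Arr 3 8 \<in> arcs Delta" "Arr 5 7 \<in> arcs Delta"
    "Arr 2 6 \<in> arcs Delta" "Cplus \<in> arcs Delta" "Cminus \<in> arcs Delta" "Arr 3 2 \<in> arcs Delta" by (simp_all add: arcs_Delta)
  let ?S = "{idm 3, A 3 2, A 3 5, A 3 8, A 3 2 * arr Cplus, A 3 2 * arr Cplus * A 1 3,
      A 3 2 * A 2 6, A 3 5 * A 5 7} \<union> S1 (A 3 2 * arr Cminus :: 'k jac)"
  have r: "right_in (jvs.span ?S) (idm 3 :: 'k jac)"
    by (rule right_in_P3) (auto intro!: S1_in jvs.span_base simp: arr_mult_idm a)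
  note R = S1_def arr_mult_idm idm_mult_arr idm_mult_idm a jvs.span_insert_0 span_two_elts insert_commute image_Un
  show "\<exists>c d. x = sc c * A 3 8 + sc d * (A 3 2 * arr Cminus * A 1 3 * A 3 8)" if "x * idm 8 = x"
    using corner_spanned[OF r assms that] by (simp add: R)
  show "\<exists>c d. x = sc c * A 3 5 + sc d * (A 3 2 * arr Cminus * A 1 3 * A 3 5)" if "x * idm 5 = x"
    using corner_spanned[OF r assms that] by (simp add: R)
  show "\<exists>c d. x = sc c * (A 3 2 * arr Cplus) + sc d * (A 3 2 * arr Cminus)" if "x * idm 1 = x"
    using corner_spanned[OF r assms that] by (simp add: R) (metis add.commute)
qed


section \<open>Morphisms to an indecomposable projective module\<close>

lemma Rep_jac_eqs:
  "x \<in> carrier J \<Longrightarrow> Rep_jac (Abs_jac x) = x" "Abs_jac (Rep_jac y) = y" "Rep_jac y \<in> carrier J"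
  by (simp_all add: Abs_jac_inverse Rep_jac_inverse Rep_jac)

lemma Rep_idm: "u \<in> {1..8} \<Longrightarrow> jac_idem Delta potW u = Rep_jac (idm u)"
  unfolding jac_idem_def idm_def by (rule Rep_toJ[symmetric]) (auto intro!: path_elt_CP simp: qpaths_Nil)

lemma Rep_arr: "a \<in> arcs Delta \<Longrightarrow> jac_arrow Delta potW a = Rep_jac (arr a)"
  unfolding jac_arrow_def arr_def Delta_simps by (rule Rep_toJ[symmetric]) (auto intro!: path_elt_CP arc_qpath)

lemma Rep_sc: "jac_scalar Delta potW c = Rep_jac (sc c)"
  unfolding jac_scalar_def sc_def by (rule Rep_toJ[symmetric]) (rule scale_carrier, rule CP.one_closed)

definition fam :: "(nat \<Rightarrow> nat) \<Rightarrow> (nat \<times> nat \<Rightarrow> 'k::field jac) \<Rightarrow> (nat, darc, 'k) pelem" where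
  "fam m r = (\<lambda>s\<in>copies Delta m. Rep_jac (r s))"

lemma finite_copies: "finite (copies Delta m)"
proof -
  have "copies Delta m = Sigma {1..8} (\<lambda>u. {..<m u})" by (auto simp: copies_def)
  then show ?thesis by simp
qed

lemma copies_verts: "s \<in> copies Delta m \<Longrightarrow> fst s \<in> {1..8}"
  by (auto simp: copies_def)

lemma fam_eq: "fam m r = fam m r' \<longleftrightarrow> (\<forall>s\<in>copies Delta m. r s = r' s)"
  unfolding fam_def by (auto simp: fun_eq_iff restrict_def Rep_jac_inject)

lemma fam_pmod: "(\<And>s. s \<in> copies Delta m \<Longrightarrow> idm (fst s) * r s = r s) \<Longrightarrow> fam m r \<in> pmod Delta potW m"
  unfolding pmod_def fam_def
proof (rule restrict_PiE_iff[THEN iffD2], rule ballI)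
  fix s assume r: "\<And>s. s \<in> copies Delta m \<Longrightarrow> idm (fst s) * r s = r s" and s: "s \<in> copies Delta m"
  have "Rep_jac (r s) = jac_idem Delta potW (fst s) \<otimes>\<^bsub>J\<^esub> Rep_jac (r s)"
    using r[OF s] unfolding Rep_idm[OF copies_verts[OF s]] by (metis times_jac.rep_eq)
  then show "Rep_jac (r s) \<in> (\<lambda>x. jac_idem Delta potW (fst s) \<otimes>\<^bsub>J\<^esub> x) ` carrier J"
    using Rep_jac_eqs(3) by blast
qed

lemma pmodE:
  assumes "x \<in> pmod Delta potW m"
  obtains r where "x = fam m r" "\<And>s. s \<in> copies Delta m \<Longrightarrow> idm (fst s) * r s = r s"
proof
  let ?r = "\<lambda>s. Abs_jac (x s)"
  have x: "x s \<in> (\<lambda>x. jac_idem Delta potW (fst s) \<otimes>\<^bsub>J\<^esub> x) ` carrier J" if "s \<in> copies Delta m" for s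
    using assms that by (auto simp: pmod_def)
  have "\<exists>y. x s = Rep_jac (idm (fst s) * y)" if s: "s \<in> copies Delta m" for s
  proof -
    obtain z where "z \<in> carrier J" "x s = jac_idem Delta potW (fst s) \<otimes>\<^bsub>J\<^esub> z" using x[OF s] by blast
    then have "x s = Rep_jac (idm (fst s) * Abs_jac z)"
      unfolding Rep_idm[OF copies_verts[OF s]] times_jac.rep_eq by (simp add: Rep_jac_eqs)
    then show ?thesis by blast
  qed
  note y = this
  have "x \<in> extensional (copies Delta m)" using assms by (auto simp: pmod_def PiE_def)
  then show "x = fam m ?r"
    unfolding fam_def using y by (intro extensionalityI[of _ "copies Delta m"]) (auto simp: Rep_jac_eqs dest!: y)
  show "idm (fst s) * ?r s = ?r s" if s: "s \<in> copies Delta m" for s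
    using y[OF s] by (auto simp: Rep_jac_eqs idm_mult_idm[OF copies_verts[OF s] copies_verts[OF s]] simp flip: mult.assoc)
qed

lemma padd_fam: "padd Delta potW m (fam m r) (fam m r') = fam m (\<lambda>s. r s + r' s)"
  by (simp add: padd_def fam_def plus_jac.rep_eq cong: restrict_cong)

lemma pact_fam: "pact Delta potW m (fam m r) (Rep_jac x) = fam m (\<lambda>s. r s * x)"
  by (simp add: pact_def fam_def times_jac.rep_eq cong: restrict_cong)

text \<open>Every weight vector considered has a single negative entry, equal to -1. So the codomain
  is one module P_v, and a map is a row of elements of e_v J e_u.\<close>

locale one_target =
  fixes m n :: "nat \<Rightarrow> nat" and v :: nat
  assumes v: "v \<in> {1..8}" and n: "\<And>u. u \<in> {1..8} \<Longrightarrow> n u = (if u = v then 1 else 0)"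
begin

lemma copies_n: "copies Delta n = {(v, 0)}"
proof -
  have "i < n u \<longleftrightarrow> u = v \<and> i = 0" if "u \<in> {1..8}" for u i using n[OF that] by auto
  then show ?thesis using v by (auto simp: copies_def)
qed

definition emb :: "'k::field jac \<Rightarrow> (nat, darc, 'k) pelem" where
  "emb x = fam n (\<lambda>_. x)"

definition ent :: "(nat, darc, 'k::field) pelem \<Rightarrow> 'k jac" where
  "ent y = Abs_jac (y (v, 0))"

lemma ent_fam [simp]: "ent (fam n r) = r (v, 0)"
  by (simp add: ent_def fam_def copies_n Rep_jac_eqs)

lemma ent_emb [simp]: "ent (emb x) = x"
  by (simp add: emb_def)

lemma fam_n: "fam n r = emb (r (v, 0))"
  unfolding emb_def fam_eq by (simp add: copies_n)

lemma emb_pmod: "idm v * x = x \<Longrightarrow> emb x \<in> pmod Delta potW n"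
  unfolding emb_def by (rule fam_pmod) (simp add: copies_n)

lemma pmod_nE:
  assumes "y \<in> pmod Delta potW n"
  shows "y = emb (ent y)" "idm v * ent y = ent y"
proof -
  obtain r where r: "y = fam n r" "\<And>s. s \<in> copies Delta n \<Longrightarrow> idm (fst s) * r s = r s" using pmodE[OF assms] by blast
  show "y = emb (ent y)" "idm v * ent y = ent y" using r(2)[of "(v, 0)"] by (simp_all add: r(1) fam_n copies_n)
qed

lemma padd_emb: "padd Delta potW n (emb x) (emb y) = emb (x + y)"
  by (simp add: emb_def padd_fam)

lemma pact_emb: "pact Delta potW n (emb x) (Rep_jac y) = emb (x * y)"
  by (simp add: emb_def pact_fam)

lemma emb_inject: "emb x = emb y \<longleftrightarrow> x = y"
  by (simp add: emb_def fam_eq copies_n)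

definition adm :: "(nat \<times> nat \<Rightarrow> 'k::field jac) \<Rightarrow> bool" where
  "adm F \<longleftrightarrow> (\<forall>s\<in>copies Delta m. idm v * F s = F s \<and> F s * idm (fst s) = F s)"

definition img :: "(nat \<times> nat \<Rightarrow> 'k::field jac) \<Rightarrow> (nat \<times> nat \<Rightarrow> 'k jac) \<Rightarrow> 'k jac" where
  "img F r = (\<Sum>s\<in>copies Delta m. F s * r s)"

text \<open>Left multiplication by the row \<open>F\<close>, which commutes with the right
  action.\<close>

definition Phi :: "(nat \<times> nat \<Rightarrow> 'k::field jac) \<Rightarrow> (nat, darc, 'k) pelem \<Rightarrow> (nat, darc, 'k) pelem" where
  "Phi F = (\<lambda>x\<in>pmod Delta potW m. emb (img F (\<lambda>s. Abs_jac (x s))))"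

text \<open>Unrelated to the list of invariants of the same name: the standard generator e_u of the
  summand \<open>s\<close>.\<close>

definition gens :: "nat \<times> nat \<Rightarrow> nat \<times> nat \<Rightarrow> 'k::field jac" where
  "gens s = (\<lambda>t. if t = s then idm (fst s) else 0)"

definition entF :: "nat \<times> nat \<Rightarrow> ((nat, darc, 'k::field) pelem \<Rightarrow> (nat, darc, 'k) pelem) \<Rightarrow> 'k jac" where
  "entF s \<phi> = ent (\<phi> (fam m (gens s)))"

lemma Phi_fam:
  assumes "\<And>s. s \<in> copies Delta m \<Longrightarrow> idm (fst s) * r s = r s"
  shows "Phi F (fam m r) = emb (img F r)"
proof -
  have "img F (\<lambda>s. Abs_jac (fam m r s)) = img F r"
    unfolding img_def by (intro sum.cong) (auto simp: fam_def Rep_jac_eqs)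
  then show ?thesis using fam_pmod[OF assms] by (simp add: Phi_def)
qed

lemma idm_img: "adm F \<Longrightarrow> idm v * img F r = img F r"
  unfolding img_def sum_distrib_left by (intro sum.cong) (auto simp: adm_def simp flip: mult.assoc)

lemma img_add: "img F (\<lambda>s. r s + r' s) = img F r + img F r'" and img_mult: "img F (\<lambda>s. r s * x) = img F r * x"
  by (simp_all add: img_def distrib_left sum.distrib sum_distrib_right mult.assoc)

lemma Phi_phom:
  fixes F :: "nat \<times> nat \<Rightarrow> 'k::field jac"
  assumes F: "adm F"
  shows "Phi F \<in> phom Delta potW m n"
  unfolding phom_def
proof (intro CollectI conjI ballI)
  show "Phi F \<in> pmod Delta potW m \<rightarrow>\<^sub>E pmod Delta potW n"
    unfolding Phi_def by (rule restrict_PiE_iff[THEN iffD2], rule ballI, rule emb_pmod, rule idm_img[OF F])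
next
  fix x y :: "(nat, darc, 'k) pelem" assume "x \<in> pmod Delta potW m" "y \<in> pmod Delta potW m"
  obtain r where r: "x = fam m r" "\<And>s. s \<in> copies Delta m \<Longrightarrow> idm (fst s) * r s = r s" using pmodE[OF \<open>x \<in> _\<close>] by blast
  obtain q where q: "y = fam m q" "\<And>s. s \<in> copies Delta m \<Longrightarrow> idm (fst s) * q s = q s" using pmodE[OF \<open>y \<in> _\<close>] by blast
  show "Phi F (padd Delta potW m x y) = padd Delta potW n (Phi F x) (Phi F y)"
    unfolding r(1) q(1) padd_fam using r(2) q(2) by (simp add: Phi_fam distrib_left img_add padd_emb)
next
  fix x :: "(nat, darc, 'k) pelem" and z :: "(nat, darc, 'k) series set" assume "x \<in> pmod Delta potW m" "z \<in> carrier J"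
  obtain r where r: "x = fam m r" "\<And>s. s \<in> copies Delta m \<Longrightarrow> idm (fst s) * r s = r s" using pmodE[OF \<open>x \<in> _\<close>] by blast
  have z: "z = Rep_jac (Abs_jac z)" using \<open>z \<in> _\<close> by (simp add: Rep_jac_eqs)
  show "Phi F (pact Delta potW m x z) = pact Delta potW n (Phi F x) z"
    unfolding r(1) pact_fam[of m r "Abs_jac z", folded z] using r(2) pact_emb[of _ "Abs_jac z", folded z]
    by (simp add: Phi_fam img_mult flip: mult.assoc)
qed

lemma gens_idm: "s \<in> copies Delta m \<Longrightarrow> idm (fst t) * gens s t = gens s t"
  using idm_mult_idm[OF copies_verts copies_verts, of s m s m] by (auto simp: gens_def)

lemma entF_Phi:
  assumes F: "adm F" and s: "s \<in> copies Delta m"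
  shows "entF s (Phi F) = F s"
proof -
  have "img F (gens s) = (\<Sum>t\<in>copies Delta m. if t = s then F s else 0)"
    unfolding img_def using F by (intro sum.cong) (auto simp: gens_def adm_def)
  then show ?thesis unfolding entF_def using Phi_fam[OF gens_idm[OF s], of F] s finite_copies by simp
qed

lemma phom_adm:
  fixes \<phi> :: "(nat, darc, 'k::field) pelem \<Rightarrow> (nat, darc, 'k) pelem"
  assumes \<phi>: "\<phi> \<in> phom Delta potW m n"
  shows "adm (\<lambda>s. entF s \<phi>)"
  unfolding adm_def
proof (intro ballI conjI)
  fix s assume s: "s \<in> copies Delta m"
  have g: "(fam m (gens s) :: (nat, darc, 'k) pelem) \<in> pmod Delta potW m" using gens_idm[OF s] by (rule fam_pmod)
  then have p: "\<phi> (fam m (gens s)) \<in> pmod Delta potW n" using \<phi> by (auto simp: phom_def)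
  show "idm v * entF s \<phi> = entF s \<phi>" unfolding entF_def using pmod_nE(2)[OF p] .
  have eq: "(fam m (gens s) :: (nat, darc, 'k) pelem) = pact Delta potW m (fam m (gens s)) (Rep_jac (idm (fst s)))"
    unfolding pact_fam fam_eq by (auto simp: gens_def idm_mult_idm[OF copies_verts[OF s] copies_verts[OF s]])
  have "\<phi> (pact Delta potW m (fam m (gens s)) (Rep_jac (idm (fst s)))) = pact Delta potW n (\<phi> (fam m (gens s))) (Rep_jac (idm (fst s)))"
    using \<phi> g Rep_jac_eqs(3) unfolding phom_def by blast
  then have "\<phi> (fam m (gens s)) = pact Delta potW n (\<phi> (fam m (gens s))) (Rep_jac (idm (fst s)))"
    by (simp only: eq[symmetric])
  then have "emb (entF s \<phi>) = emb (entF s \<phi> * idm (fst s))"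
    unfolding entF_def using pmod_nE(1)[OF p] pact_emb by metis
  then show "entF s \<phi> * idm (fst s) = entF s \<phi>" by (simp add: emb_inject)
qed

text \<open>An element of the domain is a finite sum of standard generators times ring elements;
  additivity and linearity are applied one summand at a time.\<close>

lemma phom_Phi:
  fixes \<phi> :: "(nat, darc, 'k::field) pelem \<Rightarrow> (nat, darc, 'k) pelem"
  assumes \<phi>: "\<phi> \<in> phom Delta potW m n"
  shows "\<phi> = Phi (\<lambda>s. entF s \<phi>)"
proof (rule extensionalityI[of _ "pmod Delta potW m"])
  show "\<phi> \<in> extensional (pmod Delta potW m)" using \<phi> by (auto simp: phom_def PiE_def)
  show "Phi (\<lambda>s. entF s \<phi>) \<in> extensional (pmod Delta potW m)" by (simp add: Phi_def)
  fix x :: "(nat, darc, 'k) pelem" assume "x \<in> pmod Delta potW m"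
  obtain r where r: "x = fam m r" "\<And>s. s \<in> copies Delta m \<Longrightarrow> idm (fst s) * r s = r s" using pmodE[OF \<open>x \<in> _\<close>] by blast
  have mem: "fam m q \<in> pmod Delta potW m \<Longrightarrow> \<phi> (fam m q) \<in> pmod Delta potW n" for q using \<phi> by (auto simp: phom_def)
  have add: "\<phi> (padd Delta potW m x y) = padd Delta potW n (\<phi> x) (\<phi> y)" if "x \<in> pmod Delta potW m" "y \<in> pmod Delta potW m" for x y
    using \<phi> that unfolding phom_def by blast
  have act: "\<phi> (pact Delta potW m x (Rep_jac z)) = pact Delta potW n (\<phi> x) (Rep_jac z)" if "x \<in> pmod Delta potW m" for x z
    using \<phi> that Rep_jac_eqs(3) unfolding phom_def by blast
  have "\<phi> (fam m (\<lambda>s. if s \<in> S then r s else 0)) = emb (\<Sum>s\<in>S. entF s \<phi> * r s)" if "S \<subseteq> copies Delta m" for S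
  proof -
    have "finite S" using that finite_copies finite_subset by blast
    then show ?thesis using that
    proof induction
      case empty
      have z: "(fam m (\<lambda>s. 0) :: (nat, darc, 'k) pelem) \<in> pmod Delta potW m" by (rule fam_pmod) simp
      have "\<phi> (fam m (\<lambda>s. 0)) = pact Delta potW n (\<phi> (fam m (\<lambda>s. 0))) (Rep_jac 0)"
        using act[OF z, of 0] unfolding pact_fam by simp
      also have "\<dots> = emb 0" using pact_emb[of "ent (\<phi> (fam m (\<lambda>s. 0)))" 0] pmod_nE(1)[OF mem[OF z]] by simp
      finally show ?case by simp
    next
      case (insert s S)
      have s: "s \<in> copies Delta m" using insert by auto
      let ?q = "\<lambda>t. if t \<in> S then r t else 0"
      have q: "fam m ?q \<in> pmod Delta potW m" by (rule fam_pmod) (use r(2) in auto)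
      have g: "(fam m (gens s) :: (nat, darc, 'k) pelem) \<in> pmod Delta potW m" using gens_idm[OF s] by (rule fam_pmod)
      have gr: "fam m (\<lambda>t. gens s t * r s) \<in> pmod Delta potW m"
        by (rule fam_pmod) (simp add: gens_idm[OF s] flip: mult.assoc)
      have "fam m (\<lambda>t. if t \<in> insert s S then r t else 0) = padd Delta potW m (fam m ?q) (fam m (\<lambda>t. gens s t * r s))"
        unfolding padd_fam fam_eq using insert(2) r(2)[OF s] by (auto simp: gens_def)
      then have "\<phi> (fam m (\<lambda>t. if t \<in> insert s S then r t else 0)) = padd Delta potW n (\<phi> (fam m ?q)) (\<phi> (fam m (\<lambda>t. gens s t * r s)))"
        using add[OF q gr] by simp
      also have "\<phi> (fam m (\<lambda>t. gens s t * r s)) = emb (entF s \<phi> * r s)"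
        using act[OF g, of "r s"] pmod_nE(1)[OF mem[OF g]] pact_emb[of "entF s \<phi>" "r s"] by (simp add: pact_fam entF_def)
      also have "\<phi> (fam m ?q) = emb (\<Sum>s\<in>S. entF s \<phi> * r s)" using insert by auto
      finally show ?case using insert(1,2) by (simp add: padd_emb add.commute)
    qed
  qed
  from this[OF order_refl] have "\<phi> (fam m (\<lambda>s. if s \<in> copies Delta m then r s else 0)) = emb (img (\<lambda>s. entF s \<phi>) r)"
    by (simp add: img_def)
  moreover have "fam m (\<lambda>s. if s \<in> copies Delta m then r s else 0) = x" unfolding r(1) fam_eq by simp
  ultimately show "\<phi> x = Phi (\<lambda>s. entF s \<phi>) x" using Phi_fam[OF r(2)] r(1) by simp
qed

lemma Phi_comb:
  shows "(\<lambda>x\<in>pmod Delta potW m. padd Delta potW n (Phi F x) (Phi G x)) = Phi (\<lambda>s. F s + G s)"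
    "(\<lambda>x\<in>pmod Delta potW m. pact Delta potW n (Phi F x) (jac_scalar Delta potW c)) = Phi (\<lambda>s. sc c * F s)"
  by (auto simp: Phi_def padd_emb Rep_sc pact_emb img_def distrib_right sum.distrib sum_distrib_left sc_commute mult.assoc
      intro!: restrict_ext)

lemma adm_comb: "adm F \<Longrightarrow> adm G \<Longrightarrow> adm (\<lambda>s. F s + G s)" "adm F \<Longrightarrow> adm (\<lambda>s. sc c * F s)"
  by (auto simp: adm_def distrib_left distrib_right sc_left_commute mult.assoc)

lemma phom_eq: "\<phi> \<in> phom Delta potW m n \<longleftrightarrow> (\<exists>F. adm F \<and> \<phi> = Phi F)"
  using phom_adm phom_Phi Phi_phom by blast

text \<open>Coefficients at good words depend linearly on the map, so polynomials in them may define
  the open sets of general maps.\<close>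

lemma coef_functional:
  assumes w: "w \<in> good_words" and s: "s \<in> copies Delta m"
  shows "(\<lambda>\<phi>. coefJ u w (entF s \<phi> :: 'k::field jac)) \<in> phom_functionals Delta potW m n"
  unfolding phom_functionals_def
proof (intro CollectI conjI ballI allI)
  fix \<phi> \<psi> :: "(nat, darc, 'k) pelem \<Rightarrow> (nat, darc, 'k) pelem" and c :: 'k
  assume "\<phi> \<in> phom Delta potW m n"
  then obtain F where F: "adm F" "\<phi> = Phi F" unfolding phom_eq by blast
  show "coefJ u w (entF s (\<lambda>x\<in>pmod Delta potW m. pact Delta potW n (\<phi> x) (jac_scalar Delta potW c))) = c * coefJ u w (entF s \<phi>)"
    unfolding F(2) Phi_comb using F(1) by (simp add: entF_Phi adm_comb s coefJ_sc w)
  assume "\<psi> \<in> phom Delta potW m n"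
  then obtain G where G: "adm G" "\<psi> = Phi G" unfolding phom_eq by blast
  show "coefJ u w (entF s (\<lambda>x\<in>pmod Delta potW m. padd Delta potW n (\<phi> x) (\<psi> x))) = coefJ u w (entF s \<phi>) + coefJ u w (entF s \<psi>)"
    unfolding F(2) G(2) Phi_comb using F(1) G(1) by (simp add: entF_Phi adm_comb s coefJ_add w)
qed

text \<open>Two maps are joined by the line \<open>\<gamma>\<close>, along which linear functionals
  are polynomial; so two nonempty open sets have a common map. This yields uniqueness in the
  description of \<open>CW\<close>.\<close>

lemma general_hom_meet:
  fixes P Q :: "((nat, darc, 'k::field_char_0) pelem \<Rightarrow> (nat, darc, 'k) pelem) \<Rightarrow> bool"
  assumes "general_hom Delta potW m n P" "general_hom Delta potW m n Q"
  shows "\<exists>\<phi>\<in>phom Delta potW m n. P \<phi> \<and> Q \<phi>"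
proof -
  let ?L = "phom_functionals Delta potW m n"
  obtain p \<phi> where p: "p \<in> poly_functions ?L" "\<phi> \<in> phom Delta potW m n" "p \<phi> \<noteq> 0" "\<forall>\<phi>\<in>phom Delta potW m n. p \<phi> \<noteq> 0 \<longrightarrow> P \<phi>"
    using assms(1) unfolding general_hom_def by blast
  obtain q \<psi> where q: "q \<in> poly_functions ?L" "\<psi> \<in> phom Delta potW m n" "q \<psi> \<noteq> 0" "\<forall>\<phi>\<in>phom Delta potW m n. q \<phi> \<noteq> 0 \<longrightarrow> Q \<phi>"
    using assms(2) unfolding general_hom_def by blast
  obtain F G where F: "adm F" "\<phi> = Phi F" and G: "adm G" "\<psi> = Phi G" using p(2) q(2) unfolding phom_eq by blast
  define \<gamma> where "\<gamma> t = Phi (\<lambda>s. sc (1 - t) * F s + sc t * G s)" for t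
  have \<gamma>: "\<gamma> t \<in> phom Delta potW m n" for t unfolding \<gamma>_def using F(1) G(1) by (intro Phi_phom adm_comb)
  have l: "\<exists>r. \<forall>t. l (\<gamma> t) = poly r t" if "l \<in> ?L" for l
  proof -
    have lin: "l (Phi (\<lambda>s. F s + G s)) = l (Phi F) + l (Phi G)" if "adm F" "adm G" for F G
      using Phi_phom[OF that(1)] Phi_phom[OF that(2)] \<open>l \<in> ?L\<close> unfolding phom_functionals_def Phi_comb[symmetric] by blast
    have scl: "l (Phi (\<lambda>s. sc c * F s)) = c * l (Phi F)" if "adm F" for F c
      using Phi_phom[OF that] \<open>l \<in> ?L\<close> unfolding phom_functionals_def Phi_comb[symmetric] by blast
    have "l (\<gamma> t) = (1 - t) * l (Phi F) + t * l (Phi G)" for t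
      unfolding \<gamma>_def by (simp only: lin scl adm_comb F(1) G(1))
    then have "\<forall>t. l (\<gamma> t) = poly [:l (Phi F), l (Phi G) - l (Phi F):] t" by (simp add: algebra_simps)
    then show ?thesis by blast
  qed
  have e: "\<gamma> 0 = Phi F" "\<gamma> 1 = Phi G" by (simp_all add: \<gamma>_def)
  have "p (\<gamma> 0) \<noteq> 0" "q (\<gamma> 1) \<noteq> 0" using p(3) q(3) by (simp_all add: e F(2) G(2))
  then have "\<exists>t. p (\<gamma> t) \<noteq> 0 \<and> q (\<gamma> t) \<noteq> 0"
    using poly_functions_common_nonzero[OF p(1) q(1), of \<gamma> 0 1] l by simp
  then show ?thesis using p(4) q(4) \<gamma> by blast
qed

end


section \<open>Cokernels and their dimension vectors\<close>

definition dimvec :: "nat \<Rightarrow> nat \<Rightarrow> nat \<Rightarrow> nat \<Rightarrow> nat" where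
  "dimvec a b c = (\<lambda>u. if u = 1 then a else if u = 2 then b else if u = 3 then c else 0)"

lemma cluster_char_rep_eq:
  "cluster_char_rep g d M = (\<Prod>u\<in>{1..8}. xv u powi g u) * (\<Sum>a\<le>d 1. \<Sum>b\<le>d 2. \<Sum>c\<le>d 3.
     of_int (quot_grass_euler Delta d M (dimvec a b c)) * (yv 1 ^ a * yv 2 ^ b * yv 3 ^ c))"
proof -
  let ?f = "\<lambda>e. of_int (quot_grass_euler Delta d M e) * (\<Prod>u\<in>mutables. yv u ^ e u) :: 'a kpoly fract"
  have "(\<Sum>e | \<forall>u. e u \<le> (if u \<in> mutables then d u else 0). ?f e)
      = (\<Sum>(a, b, c)\<in>{..d 1} \<times> {..d 2} \<times> {..d 3}. ?f (dimvec a b c))"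
  proof (rule sum.reindex_bij_witness[of _ "\<lambda>(a, b, c). dimvec a b c" "\<lambda>e. (e 1, e 2, e 3)"])
    fix e assume "e \<in> {e. \<forall>u. e u \<le> (if u \<in> mutables then d u else 0)}"
    then have e: "e u \<le> (if u \<in> mutables then d u else 0)" for u by blast
    have "e x = 0" if "x \<notin> {1, 2, 3}" for x using e[of x] that by (simp add: mutables_def)
    then show "(case (e 1, e 2, e 3) of (a, b, c) \<Rightarrow> dimvec a b c) = e"
      by (auto simp: dimvec_def fun_eq_iff)
    then show "(case (e 1, e 2, e 3) of (a, b, c) \<Rightarrow> ?f (dimvec a b c)) = ?f e" by simp
    show "(e 1, e 2, e 3) \<in> {..d 1} \<times> {..d 2} \<times> {..d 3}"
      using e[of 1] e[of 2] e[of 3] by (simp add: mutables_def)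
  qed (auto simp: dimvec_def mutables_def)
  also have "\<dots> = (\<Sum>a\<le>d 1. \<Sum>b\<le>d 2. \<Sum>c\<le>d 3. ?f (dimvec a b c))"
    by (simp add: sum.cartesian_product)
  finally show ?thesis unfolding cluster_char_rep_def Delta_simps
    by (simp add: mutables_def dimvec_def mult.assoc)
qed

text \<open>Two mutually inverse rectangular matrices are square: compare the traces of the two products.\<close>

lemma trace_dim_eq:
  fixes x :: "nat \<Rightarrow> nat \<Rightarrow> 'k::field_char_0"
  assumes "\<And>k j. k < d \<Longrightarrow> j < d \<Longrightarrow> (\<Sum>i<n. x i j * y k i) = of_bool (k = j)"
    and "\<And>i l. i < n \<Longrightarrow> l < n \<Longrightarrow> (\<Sum>j<d. y j l * x i j) = of_bool (i = l)"
  shows "d = n"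
proof -
  have "of_nat d = (\<Sum>k<d. \<Sum>i<n. x i k * y k i)" using assms(1) by simp
  also have "\<dots> = (\<Sum>i<n. \<Sum>k<d. y k i * x i k)" by (subst sum.swap) (simp add: mult.commute)
  also have "\<dots> = of_nat n" using assms(2) by simp
  finally show ?thesis by simp
qed

context one_target
begin

definition corner :: "nat \<Rightarrow> 'k::field jac set" where
  "corner u = {y. idm v * y = y \<and> y * idm u = y}"

definition Im :: "(nat \<times> nat \<Rightarrow> 'k::field jac) \<Rightarrow> 'k jac set" where
  "Im F = range (img F)"

lemma corner_closed:
  "x \<in> corner u \<Longrightarrow> y \<in> corner u \<Longrightarrow> x + y \<in> corner u" "x \<in> corner u \<Longrightarrow> y \<in> corner u \<Longrightarrow> x - y \<in> corner u"
  "x \<in> corner u \<Longrightarrow> sc c * x \<in> corner u" "0 \<in> corner u"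
  by (auto simp: corner_def distrib_left distrib_right left_diff_distrib right_diff_distrib sc_left_commute mult.assoc)

lemma corner_sum: "(\<And>i. i \<in> S \<Longrightarrow> f i \<in> corner u) \<Longrightarrow> (\<Sum>i\<in>S. f i) \<in> corner u"
  by (induction S rule: infinite_finite_induct) (auto intro: corner_closed)

lemma corner_arr: "a \<in> arcs Delta \<Longrightarrow> y \<in> corner (dtail a) \<Longrightarrow> y * arr a \<in> corner (dhead a)"
  by (auto simp: corner_def arr_idm mult.assoc simp flip: mult.assoc[of "idm v"])

lemma right_ideal_Im: "right_ideal (Im F)"
  unfolding right_ideal_def
proof (intro conjI ballI allI)
  show "b * x \<in> Im F" if "b \<in> Im F" for b x
    using that unfolding Im_def by (auto simp flip: img_mult)
  show "jvs.subspace (Im F)"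
  proof (rule jvs.subspaceI)
    have "img F (\<lambda>s. 0) = 0" by (simp add: img_def)
    then show "0 \<in> Im F" unfolding Im_def by (metis rangeI)
    show "x + y \<in> Im F" if "x \<in> Im F" "y \<in> Im F" for x y
      using that unfolding Im_def by (auto simp flip: img_add)
    show "sc c * x \<in> Im F" if "x \<in> Im F" for c x
      using that unfolding Im_def by (auto simp flip: img_mult sc_commute)
  qed
qed

lemma Im_gen: "s \<in> copies Delta m \<Longrightarrow> F s \<in> Im F"
proof -
  assume s: "s \<in> copies Delta m"
  have "img F (\<lambda>t. if t = s then 1 else 0) = (\<Sum>t\<in>copies Delta m. if t = s then F s else 0)"
    unfolding img_def by (intro sum.cong) auto
  then have "img F (\<lambda>t. if t = s then 1 else 0) = F s" using s finite_copies by simp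
  then show ?thesis unfolding Im_def by (metis rangeI)
qed

lemma Im_Phi:
  fixes F :: "nat \<times> nat \<Rightarrow> 'k::field jac"
  assumes F: "adm F"
  shows "emb y \<in> Phi F ` pmod Delta potW m \<longleftrightarrow> y \<in> Im F"
proof
  assume "emb y \<in> Phi F ` pmod Delta potW m"
  then obtain x where x: "x \<in> pmod Delta potW m" "emb y = Phi F x" by blast
  obtain r where "x = fam m r" "\<And>s. s \<in> copies Delta m \<Longrightarrow> idm (fst s) * r s = r s" using pmodE[OF x(1)] by blast
  then show "y \<in> Im F" using x(2) by (simp add: Phi_fam emb_inject Im_def)
next
  assume "y \<in> Im F"
  then obtain r where r: "y = img F r" by (auto simp: Im_def)
  let ?r = "\<lambda>s. idm (fst s) * r s"
  have i: "idm (fst s) * ?r s = ?r s" if "s \<in> copies Delta m" for s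
    by (simp add: idm_mult_idm[OF copies_verts[OF that] copies_verts[OF that]] flip: mult.assoc)
  have "img F ?r = y" unfolding r img_def using F by (intro sum.cong) (auto simp: adm_def simp flip: mult.assoc)
  then have "emb y = Phi F (fam m ?r)" using Phi_fam[of ?r F] i by simp
  moreover have "fam m ?r \<in> pmod Delta potW m" using fam_pmod[of m ?r] i by simp
  ultimately show "emb y \<in> Phi F ` pmod Delta potW m" by (rule image_eqI)
qed

lemma corner_image:
  assumes u: "u \<in> {1..8}"
  shows "(\<lambda>y. pact Delta potW n y (jac_idem Delta potW u)) ` pmod Delta potW n = emb ` (corner u :: 'k::field jac set)"
proof -
  have "pact Delta potW n y (jac_idem Delta potW u) \<in> emb ` corner u" if y: "y \<in> pmod Delta potW n" for y :: "(nat, darc, 'k) pelem"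
  proof -
    have "pact Delta potW n y (jac_idem Delta potW u) = emb (ent y * idm u)"
      using pact_emb[of "ent y" "idm u"] pmod_nE(1)[OF y] by (simp add: Rep_idm[OF u])
    moreover have "ent y * idm u \<in> corner u"
      using pmod_nE(2)[OF y] by (auto simp: corner_def mult.assoc idm_mult_idm[OF u u] simp flip: mult.assoc[of "idm v"])
    ultimately show ?thesis by blast
  qed
  moreover have "emb x \<in> (\<lambda>y. pact Delta potW n y (jac_idem Delta potW u)) ` pmod Delta potW n" if x: "x \<in> corner u" for x :: "'k jac"
  proof (rule image_eqI)
    show "emb x \<in> pmod Delta potW n" using x by (intro emb_pmod) (simp add: corner_def)
    show "emb x = pact Delta potW n (emb x) (jac_idem Delta potW u)" using x by (simp add: Rep_idm[OF u] pact_emb corner_def)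
  qed
  ultimately show ?thesis by blast
qed

text \<open>\<open>is_coker\<close> transported along the identification of the vertex spaces of the
  codomain with the corners e_v J e_u.\<close>

definition coker_map :: "(nat \<times> nat \<Rightarrow> 'k::field jac) \<Rightarrow> (nat \<Rightarrow> nat) \<Rightarrow> (darc \<Rightarrow> 'k mat) \<Rightarrow> (nat \<Rightarrow> 'k jac \<Rightarrow> 'k vec) \<Rightarrow> bool" where
  "coker_map F d M \<rho> \<longleftrightarrow>
     (\<forall>u\<in>{1..8}. \<rho> u ` corner u = carrier_vec (d u) \<and>
       (\<forall>x\<in>corner u. \<forall>y\<in>corner u. \<rho> u (x + y) = \<rho> u x + \<rho> u y) \<and>
       (\<forall>y\<in>corner u. \<forall>c. \<rho> u (sc c * y) = c \<cdot>\<^sub>v \<rho> u y) \<and>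
       (\<forall>y\<in>corner u. \<rho> u y = 0\<^sub>v (d u) \<longleftrightarrow> y \<in> Im F)) \<and>
     (\<forall>a\<in>arcs Delta. \<forall>y\<in>corner (dtail a). \<rho> (dhead a) (y * arr a) = (M a)\<^sup>T *\<^sub>v \<rho> (dtail a) y)"

lemma is_coker_iff:
  fixes F :: "nat \<times> nat \<Rightarrow> 'k::field jac"
  assumes F: "adm F"
  shows "is_coker Delta potW m n (Phi F) d M \<longleftrightarrow> is_rep Delta d M \<and> (\<exists>\<rho>. coker_map F d M \<rho>)"
proof -
  let ?Y = "\<lambda>u. (\<lambda>y. pact Delta potW n y (jac_idem Delta potW u)) ` pmod Delta potW n :: (nat, darc, 'k) pelem set"
  let ?Q = "\<lambda>\<pi> :: nat \<Rightarrow> (nat, darc, 'k) pelem \<Rightarrow> 'k vec. (\<forall>u \<in> verts Delta.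
           \<pi> u ` ?Y u = carrier_vec (d u) \<and>
           (\<forall>x \<in> ?Y u. \<forall>y \<in> ?Y u. \<pi> u (padd Delta potW n x y) = \<pi> u x + \<pi> u y) \<and>
           (\<forall>y \<in> ?Y u. \<forall>c. \<pi> u (pact Delta potW n y (jac_scalar Delta potW c)) = c \<cdot>\<^sub>v \<pi> u y) \<and>
           (\<forall>y \<in> ?Y u. \<pi> u y = 0\<^sub>v (d u) \<longleftrightarrow> y \<in> Phi F ` pmod Delta potW m)) \<and>
        (\<forall>a \<in> arcs Delta. \<forall>y \<in> ?Y (tail Delta a).
           \<pi> (head Delta a) (pact Delta potW n y (jac_arrow Delta potW a)) = (M a)\<^sup>T *\<^sub>v \<pi> (tail Delta a) y)"
  have Q: "?Q \<pi> \<longleftrightarrow> coker_map F d M (\<lambda>u x. \<pi> u (emb x))" for \<pi>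
  proof -
    have A: "(\<forall>u \<in> {1..8}.
           \<pi> u ` ?Y u = carrier_vec (d u) \<and>
           (\<forall>x \<in> ?Y u. \<forall>y \<in> ?Y u. \<pi> u (padd Delta potW n x y) = \<pi> u x + \<pi> u y) \<and>
           (\<forall>y \<in> ?Y u. \<forall>c. \<pi> u (pact Delta potW n y (jac_scalar Delta potW c)) = c \<cdot>\<^sub>v \<pi> u y) \<and>
           (\<forall>y \<in> ?Y u. \<pi> u y = 0\<^sub>v (d u) \<longleftrightarrow> y \<in> Phi F ` pmod Delta potW m)) \<longleftrightarrow>
       (\<forall>u\<in>{1..8}. (\<lambda>x. \<pi> u (emb x)) ` corner u = carrier_vec (d u) \<and>
       (\<forall>x\<in>corner u. \<forall>y\<in>corner u. \<pi> u (emb (x + y)) = \<pi> u (emb x) + \<pi> u (emb y)) \<and>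
       (\<forall>y\<in>corner u. \<forall>c. \<pi> u (emb (sc c * y)) = c \<cdot>\<^sub>v \<pi> u (emb y)) \<and>
       (\<forall>y\<in>corner u. \<pi> u (emb y) = 0\<^sub>v (d u) \<longleftrightarrow> y \<in> Im F))"
      by (intro ball_cong refl) (simp add: corner_image ball_simps(9) image_image padd_emb Rep_sc pact_emb sc_commute Im_Phi[OF F])
    have B: "(\<forall>a \<in> arcs Delta. \<forall>y \<in> ?Y (dtail a).
           \<pi> (dhead a) (pact Delta potW n y (jac_arrow Delta potW a)) = (M a)\<^sup>T *\<^sub>v \<pi> (dtail a) y) \<longleftrightarrow>
       (\<forall>a\<in>arcs Delta. \<forall>y\<in>corner (dtail a). \<pi> (dhead a) (emb (y * arr a)) = (M a)\<^sup>T *\<^sub>v \<pi> (dtail a) (emb y))"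
    proof (intro ball_cong refl)
      fix a assume a: "a \<in> arcs Delta"
      show "(\<forall>y \<in> ?Y (dtail a). \<pi> (dhead a) (pact Delta potW n y (jac_arrow Delta potW a)) = (M a)\<^sup>T *\<^sub>v \<pi> (dtail a) y) \<longleftrightarrow>
          (\<forall>y\<in>corner (dtail a). \<pi> (dhead a) (emb (y * arr a)) = (M a)\<^sup>T *\<^sub>v \<pi> (dtail a) (emb y))"
        unfolding corner_image[OF dtail_verts[OF a]] Rep_arr[OF a] by (simp add: pact_emb)
    qed
    show ?thesis unfolding coker_map_def Delta_simps by (rule conj_cong[OF A B])
  qed
  have "(\<exists>\<pi>. ?Q \<pi>) \<longleftrightarrow> (\<exists>\<rho>. coker_map F d M \<rho>)"
  proof
    assume "\<exists>\<pi>. ?Q \<pi>"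
    then show "\<exists>\<rho>. coker_map F d M \<rho>" unfolding Q by blast
  next
    assume "\<exists>\<rho>. coker_map F d M \<rho>"
    then obtain \<rho> where \<rho>: "coker_map F d M \<rho>" ..
    show "\<exists>\<pi>. ?Q \<pi>"
      by (rule exI[of _ "\<lambda>u y. \<rho> u (ent y)"], rule Q[of "\<lambda>u y. \<rho> u (ent y)", THEN iffD2]) (simp add: \<rho>)
  qed
  then show ?thesis unfolding is_coker_def Let_def by simp
qed

text \<open>A basis of each corner modulo the image, certified by dual functionals whose common
  kernel is the image. The first claim reads off matrices in this basis; the second shows that every
  other presentation has the same dimensions.\<close>

lemma coker_basis:
  fixes F :: "nat \<times> nat \<Rightarrow> 'k::field_char_0 jac"
  assumes b: "\<And>u i. u \<in> {1..8} \<Longrightarrow> i < d0 u \<Longrightarrow> b u i \<in> corner u"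
    and f_add: "\<And>u i x y. u \<in> {1..8} \<Longrightarrow> i < d0 u \<Longrightarrow> f u i (x + y) = f u i x + (f u i y :: 'k)"
    and f_sc: "\<And>u i c x. u \<in> {1..8} \<Longrightarrow> i < d0 u \<Longrightarrow> f u i (sc c * x) = c * f u i x"
    and fb: "\<And>u i j. u \<in> {1..8} \<Longrightarrow> i < d0 u \<Longrightarrow> j < d0 u \<Longrightarrow> f u i (b u j) = of_bool (i = j)"
    and ker: "\<And>u y. u \<in> {1..8} \<Longrightarrow> y \<in> corner u \<Longrightarrow> (\<forall>i<d0 u. f u i y = 0) \<longleftrightarrow> y \<in> Im F"
  shows "\<exists>M. is_rep Delta d0 M \<and> (\<exists>\<rho>. coker_map F d0 M \<rho>)"
    and "coker_map F d M \<rho> \<Longrightarrow> u \<in> {1..8} \<Longrightarrow> d u = d0 u"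
proof -
  have f0: "f u i 0 = 0" if "u \<in> {1..8}" "i < d0 u" for u i using f_sc[OF that, of 0 0] by simp
  have f_sum: "f u i (\<Sum>j\<in>S. g j) = (\<Sum>j\<in>S. f u i (g j))" if "u \<in> {1..8}" "i < d0 u" for u i and S :: "nat set" and g :: "nat \<Rightarrow> 'k jac"
    by (induction S rule: infinite_finite_induct) (simp_all add: f_add[OF that] f0[OF that])
  have f_diff: "f u i (x - y) = f u i x - (f u i y :: 'k)" if "u \<in> {1..8}" "i < d0 u" for u i x y
    using f_add[OF that, of "x - y" y] by simp
  define lc where "lc u c = (\<Sum>j<d0 u. sc (c j) * b u j)" for u c
  have lc: "lc u c \<in> corner u" if "u \<in> {1..8}" for u c
    unfolding lc_def using b that by (intro corner_sum corner_closed) auto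
  have f_lc: "f u i (lc u c) = c i" if "u \<in> {1..8}" "i < d0 u" for u i c
    unfolding lc_def using that by (simp add: f_sum f_sc fb)
  note RI = right_idealD[OF right_ideal_Im]
  show "\<exists>M. is_rep Delta d0 M \<and> (\<exists>\<rho>. coker_map F d0 M \<rho>)"
  proof (intro exI conjI)
    \<comment> \<open>Row \<open>i\<close> holds the coordinates of the \<open>i\<close>-th basis
      element times the arrow, because \<open>is_coker\<close> applies the transpose.\<close>
    let ?M = "\<lambda>a. mat (d0 (dtail a)) (d0 (dhead a)) (\<lambda>(i, j). f (dhead a) j (b (dtail a) i * arr a))"
    let ?r = "\<lambda>u y. vec (d0 u) (\<lambda>i. f u i y)"
    show "is_rep Delta d0 ?M" by (simp add: is_rep_def)
    show "coker_map F d0 ?M ?r" unfolding coker_map_def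
    proof (intro conjI ballI allI)
      fix u :: nat assume u: "u \<in> {1..8}"
      show "?r u ` corner u = carrier_vec (d0 u)"
      proof (intro equalityI subsetI)
        fix w :: "'k vec" assume w: "w \<in> carrier_vec (d0 u)"
        show "w \<in> ?r u ` corner u"
          by (rule image_eqI[OF _ lc[OF u, of "\<lambda>i. w $ i"]]) (use w in \<open>auto simp: f_lc[OF u]\<close>)
      qed auto
      fix y :: "'k jac" assume y: "y \<in> corner u"
      show "?r u (x + y) = ?r u x + ?r u y" for x by (auto simp: f_add[OF u])
      show "?r u (sc c * y) = c \<cdot>\<^sub>v ?r u y" for c by (auto simp: f_sc[OF u])
      show "?r u y = 0\<^sub>v (d0 u) \<longleftrightarrow> y \<in> Im F" using ker[OF u y] by (auto simp: vec_eq_iff)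
    next
      fix a and y :: "'k jac" assume a: "a \<in> arcs Delta" and y: "y \<in> corner (dtail a)"
      let ?s = "dtail a" and ?t = "dhead a"
      note s = dtail_verts[OF a] and t = dhead_verts[OF a]
      let ?z = "lc ?s (\<lambda>i. f ?s i y)"
      have "y - ?z \<in> Im F"
        using ker[OF s corner_closed(2)[OF y lc[OF s, of "\<lambda>i. f ?s i y"]]] by (simp add: f_diff[OF s] f_lc[OF s])
      then have I: "(y - ?z) * arr a \<in> Im F" by (rule RI(2))
      have "(y - ?z) * arr a \<in> corner ?t" using corner_arr[OF a corner_closed(2)[OF y lc[OF s]]] .
      then have "f ?t j ((y - ?z) * arr a) = 0" if "j < d0 ?t" for j using ker[OF t] I that by blast
      then have "f ?t j (y * arr a) = f ?t j (?z * arr a)" if "j < d0 ?t" for j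
        using that f_diff[OF t that, of "y * arr a" "?z * arr a"] by (simp add: left_diff_distrib)
      moreover have "f ?t j (?z * arr a) = (\<Sum>i<d0 ?s. f ?s i y * f ?t j (b ?s i * arr a))" if "j < d0 ?t" for j
        unfolding lc_def sum_distrib_right using that by (simp add: f_sum[OF t] f_sc[OF t] mult.assoc)
      ultimately show "?r ?t (y * arr a) = (?M a)\<^sup>T *\<^sub>v ?r ?s y"
        by (auto simp: scalar_prod_def lessThan_atLeast0 mult.commute intro!: sum.cong)
    qed
  qed
  assume co: "coker_map F d M \<rho>" and u: "u \<in> {1..8}"
  have \<rho>: "\<rho> u ` corner u = carrier_vec (d u)" "\<And>x y. x \<in> corner u \<Longrightarrow> y \<in> corner u \<Longrightarrow> \<rho> u (x + y) = \<rho> u x + \<rho> u y"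
    "\<And>y c. y \<in> corner u \<Longrightarrow> \<rho> u (sc c * y) = c \<cdot>\<^sub>v \<rho> u y" "\<And>y. y \<in> corner u \<Longrightarrow> \<rho> u y = 0\<^sub>v (d u) \<longleftrightarrow> y \<in> Im F"
    using co u unfolding coker_map_def by blast+
  have car: "\<rho> u y \<in> carrier_vec (d u)" if "y \<in> corner u" for y using \<rho>(1) that by blast
  have \<rho>_sum: "\<rho> u (\<Sum>j\<in>S. sc (c j) * g j) $ k = (\<Sum>j\<in>S. c j * \<rho> u (g j) $ k)"
    if "\<And>j. j \<in> S \<Longrightarrow> g j \<in> corner u" "k < d u" "finite S" for S c g k
    using that(3,1)
  proof induction
    case empty
    have "0 \<in> Im F" by (rule RI(7))
    then show ?case using \<rho>(4)[OF corner_closed(4)] that(2) by simp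
  next
    case (insert j S)
    then have c: "sc (c j) * g j \<in> corner u" "(\<Sum>j\<in>S. sc (c j) * g j) \<in> corner u"
      by (auto intro!: corner_closed corner_sum)
    show ?case using insert \<rho>(2)[OF c] \<rho>(3)[of "g j" "c j"] that(2) car[OF c(2)] car[of "g j"] by simp
  qed
  have "\<exists>y. \<forall>j<d u. y j \<in> corner u \<and> \<rho> u (y j) = unit_vec (d u) j"
  proof -
    have "\<forall>j. \<exists>y. j < d u \<longrightarrow> y \<in> corner u \<and> \<rho> u y = unit_vec (d u) j"
      using \<rho>(1) by (metis imageE unit_vec_carrier)
    then show ?thesis by metis
  qed
  then obtain y where y: "\<And>j. j < d u \<Longrightarrow> y j \<in> corner u" "\<And>j. j < d u \<Longrightarrow> \<rho> u (y j) = unit_vec (d u) j" by blast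
  \<comment> \<open>One matrix holds the values of the functionals at preimages \<open>y\<close> of
    the unit vectors, the other the coordinates of the images of the basis \<open>b\<close>; they
    are inverse to each other.\<close>
  show "d u = d0 u"
  proof (rule trace_dim_eq)
    fix k j assume kj: "k < d u" "j < d u"
    let ?w = "lc u (\<lambda>i. f u i (y j))"
    have w: "?w \<in> corner u" by (rule lc[OF u])
    have yw: "y j - ?w \<in> corner u" by (rule corner_closed(2)[OF y(1)[OF kj(2)] w])
    have "y j - ?w \<in> Im F"
      using ker[OF u yw] by (simp add: f_diff[OF u] f_lc[OF u])
    then have "\<rho> u (y j - ?w) = 0\<^sub>v (d u)" using \<rho>(4)[OF yw] by simp
    moreover have "\<rho> u (y j) = \<rho> u (y j - ?w) + \<rho> u ?w" using \<rho>(2)[OF yw w] by simp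
    ultimately have "unit_vec (d u) j $ k = \<rho> u ?w $ k"
      using y(2)[OF kj(2)] kj car[OF w] by simp
    also have "\<dots> = (\<Sum>i<d0 u. f u i (y j) * \<rho> u (b u i) $ k)"
      unfolding lc_def by (rule \<rho>_sum) (use b u kj in auto)
    finally have "(\<Sum>i<d0 u. f u i (y j) * \<rho> u (b u i) $ k) = unit_vec (d u) j $ k" by (rule sym)
    then show "(\<Sum>i<d0 u. f u i (y j) * \<rho> u (b u i) $ k) = of_bool (k = j)"
      using kj by (cases "k = j") simp_all
  next
    fix i l assume il: "i < d0 u" "l < d0 u"
    let ?z = "\<Sum>j<d u. sc (\<rho> u (b u l) $ j) * y j"
    have z: "?z \<in> corner u" using y(1) by (intro corner_sum corner_closed) auto
    have eq1: "\<rho> u ?z = \<rho> u (b u l)"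
    proof (rule eq_vecI)
      fix k assume "k < dim_vec (\<rho> u (b u l))"
      then have k: "k < d u" using car[OF b[OF u il(2)]] by simp
      have "\<rho> u ?z $ k = (\<Sum>j<d u. \<rho> u (b u l) $ j * \<rho> u (y j) $ k)" by (rule \<rho>_sum) (use y(1) k in auto)
      also have "\<dots> = (\<Sum>j<d u. if j = k then \<rho> u (b u l) $ k else 0)" using y(2) k by (intro sum.cong) auto
      finally show "\<rho> u ?z $ k = \<rho> u (b u l) $ k" using k by simp
    qed (use car[OF z] car[OF b[OF u il(2)]] in auto)
    have eq2: "\<rho> u (b u l) = \<rho> u (b u l - ?z) + \<rho> u ?z"
      using \<rho>(2)[OF corner_closed(2)[OF b[OF u il(2)] z] z] by simp
    have "\<rho> u (b u l - ?z) = 0\<^sub>v (d u)"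
    proof (rule eq_vecI)
      fix k assume "k < dim_vec (0\<^sub>v (d u) :: 'k vec)"
      then have k: "k < d u" by simp
      have "\<rho> u (b u l) $ k = (\<rho> u (b u l - ?z) + \<rho> u (b u l)) $ k"
        by (rule arg_cong[OF eq2[unfolded eq1]])
      also have "\<dots> = \<rho> u (b u l - ?z) $ k + \<rho> u (b u l) $ k"
        by (rule index_add_vec(1)) (use k car[OF b[OF u il(2)]] in auto)
      finally show "\<rho> u (b u l - ?z) $ k = 0\<^sub>v (d u) $ k" using k by simp
    qed (use car[OF corner_closed(2)[OF b[OF u il(2)] z]] in auto)
    then have "b u l - ?z \<in> Im F" using \<rho>(4)[OF corner_closed(2)[OF b[OF u il(2)] z]] by simp
    then have "f u i (b u l - ?z) = 0" using ker[OF u corner_closed(2)[OF b[OF u il(2)] z]] il by blast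
    then show "(\<Sum>j<d u. \<rho> u (b u l) $ j * f u i (y j)) = of_bool (i = l)"
      using il by (simp add: f_diff[OF u] f_sum[OF u] f_sc[OF u] fb[OF u])
  qed
qed

text \<open>\<open>p\<close> cuts out an open set on which all presentations of the cokernel have
  the character \<open>c\<close>. Any presentation may occur in \<open>CW\<close>, hence the
  quantification in \<open>un\<close>; a competing value would be attained at a map in this set too,
  by \<open>general_hom_meet\<close>.\<close>

lemma CW_eqI:
  fixes c :: "'k::field_char_0 kpoly fract"
  assumes mn: "m = (\<lambda>u. nat (max (g u) 0))" "n = (\<lambda>u. nat (max (- g u) 0))"
    and p: "p \<in> poly_functions (phom_functionals Delta potW m n)" and F0: "adm F0" "p (Phi F0) \<noteq> (0 :: 'k)"
    and ex: "\<And>F. adm F \<Longrightarrow> p (Phi F) \<noteq> 0 \<Longrightarrow> \<exists>d M. is_rep Delta d M \<and> (\<exists>\<rho>. coker_map F d M \<rho>)"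
    and un: "\<And>F d M \<rho>. adm F \<Longrightarrow> p (Phi F) \<noteq> 0 \<Longrightarrow> is_rep Delta d M \<Longrightarrow> coker_map F d M \<rho> \<Longrightarrow>
      (\<forall>u\<in>{4..8}. d u = 0) \<and> cluster_char_rep g d M = c"
  shows "CW g = c"
proof -
  let ?P = "\<lambda>c (\<phi> :: (nat, darc, 'k) pelem \<Rightarrow> (nat, darc, 'k) pelem). \<exists>d M. is_coker Delta potW m n \<phi> d M \<and>
          (\<forall>u \<in> verts Delta - mutables. d u = 0) \<and> c = cluster_char_rep g d M"
  have v: "verts Delta - mutables = {4..8}" by (auto simp: mutables_def)
  have g: "general_hom Delta potW m n Q" if "\<And>F. adm F \<Longrightarrow> p (Phi F) \<noteq> 0 \<Longrightarrow> Q (Phi F)" for Q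
    unfolding general_hom_def
  proof (intro bexI[OF _ p] conjI ballI impI)
    show "\<exists>\<phi>\<in>phom Delta potW m n. p \<phi> \<noteq> 0" using F0(2) Phi_phom[OF F0(1)] by blast
    fix \<phi> assume \<phi>: "\<phi> \<in> phom Delta potW m n" "p \<phi> \<noteq> 0"
    then obtain F where "adm F" "\<phi> = Phi F" unfolding phom_eq by blast
    then show "Q \<phi>" using that \<phi>(2) by blast
  qed
  have u: "(\<forall>u\<in>{4..8}. d u = 0) \<and> cluster_char_rep g d M = c" if "adm F" "p (Phi F) \<noteq> 0" "is_coker Delta potW m n (Phi F) d M" for F d M
    using un[OF that(1,2)] that(3) is_coker_iff[OF that(1)] by blast
  have "(THE c. general_hom Delta potW m n (?P c)) = c"
  proof (rule the_equality)
    show "general_hom Delta potW m n (?P c)"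
    proof (rule g)
      fix F assume F: "adm F" "p (Phi F) \<noteq> 0"
      then obtain d M where "is_coker Delta potW m n (Phi F) d M" using ex is_coker_iff[OF F(1)] by blast
      then show "?P c (Phi F)" using u[OF F] unfolding v by blast
    qed
    fix c' assume "general_hom Delta potW m n (?P c')"
    moreover have "general_hom Delta potW m n (\<lambda>\<phi>. \<forall>d M. is_coker Delta potW m n \<phi> d M \<longrightarrow> cluster_char_rep g d M = c)"
      by (rule g) (use u in blast)
    ultimately obtain \<phi> where "?P c' \<phi>" "\<forall>d M. is_coker Delta potW m n \<phi> d M \<longrightarrow> cluster_char_rep g d M = c"
      using general_hom_meet by blast
    then show "c' = c" by blast
  qed
  then show ?thesis unfolding CW_def mn .
qed

end


section \<open>Subspaces of small dimension and Grassmannians of quotients\<close>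

lemma subspace_vecI:
  assumes "N \<subseteq> carrier_vec n" "0\<^sub>v n \<in> N" "\<And>x y. x \<in> N \<Longrightarrow> y \<in> N \<Longrightarrow> x + y \<in> N" "\<And>c x. x \<in> N \<Longrightarrow> c \<cdot>\<^sub>v x \<in> N"
  shows "VectorSpace.subspace class_ring N (module_vec TYPE('k::field) n)"
proof -
  interpret vec_space "TYPE('k)" n .
  show ?thesis unfolding subspace_def submodule_def
    using assms vectorspace_axioms module_axioms by (auto simp: module_vec_simps)
qed

lemma subspace_vecD:
  assumes "VectorSpace.subspace class_ring N (module_vec TYPE('k::field) n)"
  shows "N \<subseteq> carrier_vec n" "0\<^sub>v n \<in> N" "x \<in> N \<Longrightarrow> y \<in> N \<Longrightarrow> x + y \<in> N" "x \<in> N \<Longrightarrow> c \<cdot>\<^sub>v x \<in> N"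
proof -
  interpret vec_space "TYPE('k)" n .
  show "N \<subseteq> carrier_vec n" "0\<^sub>v n \<in> N" "x \<in> N \<Longrightarrow> y \<in> N \<Longrightarrow> x + y \<in> N" "x \<in> N \<Longrightarrow> c \<cdot>\<^sub>v x \<in> N"
    using assms unfolding subspace_def submodule_def by (auto simp: module_vec_simps)
qed

definition vdim :: "nat \<Rightarrow> 'k::field vec set \<Rightarrow> nat" where
  "vdim n N = vectorspace.dim class_ring (module_vec TYPE('k) n \<lparr>carrier := N\<rparr>)"

definition vline :: "'k::field vec \<Rightarrow> 'k vec set" where
  "vline b = range (\<lambda>c. c \<cdot>\<^sub>v b)"

lemma subspace_vline:
  assumes "b \<in> carrier_vec n"
  shows "VectorSpace.subspace class_ring (vline b) (module_vec TYPE('k::field) n)"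
proof (rule subspace_vecI)
  show "0\<^sub>v n \<in> vline b" unfolding vline_def by (rule range_eqI[of _ _ 0]) (use assms in auto)
  show "x + y \<in> vline b" if "x \<in> vline b" "y \<in> vline b" for x y
    using that by (auto simp: vline_def simp flip: add_smult_distrib_vec)
  show "c \<cdot>\<^sub>v x \<in> vline b" if "x \<in> vline b" for c x using that by (auto simp: vline_def smult_smult_assoc)
qed (use assms in \<open>auto simp: vline_def\<close>)

lemma subspace_zero: "VectorSpace.subspace class_ring {0\<^sub>v n} (module_vec TYPE('k::field) n)"
  and subspace_carrier: "VectorSpace.subspace class_ring (carrier_vec n) (module_vec TYPE('k::field) n)"
  by (auto intro!: subspace_vecI)

text \<open>Spans inside a subspace agree with spans in the ambient space, so the dimension can be
  found from generating sets there.\<close>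

lemma vdim_Least:
  assumes N: "VectorSpace.subspace class_ring N (module_vec TYPE('k::field) n)"
  shows "vdim n N = (LEAST k. \<exists>A. finite A \<and> card A = k \<and> A \<subseteq> N \<and>
    LinearCombinations.module.span class_ring (module_vec TYPE('k) n) A = N)"
proof -
  interpret vec_space "TYPE('k)" n .
  have vs: "vectorspace class_ring (vs N)" by (rule subspace_is_vs[OF N])
  have sp: "LinearCombinations.module.span class_ring (vs N) A = span A" if "A \<subseteq> N" for A
    using span_li_not_depend(1)[OF that] N by (simp add: subspace_def)
  have "vdim n N = (LEAST k. \<exists>A. finite A \<and> card A = k \<and> A \<subseteq> N \<and> LinearCombinations.module.span class_ring (vs N) A = N)"
    unfolding vdim_def vectorspace.dim_def[OF vs] by simp
  also have "\<dots> = (LEAST k. \<exists>A. finite A \<and> card A = k \<and> A \<subseteq> N \<and> span A = N)"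
    by (intro arg_cong[of _ _ Least] ext) (use sp in auto)
  finally show ?thesis .
qed

lemma span_vline:
  assumes "b \<in> carrier_vec n"
  shows "LinearCombinations.module.span class_ring (module_vec TYPE('k::field) n) {b} = vline b"
proof -
  interpret vec_space "TYPE('k)" n .
  have "b \<in> vline b" unfolding vline_def by (rule range_eqI[of _ _ 1]) simp
  then have "span {b} \<subseteq> vline b"
    using span_is_subset[of "{b}" "vline b"] subspace_vline[OF assms] by (simp add: subspace_def)
  moreover have "vline b \<subseteq> span {b}"
  proof -
    have S: "VectorSpace.subspace class_ring (span {b}) V" using span_is_subspace[of "{b}"] assms by simp
    have b: "b \<in> span {b}" using in_own_span[of "{b}"] assms by simp
    show ?thesis unfolding vline_def by (rule image_subsetI) (rule subspace_vecD(4)[OF S b])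
  qed
  ultimately show ?thesis by blast
qed

lemma span_vec_empty: "LinearCombinations.module.span class_ring (module_vec TYPE('k::field) n) {} = {0\<^sub>v n}"
proof -
  interpret vec_space "TYPE('k)" n .
  have "span {} \<subseteq> {0\<^sub>v n}" using span_is_subset[of "{}" "{0\<^sub>v n}"] subspace_zero[of n, where ?'k = 'k] by (simp add: subspace_def)
  moreover have "0\<^sub>v n \<in> span {}" using subspace_vecD(2)[OF span_is_subspace[of "{}"]] by simp
  ultimately show ?thesis by blast
qed

lemma vdim_zero: "vdim n {0\<^sub>v n :: 'k::field vec} = 0"
  unfolding vdim_Least[OF subspace_zero] by (rule Least_equality) (auto intro!: exI[of _ "{}"] simp: span_vec_empty)

lemma vdim_vline:
  assumes "b \<in> carrier_vec n" "b \<noteq> 0\<^sub>v n"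
  shows "vdim n (vline b) = 1"
  unfolding vdim_Least[OF subspace_vline[OF assms(1)]]
proof (rule Least_equality)
  have b: "b \<in> vline b" unfolding vline_def by (rule range_eqI[of _ _ 1]) simp
  then show "\<exists>A. finite A \<and> card A = 1 \<and> A \<subseteq> vline b \<and> LinearCombinations.module.span class_ring (module_vec TYPE('a) n) A = vline b"
    by (intro exI[of _ "{b}"]) (simp add: span_vline[OF assms(1)])
  fix k assume "\<exists>A. finite A \<and> card A = k \<and> A \<subseteq> vline b \<and> LinearCombinations.module.span class_ring (module_vec TYPE('a) n) A = vline b"
  then obtain A where A: "finite A" "card A = k" "LinearCombinations.module.span class_ring (module_vec TYPE('a) n) A = vline b" by blast
  have "k \<noteq> 0"
  proof
    assume "k = 0"
    then have "A = {}" using A by simp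
    then show False using A(3) b assms(2) by (auto simp: span_vec_empty)
  qed
  then show "1 \<le> k" by simp
qed

lemma vdim_carrier: "vdim n (carrier_vec n :: 'k::field vec set) = n"
proof -
  interpret vec_space "TYPE('k)" n .
  have eq: "V\<lparr>carrier := carrier_vec n\<rparr> = V" by (simp add: module_vec_def)
  show ?thesis unfolding vdim_def eq by (rule dim_is_n)
qed

lemma vec_0_carrier: "carrier_vec 0 = {0\<^sub>v 0}"
  by (auto simp: vec_eq_iff)

text \<open>In dimension at most 1 a subspace is zero or everything, so \<open>e\<close> determines
  it; for \<open>n = 0\<close> the two coincide.\<close>

lemma subspace_dim_1:
  assumes N: "VectorSpace.subspace class_ring N (module_vec TYPE('k::field) n)" and n: "n \<le> 1"
    and e: "vdim n N + e = n"
  shows "N = (if e = n then {0\<^sub>v n} else carrier_vec n)"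
proof -
  note D = subspace_vecD[OF N]
  have "N = {0\<^sub>v n} \<or> N = carrier_vec n"
  proof (cases "N = {0\<^sub>v n}")
    case False
    then obtain x where x: "x \<in> N" "x \<noteq> 0\<^sub>v n" using D(2) by blast
    have "y \<in> N" if y: "y \<in> carrier_vec n" for y
    proof -
      have c: "x \<in> carrier_vec n" using D(1) x by blast
      have x0: "n = 1 \<and> x $ 0 \<noteq> 0" using c x(2) n by (cases "n = 0") (auto simp: vec_eq_iff le_Suc_eq One_nat_def)
      have "y = (y $ 0 / x $ 0) \<cdot>\<^sub>v x" using x0 c y by (auto simp: vec_eq_iff)
      then show ?thesis using D(4)[OF x(1)] by metis
    qed
    then show ?thesis using D(1) by blast
  qed auto
  then show ?thesis using e vdim_zero[of n, where ?'k = 'k] vdim_carrier[of n, where ?'k = 'k] vec_0_carrier[where ?'a = 'k]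
    by (cases "n = 0") auto
qed

text \<open>A nonzero \<open>b\<close> in \<open>N\<close> and a vector of \<open>N\<close> off its
  line have nonzero determinant \<open>\<Delta>\<close>; Cramer's rule then puts every vector into
  \<open>N\<close>.\<close>

lemma subspace_dim_2:
  assumes N: "VectorSpace.subspace class_ring N (module_vec TYPE('k::field) 2)"
  shows "N = {0\<^sub>v 2} \<or> N = carrier_vec 2 \<or> (\<exists>b\<in>carrier_vec 2. b \<noteq> 0\<^sub>v 2 \<and> N = vline b)"
proof (rule ccontr)
  note D = subspace_vecD[OF N]
  assume no: "\<not> ?thesis"
  then obtain b where b: "b \<in> N" "b \<noteq> 0\<^sub>v 2" using D(2) by blast
  have bc: "b \<in> carrier_vec 2" using D(1) b by blast
  have "vline b \<subseteq> N" using D(4)[OF b(1)] by (auto simp: vline_def)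
  then obtain x where x: "x \<in> N" "x \<notin> vline b" using no bc b(2) by blast
  have xc: "x \<in> carrier_vec 2" using D(1) x by blast
  define \<Delta> where "\<Delta> = b $ 0 * x $ 1 - b $ 1 * x $ 0"
  have "\<Delta> \<noteq> 0"
  proof
    assume "\<Delta> = 0"
    then have d: "b $ 0 * x $ 1 = b $ 1 * x $ 0" by (simp add: \<Delta>_def)
    have "b $ 0 \<noteq> 0 \<or> b $ 1 \<noteq> 0" using b(2) bc by (auto simp: vec_eq_iff less_2_cases_iff One_nat_def)
    then obtain c where "x = c \<cdot>\<^sub>v b"
    proof
      assume "b $ 0 \<noteq> 0"
      then have "x = (x $ 0 / b $ 0) \<cdot>\<^sub>v b" using d bc xc by (auto simp: vec_eq_iff less_2_cases_iff One_nat_def field_simps)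
      then show ?thesis using that by blast
    next
      assume "b $ 1 \<noteq> 0"
      then have "x = (x $ 1 / b $ 1) \<cdot>\<^sub>v b" using d bc xc by (auto simp: vec_eq_iff less_2_cases_iff One_nat_def field_simps)
      then show ?thesis using that by blast
    qed
    then show False using x(2) by (auto simp: vline_def)
  qed
  have lin: "p = n / \<Delta> * q + n' / \<Delta> * r" if "p * \<Delta> = n * q + n' * r" for n n' p q r
  proof -
    have "p = (n * q + n' * r) / \<Delta>" unfolding that[symmetric] using \<open>\<Delta> \<noteq> 0\<close> by simp
    then show ?thesis by (simp add: add_divide_distrib)
  qed
  have "y \<in> N" if y: "y \<in> carrier_vec 2" for y
  proof -
    have "y = ((y $ 0 * x $ 1 - y $ 1 * x $ 0) / \<Delta>) \<cdot>\<^sub>v b + ((b $ 0 * y $ 1 - b $ 1 * y $ 0) / \<Delta>) \<cdot>\<^sub>v x"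
    proof (rule eq_vecI)
      fix i assume "i < dim_vec (((y $ 0 * x $ 1 - y $ 1 * x $ 0) / \<Delta>) \<cdot>\<^sub>v b + ((b $ 0 * y $ 1 - b $ 1 * y $ 0) / \<Delta>) \<cdot>\<^sub>v x)"
      then have "i = 0 \<or> i = 1" using xc by auto
      then show "y $ i = (((y $ 0 * x $ 1 - y $ 1 * x $ 0) / \<Delta>) \<cdot>\<^sub>v b + ((b $ 0 * y $ 1 - b $ 1 * y $ 0) / \<Delta>) \<cdot>\<^sub>v x) $ i"
      proof
        assume i: "i = 0"
        have "y $ 0 * \<Delta> = (y $ 0 * x $ 1 - y $ 1 * x $ 0) * b $ 0 + (b $ 0 * y $ 1 - b $ 1 * y $ 0) * x $ 0"
          unfolding \<Delta>_def by (simp add: algebra_simps)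
        from lin[OF this] show ?thesis using bc xc unfolding i by simp
      next
        assume i: "i = 1"
        have "y $ 1 * \<Delta> = (y $ 0 * x $ 1 - y $ 1 * x $ 0) * b $ 1 + (b $ 0 * y $ 1 - b $ 1 * y $ 0) * x $ 1"
          unfolding \<Delta>_def by (simp add: algebra_simps)
        from lin[OF this] show ?thesis using bc xc unfolding i by simp
      qed
    qed (use xc y in auto)
    then show ?thesis using D(3)[OF D(4)[OF b(1)] D(4)[OF x(1)]] by metis
  qed
  then show False using no D(1) by blast
qed

section \<open>Grassmannians of quotients of the representations that occur\<close>

lemma quot_grass_iff:
  "N \<in> quot_grass Delta d M e \<longleftrightarrow> N \<in> extensional {1..8} \<and>
    (\<forall>u\<in>{1..8}. VectorSpace.subspace class_ring (N u) (module_vec TYPE('k::field) (d u)) \<and> vdim (d u) (N u) + e u = d u) \<and>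
    (\<forall>a\<in>arcs Delta. \<forall>v\<in>N (dtail a). (M a)\<^sup>T *\<^sub>v v \<in> N (dhead a))"
  by (simp add: quot_grass_def vdim_def)

lemma mult_vec_11: "B \<in> carrier_mat 1 1 \<Longrightarrow> v \<in> carrier_vec 1 \<Longrightarrow> (B\<^sup>T *\<^sub>v v) $ 0 = B $$ (0, 0) * v $ (0 :: nat)"
  by (simp add: scalar_prod_def One_nat_def)

lemma mult_vec_21: "B \<in> carrier_mat 2 1 \<Longrightarrow> v \<in> carrier_vec 2 \<Longrightarrow> (B\<^sup>T *\<^sub>v v) $ 0 = B $$ (0, 0) * v $ (0 :: nat) + B $$ (1, 0) * v $ 1"
  by (simp add: scalar_prod_def One_nat_def numeral_2_eq_2)

lemma mult_vec_12: "B \<in> carrier_mat 1 2 \<Longrightarrow> v \<in> carrier_vec 1 \<Longrightarrow> j < 2 \<Longrightarrow> (B\<^sup>T *\<^sub>v v) $ j = B $$ (0, j) * v $ (0 :: nat)"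
  by (simp add: scalar_prod_def One_nat_def)

lemma vec1_neq0: "v \<in> carrier_vec 1 \<Longrightarrow> v \<noteq> 0\<^sub>v 1 \<longleftrightarrow> v $ 0 \<noteq> 0"
  by (auto simp: vec_eq_iff)

text \<open>Points of the Grassmannian are kernels, so a full quotient at \<open>u\<close>
  corresponds to the zero space.\<close>

definition quot0 :: "(nat \<Rightarrow> nat) \<Rightarrow> (nat \<Rightarrow> nat) \<Rightarrow> nat \<Rightarrow> complex vec set" where
  "quot0 d e = (\<lambda>u\<in>{1..8}. if e u = d u then {0\<^sub>v (d u)} else carrier_vec (d u))"

lemma rep_mult_carrier:
  "is_rep Delta d M \<Longrightarrow> a \<in> arcs Delta \<Longrightarrow> v \<in> carrier_vec (d (dtail a)) \<Longrightarrow> (M a)\<^sup>T *\<^sub>v v \<in> carrier_vec (d (dhead a))"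
  unfolding is_rep_def Delta_simps by (intro mult_mat_vec_carrier[of _ _ "d (dtail a)"]) auto

lemma rep_mult_zero:
  "is_rep Delta d M \<Longrightarrow> a \<in> arcs Delta \<Longrightarrow> (M a)\<^sup>T *\<^sub>v 0\<^sub>v (d (dtail a)) = (0\<^sub>v (d (dhead a)) :: 'k::field vec)"
  unfolding is_rep_def Delta_simps by (auto simp: vec_eq_iff)

lemma is_rep_map: "is_rep Q d M \<Longrightarrow> is_rep Q d (\<lambda>a. map_mat \<sigma> (M a))"
  by (auto simp: is_rep_def)

text \<open>All spaces have dimension at most 1, so \<open>e\<close> fixes the kernel. It is a
  subrepresentation unless it is everything at \<open>s\<close> and zero at \<open>t\<close>, where
  the map is nonzero; in terms of quotient dimensions this is the condition e t \<le> e s.\<close>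

lemma quot_grass_pair:
  assumes rep: "is_rep Delta d M" and st: "s \<in> {1..8}" "t \<in> {1..8}" and d: "d s = 1" "d t = 1" "\<And>u. u \<in> {1..8} \<Longrightarrow> u \<noteq> s \<Longrightarrow> u \<noteq> t \<Longrightarrow> d u = 0"
    and arc: "\<And>a. a \<in> arcs Delta \<Longrightarrow> dtail a \<in> {s, t} \<Longrightarrow> dhead a \<in> {s, t} \<Longrightarrow> dtail a = s \<and> dhead a = t"
    and a0: "a0 \<in> arcs Delta" "dtail a0 = s" "dhead a0 = t" "M a0 $$ (0, 0) \<noteq> (0 :: complex)"
    and e: "\<And>u. u \<in> {1..8} \<Longrightarrow> e u \<le> d u"
  shows "quot_grass Delta d M e = (if e t \<le> e s then {quot0 d e} else {})"
proof -
  have d1: "d u \<le> 1" if "u \<in> {1..8}" for u using d that by (cases "u = s"; cases "u = t") auto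
  have sub: "N = quot0 d e \<and> e t \<le> e s" if N: "N \<in> quot_grass Delta d M e" for N
  proof
    note N' = N[unfolded quot_grass_iff]
    have "N u = quot0 d e u" if u: "u \<in> {1..8}" for u
      using subspace_dim_1[of "N u" "d u" "e u"] N' d1[OF u] u by (auto simp: quot0_def)
    then show eq: "N = quot0 d e" using N' by (intro extensionalityI[of _ "{1..8}"]) (auto simp: quot0_def)
    show "e t \<le> e s"
    proof (rule ccontr)
      assume "\<not> e t \<le> e s"
      then have "e s = 0" "e t = 1" using e[OF st(2)] d(2) by auto
      then have "N s = carrier_vec 1" "N t = {0\<^sub>v 1}" using d st by (auto simp: eq quot0_def)
      then have "(M a0)\<^sup>T *\<^sub>v vec 1 (\<lambda>_. 1) = 0\<^sub>v 1" using N' a0(1-3) by force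
      moreover have "M a0 \<in> carrier_mat 1 1" using rep a0 d by (auto simp: is_rep_def)
      ultimately show False using mult_vec_11[of "M a0" "vec 1 (\<lambda>_. 1)"] a0(4) by simp
    qed
  qed
  have "quot0 d e \<in> quot_grass Delta d M e" if le: "e t \<le> e s"
    unfolding quot_grass_iff
  proof (intro conjI ballI)
    fix u :: nat assume u: "u \<in> {1..8}"
    show "VectorSpace.subspace class_ring (quot0 d e u) (module_vec TYPE(complex) (d u))"
      using u by (simp add: quot0_def subspace_zero subspace_carrier)
    show "vdim (d u) (quot0 d e u) + e u = d u"
      using u e[OF u] d1[OF u] by (auto simp: quot0_def vdim_zero vdim_carrier)
  next
    fix a v assume a: "a \<in> arcs Delta" and v: "v \<in> quot0 d e (dtail a)"
    note u = dtail_verts[OF a] dhead_verts[OF a]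
    have vc: "v \<in> carrier_vec (d (dtail a))" using v u by (auto simp: quot0_def split: if_splits)
    have c: "(M a)\<^sup>T *\<^sub>v v \<in> carrier_vec (d (dhead a))" by (rule rep_mult_carrier[OF rep a vc])
    show "(M a)\<^sup>T *\<^sub>v v \<in> quot0 d e (dhead a)"
    proof (cases "e (dhead a) = d (dhead a)")
      case False
      then show ?thesis using c u by (simp add: quot0_def)
    next
      case True
      then have h: "quot0 d e (dhead a) = {0\<^sub>v (d (dhead a))}" using u by (simp add: quot0_def)
      have "d (dhead a) = 0 \<or> e (dtail a) = d (dtail a)"
      proof (rule disjCI)
        assume t: "e (dtail a) \<noteq> d (dtail a)"
        have ts: "dtail a \<in> {s, t}" using t d(3)[OF u(1)] e[OF u(1)] by force
        show "d (dhead a) = 0"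
        proof (rule ccontr)
          assume "d (dhead a) \<noteq> 0"
          then have hs: "dhead a \<in> {s, t}" using d(3)[OF u(2)] by auto
          then have "dtail a = s" "dhead a = t" using arc[OF a ts hs] by auto
          then show False using True t le d e[OF st(1)] by auto
        qed
      qed
      then show ?thesis
      proof
        assume "d (dhead a) = 0"
        then show ?thesis using c h vec_0_carrier[where ?'a = complex] by auto
      next
        assume "e (dtail a) = d (dtail a)"
        then have "v = 0\<^sub>v (d (dtail a))" using v u by (simp add: quot0_def)
        then show ?thesis using rep_mult_zero[OF rep a] h by simp
      qed
    qed
  qed (simp add: quot0_def)
  then show ?thesis using sub by auto
qed

text \<open>Field embeddings preserve the nonvanishing of the one relevant entry, so all complex
  points look alike.\<close>

lemma quot_grass_euler_pair:
  fixes M :: "darc \<Rightarrow> 'k::field_char_0 mat"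
  assumes rep: "is_rep Delta d M" and st: "s \<in> {1..8}" "t \<in> {1..8}" and d: "d s = 1" "d t = 1" "\<And>u. u \<in> {1..8} \<Longrightarrow> u \<noteq> s \<Longrightarrow> u \<noteq> t \<Longrightarrow> d u = 0"
    and arc: "\<And>a. a \<in> arcs Delta \<Longrightarrow> dtail a \<in> {s, t} \<Longrightarrow> dhead a \<in> {s, t} \<Longrightarrow> dtail a = s \<and> dhead a = t"
    and a0: "a0 \<in> arcs Delta" "dtail a0 = s" "dhead a0 = t" "M a0 $$ (0, 0) \<noteq> 0"
    and e: "\<And>u. u \<in> {1..8} \<Longrightarrow> e u \<le> d u"
  shows "quot_grass_euler Delta d M e = of_bool (e t \<le> e s)"
proof (rule quot_grass_euler_eq)
  show "finite (arcs Delta)" by (simp add: arcs_Delta)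
  fix K and \<sigma> :: "'k \<Rightarrow> complex" assume K: "field_emb K \<sigma>" "\<forall>a\<in>arcs Delta. elements_mat (M a) \<subseteq> K"
  have m: "M a0 \<in> carrier_mat 1 1" using rep a0 d by (auto simp: is_rep_def)
  then have "M a0 $$ (0, 0) \<in> K" using K(2) a0(1) elements_matI[OF m, of 0 0] by auto
  then have "map_mat \<sigma> (M a0) $$ (0, 0) \<noteq> 0" using field_embD(8)[OF K(1)] a0(4) m by simp
  note g = quot_grass_pair[OF is_rep_map[OF rep] st d arc a0(1-3) this e]
  show "euler_char (quot_grass_top Delta d (\<lambda>a. map_mat \<sigma> (M a)) e) = of_bool (e t \<le> e s)"
  proof (cases "e t \<le> e s")
    case True
    then have "topspace (quot_grass_top Delta d (\<lambda>a. map_mat \<sigma> (M a)) e) = {quot0 d e}"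
      using g by (simp add: topspace_quot_grass_top)
    then show ?thesis using True euler_char_singleton by simp
  next
    case False
    then have "topspace (quot_grass_top Delta d (\<lambda>a. map_mat \<sigma> (M a)) e) = {}"
      using g by (simp add: topspace_quot_grass_top)
    then show ?thesis using False euler_char_empty by simp
  qed
qed


unbundle no vec_syntax

lemma two_equations_det:
  fixes p :: "'a::comm_ring_1"
  assumes "p * a + q * b = 0" "p * c + q * d = 0"
  shows "p * (a * d - b * c) = 0" "q * (a * d - b * c) = 0"
proof -
  have "p * (a * d - b * c) = d * (p * a + q * b) - b * (p * c + q * d)" by (simp add: algebra_simps)
  then show "p * (a * d - b * c) = 0" by (simp add: assms)
  have "q * (a * d - b * c) = a * (p * c + q * d) - c * (p * a + q * b)" by (simp add: algebra_simps)
  then show "q * (a * d - b * c) = 0" by (simp add: assms)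
qed

definition quot1 :: "complex vec \<Rightarrow> (nat \<Rightarrow> nat) \<Rightarrow> (nat \<Rightarrow> nat) \<Rightarrow> nat \<Rightarrow> complex vec set" where
  "quot1 w d e = (\<lambda>u\<in>{1..8}. if u = 3 \<and> e 3 = 1 then vline w else if e u = d u then {0\<^sub>v (d u)} else carrier_vec (d u))"

text \<open>From the top, the module has the composition factors at 3, 2, 1, 3. For \<open>e\<close>
  bounded by (1, 1, 2) these are the dimension vectors of its five quotients, zero included.\<close>

definition uniserial_ok :: "(nat \<Rightarrow> nat) \<Rightarrow> bool" where
  "uniserial_ok e \<longleftrightarrow> e 1 \<le> e 2 \<and> (e 3 = 2 \<longrightarrow> e 1 = 1) \<and> (e 3 = 0 \<longrightarrow> e 2 = 0)"

text \<open>The vector \<open>w\<close> spans both the image of 1 -> 3 and the kernel of 3 -> 2, so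
  a subrepresentation with a line at 3 has the line of \<open>w\<close> there.\<close>

lemma quot_grass_uniserial:
  fixes w :: "complex Matrix.vec" and M :: "darc \<Rightarrow> complex mat"
  assumes rep: "is_rep Delta d M" and d: "d 1 = 1" "d 2 = 1" "d 3 = 2" "\<And>u. u \<in> {4..8} \<Longrightarrow> d u = 0"
    and w: "w = vec 2 (\<lambda>j. M (Arr 1 3) $$ (0, j))" "w $ 0 \<noteq> 0 \<or> w $ 1 \<noteq> 0"
    and pq: "M (Arr 3 2) $$ (0, 0) \<noteq> 0 \<or> M (Arr 3 2) $$ (1, 0) \<noteq> 0"
    and pw: "M (Arr 3 2) $$ (0, 0) * w $ 0 + M (Arr 3 2) $$ (1, 0) * w $ 1 = 0"
    and cm: "M Cminus $$ (0, 0) \<noteq> 0"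
    and e: "\<And>u. u \<in> {1..8} \<Longrightarrow> e u \<le> d u"
  shows "quot_grass Delta d M e = (if uniserial_ok e then {quot1 w d e} else {})"
proof -
  have u8: "u = 1 \<or> u = 2 \<or> u = 3 \<or> u \<in> {4..8}" if "u \<in> {1..8}" for u :: nat using that by auto
  have a: "Arr 1 3 \<in> arcs Delta" "Arr 3 2 \<in> arcs Delta" "Cminus \<in> arcs Delta" by (simp_all add: arcs_Delta)
  have m: "M (Arr 1 3) \<in> carrier_mat 1 2" "M (Arr 3 2) \<in> carrier_mat 2 1" "M Cminus \<in> carrier_mat 1 1"
    using rep a d unfolding is_rep_def Delta_simps by (metis dtail.simps dhead.simps)+
  have wc: "w \<in> carrier_vec 2" using w(1) by simp
  moreover have "w \<noteq> 0\<^sub>v 2"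
  proof
    assume "w = 0\<^sub>v 2"
    then have "w $ 0 = 0" "w $ 1 = 0" by simp_all
    then show False using w(2) by simp
  qed
  ultimately have wc: "w \<in> carrier_vec 2" "w \<noteq> 0\<^sub>v 2" by blast+
  have m13: "(M (Arr 1 3))\<^sup>T *\<^sub>v v = v $ 0 \<cdot>\<^sub>v w" if "v \<in> carrier_vec 1" for v
  proof (rule eq_vecI)
    fix j assume "j < dim_vec (v $ 0 \<cdot>\<^sub>v w)"
    then have j: "j < 2" using wc by simp
    show "((M (Arr 1 3))\<^sup>T *\<^sub>v v) $ j = (v $ 0 \<cdot>\<^sub>v w) $ j" using mult_vec_12[OF m(1) that j] j by (simp add: w(1))
  qed (use m(1) wc in simp)
  have m32w: "(M (Arr 3 2))\<^sup>T *\<^sub>v (c \<cdot>\<^sub>v w) = 0\<^sub>v 1" for c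
  proof (rule eq_vecI)
    fix j assume "j < dim_vec (0\<^sub>v 1 :: complex vec)"
    then have j: "j = 0" by simp
    have "M (Arr 3 2) $$ (0, 0) * (c * w $ 0) + M (Arr 3 2) $$ (1, 0) * (c * w $ 1) = c * 0"
      unfolding pw[symmetric] by (simp add: algebra_simps)
    then show "((M (Arr 3 2))\<^sup>T *\<^sub>v (c \<cdot>\<^sub>v w)) $ j = 0\<^sub>v 1 $ j"
      unfolding j using mult_vec_21[OF m(2), of "c \<cdot>\<^sub>v w"] wc(1) by simp
  qed (use m in simp)
  have ker32: "v \<in> vline w" if v: "v \<in> carrier_vec 2" "(M (Arr 3 2))\<^sup>T *\<^sub>v v = 0\<^sub>v 1" for v
  proof -
    let ?p = "M (Arr 3 2) $$ (0, 0)" and ?q = "M (Arr 3 2) $$ (1, 0)"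
    have z: "?p * v $ 0 + ?q * v $ 1 = 0" using mult_vec_21[OF m(2) v(1)] v(2) by simp
    have "?p * (v $ 0 * w $ 1 - v $ 1 * w $ 0) = 0" "?q * (v $ 0 * w $ 1 - v $ 1 * w $ 0) = 0"
      using two_equations_det[OF z pw] by simp_all
    then have dt: "v $ 0 * w $ 1 = v $ 1 * w $ 0" using pq by auto
    from w(2) show ?thesis
    proof
      assume "w $ 0 \<noteq> 0"
      then have "v = (v $ 0 / w $ 0) \<cdot>\<^sub>v w" using dt v wc by (auto simp: vec_eq_iff less_2_cases_iff One_nat_def field_simps)
      then show ?thesis unfolding vline_def by blast
    next
      assume "w $ 1 \<noteq> 0"
      then have "v = (v $ 1 / w $ 1) \<cdot>\<^sub>v w" using dt v wc by (auto simp: vec_eq_iff less_2_cases_iff One_nat_def field_simps)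
      then show ?thesis unfolding vline_def by blast
    qed
  qed
  have one: "vec 1 (\<lambda>_. 1) \<in> (carrier_vec 1 :: complex vec set)" by simp
  have sub: "uniserial_ok e \<and> N = quot1 w d e" if N: "N \<in> quot_grass Delta d M e" for N
  proof -
    note N' = N[unfolded quot_grass_iff]
    have S: "VectorSpace.subspace class_ring (N u) (module_vec TYPE(complex) (d u))" "vdim (d u) (N u) + e u = d u" if "u \<in> {1..8}" for u
      using N' that by auto
    have N1: "N u = (if e u = d u then {0\<^sub>v (d u)} else carrier_vec (d u))" if "u \<in> {1..8}" "u \<noteq> 3" for u
    proof -
      have "d u \<le> 1" using u8[OF that(1)] that(2) d by fastforce
      then show ?thesis by (rule subspace_dim_1[OF S(1)[OF that(1)] _ S(2)[OF that(1)]])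
    qed
    have arr: "v \<in> N (dtail a) \<Longrightarrow> (M a)\<^sup>T *\<^sub>v v \<in> N (dhead a)" if "a \<in> arcs Delta" for a v using N' that by blast
    have e12: "e 1 \<le> e 2"
    proof (rule ccontr)
      assume "\<not> e 1 \<le> e 2"
      then have "e 2 = 0" "e 1 = 1" using e[of 1] d by auto
      then have "N 2 = carrier_vec 1" "N 1 = {0\<^sub>v 1}" using N1[of 1] N1[of 2] d by auto
      then have "(M Cminus)\<^sup>T *\<^sub>v vec 1 (\<lambda>_. 1) = 0\<^sub>v 1" using arr[OF a(3)] one by auto
      then show False using mult_vec_11[OF m(3) one] cm by simp
    qed
    have w3: "e 1 = 0 \<Longrightarrow> w \<in> N 3"
    proof -
      assume "e 1 = 0"
      then have "vec 1 (\<lambda>_. 1) \<in> N 1" using N1[of 1] d one by auto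
      then have "(M (Arr 1 3))\<^sup>T *\<^sub>v vec 1 (\<lambda>_. 1) \<in> N 3" using arr[OF a(1)] by simp
      then show "w \<in> N 3" unfolding m13[OF one] by simp
    qed
    have v3: "(M (Arr 3 2))\<^sup>T *\<^sub>v v = 0\<^sub>v 1" if "e 2 = 1" "v \<in> N 3" for v
      using arr[OF a(2), of v] that N1[of 2] d by auto
    have e3: "N 3 = (if e 3 = 1 then vline w else if e 3 = 2 then {0\<^sub>v 2} else carrier_vec 2)"
    proof (cases "e 3 = 1")
      case False
      have "N 3 = {0\<^sub>v 2} \<or> N 3 = carrier_vec 2 \<or> (\<exists>b\<in>carrier_vec 2. b \<noteq> 0\<^sub>v 2 \<and> N 3 = vline b)"
        using subspace_dim_2[of "N 3"] S(1)[of 3] d by simp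
      moreover have "vdim 2 (N 3) \<noteq> 1" using S(2)[of 3] d False by simp
      ultimately have "N 3 = {0\<^sub>v 2} \<or> N 3 = carrier_vec 2" by (elim disjE bexE conjE) (auto simp: vdim_vline)
      then show ?thesis using S(2)[of 3] d False vdim_zero[of 2, where ?'k = complex] vdim_carrier[of 2, where ?'k = complex] by auto
    next
      case True
      have "N 3 = {0\<^sub>v 2} \<or> N 3 = carrier_vec 2 \<or> (\<exists>b\<in>carrier_vec 2. b \<noteq> 0\<^sub>v 2 \<and> N 3 = vline b)"
        using subspace_dim_2[of "N 3"] S(1)[of 3] d by simp
      then obtain b where b: "b \<in> carrier_vec 2" "b \<noteq> 0\<^sub>v 2" "N 3 = vline b"
        using S(2)[of 3] d True vdim_zero[of 2, where ?'k = complex] vdim_carrier[of 2, where ?'k = complex] by auto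
      \<comment> \<open>Either the subrepresentation is zero at 2, and then its space at 3 lies in
        the kernel of 3 -> 2, or it is everything at 1, and then it contains
        \<open>w\<close>.\<close>
      have "b \<in> vline w \<or> w \<in> vline b"
      proof (cases "e 2 = 1")
        case True
        have "b \<in> N 3" unfolding b(3) vline_def by (rule range_eqI[of _ _ 1]) simp
        then show ?thesis using ker32[OF b(1) v3[OF True]] by blast
      next
        case False
        then have "e 1 = 0" using e12 e[of 2] d by auto
        then show ?thesis using w3 b(3) by simp
      qed
      then obtain c where c: "c \<noteq> 0" "b = c \<cdot>\<^sub>v w"
      proof
        assume "b \<in> vline w"
        then obtain c where "b = c \<cdot>\<^sub>v w" by (auto simp: vline_def)
        then show thesis using that[of c] b(2) wc(1) by (cases "c = 0") auto
      next
        assume "w \<in> vline b"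
        then obtain c where c: "w = c \<cdot>\<^sub>v b" by (auto simp: vline_def)
        then have "c \<noteq> 0" using wc(2) b(1) by auto
        then show thesis using that[of "inverse c"] c by (simp add: smult_smult_assoc)
      qed
      have "vline b = vline w"
      proof (intro equalityI subsetI)
        fix x assume "x \<in> vline b"
        then show "x \<in> vline w" by (auto simp: vline_def c(2) smult_smult_assoc)
      next
        fix x assume "x \<in> vline w"
        then obtain t where t: "x = t \<cdot>\<^sub>v w" by (auto simp: vline_def)
        have "x = (t / c) \<cdot>\<^sub>v b" using c(1) by (simp add: t c(2) smult_smult_assoc)
        then show "x \<in> vline b" by (auto simp: vline_def)
      qed
      then show ?thesis using b(3) True by simp
    qed
    have "e 1 = 1" if "e 3 = 2"
    proof (rule ccontr)
      assume "e 1 \<noteq> 1"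
      then have "e 1 = 0" using e[of 1] d by simp
      then show False using w3 e3 that wc(2) by simp
    qed
    moreover have "e 2 = 0" if "e 3 = 0"
    proof (rule ccontr)
      assume "e 2 \<noteq> 0"
      then have e2: "e 2 = 1" using e[of 2] d by simp
      have "v \<in> vline w" if "v \<in> carrier_vec 2" for v
        using ker32[OF that v3[OF e2]] that e3 \<open>e 3 = 0\<close> by simp
      then have "carrier_vec 2 = vline w" using wc(1) by (auto simp: vline_def)
      then show False using vdim_carrier[of 2, where ?'k = complex] vdim_vline[OF wc] by simp
    qed
    ultimately have "uniserial_ok e" using e12 by (simp add: uniserial_ok_def)
    moreover have "N = quot1 w d e"
    proof (rule extensionalityI[of _ "{1..8}"])
      show "N \<in> extensional {1..8}" by (rule conjunct1[OF N'])
      show "quot1 w d e \<in> extensional {1..8}" by (simp add: quot1_def)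
      fix u :: nat assume u: "u \<in> {1..8}"
      show "N u = quot1 w d e u"
      proof (cases "u = 3")
        case True
        then show ?thesis using e3 d(3) by (simp add: quot1_def)
      next
        case False
        then show ?thesis using N1[OF u False] u by (simp add: quot1_def)
      qed
    qed
    ultimately show ?thesis by blast
  qed
  have "quot1 w d e \<in> quot_grass Delta d M e" if ok: "uniserial_ok e"
    unfolding quot_grass_iff
  proof (intro conjI ballI)
    fix u :: nat assume u: "u \<in> {1..8}"
    show "VectorSpace.subspace class_ring (quot1 w d e u) (module_vec TYPE(complex) (d u))"
      using u d(3) subspace_vline[OF wc(1)] by (simp add: quot1_def subspace_zero subspace_carrier)
    show "vdim (d u) (quot1 w d e u) + e u = d u"
      using u8[OF u] e[OF u] d vdim_vline[OF wc] by (auto simp: quot1_def vdim_zero vdim_carrier)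
  next
    fix b v assume b: "b \<in> arcs Delta" and v: "v \<in> quot1 w d e (dtail b)"
    note u = dtail_verts[OF b] dhead_verts[OF b]
    have vl: "vline w \<subseteq> carrier_vec 2" using wc(1) by (auto simp: vline_def)
    have vc: "v \<in> carrier_vec (d (dtail b))" using v u vl d(3) by (auto simp: quot1_def split: if_splits)
    have c: "(M b)\<^sup>T *\<^sub>v v \<in> carrier_vec (d (dhead b))" by (rule rep_mult_carrier[OF rep b vc])
    \<comment> \<open>All other arrows have a zero space at one end; the two arrows 2 -> 1 are
      treated alike.\<close>
    consider "d (dtail b) = 0" | "d (dhead b) = 0" | "b = Arr 1 3" | "b = Arr 3 2" | "dtail b = 2 \<and> dhead b = 1"
      using b d(4) unfolding arcs_Delta by auto
    then show "(M b)\<^sup>T *\<^sub>v v \<in> quot1 w d e (dhead b)"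
    proof cases
      case 1
      then have v0: "v = 0\<^sub>v (d (dtail b))" using vc by (auto simp: vec_eq_iff)
      have "0\<^sub>v (d (dhead b)) \<in> quot1 w d e (dhead b)"
        using u d(3) subspace_vecD(2)[OF subspace_vline[OF wc(1)]] by (auto simp: quot1_def)
      then show ?thesis using rep_mult_zero[OF rep b] v0 by simp
    next
      case 2
      have "(M b)\<^sup>T *\<^sub>v v = 0\<^sub>v (d (dhead b))" using c unfolding 2 vec_0_carrier by (rule singletonD)
      moreover have "dhead b \<noteq> 3" using 2 d(3) by auto
      ultimately show ?thesis using u 2 by (auto simp: quot1_def)
    next
      case 3
      show ?thesis
      proof (cases "e 1 = 1")
        case True
        then have "v = 0\<^sub>v (d (dtail b))" using v 3 d by (simp add: quot1_def)
        moreover have "0\<^sub>v 2 \<in> quot1 w d e 3"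
          using d(3) subspace_vecD(2)[OF subspace_vline[OF wc(1)]] by (auto simp: quot1_def)
        ultimately show ?thesis using rep_mult_zero[OF rep b] 3 d by simp
      next
        case False
        then have "e 3 \<noteq> 2" using ok by (auto simp: uniserial_ok_def)
        then have "x \<in> vline w \<Longrightarrow> x \<in> quot1 w d e 3" for x using d(3) vl by (auto simp: quot1_def)
        then show ?thesis using m13[of v] vc 3 d by (auto simp: vline_def)
      qed
    next
      case 4
      show ?thesis
      proof (cases "e 2 = 1")
        case False
        then show ?thesis using c 4 d by (simp add: quot1_def)
      next
        case True
        then have "e 3 \<noteq> 0" using ok by (auto simp: uniserial_ok_def)
        then have "e 3 = 1 \<or> e 3 = 2" using e[of 3] d by auto
        then have "v \<in> vline w" using v 4 d subspace_vecD(2)[OF subspace_vline[OF wc(1)]] by (auto simp: quot1_def)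
        then show ?thesis using m32w 4 True d by (auto simp: vline_def quot1_def)
      qed
    next
      case 5
      show ?thesis
      proof (cases "e 2 = 1")
        case True
        then have "v = 0\<^sub>v (d (dtail b))" using v 5 d by (simp add: quot1_def)
        moreover have "0\<^sub>v 1 \<in> quot1 w d e 1" using d by (auto simp: quot1_def)
        ultimately show ?thesis using rep_mult_zero[OF rep b] 5 d by simp
      next
        case False
        then have "e 1 = 0" using ok e[of 2] d by (auto simp: uniserial_ok_def)
        then show ?thesis using c 5 d by (simp add: quot1_def)
      qed
    qed
  qed (simp add: quot1_def)
  then show ?thesis using sub by auto
qed

lemma quot_grass_euler_uniserial:
  fixes M :: "darc \<Rightarrow> 'k::field_char_0 mat"
  assumes rep: "is_rep Delta d M" and d: "d 1 = 1" "d 2 = 1" "d 3 = 2" "\<And>u. u \<in> {4..8} \<Longrightarrow> d u = 0"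
    and w: "M (Arr 1 3) $$ (0, 0) \<noteq> 0 \<or> M (Arr 1 3) $$ (0, 1) \<noteq> 0"
    and pq: "M (Arr 3 2) $$ (0, 0) \<noteq> 0 \<or> M (Arr 3 2) $$ (1, 0) \<noteq> 0"
    and pw: "M (Arr 3 2) $$ (0, 0) * M (Arr 1 3) $$ (0, 0) + M (Arr 3 2) $$ (1, 0) * M (Arr 1 3) $$ (0, 1) = 0"
    and cm: "M Cminus $$ (0, 0) \<noteq> 0"
    and e: "\<And>u. u \<in> {1..8} \<Longrightarrow> e u \<le> d u"
  shows "quot_grass_euler Delta d M e = of_bool (uniserial_ok e)"
proof (rule quot_grass_euler_eq)
  show "finite (arcs Delta)" by (simp add: arcs_Delta)
  fix K and \<sigma> :: "'k \<Rightarrow> complex" assume K: "field_emb K \<sigma>" "\<forall>a\<in>arcs Delta. elements_mat (M a) \<subseteq> K"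
  let ?M = "\<lambda>a. map_mat \<sigma> (M a)"
  have a: "Arr 1 3 \<in> arcs Delta" "Arr 3 2 \<in> arcs Delta" "Cminus \<in> arcs Delta" by (simp_all add: arcs_Delta)
  have m: "M (Arr 1 3) \<in> carrier_mat 1 2" "M (Arr 3 2) \<in> carrier_mat 2 1" "M Cminus \<in> carrier_mat 1 1"
    using rep a d unfolding is_rep_def Delta_simps by (metis dtail.simps dhead.simps)+
  have k: "M (Arr 1 3) $$ (0, 0) \<in> K" "M (Arr 1 3) $$ (0, 1) \<in> K" "M (Arr 3 2) $$ (0, 0) \<in> K" "M (Arr 3 2) $$ (1, 0) \<in> K"
    "M Cminus $$ (0, 0) \<in> K"
    using K(2) a elements_matI[OF m(1), of 0 0] elements_matI[OF m(1), of 0 1] elements_matI[OF m(2), of 0 0]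
      elements_matI[OF m(2), of 1 0] elements_matI[OF m(3), of 0 0] by (simp_all add: subset_iff)
  have i: "?M (Arr 1 3) $$ (0, 0) = \<sigma> (M (Arr 1 3) $$ (0, 0))" "?M (Arr 1 3) $$ (0, 1) = \<sigma> (M (Arr 1 3) $$ (0, 1))"
    "?M (Arr 3 2) $$ (0, 0) = \<sigma> (M (Arr 3 2) $$ (0, 0))" "?M (Arr 3 2) $$ (1, 0) = \<sigma> (M (Arr 3 2) $$ (1, 0))"
    "?M Cminus $$ (0, 0) = \<sigma> (M Cminus $$ (0, 0))" using m by auto
  note s = field_embD[OF K(1)]
  have pw': "\<sigma> (M (Arr 3 2) $$ (0, 0)) * \<sigma> (M (Arr 1 3) $$ (0, 0)) + \<sigma> (M (Arr 3 2) $$ (1, 0)) * \<sigma> (M (Arr 1 3) $$ (0, 1)) = 0"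
    using arg_cong[OF pw, of \<sigma>] k sub_fieldD(4)[OF s(1)] by (simp add: s)
  define w where "w = vec 2 (\<lambda>j. ?M (Arr 1 3) $$ (0, j))"
  have wi: "w $ 0 = \<sigma> (M (Arr 1 3) $$ (0, 0))" "w $ 1 = \<sigma> (M (Arr 1 3) $$ (0, 1))" using i by (auto simp: w_def)
  have g: "quot_grass Delta d ?M e = (if uniserial_ok e then {quot1 w d e} else {})"
    by (rule quot_grass_uniserial[OF is_rep_map[OF rep] d w_def])
      (use w pq cm pw' k e in \<open>auto simp: i wi s(8)\<close>)
  show "euler_char (quot_grass_top Delta d ?M e) = of_bool (uniserial_ok e)"
  proof (cases "uniserial_ok e")
    case True
    then have "topspace (quot_grass_top Delta d ?M e) = {quot1 w d e}" using g by (simp add: topspace_quot_grass_top)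
    then show ?thesis using True euler_char_singleton by simp
  next
    case False
    then have "topspace (quot_grass_top Delta d ?M e) = {}" using g by (simp add: topspace_quot_grass_top)
    then show ?thesis using False euler_char_empty by simp
  qed
qed


section \<open>The generic cokernels\<close>

lemma coefJ_arr_mult:
  assumes a: "a \<in> arcs Delta" and w: "w \<in> good_words"
  shows "coefJ u w (arr a * y) = (if u = dtail a \<and> w \<noteq> [] \<and> hd w = a then coefJ (dhead a) (tl w) y else (0 :: 'k::field))"
proof -
  obtain f where f: "f \<in> carrier CP" "y = toJ f" using toJ_surj by metis
  have c: "(path_elt (dtail a, [a]) :: (nat, darc, 'k) series) \<in> carrier CP"
    by (rule path_elt_CP[OF arc_qpath[OF a]])
  have t: "tl w \<in> good_words" using good_words_drop[OF w, of 1] by (simp add: drop_Suc One_nat_def)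
  have "coefJ u w (arr a * y) = (path_elt (dtail a, [a]) \<otimes>\<^bsub>CP\<^esub> f) (u, w)"
    unfolding f(2) arr_def toJ_hom(2)[OF c f(1), symmetric] by (rule coefJ_toJ[OF CP.m_closed[OF c f(1)] w])
  then show ?thesis by (simp add: path_elt_arc_mult f coefJ_toJ[OF f(1) t])
qed

definition jfun :: "('k::field jac \<Rightarrow> 'k) \<Rightarrow> bool" where
  "jfun f \<longleftrightarrow> (\<forall>x y. f (x + y) = f x + f y) \<and> (\<forall>c x. f (sc c * x) = c * f x)"

lemma jfun_coefJ: "w \<in> good_words \<Longrightarrow> jfun (coefJ u w)"
  by (simp add: jfun_def coefJ_add coefJ_sc)

lemma jfun_zero: "jfun f \<Longrightarrow> f 0 = 0"
  unfolding jfun_def using mult_zero_left[of "0 :: _ jac"] by (metis mult_zero_left sc_0)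

lemma jfun_sum: "jfun f \<Longrightarrow> f (\<Sum>s\<in>S. g s) = (\<Sum>s\<in>S. f (g s))"
proof (induction S rule: infinite_finite_induct)
  case (insert s S)
  then show ?case by (simp add: jfun_def)
qed (simp_all add: jfun_zero)

context one_target
begin

lemma jfun_Im_zero:
  assumes f: "jfun f" and z: "\<And>s r. s \<in> copies Delta m \<Longrightarrow> f (F s * r) = 0" and y: "y \<in> Im F"
  shows "f y = 0"
  using y by (auto simp: Im_def img_def jfun_sum[OF f] z)

text \<open>The paths in \<open>F s\<close> end at \<open>fst s\<close>, so a word that avoids this
  vertex has no prefix among them.\<close>

lemma coefJ_gen_zero:
  assumes F: "adm F" and s: "s \<in> copies Delta m" and w: "w \<in> good_words"
    and e: "\<And>i. i \<le> length w \<Longrightarrow> pend Delta u (take i w) \<noteq> fst s"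
  shows "coefJ u w (F s * r) = 0"
  unfolding coefJ_mult[OF w]
proof (intro sum.neutral ballI)
  fix i assume "i \<in> {..length w}"
  then have "coefJ u (take i w) (F s * idm (fst s)) = 0"
    using coefJ_mult_idm[OF good_words_take[OF w] copies_verts[OF s], of u i "F s"] e[of i] by simp
  then have "coefJ u (take i w) (F s) = 0" using F s by (simp add: adm_def)
  then show "coefJ u (take i w) (F s) * coefJ (pend Delta u (take i w)) (drop i w) r = 0" by simp
qed

text \<open>Replaces the kernel condition of \<open>coker_basis\<close> by spanning: if
  \<open>b\<close> and the image exhaust P_v, a corner element is a combination of \<open>b\<close>
  modulo the image, and the dual functionals read off its coefficients.\<close>

lemma coker_basis2:
  fixes F :: "nat \<times> nat \<Rightarrow> 'k::field_char_0 jac"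
  assumes b: "\<And>u i. u \<in> {1..8} \<Longrightarrow> i < d0 u \<Longrightarrow> b u i \<in> corner u"
    and f: "\<And>u i. u \<in> {1..8} \<Longrightarrow> i < d0 u \<Longrightarrow> jfun (f u i)"
    and fb: "\<And>u i j. u \<in> {1..8} \<Longrightarrow> i < d0 u \<Longrightarrow> j < d0 u \<Longrightarrow> f u i (b u j) = of_bool (i = j)"
    and f_Im: "\<And>u i y. u \<in> {1..8} \<Longrightarrow> i < d0 u \<Longrightarrow> y \<in> Im F \<Longrightarrow> f u i y = 0"
    and V: "\<And>V. jvs.subspace V \<Longrightarrow> Im F \<subseteq> V \<Longrightarrow> (\<And>u i. u \<in> {1..8} \<Longrightarrow> i < d0 u \<Longrightarrow> b u i \<in> V) \<Longrightarrow> right_in V (idm v)"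
  shows "\<exists>M. is_rep Delta d0 M \<and> (\<exists>\<rho>. coker_map F d0 M \<rho>)"
    and "coker_map F d M \<rho> \<Longrightarrow> u \<in> {1..8} \<Longrightarrow> d u = d0 u"
    and "coker_map F d M \<rho> \<Longrightarrow> u \<in> {1..8} \<Longrightarrow> y \<in> corner u \<Longrightarrow> \<rho> u y = 0\<^sub>v (d u) \<longleftrightarrow> (\<forall>i<d0 u. f u i y = 0)"
proof -
  define B where "B = (\<Union>u\<in>{1..8}. b u ` {..<d0 u})"
  define lc where "lc u c = (\<Sum>j<d0 u. sc (c j) * b u j)" for u c
  have lc_f: "f u i (lc u c) = c i" if "u \<in> {1..8}" "i < d0 u" for u i c
    unfolding lc_def jfun_sum[OF f[OF that]] using f[OF that] fb[OF that] that by (simp add: jfun_def)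
  have lc: "\<exists>c. x * idm u = lc u c" if u: "u \<in> {1..8}" and x: "x \<in> jvs.span B" for x u
    using x
  proof (induction rule: jvs.span_induct_alt)
    case base
    show ?case by (rule exI[of _ "\<lambda>_. 0"]) (simp add: lc_def)
  next
    case (step t x y)
    then obtain c where c: "y * idm u = lc u c" by blast
    obtain u' j where j: "u' \<in> {1..8}" "j < d0 u'" "x = b u' j" using step(1) by (auto simp: B_def)
    have "x * idm u = (b u' j * idm u') * idm u" using b[OF j(1,2)] j(3) by (simp add: corner_def)
    also have "\<dots> = (if u' = u then x else 0)"
      unfolding mult.assoc idm_mult_idm[OF j(1) u] using b[OF j(1,2)] j(3) by (auto simp: corner_def)
    finally have xu: "x * idm u = (if u' = u then x else 0)" .
    have "(sc t * x + y) * idm u = lc u (\<lambda>i. c i + (if u' = u \<and> i = j then t else 0))"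
    proof (cases "u' = u")
      case True
      have "lc u (\<lambda>i. c i + (if i = j then t else 0)) = lc u c + (\<Sum>i<d0 u. if i = j then sc t * b u j else 0)"
        unfolding lc_def sum.distrib[symmetric] by (intro sum.cong) (auto simp: sc_add distrib_right)
      also have "\<dots> = lc u c + sc t * x" using j True by simp
      finally show ?thesis using True xu c by (simp add: distrib_right mult.assoc add.commute)
    next
      case False
      then show ?thesis using xu c by (simp add: distrib_right mult.assoc)
    qed
    then show ?case by blast
  qed
  \<comment> \<open>The smallest subspace to which assumption \<open>V\<close> applies.\<close>
  let ?V = "{x + y |x y. x \<in> jvs.span B \<and> y \<in> Im F}"
  have "jvs.subspace ?V" by (rule jvs.subspace_sums[OF jvs.subspace_span right_idealD(1)[OF right_ideal_Im]])
  moreover have "Im F \<subseteq> ?V" using jvs.span_zero by force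
  moreover have "b u i \<in> ?V" if "u \<in> {1..8}" "i < d0 u" for u i
  proof -
    have "b u i \<in> jvs.span B" unfolding B_def using that by (intro jvs.span_base) blast
    then show ?thesis using right_idealD(7)[OF right_ideal_Im, of F] by force
  qed
  ultimately have rV: "right_in ?V (idm v)" by (rule V)
  have ker: "(\<forall>i<d0 u. f u i y = 0) \<longleftrightarrow> y \<in> Im F" if u: "u \<in> {1..8}" and y: "y \<in> corner u" for u y
  proof
    assume z: "\<forall>i<d0 u. f u i y = 0"
    have "idm v * y = y" using y by (simp add: corner_def)
    then have "y \<in> ?V" using rV[unfolded right_in_def, THEN spec, of y] by (simp only:)
    then obtain x x' where x: "y = x + x'" "x \<in> jvs.span B" "x' \<in> Im F" by blast
    obtain c where c: "x * idm u = lc u c" using lc[OF u x(2)] by blast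
    have x'u: "x' * idm u \<in> Im F" by (rule right_idealD(2)[OF right_ideal_Im x(3)])
    have "y = y * idm u" using y by (simp add: corner_def)
    then have yc: "y = lc u c + x' * idm u" using c by (simp add: x(1) distrib_right)
    have "c i = 0" if i: "i < d0 u" for i
    proof -
      have "f u i y = f u i (lc u c) + f u i (x' * idm u)" unfolding yc using f[OF u i] by (simp only: jfun_def)
      then show ?thesis using z i lc_f[OF u i] f_Im[OF u i x'u] by simp
    qed
    then have "lc u c = 0" by (simp add: lc_def)
    then show "y \<in> Im F" using yc x'u by simp
  qed (use f_Im u in blast)
  have f1: "f u i (x + y) = f u i x + f u i y" "f u i (sc c * x) = c * f u i x" if "u \<in> {1..8}" "i < d0 u" for u i x y c
    using f[OF that] by (simp_all add: jfun_def)
  show "\<exists>M. is_rep Delta d0 M \<and> (\<exists>\<rho>. coker_map F d0 M \<rho>)"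
    by (rule coker_basis(1)[where b = b and f = f and F = F]) (fact b f1 fb ker)+
  show "d u = d0 u" if "coker_map F d M \<rho>" "u \<in> {1..8}"
    by (rule coker_basis(2)[where b = b and f = f and F = F and M = M and \<rho> = \<rho>]) (fact b f1 fb ker that)+
  show "\<rho> u y = 0\<^sub>v (d u) \<longleftrightarrow> (\<forall>i<d0 u. f u i y = 0)" if "coker_map F d M \<rho>" "u \<in> {1..8}" "y \<in> corner u"
    using that ker[OF that(2,3)] unfolding coker_map_def by blast
qed

end

text \<open>\<open>A 1 3 * A 3 5\<close> lies in the image with \<open>A 1 4\<close>, being minus
  \<open>A 1 4 * A 4 5\<close>; so nothing beyond e_1 and \<open>A 1 3\<close> is left.\<close>

lemma quot_in1:
  fixes I :: "'k::field jac set"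
  assumes V: "jvs.subspace V" "I \<subseteq> V" and I: "right_ideal I" and mem: "idm 1 \<in> V" "A 1 3 \<in> V" and i: "A 1 4 \<in> I" "A 1 3 * A 3 8 \<in> I"
  shows "right_in V (idm 1)"
proof -
  note s = right_in_steps[OF V(1)] and D = right_idealD[OF I]
  note R = jac_rules arr_mult_idm idm_mult_arr idm_mult_idm right_in_zero[OF V(1)] mem
  have rI: "right_in V b" if "b \<in> I" for b using D(2)[OF that] V(2) by (auto simp: right_in_def)
  have a: "Arr 1 3 \<in> arcs Delta" "Arr 1 4 \<in> arcs Delta" by (simp_all add: arcs_Delta)
  have q: "A 1 3 * A 3 5 \<in> I" using D(3)[OF D(2)[OF i(1), of "A 4 5"]] by (simp add: jac_rules)
  have r: "right_in V (A 1 3)" by (rule s(3)) (simp_all add: R a rI i q)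
  show ?thesis by (rule s(1)) (simp_all add: R a rI i r)
qed

text \<open>\<open>A 2 6\<close> puts \<open>arr Cplus * A 1 3\<close> and
  \<open>arr Cminus * A 1 4\<close> into the image; since both coefficients of the second generator
  are nonzero, the two mixed products follow.\<close>

lemma quot_in2:
  fixes I :: "'k::field jac set"
  assumes V: "jvs.subspace V" "I \<subseteq> V" and I: "right_ideal I" and mem: "idm 2 \<in> V" "arr Cplus \<in> V"
    and i: "A 2 6 \<in> I" "sc \<alpha> * arr Cplus + sc \<beta> * arr Cminus \<in> I" and nz: "\<alpha> \<noteq> 0" "\<beta> \<noteq> 0"
  shows "right_in V (idm 2)"
proof -
  note s = right_in_steps[OF V(1)] and D = right_idealD[OF I]
  have rI: "right_in V b" if "b \<in> I" for b using D(2)[OF that] V(2) by (auto simp: right_in_def)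
  have a: "Cplus \<in> arcs Delta" "Cminus \<in> arcs Delta" by (simp_all add: arcs_Delta)
  have p3: "arr Cplus * A 1 3 \<in> I" and m4: "arr Cminus * A 1 4 \<in> I"
    using D(2)[OF i(1), of "A 6 3"] D(2)[OF i(1), of "A 6 4"] by (simp_all add: jac_rules)
  have "sc \<beta> * (arr Cminus * A 1 3) \<in> I"
    using D(6)[OF D(2)[OF i(2), of "A 1 3"] D(4)[OF p3, of \<alpha>]] by (simp add: distrib_right mult.assoc)
  then have m3: "arr Cminus * A 1 3 \<in> I" by (rule D(8)[OF _ nz(2)])
  have "sc \<alpha> * (arr Cplus * A 1 4) \<in> I"
    using D(6)[OF D(2)[OF i(2), of "A 1 4"] D(4)[OF m4, of \<beta>]] by (simp add: distrib_right mult.assoc)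
  then have p4: "arr Cplus * A 1 4 \<in> I" by (rule D(8)[OF _ nz(1)])
  have "sc (inverse \<beta>) * ((sc \<alpha> * arr Cplus + sc \<beta> * arr Cminus) - sc \<alpha> * arr Cplus) \<in> V"
    using i(2) V mem(2) by (intro jvs.subspace_scale jvs.subspace_diff) auto
  then have cm: "arr Cminus \<in> V" using nz by (simp add: sc_mult_mult flip: mult.assoc)
  have "right_in V (arr Cplus)" by (rule s(1)) (simp_all add: arr_mult_idm a mem rI p3 p4)
  moreover have "right_in V (arr Cminus)" by (rule s(1)) (simp_all add: arr_mult_idm a cm rI m3 m4)
  moreover have "A 2 6 \<in> V" using i(1) V(2) by blast
  ultimately show ?thesis using right_in_P2[OF V(1) mem(1)] by blast
qed

text \<open>\<open>A 3 2 * arr Cplus = A 3 5 * A 5 1\<close> and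
  \<open>A 3 2 * A 2 6 = A 3 8 * A 8 6\<close> lie in the image, so only the continuation by
  \<open>arr Cminus\<close> is left as a hypothesis.\<close>

lemma quot_in3:
  fixes I :: "'k::field jac set"
  assumes V: "jvs.subspace V" "I \<subseteq> V" and I: "right_ideal I" and mem: "idm 3 \<in> V" "A 3 2 \<in> V"
    and i: "A 3 8 \<in> I" "A 3 5 \<in> I" and cm: "right_in V (A 3 2 * arr Cminus)"
  shows "right_in V (idm 3)"
proof (rule right_in_P3[OF V(1) mem])
  note D = right_idealD[OF I]
  have p: "A 3 2 * arr Cplus \<in> I" and q: "A 3 2 * A 2 6 \<in> I"
    using D(2)[OF i(2), of "A 5 1"] D(2)[OF i(1), of "A 8 6"] by (simp_all add: jac_rules)
  show "A 3 5 \<in> V" "A 3 8 \<in> V" "A 3 2 * arr Cplus \<in> V" "A 3 2 * arr Cplus * A 1 3 \<in> V" "A 3 2 * A 2 6 \<in> V" "A 3 5 * A 5 7 \<in> V"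
    using i p q D(2)[OF p] D(2)[OF i(2)] V(2) by auto
qed (rule cm)

text \<open>\<open>A 3 2 * arr Cminus * A 1 4\<close> equals \<open>A 3 8 * A 8 6 * A 6 4\<close>
  and lies in the image; multiplied by \<open>A 4 5\<close> it gives, up to sign, the path through
  \<open>A 1 3 * A 3 5\<close>.\<close>

lemma quot_in312:
  fixes I :: "'k::field jac set"
  assumes V: "jvs.subspace V" "I \<subseteq> V" and I: "right_ideal I"
    and mem: "A 3 2 * arr Cminus \<in> V" "A 3 2 * arr Cminus * A 1 3 \<in> V"
    and i: "A 3 8 \<in> I" "A 3 2 * arr Cminus * A 1 3 * A 3 8 \<in> I"
  shows "right_in V (A 3 2 * arr Cminus)" "A 3 2 * arr Cminus * A 1 3 * A 3 5 \<in> I"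
proof -
  note s = right_in_steps[OF V(1)] and D = right_idealD[OF I]
  have rI: "right_in V b" if "b \<in> I" for b using D(2)[OF that] V(2) by (auto simp: right_in_def)
  have a: "Arr 1 3 \<in> arcs Delta" "Cminus \<in> arcs Delta" by (simp_all add: arcs_Delta)
  have m4: "A 3 2 * arr Cminus * A 1 4 \<in> I"
    using D(2)[OF D(2)[OF i(1), of "A 8 6"], of "A 6 4"] by (simp add: jac_rules)
  show q: "A 3 2 * arr Cminus * A 1 3 * A 3 5 \<in> I"
    using D(3)[OF D(2)[OF m4, of "A 4 5"]] by (simp add: jac_rules)
  have r: "right_in V (A 3 2 * arr Cminus * A 1 3)"
    by (rule s(3)) (simp_all add: jac_rules arr_mult_idm a mem rI i q right_in_zero[OF V(1)])
  show "right_in V (A 3 2 * arr Cminus)" by (rule s(1)) (simp_all add: arr_mult_idm a mem rI m4 r)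
qed

section \<open>Cluster characters of modules with two composition factors\<close>

lemma prod_verts: "(\<Prod>u\<in>{1..8}. f u) = f 1 * f 2 * f 3 * f 4 * f 5 * f 6 * f 7 * (f (8 :: nat) :: 'b::comm_monoid_mult)"
proof -
  have "{1..8 :: nat} = {1, 2, 3, 4, 5, 6, 7, 8}" by auto
  then show ?thesis by (simp add: mult.assoc)
qed

lemma sum_le_small: "(\<Sum>a\<le>0. f a) = f (0 :: nat)" "(\<Sum>a\<le>1. f a) = f 0 + f (1 :: nat)" "(\<Sum>a\<le>2. f a) = f 0 + f 1 + (f (2 :: nat) :: 'b::comm_monoid_add)"
  by (simp_all add: numeral_2_eq_2 One_nat_def)

text \<open>A nonsplit extension with top at \<open>s\<close> and socle at \<open>t\<close> has the
  quotients zero, the simple module at \<open>s\<close>, and itself. The pairs are steps of the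
  cycle 2 -> 1 -> 3 -> 2, so all arrows between the two vertices point from \<open>s\<close> to
  \<open>t\<close>.\<close>

lemma cluster_char_pair:
  fixes M :: "darc \<Rightarrow> 'k::field_char_0 mat"
  assumes rep: "is_rep Delta d M" and st: "(s, t) \<in> {(2, 1), (1, 3), (3, 2)}"
    and d: "\<And>u. u \<in> {1..8} \<Longrightarrow> d u = of_bool (u = s \<or> u = t)"
    and a0: "a0 \<in> arcs Delta" "dtail a0 = s" "dhead a0 = t" "M a0 $$ (0, 0) \<noteq> 0"
  shows "cluster_char_rep g d M = (\<Prod>u\<in>{1..8}. xv u powi g u) * (1 + yv s + yv s * yv t)"
proof -
  have v: "s \<in> {1..8}" "t \<in> {1..8}" using st by auto
  have arc: "dtail a = s \<and> dhead a = t" if "a \<in> arcs Delta" "dtail a \<in> {s, t}" "dhead a \<in> {s, t}" for a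
    using that st unfolding arcs_Delta by auto
  have q: "quot_grass_euler Delta d M e = of_bool (e t \<le> e s)" if "\<And>u. u \<in> {1..8} \<Longrightarrow> e u \<le> d u" for e
    by (rule quot_grass_euler_pair[OF rep v _ _ _ arc a0 that]) (use d v in auto)
  have e: "dimvec a b c u \<le> d u" if "a \<le> d 1" "b \<le> d 2" "c \<le> d 3" for a b c u using that by (simp add: dimvec_def)
  have "(\<Sum>a\<le>d 1. \<Sum>b\<le>d 2. \<Sum>c\<le>d 3. of_int (quot_grass_euler Delta d M (dimvec a b c)) * (yv 1 ^ a * yv 2 ^ b * yv 3 ^ c))
      = (\<Sum>a\<le>d 1. \<Sum>b\<le>d 2. \<Sum>c\<le>d 3. of_bool (dimvec a b c t \<le> dimvec a b c s) * (yv 1 ^ a * yv 2 ^ b * yv 3 ^ c :: 'k kpoly fract))"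
    using q e by (intro sum.cong refl) simp
  also have "\<dots> = 1 + yv s + yv s * yv t"
    using st d[of 1] d[of 2] d[of 3] by (elim insertE emptyE) (simp_all add: sum_le_small dimvec_def mult.commute)
  finally show ?thesis unfolding cluster_char_rep_eq by simp
qed

context one_target
begin

text \<open>Common pattern of three of the four characters: for each map in the open set, dual bases
  at \<open>s\<close> and \<open>t\<close> and a nonzero action of \<open>a0\<close> determine the
  cokernel up to what the character sees.\<close>

lemma CW_pair:
  fixes p :: "((nat, darc, 'k::field_char_0) pelem \<Rightarrow> (nat, darc, 'k) pelem) \<Rightarrow> 'k"
  assumes mn: "m = (\<lambda>u. nat (max (g u) 0))" "n = (\<lambda>u. nat (max (- g u) 0))"
    and p: "p \<in> poly_functions (phom_functionals Delta potW m n)" and F0: "adm F0" "p (Phi F0) \<noteq> 0"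
    and st: "(s, t) \<in> {(2, 1), (1, 3), (3, 2)}" and a0: "a0 \<in> arcs Delta" "dtail a0 = s" "dhead a0 = t"
    and D: "\<And>F. adm F \<Longrightarrow> p (Phi F) \<noteq> 0 \<Longrightarrow> \<exists>bs bt fs ft. bs \<in> corner s \<and> bt \<in> corner t \<and> jfun fs \<and> jfun ft \<and>
      fs bs = 1 \<and> ft bt = 1 \<and> (\<forall>y\<in>Im F. fs y = 0 \<and> ft y = 0) \<and>
      (\<forall>V. jvs.subspace V \<longrightarrow> Im F \<subseteq> V \<longrightarrow> bs \<in> V \<longrightarrow> bt \<in> V \<longrightarrow> right_in V (idm v)) \<and> ft (bs * arr a0) \<noteq> 0"
  shows "CW g = (\<Prod>u\<in>{1..8}. xv u powi g u) * (1 + yv s + yv s * (yv t :: 'k kpoly fract))"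
proof (rule CW_eqI[OF mn p F0])
  fix F :: "nat \<times> nat \<Rightarrow> 'k jac" assume F: "adm F" "p (Phi F) \<noteq> 0"
  obtain bs bt fs ft where B: "bs \<in> corner s" "bt \<in> corner t" "jfun fs" "jfun ft"
      "fs bs = 1" "ft bt = 1" "\<forall>y\<in>Im F. fs y = 0 \<and> ft y = 0"
      "\<forall>V. jvs.subspace V \<longrightarrow> Im F \<subseteq> V \<longrightarrow> bs \<in> V \<longrightarrow> bt \<in> V \<longrightarrow> right_in V (idm v)" "ft (bs * arr a0) \<noteq> 0"
    using D[OF F] by blast
  have v8: "s \<in> {1..8}" "t \<in> {1..8}" "s \<noteq> t" using st by auto
  let ?d = "\<lambda>u. of_bool (u = s \<or> u = t) :: nat" and ?b = "\<lambda>u (i :: nat). if u = s then bs else bt"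
  let ?f = "\<lambda>u (i :: nat). if u = s then fs else ft"
  have c1: "?b u i \<in> corner u" if "u \<in> {1..8}" "i < ?d u" for u i using that(2) B(1,2) by (cases "u = s"; cases "u = t") auto
  have c2: "jfun (?f u i)" if "u \<in> {1..8}" "i < ?d u" for u i using B(3,4) by simp
  have c3: "?f u i (?b u j) = of_bool (i = j)" if "u \<in> {1..8}" "i < ?d u" "j < ?d u" for u i j
    using that(2,3) B(5,6) by (cases "u = s"; cases "u = t") auto
  have c4: "?f u i y = 0" if "u \<in> {1..8}" "i < ?d u" "y \<in> Im F" for u i y using that(3) B(7) by auto
  have c5: "right_in V (idm v)" if "jvs.subspace V" "Im F \<subseteq> V" "\<And>u i. u \<in> {1..8} \<Longrightarrow> i < ?d u \<Longrightarrow> ?b u i \<in> V" for V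
    using that(1,2) that(3)[OF v8(1), of 0] that(3)[OF v8(2), of 0] v8(3) B(8) by auto
  have K1: "\<exists>M. is_rep Delta ?d M \<and> (\<exists>\<rho>. coker_map F ?d M \<rho>)"
    by (rule coker_basis2(1)[where b = ?b and f = ?f and F = F]) (fact c1 c2 c3 c4 c5)+
  have K2: "d u = ?d u" if "coker_map F d M \<rho>" "u \<in> {1..8}" for d M \<rho> u
    by (rule coker_basis2(2)[where b = ?b and f = ?f and F = F and M = M and \<rho> = \<rho>]) (fact c1 c2 c3 c4 c5 that)+
  have K3: "\<rho> u y = 0\<^sub>v (d u) \<longleftrightarrow> (\<forall>i<?d u. ?f u i y = 0)" if "coker_map F d M \<rho>" "u \<in> {1..8}" "y \<in> corner u" for d M \<rho> u y
    by (rule coker_basis2(3)[where b = ?b and f = ?f and F = F and M = M and \<rho> = \<rho>]) (fact c1 c2 c3 c4 c5 that)+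
  show "\<exists>d M. is_rep Delta d M \<and> (\<exists>\<rho>. coker_map F d M \<rho>)" using K1 by blast
  fix d M \<rho> assume rep: "is_rep Delta d M" and co: "coker_map F d M \<rho>"
  have d: "d u = of_bool (u = s \<or> u = t)" if "u \<in> {1..8}" for u using K2[OF co that] by simp
  have "bs \<in> corner (dtail a0)" using a0(2) B(1) by simp
  then have "\<rho> (dhead a0) (bs * arr a0) = (M a0)\<^sup>T *\<^sub>v \<rho> (dtail a0) bs"
    using co a0(1) unfolding coker_map_def by blast
  then have "\<rho> t (bs * arr a0) = (M a0)\<^sup>T *\<^sub>v \<rho> s bs" by (simp only: a0)
  moreover have "\<rho> s bs \<in> carrier_vec (d s)" using co B(1) v8(1) unfolding coker_map_def by blast
  then have "\<rho> s bs \<in> carrier_vec 1" using d[OF v8(1)] by simp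
  moreover have "bs * arr a0 \<in> corner t" using corner_arr[OF a0(1), of bs] a0(2,3) B(1) by simp
  then have "\<rho> t (bs * arr a0) \<noteq> 0\<^sub>v 1"
    using K3[OF co v8(2), of "bs * arr a0"] B(9) v8(3) d[OF v8(2)] by simp
  moreover have "M a0 \<in> carrier_mat 1 1" using rep a0 d v8 unfolding is_rep_def Delta_simps by fastforce
  ultimately have nz: "M a0 $$ (0, 0) \<noteq> 0"
    using mult_vec_11[of "M a0" "\<rho> s bs"] vec1_neq0[of "(M a0)\<^sup>T *\<^sub>v \<rho> s bs"] by auto
  have "cluster_char_rep g d M = (\<Prod>u\<in>{1..8}. xv u powi g u) * (1 + yv s + yv s * yv t)"
    by (rule cluster_char_pair[OF rep st _ a0 nz]) (fact d)
  moreover have "\<forall>u\<in>{4..8}. d u = 0" using d st by auto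
  ultimately show "(\<forall>u\<in>{4..8}. d u = 0) \<and> cluster_char_rep g d M = (\<Prod>u\<in>{1..8}. xv u powi g u) * (1 + yv s + yv s * yv t)" by blast
qed

end


section \<open>The four cluster characters\<close>

lemma pend_mem: "pend Delta u w \<in> set (u # map dhead w)"
  by (induction w arbitrary: u) auto

lemma coefJ_zero: "w \<in> good_words \<Longrightarrow> coefJ u w 0 = 0"
  by (rule jfun_zero[OF jfun_coefJ])

context one_target
begin

lemma coefJ_Im:
  assumes F: "adm F" and w: "w \<in> good_words" and e: "\<forall>s\<in>copies Delta m. fst s \<notin> set (u # map dhead w)" and y: "y \<in> Im F"
  shows "coefJ u w y = 0"
proof (rule jfun_Im_zero[OF jfun_coefJ[OF w] _ y])
  fix s r assume s: "s \<in> copies Delta m"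
  have "pend Delta u (take i w) \<noteq> fst s" for i
  proof -
    have "set (u # map dhead (take i w)) \<subseteq> set (u # map dhead w)" using set_take_subset[of i w] by auto
    then show ?thesis using pend_mem[of u "take i w"] e s by (metis subsetD)
  qed
  then show "coefJ u w (F s * r) = 0" by (intro coefJ_gen_zero[OF F s w])
qed

end

text \<open>A general map P_8 + P_4 -> P_1 has nonzero multiples of \<open>A 1 3 * A 3 8\<close> and
  \<open>A 1 4\<close> as entries; e_1 and \<open>A 1 3\<close> survive in the cokernel.\<close>

lemma x31_formula: "x31 = (xv 8 * xv 4 / xv 1 * (1 + yv 1 + yv 1 * yv 3) :: 'k::field_char_0 kpoly fract)"
proof -
  define g :: "nat \<Rightarrow> int" where "g = (\<lambda>v. ev 8 v + ev 4 v - ev 1 v)"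
  define m where "m = (\<lambda>u. nat (max (g u) 0))"
  define n where "n = (\<lambda>u. nat (max (- g u) 0))"
  have mm: "m u = (if u = 8 \<or> u = 4 then 1 else 0)" and nn: "n u = (if u = 1 then 1 else 0)" for u
    by (cases "u = 8"; cases "u = 4"; cases "u = 1"; simp add: m_def n_def g_def ev_def)+
  interpret one_target m n 1 by unfold_locales (simp_all add: nn)
  have c: "copies Delta m = {(8, 0), (4, 0)}" by (auto simp: copies_def mm split: if_splits)
  have a: "Arr 1 3 \<in> arcs Delta" "Arr 3 8 \<in> arcs Delta" "Arr 1 4 \<in> arcs Delta" by (simp_all add: arcs_Delta)
  let ?F0 = "\<lambda>s :: nat \<times> nat. if s = (8, 0) then A 1 3 * A 3 8 else A 1 4 :: 'k jac"
  let ?p = "\<lambda>\<phi>. coefJ 1 [Arr 1 3, Arr 3 8] (entF (8, 0) \<phi>) * coefJ 1 [Arr 1 4] (entF (4, 0) \<phi>) :: 'k"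
  have p: "?p \<in> poly_functions (phom_functionals Delta potW m n)"
    by (intro poly_functions.mult poly_functions.linear coef_functional) (simp_all add: c good_words_def)
  have F0: "adm ?F0" by (simp add: adm_def c idm_mult_arr arr_mult_idm a flip: mult.assoc)
  have p0: "?p (Phi ?F0) \<noteq> 0" by (simp add: entF_Phi[OF F0] c coefJ_arr_mult coefJ_arr a good_words_def)
  have "CW g = (\<Prod>u\<in>{1..8}. xv u powi g u) * (1 + yv 1 + yv 1 * (yv 3 :: 'k kpoly fract))"
  proof (rule CW_pair[OF m_def n_def p F0 p0, where ?a0.0 = "Arr 1 3"])
    fix F :: "nat \<times> nat \<Rightarrow> 'k jac" assume F: "adm F" "?p (Phi F) \<noteq> 0"
    note R = right_idealD[OF right_ideal_Im[of F]] and G = Im_gen[of _ F]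
    obtain \<alpha> where \<alpha>: "F (8, 0) = sc \<alpha> * (A 1 3 * A 3 8)" using corner1(1)[of "F (8, 0)"] F(1) by (auto simp: adm_def c)
    obtain \<beta> where \<beta>: "F (4, 0) = sc \<beta> * A 1 4" using corner1(2)[of "F (4, 0)"] F(1) by (auto simp: adm_def c)
    have nz: "\<alpha> \<noteq> 0" "\<beta> \<noteq> 0" using F(2) by (auto simp: entF_Phi[OF F(1)] c \<alpha> \<beta> coefJ_zero good_words_def)
    have gi: "sc \<alpha> * (A 1 3 * A 3 8) \<in> Im F" "sc \<beta> * A 1 4 \<in> Im F"
      using G[of "(8, 0)"] G[of "(4, 0)"] by (simp_all add: c \<alpha> \<beta>)
    note i = R(8)[OF gi(2) nz(2)] R(8)[OF gi(1) nz(1)]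
    have "right_in V (idm 1)" if "jvs.subspace V" "Im F \<subseteq> V" "idm 1 \<in> V" "A 1 3 \<in> V" for V
      by (rule quot_in1[OF that(1,2) right_ideal_Im that(3,4) i])
    then show "\<exists>bs bt fs ft. bs \<in> corner 1 \<and> bt \<in> corner 3 \<and> jfun fs \<and> jfun ft \<and>
      fs bs = 1 \<and> ft bt = 1 \<and> (\<forall>y\<in>Im F. fs y = 0 \<and> ft y = 0) \<and>
      (\<forall>V. jvs.subspace V \<longrightarrow> Im F \<subseteq> V \<longrightarrow> bs \<in> V \<longrightarrow> bt \<in> V \<longrightarrow> right_in V (idm 1)) \<and> ft (bs * A 1 3) \<noteq> 0"
      by (intro exI[of _ "idm 1"] exI[of _ "A 1 3"] exI[of _ "coefJ 1 []"] exI[of _ "coefJ 1 [Arr 1 3]"])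
        (simp add: corner_def idm_mult_arr arr_mult_idm idm_mult_idm a jfun_coefJ good_words_def coefJ_idm coefJ_arr coefJ_Im[OF F(1)] c)
  qed (simp_all add: a)
  moreover have "(\<Prod>u\<in>{1..8}. xv u powi g u) = (xv 8 * xv 4 / xv 1 :: 'k kpoly fract)"
    unfolding prod_verts by (simp add: g_def ev_def power_int_minus divide_inverse)
  ultimately show ?thesis unfolding x31_def g_def by simp
qed

text \<open>A general map P_6 + P_1 -> P_2 consists of a multiple of \<open>A 2 6\<close> and a
  combination of both arrows 2 -> 1 with nonzero coefficients, which makes the two arrows
  proportional in the cokernel.\<close>

lemma x2circ_formula: "x2circ = (xv 6 * xv 1 / xv 2 * (1 + yv 2 + yv 2 * yv 1) :: 'k::field_char_0 kpoly fract)"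
proof -
  define g :: "nat \<Rightarrow> int" where "g = (\<lambda>v. ev 6 v + ev 1 v - ev 2 v)"
  define m where "m = (\<lambda>u. nat (max (g u) 0))"
  define n where "n = (\<lambda>u. nat (max (- g u) 0))"
  have mm: "m u = (if u = 6 \<or> u = 1 then 1 else 0)" and nn: "n u = (if u = 2 then 1 else 0)" for u
    by (cases "u = 6"; cases "u = 1"; cases "u = 2"; simp add: m_def n_def g_def ev_def)+
  interpret one_target m n 2 by unfold_locales (simp_all add: nn)
  have c: "copies Delta m = {(6, 0), (1, 0)}" by (auto simp: copies_def mm split: if_splits)
  have a: "Arr 2 6 \<in> arcs Delta" "Cplus \<in> arcs Delta" "Cminus \<in> arcs Delta" by (simp_all add: arcs_Delta)
  let ?F0 = "\<lambda>s :: nat \<times> nat. if s = (6, 0) then A 2 6 else arr Cplus + arr Cminus :: 'k jac"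
  let ?p = "\<lambda>\<phi>. coefJ 2 [Arr 2 6] (entF (6, 0) \<phi>) * (coefJ 2 [Cplus] (entF (1, 0) \<phi>) * coefJ 2 [Cminus] (entF (1, 0) \<phi>)) :: 'k"
  have p: "?p \<in> poly_functions (phom_functionals Delta potW m n)"
    by (intro poly_functions.mult poly_functions.linear coef_functional) (simp_all add: c good_words_def)
  have F0: "adm ?F0" by (simp add: adm_def c idm_mult_arr arr_mult_idm a distrib_left distrib_right)
  have p0: "?p (Phi ?F0) \<noteq> 0" by (simp add: entF_Phi[OF F0] c coefJ_arr coefJ_add a good_words_def)
  have "CW g = (\<Prod>u\<in>{1..8}. xv u powi g u) * (1 + yv 2 + yv 2 * (yv 1 :: 'k kpoly fract))"
  proof (rule CW_pair[OF m_def n_def p F0 p0, where ?a0.0 = Cplus])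
    fix F :: "nat \<times> nat \<Rightarrow> 'k jac" assume F: "adm F" "?p (Phi F) \<noteq> 0"
    note R = right_idealD[OF right_ideal_Im[of F]] and G = Im_gen[of _ F]
    obtain \<alpha> where \<alpha>: "F (6, 0) = sc \<alpha> * A 2 6" using corner2(1)[of "F (6, 0)"] F(1) by (auto simp: adm_def c)
    obtain l k where lk: "F (1, 0) = sc l * arr Cplus + sc k * arr Cminus" using corner2(2)[of "F (1, 0)"] F(1) by (auto simp: adm_def c)
    have nz: "\<alpha> \<noteq> 0" "l \<noteq> 0" "k \<noteq> 0"
      using F(2) by (auto simp: entF_Phi[OF F(1)] c \<alpha> lk coefJ_add coefJ_sc coefJ_arr coefJ_zero a good_words_def)
    have gi: "sc \<alpha> * A 2 6 \<in> Im F" "sc l * arr Cplus + sc k * arr Cminus \<in> Im F"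
      using G[of "(6, 0)"] G[of "(1, 0)"] by (simp_all add: c \<alpha> lk)
    note i = R(8)[OF gi(1) nz(1)] gi(2)
    \<comment> \<open>The combination of arrow coefficients that vanishes on
      \<open>F (1, 0)\<close>. It is \<open>k\<close> on \<open>arr Cplus\<close>, whence the factor
      \<open>inverse k\<close> in the basis element.\<close>
    define ft where "ft = (\<lambda>x. k * coefJ 2 [Cplus] x - l * coefJ 2 [Cminus] x)"
    have w: "[Cplus] \<in> good_words" "[Cminus] \<in> good_words" "[] \<in> good_words" by (simp_all add: good_words_def)
    have jft: "jfun ft" unfolding jfun_def ft_def by (simp add: coefJ_add coefJ_sc w algebra_simps)
    have z: "ft y = 0" if y: "y \<in> Im F" for y
    proof (rule jfun_Im_zero[OF jft _ y])
      fix s r assume s: "s \<in> copies Delta m"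
      show "ft (F s * r) = 0"
      proof (cases "s = (6, 0)")
        case True
        then show ?thesis by (simp add: ft_def \<alpha> mult.assoc coefJ_sc w coefJ_arr_mult a)
      next
        case False
        then have "s = (1, 0)" using s c by auto
        then show ?thesis by (simp add: ft_def lk distrib_right mult.assoc coefJ_add coefJ_sc w coefJ_arr_mult a)
      qed
    qed
    have r: "right_in V (idm 2)" if "jvs.subspace V" "Im F \<subseteq> V" "idm 2 \<in> V" "sc (inverse k) * arr Cplus \<in> V" for V
    proof -
      have "sc k * (sc (inverse k) * arr Cplus) \<in> V" by (rule jvs.subspace_scale[OF that(1,4)])
      then have "arr Cplus \<in> V" using nz by (simp add: sc_mult_mult flip: mult.assoc)
      then show ?thesis by (rule quot_in2[OF that(1,2) right_ideal_Im that(3) _ i nz(2,3)])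
    qed
    have f1: "idm 2 \<in> corner 2" "sc (inverse k) * arr Cplus \<in> corner 1"
      by (simp_all add: corner_def sc_left_commute mult.assoc idm_mult_arr arr_mult_idm idm_mult_idm a)
    have f2: "jfun (coefJ 2 [])" "coefJ 2 [] (idm 2) = (1 :: 'k)" by (simp_all add: jfun_coefJ coefJ_idm w)
    have f3: "ft (sc (inverse k) * arr Cplus) = 1" "ft (idm 2 * arr Cplus) \<noteq> 0"
      by (simp_all add: ft_def coefJ_sc coefJ_arr w a idm_mult_arr nz)
    have f4: "\<forall>y\<in>Im F. coefJ 2 [] y = 0 \<and> ft y = 0" using z coefJ_Im[OF F(1) w(3)] c by simp
    have f5: "\<forall>V. jvs.subspace V \<longrightarrow> Im F \<subseteq> V \<longrightarrow> idm 2 \<in> V \<longrightarrow> sc (inverse k) * arr Cplus \<in> V \<longrightarrow> right_in V (idm 2)"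
      using r by blast
    show "\<exists>bs bt fs ft. bs \<in> corner 2 \<and> bt \<in> corner 1 \<and> jfun fs \<and> jfun ft \<and>
      fs bs = 1 \<and> ft bt = 1 \<and> (\<forall>y\<in>Im F. fs y = 0 \<and> ft y = 0) \<and>
      (\<forall>V. jvs.subspace V \<longrightarrow> Im F \<subseteq> V \<longrightarrow> bs \<in> V \<longrightarrow> bt \<in> V \<longrightarrow> right_in V (idm 2)) \<and> ft (bs * arr Cplus) \<noteq> 0"
      by (rule exI[of _ "idm 2"], rule exI[of _ "sc (inverse k) * arr Cplus"], rule exI[of _ "coefJ 2 []"], rule exI[of _ ft])
        (intro conjI f1 f2 f3 f4 f5 jft)
  qed (simp_all add: a)
  moreover have "(\<Prod>u\<in>{1..8}. xv u powi g u) = (xv 6 * xv 1 / xv 2 :: 'k kpoly fract)"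
    unfolding prod_verts by (simp add: g_def ev_def power_int_minus divide_inverse)
  ultimately show ?thesis unfolding x2circ_def g_def by simp
qed

text \<open>The entries of a general map P_8 + P_5 + P_1 -> P_3 contain terms besides
  \<open>A 3 8\<close>, \<open>A 3 5\<close> and \<open>A 3 2 * arr Cminus\<close>; these terms lie
  in the image and can be subtracted. What survives is e_3 and \<open>A 3 2\<close>.\<close>

lemma x32_formula: "x32 = (xv 8 * xv 5 * xv 1 / xv 3 * (1 + yv 3 + yv 3 * yv 2) :: 'k::field_char_0 kpoly fract)"
proof -
  define g :: "nat \<Rightarrow> int" where "g = (\<lambda>v. ev 8 v + ev 5 v + ev 1 v - ev 3 v)"
  define m where "m = (\<lambda>u. nat (max (g u) 0))"
  define n where "n = (\<lambda>u. nat (max (- g u) 0))"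
  have mm: "m u = (if u = 8 \<or> u = 5 \<or> u = 1 then 1 else 0)" and nn: "n u = (if u = 3 then 1 else 0)" for u
    by (cases "u = 8"; cases "u = 5"; cases "u = 1"; cases "u = 3"; simp add: m_def n_def g_def ev_def)+
  interpret one_target m n 3 by unfold_locales (simp_all add: nn)
  have c: "copies Delta m = {(8, 0), (5, 0), (1, 0)}" by (auto simp: copies_def mm split: if_splits)
  have a: "Arr 3 8 \<in> arcs Delta" "Arr 3 5 \<in> arcs Delta" "Arr 3 2 \<in> arcs Delta" "Cplus \<in> arcs Delta" "Cminus \<in> arcs Delta" "Arr 1 3 \<in> arcs Delta"
    by (simp_all add: arcs_Delta)
  let ?F0 = "\<lambda>s :: nat \<times> nat. if s = (8, 0) then A 3 8 else if s = (5, 0) then A 3 5 else A 3 2 * arr Cminus :: 'k jac"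
  let ?p = "\<lambda>\<phi>. coefJ 3 [Arr 3 8] (entF (8, 0) \<phi>) * (coefJ 3 [Arr 3 5] (entF (5, 0) \<phi>) * coefJ 3 [Arr 3 2, Cminus] (entF (1, 0) \<phi>)) :: 'k"
  have p: "?p \<in> poly_functions (phom_functionals Delta potW m n)"
    by (intro poly_functions.mult poly_functions.linear coef_functional) (simp_all add: c good_words_def)
  have F0: "adm ?F0" by (simp add: adm_def c idm_mult_arr arr_mult_idm a flip: mult.assoc)
  have p0: "?p (Phi ?F0) \<noteq> 0" by (simp add: entF_Phi[OF F0] c coefJ_arr coefJ_arr_mult a good_words_def)
  have "CW g = (\<Prod>u\<in>{1..8}. xv u powi g u) * (1 + yv 3 + yv 3 * (yv 2 :: 'k kpoly fract))"
  proof (rule CW_pair[OF m_def n_def p F0 p0, where ?a0.0 = "Arr 3 2"])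
    fix F :: "nat \<times> nat \<Rightarrow> 'k jac" assume F: "adm F" "?p (Phi F) \<noteq> 0"
    note R = right_idealD[OF right_ideal_Im[of F]] and G = Im_gen[of _ F]
    let ?w = "A 3 2 * arr Cminus * A 1 3 :: 'k jac"
    obtain \<alpha> \<alpha>' where \<alpha>: "F (8, 0) = sc \<alpha> * A 3 8 + sc \<alpha>' * (?w * A 3 8)" using corner3(1)[of "F (8, 0)"] F(1) by (auto simp: adm_def c)
    obtain \<beta> \<beta>' where \<beta>: "F (5, 0) = sc \<beta> * A 3 5 + sc \<beta>' * (?w * A 3 5)" using corner3(2)[of "F (5, 0)"] F(1) by (auto simp: adm_def c)
    obtain \<gamma>' \<gamma> where \<gamma>: "F (1, 0) = sc \<gamma>' * (A 3 2 * arr Cplus) + sc \<gamma> * (A 3 2 * arr Cminus)"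
      using corner3(3)[of "F (1, 0)"] F(1) by (auto simp: adm_def c)
    have nz: "\<alpha> \<noteq> 0" "\<beta> \<noteq> 0" "\<gamma> \<noteq> 0"
      using F(2) by (auto simp: entF_Phi[OF F(1)] c \<alpha> \<beta> \<gamma> coefJ_zero coefJ_add coefJ_sc coefJ_arr coefJ_arr_mult mult.assoc a good_words_def)
    have Gs: "F (8, 0) \<in> Im F" "F (5, 0) \<in> Im F" "F (1, 0) \<in> Im F" using G c by auto
    \<comment> \<open>By \<open>jac_relations_z\<close> these multiples lose their
      \<open>arr Cplus\<close> term, which puts the longer paths into the image.\<close>
    have e: "F (1, 0) * (A 1 3 * A 3 8) = sc \<gamma>' * (A 3 2 * arr Cplus * A 1 3 * A 3 8) + sc \<gamma> * (?w * A 3 8)"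
      "F (1, 0) * (A 1 3 * A 3 5) = sc \<gamma>' * (A 3 2 * arr Cplus * A 1 3 * A 3 5) + sc \<gamma> * (?w * A 3 5)"
      by (simp_all add: \<gamma> distrib_right mult.assoc)
    have "sc \<gamma> * (?w * A 3 8) \<in> Im F" "sc \<gamma> * (?w * A 3 5) \<in> Im F"
      using R(2)[OF Gs(3), of "A 1 3 * A 3 8"] R(2)[OF Gs(3), of "A 1 3 * A 3 5"] unfolding e jac_relations_z by simp_all
    then have w: "?w * A 3 8 \<in> Im F" "?w * A 3 5 \<in> Im F" using R(8) nz(3) by blast+
    have "sc \<alpha> * A 3 8 \<in> Im F" "sc \<beta> * A 3 5 \<in> Im F"
      using R(6)[OF Gs(1) R(4)[OF w(1), of \<alpha>']] R(6)[OF Gs(2) R(4)[OF w(2), of \<beta>']] by (simp_all add: \<alpha> \<beta>)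
    then have i: "A 3 8 \<in> Im F" "A 3 5 \<in> Im F" using R(8) nz by blast+
    have cp: "A 3 2 * arr Cplus \<in> Im F" using R(2)[OF i(2), of "A 5 1"] by (simp add: jac_rules)
    have "sc \<gamma> * (A 3 2 * arr Cminus) \<in> Im F" using R(6)[OF Gs(3) R(4)[OF cp, of \<gamma>']] by (simp add: \<gamma>)
    then have cm: "A 3 2 * arr Cminus \<in> Im F" using R(8) nz(3) by blast
    have "right_in V (idm 3)" if "jvs.subspace V" "Im F \<subseteq> V" "idm 3 \<in> V" "A 3 2 \<in> V" for V
      by (rule quot_in3[OF that(1,2) right_ideal_Im that(3,4) i]) (use R(2)[OF cm] that(2) in \<open>auto simp: right_in_def\<close>)
    then show "\<exists>bs bt fs ft. bs \<in> corner 3 \<and> bt \<in> corner 2 \<and> jfun fs \<and> jfun ft \<and>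
      fs bs = 1 \<and> ft bt = 1 \<and> (\<forall>y\<in>Im F. fs y = 0 \<and> ft y = 0) \<and>
      (\<forall>V. jvs.subspace V \<longrightarrow> Im F \<subseteq> V \<longrightarrow> bs \<in> V \<longrightarrow> bt \<in> V \<longrightarrow> right_in V (idm 3)) \<and> ft (bs * A 3 2) \<noteq> 0"
      by (intro exI[of _ "idm 3"] exI[of _ "A 3 2"] exI[of _ "coefJ 3 []"] exI[of _ "coefJ 3 [Arr 3 2]"])
        (simp add: corner_def idm_mult_arr arr_mult_idm idm_mult_idm a jfun_coefJ good_words_def coefJ_idm coefJ_arr coefJ_Im[OF F(1)] c)
  qed (simp_all add: a)
  moreover have "(\<Prod>u\<in>{1..8}. xv u powi g u) = (xv 8 * xv 5 * xv 1 / xv 3 :: 'k kpoly fract)"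
    unfolding prod_verts by (simp add: g_def ev_def power_int_minus divide_inverse)
  ultimately show ?thesis unfolding x32_def g_def by simp
qed


text \<open>The corner e_3 J e_8 is spanned by \<open>A 3 8\<close> and a path of length 4, and two
  general maps from P_8 cover both: the open condition is a nonzero 2x2 determinant together with a
  nonzero coefficient of \<open>A 3 5\<close>. The cokernel has the basis e_3, \<open>A 3 2\<close>,
  \<open>A 3 2 * arr Cminus\<close>, \<open>A 3 2 * arr Cminus * A 1 3\<close>.\<close>

lemma x312_formula: "x312 = (xv 8 * xv 8 * xv 5 / xv 3 * (1 + yv 3 + yv 3 * yv 2 + yv 3 * yv 2 * yv 1 + yv 3 * yv 3 * yv 2 * yv 1) :: 'k::field_char_0 kpoly fract)"
proof -
  define g :: "nat \<Rightarrow> int" where "g = (\<lambda>v. 2 * ev 8 v + ev 5 v - ev 3 v)"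
  define m where "m = (\<lambda>u. nat (max (g u) 0))"
  define n where "n = (\<lambda>u. nat (max (- g u) 0))"
  have mm: "m u = (if u = 8 then 2 else if u = 5 then 1 else 0)" and nn: "n u = (if u = 3 then 1 else 0)" for u
    by (cases "u = 8"; cases "u = 5"; cases "u = 3"; simp add: m_def n_def g_def ev_def)+
  interpret one_target m n 3 by unfold_locales (simp_all add: nn)
  have c: "copies Delta m = {(8, 0), (8, 1), (5, 0)}" by (auto simp: copies_def mm less_2_cases_iff One_nat_def split: if_splits)
  have a: "Arr 3 8 \<in> arcs Delta" "Arr 3 5 \<in> arcs Delta" "Arr 3 2 \<in> arcs Delta" "Cminus \<in> arcs Delta" "Arr 1 3 \<in> arcs Delta"
    by (simp_all add: arcs_Delta)
  let ?w = "A 3 2 * arr Cminus * A 1 3 :: 'k jac" and ?ww = "[Arr 3 2, Cminus, Arr 1 3, Arr 3 8]"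
  let ?F0 = "\<lambda>s :: nat \<times> nat. if s = (8, 0) then A 3 8 else if s = (8, 1) then ?w * A 3 8 else A 3 5 :: 'k jac"
  let ?c = "\<lambda>i \<phi>. coefJ 3 [Arr 3 8] (entF (8, i) \<phi>) :: 'k" and ?e = "\<lambda>i \<phi>. coefJ 3 ?ww (entF (8, i) \<phi>) :: 'k"
  let ?p = "\<lambda>\<phi>. (?c 0 \<phi> * ?e 1 \<phi> + - 1 * (?c 1 \<phi> * ?e 0 \<phi>)) * coefJ 3 [Arr 3 5] (entF (5, 0) \<phi>) :: 'k"
  have p: "?p \<in> poly_functions (phom_functionals Delta potW m n)"
    by (intro poly_functions.mult poly_functions.add poly_functions.const poly_functions.linear coef_functional) (simp_all add: c good_words_def)
  have F0: "adm ?F0" by (simp add: adm_def c idm_mult_arr arr_mult_idm a flip: mult.assoc)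
  have p0: "?p (Phi ?F0) \<noteq> 0"
    by (simp add: entF_Phi[OF F0] c coefJ_arr coefJ_arr_mult mult.assoc a good_words_def)
  let ?R = "(\<Prod>u\<in>{1..8}. xv u powi g u) * (1 + yv 3 + yv 3 * yv 2 + yv 3 * yv 2 * yv 1 + yv 3 * yv 3 * yv 2 * yv 1) :: 'k kpoly fract"
  let ?d = "dimvec 1 1 2"
  let ?b = "\<lambda>u (i :: nat). if u = 1 then A 3 2 * arr Cminus else if u = 2 then A 3 2 else if i = 0 then idm 3 else ?w"
  let ?l = "\<lambda>u (i :: nat). if u = 1 then [Arr 3 2, Cminus] else if u = 2 then [Arr 3 2] else if i = 0 then [] else [Arr 3 2, Cminus, Arr 1 3]"
  let ?f = "\<lambda>u i. coefJ 3 (?l u i) :: 'k jac \<Rightarrow> 'k"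
  have lg: "?l u i \<in> good_words" for u i by (simp add: good_words_def)
  have d_cases: "u = 1 \<and> i = 0 \<or> u = 2 \<and> i = 0 \<or> u = 3 \<and> (i = 0 \<or> i = 1)" if "i < ?d u" for u i
    using that by (auto simp: dimvec_def split: if_splits)
  have c1: "?b u i \<in> corner u" if "u \<in> {1..8}" "i < ?d u" for u i
    using d_cases[OF that(2)] by (elim disjE conjE) (simp_all add: corner_def idm_mult_arr arr_mult_idm idm_mult_idm a flip: mult.assoc)
  have c2: "jfun (?f u i)" if "u \<in> {1..8}" "i < ?d u" for u i by (rule jfun_coefJ[OF lg])
  have c3: "?f u i (?b u j) = of_bool (i = j)" if "u \<in> {1..8}" "i < ?d u" "j < ?d u" for u i j
    using d_cases[OF that(2)] d_cases[OF that(3)]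
    by (elim disjE conjE) (simp_all add: coefJ_arr coefJ_arr_mult coefJ_idm mult.assoc a good_words_def)
  have "CW g = ?R"
  proof (rule CW_eqI[OF m_def n_def p F0 p0])
    fix F :: "nat \<times> nat \<Rightarrow> 'k jac" assume F: "adm F" "?p (Phi F) \<noteq> 0"
    note R = right_idealD[OF right_ideal_Im[of F]] and G = Im_gen[of _ F]
    obtain \<alpha> \<alpha>' where \<alpha>: "F (8, 0) = sc \<alpha> * A 3 8 + sc \<alpha>' * (?w * A 3 8)" using corner3(1)[of "F (8, 0)"] F(1) by (auto simp: adm_def c)
    obtain \<beta> \<beta>' where \<beta>: "F (8, 1) = sc \<beta> * A 3 8 + sc \<beta>' * (?w * A 3 8)" using corner3(1)[of "F (8, 1)"] F(1) by (auto simp: adm_def c)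
    obtain \<gamma> \<gamma>' where \<gamma>: "F (5, 0) = sc \<gamma> * A 3 5 + sc \<gamma>' * (?w * A 3 5)" using corner3(2)[of "F (5, 0)"] F(1) by (auto simp: adm_def c)
    have "(\<alpha> * \<beta>' - \<beta> * \<alpha>') * \<gamma> \<noteq> 0"
      using F(2) by (simp add: entF_Phi[OF F(1)] c \<alpha> \<beta> \<gamma> coefJ_zero coefJ_add coefJ_sc coefJ_arr coefJ_arr_mult mult.assoc a good_words_def)
    then have nz: "\<alpha> * \<beta>' - \<beta> * \<alpha>' \<noteq> 0" "\<gamma> \<noteq> 0" by auto
    have Gs: "F (8, 0) \<in> Im F" "F (8, 1) \<in> Im F" "F (5, 0) \<in> Im F" using G c by auto
    have s: "sc x * (sc y * z) = sc (x * y) * z" for x y and z :: "'k jac" by (simp add: sc_mult_mult flip: mult.assoc)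
    \<comment> \<open>Cramer's rule for the two entries at vertex 8.\<close>
    have e: "sc \<beta>' * F (8, 0) - sc \<alpha>' * F (8, 1) = sc (\<alpha> * \<beta>' - \<beta> * \<alpha>') * A 3 8"
      "sc \<alpha> * F (8, 1) - sc \<beta> * F (8, 0) = sc (\<alpha> * \<beta>' - \<beta> * \<alpha>') * (?w * A 3 8)"
      unfolding \<alpha> \<beta> distrib_left s jvs.scale_left_diff_distrib by (simp_all add: mult.commute)
    have i: "A 3 8 \<in> Im F" "?w * A 3 8 \<in> Im F"
      using R(8)[OF _ nz(1)] R(6)[OF R(4)[OF Gs(1), of \<beta>'] R(4)[OF Gs(2), of \<alpha>']] R(6)[OF R(4)[OF Gs(2), of \<alpha>] R(4)[OF Gs(1), of \<beta>]]
      unfolding e by blast+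
    \<comment> \<open>Only the conclusion about the image is wanted here, so the whole algebra
      serves as \<open>V\<close>.\<close>
    have q: "?w * A 3 5 \<in> Im F"
      by (rule quot_in312(2)[OF jvs.subspace_UNIV subset_UNIV right_ideal_Im UNIV_I UNIV_I i])
    have "sc \<gamma> * A 3 5 \<in> Im F" using R(6)[OF Gs(3) R(4)[OF q, of \<gamma>']] by (simp add: \<gamma>)
    then have i5: "A 3 5 \<in> Im F" using R(8) nz(2) by blast
    have c4: "?f u i y = 0" if "u \<in> {1..8}" "i < ?d u" "y \<in> Im F" for u i y
      using that(3) by (intro coefJ_Im[OF F(1) lg]) (auto simp: c)
    have c5: "right_in V (idm 3)" if V: "jvs.subspace V" "Im F \<subseteq> V" "\<And>u i. u \<in> {1..8} \<Longrightarrow> i < ?d u \<Longrightarrow> ?b u i \<in> V" for V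
    proof -
      have b: "A 3 2 * arr Cminus \<in> V" "A 3 2 \<in> V" "idm 3 \<in> V" "?w \<in> V"
        using V(3)[of 1 0] V(3)[of 2 0] V(3)[of 3 0] V(3)[of 3 1] by (simp_all add: dimvec_def)
      show ?thesis by (rule quot_in3[OF V(1,2) right_ideal_Im b(3,2) i(1) i5 quot_in312(1)[OF V(1,2) right_ideal_Im b(1,4) i]])
    qed
    have K1: "\<exists>M. is_rep Delta ?d M \<and> (\<exists>\<rho>. coker_map F ?d M \<rho>)"
      by (rule coker_basis2(1)[where b = ?b and f = ?f and F = F]) (fact c1 c2 c3 c4 c5)+
    then show "\<exists>d M. is_rep Delta d M \<and> (\<exists>\<rho>. coker_map F d M \<rho>)" by blast
    fix d M \<rho> assume rep: "is_rep Delta d M" and co: "coker_map F d M \<rho>"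
    have K2: "d u = ?d u" if "u \<in> {1..8}" for u
      by (rule coker_basis2(2)[where b = ?b and f = ?f and F = F and M = M and \<rho> = \<rho>]) (fact c1 c2 c3 c4 c5 co that)+
    have K3: "\<rho> u y = 0\<^sub>v (d u) \<longleftrightarrow> (\<forall>i<?d u. ?f u i y = 0)" if "u \<in> {1..8}" "y \<in> corner u" for u y
      by (rule coker_basis2(3)[where b = ?b and f = ?f and F = F and M = M and \<rho> = \<rho>]) (fact c1 c2 c3 c4 c5 co that)+
    have d: "d 1 = 1" "d 2 = 1" "d 3 = 2" "\<And>u. u \<in> {4..8} \<Longrightarrow> d u = 0" using K2 by (simp_all add: dimvec_def)
    have mem: "(A 3 2 * arr Cminus :: 'k jac) \<in> corner 1" "(A 3 2 :: 'k jac) \<in> corner 2" "(idm 3 :: 'k jac) \<in> corner 3" "?w \<in> corner 3"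
      by (simp_all add: corner_def idm_mult_arr arr_mult_idm idm_mult_idm a flip: mult.assoc)
    have car: "\<rho> u y \<in> carrier_vec (d u)" if "u \<in> {1..8}" "y \<in> corner u" for u y
      using co that unfolding coker_map_def by blast
    have ar: "\<rho> (dhead b) (y * arr b) = (M b)\<^sup>T *\<^sub>v \<rho> (dtail b) y" if "b \<in> arcs Delta" "y \<in> corner (dtail b)" for b y
      using co that unfolding coker_map_def by blast
    have m: "M (Arr 1 3) \<in> carrier_mat 1 2" "M (Arr 3 2) \<in> carrier_mat 2 1" "M Cminus \<in> carrier_mat 1 1"
      using rep a d unfolding is_rep_def Delta_simps by (metis dtail.simps dhead.simps)+
    define r1 r2 r3 r4 where r: "r1 = \<rho> 1 (A 3 2 * arr Cminus)" "r2 = \<rho> 2 (A 3 2)" "r3 = \<rho> 3 (idm 3)" "r4 = \<rho> 3 ?w"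
    have rc: "r1 \<in> carrier_vec 1" "r2 \<in> carrier_vec 1" "r3 \<in> carrier_vec 2" "r4 \<in> carrier_vec 2"
      unfolding r using car[OF _ mem(1)] car[OF _ mem(2)] car[OF _ mem(3)] car[OF _ mem(4)] d by auto
    have "r1 \<noteq> 0\<^sub>v 1" "r2 \<noteq> 0\<^sub>v 1" "r4 \<noteq> 0\<^sub>v 2"
      unfolding r using K3[OF _ mem(1)] K3[OF _ mem(2)] K3[OF _ mem(4)] d c3[of 1 0 0] c3[of 2 0 0] c3[of 3 1 1]
      by (auto simp: dimvec_def)
    note rn = this
    have w4: "(M (Arr 1 3))\<^sup>T *\<^sub>v r1 = r4" using ar[OF a(5), of "A 3 2 * arr Cminus"] mem(1) by (simp add: r)
    have w2: "(M (Arr 3 2))\<^sup>T *\<^sub>v r3 = r2" using ar[OF a(3), of "idm 3"] mem(3) by (simp add: r idm_mult_arr a)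
    have w1: "(M Cminus)\<^sup>T *\<^sub>v r2 = r1" using ar[OF a(4), of "A 3 2"] mem(2) by (simp add: r)
    \<comment> \<open>In matrix form this says that the image of 1 -> 3 lies in the kernel of 3 ->
      2.\<close>
    have "?w * A 3 2 = 0" by (simp add: jac_rules)
    then have w0: "(M (Arr 3 2))\<^sup>T *\<^sub>v r4 = \<rho> 2 0" using ar[OF a(3), of ?w] mem(4) by (simp add: r)
    have "\<rho> 2 0 = 0\<^sub>v 1" using K3[OF _ corner_closed(4), of 2] d by (simp add: coefJ_zero good_words_def)
    then have w0: "(M (Arr 3 2))\<^sup>T *\<^sub>v r4 = 0\<^sub>v 1" using w0 by simp
    have x: "r1 $ 0 \<noteq> 0" using rn(1) vec1_neq0[OF rc(1)] by simp
    have r4i: "r4 $ 0 = M (Arr 1 3) $$ (0, 0) * r1 $ 0" "r4 $ 1 = M (Arr 1 3) $$ (0, 1) * r1 $ 0"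
      using mult_vec_12[OF m(1) rc(1), of 0] mult_vec_12[OF m(1) rc(1), of 1] by (simp_all add: w4)
    have e1: "M (Arr 1 3) $$ (0, 0) \<noteq> 0 \<or> M (Arr 1 3) $$ (0, 1) \<noteq> 0"
    proof (rule ccontr)
      assume "\<not> ?thesis"
      then have "r4 $ 0 = 0" "r4 $ 1 = 0" using r4i by simp_all
      then have "r4 = 0\<^sub>v 2" using rc(4) by (auto simp: vec_eq_iff less_2_cases_iff One_nat_def)
      then show False using rn(3) by simp
    qed
    have e2: "M (Arr 3 2) $$ (0, 0) \<noteq> 0 \<or> M (Arr 3 2) $$ (1, 0) \<noteq> 0"
      using mult_vec_21[OF m(2) rc(3)] rn(2) vec1_neq0[OF rc(2)] by (auto simp: w2)
    have "M (Arr 3 2) $$ (0, 0) * r4 $ 0 + M (Arr 3 2) $$ (1, 0) * r4 $ 1 = 0"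
      using mult_vec_21[OF m(2) rc(4)] by (simp add: w0)
    then have "(M (Arr 3 2) $$ (0, 0) * M (Arr 1 3) $$ (0, 0) + M (Arr 3 2) $$ (1, 0) * M (Arr 1 3) $$ (0, 1)) * r1 $ 0 = 0"
      unfolding r4i by (simp add: distrib_right mult.assoc)
    then have e3: "M (Arr 3 2) $$ (0, 0) * M (Arr 1 3) $$ (0, 0) + M (Arr 3 2) $$ (1, 0) * M (Arr 1 3) $$ (0, 1) = 0" using x by simp
    have e4: "M Cminus $$ (0, 0) \<noteq> 0" using mult_vec_11[OF m(3) rc(2)] x by (auto simp: w1)
    have q: "quot_grass_euler Delta d M e = of_bool (uniserial_ok e)" if "\<And>u. u \<in> {1..8} \<Longrightarrow> e u \<le> d u" for e
      by (rule quot_grass_euler_uniserial[OF rep d e1 e2 e3 e4 that])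
    have de: "dimvec a b c u \<le> d u" if "a \<le> d 1" "b \<le> d 2" "c \<le> d 3" for a b c u using that by (simp add: dimvec_def)
    have "(\<Sum>a\<le>d 1. \<Sum>b\<le>d 2. \<Sum>c\<le>d 3. of_int (quot_grass_euler Delta d M (dimvec a b c)) * (yv 1 ^ a * yv 2 ^ b * yv 3 ^ c))
        = (\<Sum>a\<le>d 1. \<Sum>b\<le>d 2. \<Sum>c\<le>d 3. of_bool (uniserial_ok (dimvec a b c)) * (yv 1 ^ a * yv 2 ^ b * yv 3 ^ c :: 'k kpoly fract))"
      using q de by (intro sum.cong refl) simp
    also have "\<dots> = 1 + yv 3 + yv 3 * yv 2 + yv 3 * yv 2 * yv 1 + yv 3 * yv 3 * yv 2 * yv 1"
      unfolding d by (simp add: sum_le_small uniserial_ok_def dimvec_def power2_eq_square ac_simps)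
    finally have "cluster_char_rep g d M = ?R" unfolding cluster_char_rep_eq by simp
    then show "(\<forall>u\<in>{4..8}. d u = 0) \<and> cluster_char_rep g d M = ?R" using d(4) by blast
  qed
  moreover have "(\<Prod>u\<in>{1..8}. xv u powi g u) = (xv 8 * xv 8 * xv 5 / xv 3 :: 'k kpoly fract)"
    unfolding prod_verts by (simp add: g_def ev_def power_int_minus divide_inverse power2_eq_square)
  ultimately show ?thesis unfolding x312_def g_def by simp
qed


section \<open>The cluster characters as polynomials\<close>

lemma gen_relations_fract:
  fixes G :: "nat \<Rightarrow> 'k::field_char_0 kpoly fract"
  assumes "G = (\<lambda>i. to_fract (gen i kvar))"
  shows "G 1 * G 7 = G 0 * G 8 + G 12 * G 2" "G 1 * G 8 = G 0 * G 9 - G 12 * G 3"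
    "G 4 * G 1 * G 1 = G 0 * G 1 * G 5 - G 0 * G 0 * G 6 - G 11 * G 12"
    "G 11 * G 8 = G 1 * G 4 * G 3 + G 0 * G 6 * G 2"
    "G 11 * G 10 = G 6 * G 2 * G 2 + G 5 * G 2 * G 3 + G 4 * G 3 * G 3"
proof -
  let ?g = "\<lambda>i. gen i kvar :: 'k kpoly"
  have g: "pev (?g i) e = gen i e" if "i < 13" for i and e :: "coord \<Rightarrow> 'k" by (rule pev_gen[OF that])
  have "(?g 1 * ?g 7 = ?g 0 * ?g 8 + ?g 12 * ?g 2) \<and>
    (?g 1 * ?g 8 = ?g 0 * ?g 9 - ?g 12 * ?g 3) \<and>
    (?g 4 * ?g 1 * ?g 1 = ?g 0 * ?g 1 * ?g 5 - ?g 0 * ?g 0 * ?g 6 - ?g 11 * ?g 12) \<and>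
    (?g 11 * ?g 8 = ?g 1 * ?g 4 * ?g 3 + ?g 0 * ?g 6 * ?g 2) \<and>
    (?g 11 * ?g 10 = ?g 6 * ?g 2 * ?g 2 + ?g 5 * ?g 2 * ?g 3 + ?g 4 * ?g 3 * ?g 3)"
    by (intro conjI; rule pev_inject; simp add: g gen_relations)
  then show "G 1 * G 7 = G 0 * G 8 + G 12 * G 2" "G 1 * G 8 = G 0 * G 9 - G 12 * G 3"
    "G 4 * G 1 * G 1 = G 0 * G 1 * G 5 - G 0 * G 0 * G 6 - G 11 * G 12"
    "G 11 * G 8 = G 1 * G 4 * G 3 + G 0 * G 6 * G 2"
    "G 11 * G 10 = G 6 * G 2 * G 2 + G 5 * G 2 * G 3 + G 4 * G 3 * G 3"
    unfolding assms by (simp_all flip: to_fract_mult to_fract_add to_fract_diff)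
qed

text \<open>Zero belongs to every subalgebra and could be dropped from a generating set. The
  nonvanishing of all denominators is deduced from this.\<close>

lemma zero_notin_minimal:
  assumes "minimally_generates S B"
  shows "0 \<notin> S"
proof
  assume z: "0 \<in> S"
  have "x \<in> k_subalgebra (S - {0})" if "x \<in> k_subalgebra S" for x
    using that
  proof induction
    case (gen x)
    have "to_fract (kconst 0) \<in> k_subalgebra (S - {0})" by (rule k_subalgebra.const)
    then have "0 \<in> k_subalgebra (S - {0})" by (simp add: kconst_def)
    then show ?case using gen by (cases "x = 0") (auto intro: k_subalgebra.gen)
  qed (auto intro: k_subalgebra.intros)
  moreover have "x \<in> k_subalgebra S" if "x \<in> k_subalgebra (S - {0})" for x
    using that by induction (auto intro: k_subalgebra.intros)
  ultimately have "k_subalgebra (S - {0}) = k_subalgebra S" by blast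
  moreover have "S - {0} \<subset> S" using z by blast
  ultimately show False using assms unfolding minimally_generates_def by metis
qed

lemma yv_eq:
  "(yv 1 :: 'k::field kpoly fract) = xv 2 * xv 2 * xv 5 / (xv 3 * xv 4)" "(yv 2 :: 'k kpoly fract) = xv 3 * xv 4 / (xv 1 * xv 1 * xv 6)"
  "(yv 3 :: 'k kpoly fract) = xv 1 * xv 6 * xv 7 / (xv 2 * xv 5 * xv 8)"
proof -
  have s: "{a \<in> arcs Delta. dhead a = 1} = {Cplus, Cminus, Arr 5 1}" "{a \<in> arcs Delta. dtail a = 1} = {Arr 1 3, Arr 1 4}"
    "{a \<in> arcs Delta. dhead a = 2} = {Arr 3 2, Arr 4 2}" "{a \<in> arcs Delta. dtail a = 2} = {Cplus, Cminus, Arr 2 6}"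
    "{a \<in> arcs Delta. dhead a = 3} = {Arr 1 3, Arr 6 3, Arr 7 3}" "{a \<in> arcs Delta. dtail a = 3} = {Arr 3 2, Arr 3 5, Arr 3 8}"
    unfolding arcs_Delta by auto
  show "(yv 1 :: 'k kpoly fract) = xv 2 * xv 2 * xv 5 / (xv 3 * xv 4)" "(yv 2 :: 'k kpoly fract) = xv 3 * xv 4 / (xv 1 * xv 1 * xv 6)"
    "(yv 3 :: 'k kpoly fract) = xv 1 * xv 6 * xv 7 / (xv 2 * xv 5 * xv 8)"
    unfolding yv_def Delta_simps s by (simp_all add: mult.assoc)
qed

text \<open>With p, q, c, n, h0, h2, r, s for x_1, ..., x_8, each relation is solved for its
  generator outside the initial cluster: k0 and k2 through k1, and l through h1. After that all
  identities are comparisons of Laurent polynomials.\<close>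

lemma laurent_identities:
  fixes p q r s h0 h1 h2 k0 k1 k2 l c n :: "'a::field"
  assumes nz: "p \<noteq> 0" "q \<noteq> 0" "c \<noteq> 0" "n \<noteq> 0" "h0 \<noteq> 0" "h2 \<noteq> 0" "r \<noteq> 0" "s \<noteq> 0"
    and e: "q * k0 = p * k1 + n * r" "q * k1 = p * k2 - n * s" "h0 * q * q = p * q * h1 - p * p * h2 - c * n"
      "c * k1 = q * h0 * s + p * h2 * r" "c * l = h2 * r * r + h1 * r * s + h0 * s * s"
    and y: "y1 = q * q * h0 / (c * n)" "y2 = c * n / (p * p * h2)" "y3 = p * h2 * r / (q * h0 * s)"
  shows "h2 * p / q * (1 + y2 + y2 * y1) = h1" "(q * h0 * s + p * h2 * r) / c = k1" "s * n / p * (1 + y1 + y1 * y3) = k2"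
    "s * h0 * p / c * (1 + y3 + y3 * y2) = k0" "s * s * h0 / c * (1 + y3 + y3 * y2 + y3 * y2 * y1 + y3 * y3 * y2 * y1) = l"
proof -
  have y21: "y2 * y1 = q * q * h0 / (p * p * h2)" using nz by (simp add: y)
  have y13: "y1 * y3 = p * q * h2 * r / (c * n * s)" using nz by (simp add: y field_simps)
  have y32: "y3 * y2 = c * n * r / (p * q * h0 * s)" using nz by (simp add: y field_simps)
  have y321: "y3 * y2 * y1 = q * r / (p * s)" using nz by (simp add: y field_simps)
  have y3321: "y3 * y3 * y2 * y1 = h2 * r * r / (h0 * s * s)" using nz by (simp add: y field_simps)
  have "h0 * q * q + p * p * h2 + c * n = p * q * h1" using e(3) by simp
  then have h1: "h1 = (h0 * q * q + p * p * h2 + c * n) / (p * q)" using nz by simp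
  have k1: "k1 = (q * h0 * s + p * h2 * r) / c" using nz by (simp add: e(4)[symmetric])
  have k2: "k2 = (q * k1 + n * s) / p" using nz by (simp add: e(2))
  have k0: "k0 = (p * k1 + n * r) / q" using nz by (simp add: e(1)[symmetric])
  have l: "l = (h2 * r * r + h1 * r * s + h0 * s * s) / c" using nz by (simp add: e(5)[symmetric])
  show "h2 * p / q * (1 + y2 + y2 * y1) = h1" unfolding h1 y21 unfolding y using nz by (simp add: field_simps)
  show "(q * h0 * s + p * h2 * r) / c = k1" by (simp add: k1)
  show "s * n / p * (1 + y1 + y1 * y3) = k2" unfolding k2 k1 y13 unfolding y using nz by (simp add: field_simps)
  show "s * h0 * p / c * (1 + y3 + y3 * y2) = k0" unfolding k0 k1 y32 unfolding y using nz by (simp add: field_simps)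
  show "s * s * h0 / c * (1 + y3 + y3 * y2 + y3 * y2 * y1 + y3 * y3 * y2 * y1) = l"
    unfolding l h1 y3321 y321 y32 unfolding y using nz by (simp add: field_simps)
qed

text \<open>Once \<open>x2circ\<close>, \<open>x3prime\<close>, \<open>x31\<close>,
  \<open>x32\<close>, \<open>x312\<close> are recognised as the generators with indices 5, 8, 9, 7,
  10, \<open>X\<close> is the set of all thirteen generators.\<close>

theorem proposition9p6:
  fixes X :: "'k::{alg_closed_field, field_char_0} kpoly fract set"
  assumes "X = {xv 1, xv 2, xv 3, xv 4, xv 5, xv 6, xv 7, xv 8, x2circ, x3prime, x31, x32, x312}"
  shows "card X = 13 \<and> minimally_generates X (to_fract ` SI)"
proof -
  define G :: "nat \<Rightarrow> 'k kpoly fract" where "G = (\<lambda>i. to_fract (gen i kvar))"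
  have Gp: "to_fract ` (gen_polys :: 'k kpoly set) = G ` {..<13}"
    by (simp add: gen_polys_def image_image G_def)
  have min: "card (G ` {..<13}) = 13" "minimally_generates (G ` {..<13}) (to_fract ` SI)"
    using gen_polys_minimal[where 'k = 'k] unfolding Gp by blast+
  \<comment> \<open>Minimality already implies that the initial variables are nonzero.\<close>
  have nz: "G i \<noteq> 0" if "i < 13" for i using zero_notin_minimal[OF min(2)] that by (metis imageI lessThan_iff)
  have x: "xv 1 = G 0" "xv 2 = G 1" "xv 3 = G 11" "xv 4 = G 12" "xv 5 = G 4" "xv 6 = G 6" "xv 7 = G 2" "xv 8 = G 3"
    by (simp_all add: G_def xv_eq)
  have I: "x2circ = G 5" "x3prime = G 8" "x31 = G 9" "x32 = G 7" "x312 = G 10"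
    unfolding x2circ_formula x3prime_def x31_formula x32_formula x312_formula x
    using laurent_identities[OF nz[of 0] nz[of 1] nz[of 11] nz[of 12] nz[of 4] nz[of 6] nz[of 2] nz[of 3], of "G 7" "G 8" "G 9" "G 5" "G 10" "yv 1" "yv 2" "yv 3"]
      gen_relations_fract[OF G_def] yv_eq[where ?'k = 'k] unfolding x by simp_all
  have "{..<13 :: nat} = {0, 1, 2, 3, 4, 5, 6, 7, 8, 9, 10, 11, 12}"
    by (auto simp: numeral_eq_Suc One_nat_def less_Suc_eq)
  then have "X = G ` {..<13}" unfolding assms x I by (simp add: insert_commute)
  then show ?thesis using min by simp
qed

end
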